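(* The category $\Sigma\mathrm{Vect}$ of strong $\mathbf{k}$-vector spaces is contained in $\mathrm{Ind}\text{-}(\mathrm{Vect}^{\mathrm{op}})$, is a reflective subcategory of $\mathrm{Ind}\text{-}(\mathrm{Vect}^{\mathrm{op}})$, and is the torsion-free part for a torsion theory on $\mathrm{Ind}\text{-}(\mathrm{Vect}^{\mathrm{op}})$.
   Context: Fix a field $\mathbf{k}$ and a (non-trivial) Grothendieck universe; sets in it are small. $\mathrm{Vect}$ is the category of small $\mathbf{k}$-vector spaces, $[\mathrm{Vect},\mathrm{Vect}]$ the category of $\mathbf{k}$-additive functors (acting $\mathbf{k}$-linearly on hom-spaces) and natural transformations, $\mathbb{Y}V:=\mathrm{Vect}(V,-)$. $\mathrm{Ind}\text{-}(\mathrm{Vect}^{\mathrm{op}})$ is the full subcategory of $[\mathrm{Vect},\mathrm{Vect}]$ on the small functors, i.e. those isomorphic to a colimit, over a small directed poset, of representables $\mathbb{Y}V$; it is Abelian with small limits and colimits computed pointwise. For a small set $I$, $\delta_i:\mathbf{k}^{\oplus I}\to\mathbf{k}$ is the $i$-th coordinate functional and $\sigma:\mathbf{k}^{\oplus I}\to\mathbf{k}$ is the functional with value $1$ on all canonical basis vectors. For $X\in[\mathrm{Vect},\mathrm{Vect}]$, $(x_i)_{i\in I}\in(X\mathbf{k})^I$ is summable if there is $x\in X(\mathbf{k}^{\oplus I})$ with $X(\delta_i)(x)=x_i$ for all $i$; then $X(\sigma)(x)$ is called a sum of it. $X$ is a strong $\mathbf{k}$-vector space if every summable family has a unique sum and $X$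 is $\mathbf{k}$-concrete (for all $V$ and $f,g:\mathbb{Y}V\to X$: $f=g$ iff $f,g$ have the same component at $\mathbf{k}$). $\Sigma\mathrm{Vect}$ is the full subcategory of $[\mathrm{Vect},\mathrm{Vect}]$ on the strong $\mathbf{k}$-vector spaces. In a category, arrows $e:a\to b$ and $m:c\to d$ satisfy $e\perp m$ if for all $l:a\to c$, $k:b\to d$ with $m l=k e$ there is a unique $h:b\to c$ with $he=l$ and $mh=k$. An orthogonal factorization system is a pair $(\mathcal{E},\mathcal{M})$ of classes of arrows with $\mathcal{M}=\{m:\forall e\in\mathcal{E},\,e\perp m\}$, $\mathcal{E}=\{e:\forall m\in\mathcal{M},\,e\perp m\}$ and such that every arrow factors as $m\cdot e$ with $m\in\mathcal{M}$, $e\in\mathcal{E}$. A torsion theory is an orthogonal factorization system in which both $\mathcal{E}$ and $\mathcal{M}$ have the 3-for-2 property (if two of $f,g,g\cdot f$ are in the class then so is the third); its torsion-free part is the class of objects $c$ such that $c\to 0$ is in $\mathcal{M}$. *)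

theory Defs
  imports "HOL-Algebra.Module" "HOL-Library.FuncSet"
begin

section \<open>Categories\<close>

text \<open>
  Arrows carry their domain and codomain.  Composition is written in the order of application of
  functions: \<open>Comp C g f\<close> is the composite of \<open>f : a \<rightarrow> b\<close> followed by \<open>g : b \<rightarrow> c\<close>.
\<close>

record ('o, 'a) category =
  Obj :: "'o set"
  Arr :: "'a set"
  Dom :: "'a \<Rightarrow> 'o"
  Cod :: "'a \<Rightarrow> 'o"
  Id :: "'o \<Rightarrow> 'a"
  Comp :: "'a \<Rightarrow> 'a \<Rightarrow> 'a"

definition Hom :: "('o, 'a) category \<Rightarrow> 'o \<Rightarrow> 'o \<Rightarrow> 'a set"
  where "Hom C a b = {f \<in> Arr C. Dom C f = a \<and> Cod C f = b}"

definition full_subcategory :: "('o, 'a) category \<Rightarrow> 'o set \<Rightarrow> ('o, 'a) category"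
  where "full_subcategory C S =
    C\<lparr>Obj := Obj C \<inter> S, Arr := {f \<in> Arr C. Dom C f \<in> S \<and> Cod C f \<in> S}\<rparr>"

definition is_full_subcategory :: "('o, 'a) category \<Rightarrow> ('o, 'a) category \<Rightarrow> bool"
  where "is_full_subcategory D C \<longleftrightarrow> Obj D \<subseteq> Obj C \<and> D = full_subcategory C (Obj D)"


subsection \<open>Functors and natural transformations\<close>

record ('o, 'a, 'p, 'b) functor_data =
  FObj :: "'o \<Rightarrow> 'p"
  FArr :: "'a \<Rightarrow> 'b"

text \<open>
  Both components of a functor are extensional functions, and so are the families of components
  of natural transformations below; thus equality in HOL is equality of functors and of natural
  transformations.
\<close>

definition is_functor ::
    "('o, 'a) category \<Rightarrow> ('p, 'b) category \<Rightarrow> ('o, 'a, 'p, 'b) functor_data \<Rightarrow> bool"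
  where "is_functor C D F \<longleftrightarrow>
    FObj F \<in> Obj C \<rightarrow>\<^sub>E Obj D \<and>
    FArr F \<in> Arr C \<rightarrow>\<^sub>E Arr D \<and>
    (\<forall>f\<in>Arr C. FArr F f \<in> Hom D (FObj F (Dom C f)) (FObj F (Cod C f))) \<and>
    (\<forall>a\<in>Obj C. FArr F (Id C a) = Id D (FObj F a)) \<and>
    (\<forall>f\<in>Arr C. \<forall>g\<in>Arr C. Cod C f = Dom C g \<longrightarrow>
       FArr F (Comp C g f) = Comp D (FArr F g) (FArr F f))"

definition nat_trans ::
    "('o, 'a) category \<Rightarrow> ('p, 'b) category \<Rightarrow> ('o, 'a, 'p, 'b) functor_data
      \<Rightarrow> ('o, 'a, 'p, 'b) functor_data \<Rightarrow> ('o \<Rightarrow> 'b) \<Rightarrow> bool"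
  where "nat_trans C D F G t \<longleftrightarrow>
    t \<in> Obj C \<rightarrow>\<^sub>E Arr D \<and>
    (\<forall>a\<in>Obj C. t a \<in> Hom D (FObj F a) (FObj G a)) \<and>
    (\<forall>f\<in>Arr C. Comp D (FArr G f) (t (Dom C f)) = Comp D (t (Cod C f)) (FArr F f))"

datatype ('o, 'm) arrow = Arrow (src: 'o) (tgt: 'o) (body: 'm)

definition functor_category ::
    "('o, 'a) category \<Rightarrow> ('p, 'b) category
      \<Rightarrow> (('o, 'a, 'p, 'b) functor_data, (('o, 'a, 'p, 'b) functor_data, 'o \<Rightarrow> 'b) arrow) category"
  where "functor_category C D =
    \<lparr>Obj = {F. is_functor C D F},
     Arr = {Arrow F G t | F G t. is_functor C D F \<and> is_functor C D G \<and> nat_trans C D F G t},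
     Dom = src,
     Cod = tgt,
     Id = (\<lambda>F. Arrow F F (\<lambda>a\<in>Obj C. Id D (FObj F a))),
     Comp = (\<lambda>t s. Arrow (src s) (tgt t) (\<lambda>a\<in>Obj C. Comp D (body t a) (body s a)))\<rparr>"


subsection \<open>Reflective subcategories\<close>

text \<open>
  \<open>F : C \<rightarrow> D\<close> is left adjoint to \<open>G : D \<rightarrow> C\<close> via the bijections
  \<open>\<phi> c d : D(F c, d) \<cong> C(c, G d)\<close>, natural in \<open>c\<close> and \<open>d\<close>.
\<close>

definition adjunction ::
    "('o, 'a) category \<Rightarrow> ('p, 'b) category \<Rightarrow> ('o, 'a, 'p, 'b) functor_data
      \<Rightarrow> ('p, 'b, 'o, 'a) functor_data \<Rightarrow> ('o \<Rightarrow> 'p \<Rightarrow> 'b \<Rightarrow> 'a) \<Rightarrow> bool"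
  where "adjunction C D F G \<phi> \<longleftrightarrow>
    is_functor C D F \<and> is_functor D C G \<and>
    (\<forall>c\<in>Obj C. \<forall>d\<in>Obj D. bij_betw (\<phi> c d) (Hom D (FObj F c) d) (Hom C c (FObj G d))) \<and>
    (\<forall>c\<in>Obj C. \<forall>d\<in>Obj D. \<forall>d'\<in>Obj D. \<forall>f\<in>Hom D (FObj F c) d. \<forall>g\<in>Hom D d d'.
       \<phi> c d' (Comp D g f) = Comp C (FArr G g) (\<phi> c d f)) \<and>
    (\<forall>c\<in>Obj C. \<forall>c'\<in>Obj C. \<forall>d\<in>Obj D. \<forall>f\<in>Hom D (FObj F c) d. \<forall>h\<in>Hom C c' c.
       \<phi> c' d (Comp D f (FArr F h)) = Comp C (\<phi> c d f) h)"

definition inclusion_functor :: "('o, 'a) category \<Rightarrow> ('o, 'a, 'o, 'a) functor_data"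
  where "inclusion_functor D = \<lparr>FObj = (\<lambda>a\<in>Obj D. a), FArr = (\<lambda>f\<in>Arr D. f)\<rparr>"

definition reflective_subcategory :: "('o, 'a) category \<Rightarrow> ('o, 'a) category \<Rightarrow> bool"
  where "reflective_subcategory D C \<longleftrightarrow>
    is_full_subcategory D C \<and> (\<exists>R \<phi>. adjunction C D R (inclusion_functor D) \<phi>)"


subsection \<open>Colimits over posets\<close>

definition poset_category :: "'i set \<Rightarrow> ('i \<times> 'i) set \<Rightarrow> ('i, 'i \<times> 'i) category"
  where "poset_category I r =
    \<lparr>Obj = I, Arr = r, Dom = fst, Cod = snd, Id = (\<lambda>i. (i, i)), Comp = (\<lambda>g f. (fst f, snd g))\<rparr>"

definition directed_poset :: "'i set \<Rightarrow> ('i \<times> 'i) set \<Rightarrow> bool"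
  where "directed_poset I r \<longleftrightarrow>
    partial_order_on I r \<and> I \<noteq> {} \<and> (\<forall>i\<in>I. \<forall>j\<in>I. \<exists>k\<in>I. (i, k) \<in> r \<and> (j, k) \<in> r)"

definition cocone ::
    "('i, 'j) category \<Rightarrow> ('o, 'a) category \<Rightarrow> ('i, 'j, 'o, 'a) functor_data
      \<Rightarrow> 'o \<Rightarrow> ('i \<Rightarrow> 'a) \<Rightarrow> bool"
  where "cocone J C D x \<iota> \<longleftrightarrow>
    x \<in> Obj C \<and>
    (\<forall>i\<in>Obj J. \<iota> i \<in> Hom C (FObj D i) x) \<and>
    (\<forall>u\<in>Arr J. Comp C (\<iota> (Cod J u)) (FArr D u) = \<iota> (Dom J u))"

text \<open>Being a colimit of \<open>D\<close> is a property of \<open>x\<close> that is invariant under isomorphism.\<close>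

definition is_colimit ::
    "('i, 'j) category \<Rightarrow> ('o, 'a) category \<Rightarrow> ('i, 'j, 'o, 'a) functor_data \<Rightarrow> 'o \<Rightarrow> bool"
  where "is_colimit J C D x \<longleftrightarrow>
    (\<exists>\<iota>. cocone J C D x \<iota> \<and>
      (\<forall>y \<kappa>. cocone J C D y \<kappa> \<longrightarrow>
        (\<exists>!h. h \<in> Hom C x y \<and> (\<forall>i\<in>Obj J. Comp C h (\<iota> i) = \<kappa> i))))"


subsection \<open>Orthogonal factorization systems and torsion theories\<close>

definition orthogonal :: "('o, 'a) category \<Rightarrow> 'a \<Rightarrow> 'a \<Rightarrow> bool"
  where "orthogonal C e m \<longleftrightarrow>
    (\<forall>l\<in>Hom C (Dom C e) (Dom C m). \<forall>k\<in>Hom C (Cod C e) (Cod C m).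
       Comp C m l = Comp C k e \<longrightarrow>
       (\<exists>!h. h \<in> Hom C (Cod C e) (Dom C m) \<and> Comp C h e = l \<and> Comp C m h = k))"

definition orthogonal_factorization_system ::
    "('o, 'a) category \<Rightarrow> 'a set \<Rightarrow> 'a set \<Rightarrow> bool"
  where "orthogonal_factorization_system C E M \<longleftrightarrow>
    M = {m \<in> Arr C. \<forall>e\<in>E. orthogonal C e m} \<and>
    E = {e \<in> Arr C. \<forall>m\<in>M. orthogonal C e m} \<and>
    (\<forall>f\<in>Arr C. \<exists>e\<in>E. \<exists>m\<in>M. Cod C e = Dom C m \<and> f = Comp C m e)"

definition three_for_two :: "('o, 'a) category \<Rightarrow> 'a set \<Rightarrow> bool"
  where "three_for_two C W \<longleftrightarrow>
    (\<forall>f\<in>Arr C. \<forall>g\<in>Arr C. Cod C f = Dom C g \<longrightarrow>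
       (f \<in> W \<and> g \<in> W \<longrightarrow> Comp C g f \<in> W) \<and>
       (f \<in> W \<and> Comp C g f \<in> W \<longrightarrow> g \<in> W) \<and>
       (g \<in> W \<and> Comp C g f \<in> W \<longrightarrow> f \<in> W))"

definition torsion_theory :: "('o, 'a) category \<Rightarrow> 'a set \<Rightarrow> 'a set \<Rightarrow> bool"
  where "torsion_theory C E M \<longleftrightarrow>
    orthogonal_factorization_system C E M \<and> three_for_two C E \<and> three_for_two C M"

definition zero_object :: "('o, 'a) category \<Rightarrow> 'o \<Rightarrow> bool"
  where "zero_object C z \<longleftrightarrow>
    z \<in> Obj C \<and> (\<forall>a\<in>Obj C. (\<exists>!f. f \<in> Hom C a z) \<and> (\<exists>!f. f \<in> Hom C z a))"

definition torsion_free_part :: "('o, 'a) category \<Rightarrow> 'a set \<Rightarrow> 'o set"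
  where "torsion_free_part C M = {c \<in> Obj C. \<exists>z f. zero_object C z \<and> f \<in> Hom C c z \<and> f \<in> M}"


section \<open>Grothendieck universes\<close>

text \<open>
  A Grothendieck universe is presented as a type \<open>'u\<close> (the members of the universe) together with
  \<open>elts\<close>, sending a member of the universe to the set of its elements; these are again members of
  the universe by transitivity, which is thus built into the typing.  Well-foundedness of
  membership plays no role and is not required.  Nontriviality means that some member of the
  universe is infinite.
\<close>

locale grothendieck_universe =
  fixes elts :: "'u \<Rightarrow> 'u set"
  assumes extensionality: "elts x = elts y \<Longrightarrow> x = y"
    and pairing: "\<exists>z. elts z = {x, y}"
    and power_set: "\<exists>p. elts ` elts p = Pow (elts x)"
    and union: "\<exists>z. elts z = (\<Union>i\<in>elts x. elts (f i))"
    and nontrivial: "\<exists>x. infinite (elts x)"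

definition small :: "('u \<Rightarrow> 'u set) \<Rightarrow> 'u set \<Rightarrow> bool"
  where "small elts A \<longleftrightarrow> (\<exists>x. elts x = A)"

text \<open>
  Ordered pairs are Kuratowski pairs, and a function with small domain \<open>A\<close> is encoded by its graph
  as a member of the universe; \<open>app elts z\<close> recovers the function from its graph \<open>z\<close>.
\<close>

definition set_code :: "('u \<Rightarrow> 'u set) \<Rightarrow> 'u set \<Rightarrow> 'u"
  where "set_code elts A = (THE z. elts z = A)"

definition opair :: "('u \<Rightarrow> 'u set) \<Rightarrow> 'u \<Rightarrow> 'u \<Rightarrow> 'u"
  where "opair elts x y = set_code elts {set_code elts {x}, set_code elts {x, y}}"

definition graph :: "('u \<Rightarrow> 'u set) \<Rightarrow> 'u set \<Rightarrow> ('u \<Rightarrow> 'u) \<Rightarrow> 'u"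
  where "graph elts A f = set_code elts ((\<lambda>x. opair elts x (f x)) ` A)"

definition app :: "('u \<Rightarrow> 'u set) \<Rightarrow> 'u \<Rightarrow> 'u \<Rightarrow> 'u"
  where "app elts z x = (THE y. opair elts x y \<in> elts z)"


section \<open>Small vector spaces\<close>

type_synonym 'u space = "('u, 'u) module"
type_synonym 'u linmap = "('u space, 'u \<Rightarrow> 'u) arrow"

text \<open>
  A module record has two fields, \<open>mult\<close> and \<open>one\<close>, that are not part of the structure of a module,
  and its operations are total functions.  This constructor puts such irrelevant data into a
  normal form, so that equality of records is equality of vector spaces.
\<close>

definition mk_space :: "'u set \<Rightarrow> 'u \<Rightarrow> ('u \<Rightarrow> 'u \<Rightarrow> 'u) \<Rightarrow> 'u set \<Rightarrow> ('u \<Rightarrow> 'u \<Rightarrow> 'u) \<Rightarrow> 'u space"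
  where "mk_space A z pl S sc =
    \<lparr>carrier = A, mult = undefined, one = undefined, zero = z,
     add = (\<lambda>x\<in>A. \<lambda>y\<in>A. pl x y), smult = (\<lambda>c\<in>S. \<lambda>x\<in>A. sc c x)\<rparr>"

text \<open>
  \<open>K\<close> is the ground field, itself a structure on a small set of members of the universe.  A vector
  space is a member of the universe exactly if its underlying set is.
\<close>

context
  fixes elts :: "'u \<Rightarrow> 'u set" and K :: "'u ring"
begin

definition small_space :: "'u space \<Rightarrow> bool"
  where "small_space V \<longleftrightarrow>
    module K V \<and> small elts (carrier V) \<and>
    V = mk_space (carrier V) (zero V) (add V) (carrier K) (smult V)"

definition linear_map :: "'u space \<Rightarrow> 'u space \<Rightarrow> ('u \<Rightarrow> 'u) \<Rightarrow> bool"
  where "linear_map V W f \<longleftrightarrow>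
    f \<in> carrier V \<rightarrow>\<^sub>E carrier W \<and>
    (\<forall>x\<in>carrier V. \<forall>y\<in>carrier V. f (x \<oplus>\<^bsub>V\<^esub> y) = f x \<oplus>\<^bsub>W\<^esub> f y) \<and>
    (\<forall>c\<in>carrier K. \<forall>x\<in>carrier V. f (c \<odot>\<^bsub>V\<^esub> x) = c \<odot>\<^bsub>W\<^esub> f x)"

definition Vect :: "('u space, 'u linmap) category"
  where "Vect =
    \<lparr>Obj = {V. small_space V},
     Arr = {Arrow V W f | V W f. small_space V \<and> small_space W \<and> linear_map V W f},
     Dom = src,
     Cod = tgt,
     Id = (\<lambda>V. Arrow V V (\<lambda>x\<in>carrier V. x)),
     Comp = (\<lambda>g f. Arrow (src f) (tgt g) (\<lambda>x\<in>carrier (src f). body g (body f x)))\<rparr>"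

definition ground :: "'u space"
  where "ground = mk_space (carrier K) (zero K) (add K) (carrier K) (mult K)"

text \<open>
  The space of finitely supported functions on \<open>elts I\<close>, its canonical basis, its coordinate
  functionals \<open>\<delta>\<^sub>i\<close>, and the functional \<open>\<sigma>\<close> taking the value 1 on each basis vector.
\<close>

definition dsum :: "'u \<Rightarrow> 'u space"
  where "dsum I =
    mk_space
      {graph elts (elts I) f | f.
         f \<in> elts I \<rightarrow>\<^sub>E carrier K \<and> finite {i \<in> elts I. f i \<noteq> \<zero>\<^bsub>K\<^esub>}}
      (graph elts (elts I) (\<lambda>i. \<zero>\<^bsub>K\<^esub>))
      (\<lambda>a b. graph elts (elts I) (\<lambda>i. app elts a i \<oplus>\<^bsub>K\<^esub> app elts b i))
      (carrier K)
      (\<lambda>c a. graph elts (elts I) (\<lambda>i. c \<otimes>\<^bsub>K\<^esub> app elts a i))"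

definition basis_vector :: "'u \<Rightarrow> 'u \<Rightarrow> 'u"
  where "basis_vector I i = graph elts (elts I) (\<lambda>j. if j = i then \<one>\<^bsub>K\<^esub> else \<zero>\<^bsub>K\<^esub>)"

definition delta :: "'u \<Rightarrow> 'u \<Rightarrow> 'u linmap"
  where "delta I i = Arrow (dsum I) ground (\<lambda>a\<in>carrier (dsum I). app elts a i)"

definition sigma :: "'u \<Rightarrow> 'u linmap"
  where "sigma I = (THE s. s \<in> Hom Vect (dsum I) ground \<and>
    (\<forall>i\<in>elts I. body s (basis_vector I i) = \<one>\<^bsub>K\<^esub>))"


section \<open>Linear endofunctors of the category of vector spaces\<close>

definition arrow_add :: "'u linmap \<Rightarrow> 'u linmap \<Rightarrow> 'u linmap"
  where "arrow_add f g =
    Arrow (src f) (tgt f) (\<lambda>x\<in>carrier (src f). body f x \<oplus>\<^bsub>tgt f\<^esub> body g x)"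

definition arrow_smult :: "'u \<Rightarrow> 'u linmap \<Rightarrow> 'u linmap"
  where "arrow_smult c f = Arrow (src f) (tgt f) (\<lambda>x\<in>carrier (src f). c \<odot>\<^bsub>tgt f\<^esub> body f x)"

definition linear_functor :: "('u space, 'u linmap, 'u space, 'u linmap) functor_data \<Rightarrow> bool"
  where "linear_functor X \<longleftrightarrow>
    (\<forall>V\<in>Obj Vect. \<forall>W\<in>Obj Vect. \<forall>f\<in>Hom Vect V W.
       (\<forall>g\<in>Hom Vect V W. FArr X (arrow_add f g) = arrow_add (FArr X f) (FArr X g)) \<and>
       (\<forall>c\<in>carrier K. FArr X (arrow_smult c f) = arrow_smult c (FArr X f)))"

text \<open>The category [Vect, Vect].\<close>

definition LinEnd ::
    "(('u space, 'u linmap, 'u space, 'u linmap) functor_data,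
      (('u space, 'u linmap, 'u space, 'u linmap) functor_data, 'u space \<Rightarrow> 'u linmap) arrow) category"
  where "LinEnd = full_subcategory (functor_category Vect Vect) {X. linear_functor X}"

text \<open>The representable functor Vect(V, -), with Vect(V, W) encoded as a set of graphs.\<close>

definition hom_space :: "'u space \<Rightarrow> 'u space \<Rightarrow> 'u space"
  where "hom_space V W =
    mk_space
      {graph elts (carrier V) (body f) | f. f \<in> Hom Vect V W}
      (graph elts (carrier V) (\<lambda>v. \<zero>\<^bsub>W\<^esub>))
      (\<lambda>a b. graph elts (carrier V) (\<lambda>v. app elts a v \<oplus>\<^bsub>W\<^esub> app elts b v))
      (carrier K)
      (\<lambda>c a. graph elts (carrier V) (\<lambda>v. c \<odot>\<^bsub>W\<^esub> app elts a v))"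

definition Yoneda :: "'u space \<Rightarrow> ('u space, 'u linmap, 'u space, 'u linmap) functor_data"
  where "Yoneda V =
    \<lparr>FObj = (\<lambda>W\<in>Obj Vect. hom_space V W),
     FArr = (\<lambda>g\<in>Arr Vect. Arrow (hom_space V (src g)) (hom_space V (tgt g))
       (\<lambda>a\<in>carrier (hom_space V (src g)). graph elts (carrier V) (\<lambda>v. body g (app elts a v))))\<rparr>"

definition small_functor :: "('u space, 'u linmap, 'u space, 'u linmap) functor_data \<Rightarrow> bool"
  where "small_functor X \<longleftrightarrow>
    (\<exists>I r D. small elts I \<and> directed_poset I r \<and>
       is_functor (poset_category I r) LinEnd D \<and>
       (\<forall>i\<in>I. \<exists>V\<in>Obj Vect. FObj D i = Yoneda V) \<and>
       is_colimit (poset_category I r) LinEnd D X)"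

definition IndVectOp ::
    "(('u space, 'u linmap, 'u space, 'u linmap) functor_data,
      (('u space, 'u linmap, 'u space, 'u linmap) functor_data, 'u space \<Rightarrow> 'u linmap) arrow) category"
  where "IndVectOp = full_subcategory LinEnd {X. small_functor X}"


section \<open>Strong vector spaces\<close>

definition summability_witness ::
    "('u space, 'u linmap, 'u space, 'u linmap) functor_data \<Rightarrow> 'u \<Rightarrow> ('u \<Rightarrow> 'u) \<Rightarrow> 'u \<Rightarrow> bool"
  where "summability_witness X I x t \<longleftrightarrow>
    t \<in> carrier (FObj X (dsum I)) \<and> (\<forall>i\<in>elts I. body (FArr X (delta I i)) t = x i)"

definition summable_family ::
    "('u space, 'u linmap, 'u space, 'u linmap) functor_data \<Rightarrow> 'u \<Rightarrow> ('u \<Rightarrow> 'u) \<Rightarrow> bool"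
  where "summable_family X I x \<longleftrightarrow> (\<exists>t. summability_witness X I x t)"

definition is_sum ::
    "('u space, 'u linmap, 'u space, 'u linmap) functor_data \<Rightarrow> 'u \<Rightarrow> ('u \<Rightarrow> 'u) \<Rightarrow> 'u \<Rightarrow> bool"
  where "is_sum X I x s \<longleftrightarrow>
    (\<exists>t. summability_witness X I x t \<and> s = body (FArr X (sigma I)) t)"

definition concrete_functor :: "('u space, 'u linmap, 'u space, 'u linmap) functor_data \<Rightarrow> bool"
  where "concrete_functor X \<longleftrightarrow>
    (\<forall>V\<in>Obj Vect. \<forall>f\<in>Hom LinEnd (Yoneda V) X. \<forall>g\<in>Hom LinEnd (Yoneda V) X.
       f = g \<longleftrightarrow> body f ground = body g ground)"

definition strong_space :: "('u space, 'u linmap, 'u space, 'u linmap) functor_data \<Rightarrow> bool"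
  where "strong_space X \<longleftrightarrow>
    (\<forall>I. \<forall>x\<in>elts I \<rightarrow>\<^sub>E carrier (FObj X ground).
       summable_family X I x \<longrightarrow> (\<exists>!s. is_sum X I x s)) \<and>
    concrete_functor X"

definition SigmaVect ::
    "(('u space, 'u linmap, 'u space, 'u linmap) functor_data,
      (('u space, 'u linmap, 'u space, 'u linmap) functor_data, 'u space \<Rightarrow> 'u linmap) arrow) category"
  where "SigmaVect = full_subcategory LinEnd {X. strong_space X}"

end

end

theory Submission
  imports Defs
begin

text \<open>
  A linear functor \<open>X\<close> is strong iff an element of \<open>X(k\<^sup>(\<^sup>I\<^sup>))\<close> vanishes as soon as all its
  coordinates \<open>X(\<delta>\<^sub>i)\<close> do: every functional on \<open>k\<^sup>(\<^sup>I\<^sup>)\<close> factors as \<open>\<sigma>\<close> after a diagonal map, and every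
  space is a retract of some \<open>k\<^sup>(\<^sup>I\<^sup>)\<close>.  Closing zero under the corresponding rule inside an arbitrary
  \<open>X\<close> yields the torsion subfunctor \<open>tX\<close>; its elements are generated inductively, so it is natural
  and idempotent, \<open>X/tX\<close> is strong, and \<open>X \<mapsto> X/tX\<close> is the reflection.  The left class consists of
  the maps inducing isomorphisms modulo torsion, the right class of those inducing isomorphisms on
  torsion, and a map \<open>A \<rightarrow> B\<close> factors through the pullback of \<open>B \<rightarrow> B/tB \<leftarrow> A/tA\<close>.

  Smallness of a functor is equivalent to a bound on the dimension of the spaces that support its
  elements, a condition inherited by subobjects, quotients and finite products.  It holds for
  strong functors by Hilbert's hotel: if infinitely many coordinates of \<open>x\<close> were equal to \<open>h \<noteq> 0\<close>,
  shifting them along would fix \<open>x\<close> and change its sum by \<open>h\<close>.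
\<close>

section \<open>Small sets\<close>

text \<open>An element whose coordinates are torsion but not zero acquires zero coordinates in a
  quotient by torsion. So a single pass of the vanishing rule is not enough: the rule must accept
  torsion coordinates, and \<open>tors\<close> is its least fixed point. The obstacle that shapes
  the proof is smallness, which is defined by a colimit over a small directed poset, formed among
  all linear endofunctors. Closure under quotients and pullbacks is not visible in that form, but is
  easy for the bound; the price is to present every bounded functor as such a colimit. The elements
  of X form a category that is neither small nor a poset, so it has to be cut down. Generators are
  taken from the one set X(\<open>ds A\<close>) and placed in disjoint copies of
  \<open>ds A\<close>; a finite set of them is paired with a subspace supporting their sum. Keeping
  honest subspaces of one ambient space makes the indices a small poset, and shrinking a subspace to
  a kernel produces both the upper bounds and the identifications that the colimit requires.\<close>

context grothendieck_universe
begin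

lemma elts_set_code [simp]: "small elts A \<Longrightarrow> elts (set_code elts A) = A"
proof -
  assume "small elts A"
  then obtain x where x: "elts x = A"
    by (auto simp: small_def)
  then have "set_code elts A = x"
    unfolding set_code_def by (intro the_equality) (auto intro: extensionality)
  with x show ?thesis
    by simp
qed

lemma small_elts [simp]: "small elts (elts x)"
  by (auto simp: small_def)

text \<open>Separation comes for free: \<open>power_set\<close> speaks of the full HOL power set, so
  every HOL subset of a small set has a code.\<close>

lemma small_subset:
  assumes "small elts A" "B \<subseteq> A"
  shows "small elts B"
proof -
  obtain x where "elts x = A"
    using assms by (auto simp: small_def)
  then obtain p where "elts ` elts p = Pow A"
    using power_set[of x] by auto
  moreover have "B \<in> Pow A"
    using assms(2) by simp
  ultimately have "B \<in> elts ` elts p"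
    by simp
  then show ?thesis
    by (auto simp: small_def)
qed

lemma small_insert_pair: "small elts {x, y}"
  using pairing by (auto simp: small_def)

lemma small_singleton: "small elts {x}"
  using pairing[of x x] by (auto simp: small_def)

lemma small_UN_elts:
  assumes "small elts A"
  shows "small elts (\<Union>a\<in>A. elts (f a))"
proof -
  obtain x where "elts x = A"
    using assms by (auto simp: small_def)
  then show ?thesis
    using union[of f x] by (auto simp: small_def)
qed

lemma small_UN:
  assumes "small elts A" "\<And>a. a \<in> A \<Longrightarrow> small elts (B a)"
  shows "small elts (\<Union>a\<in>A. B a)"
proof -
  have "(\<Union>a\<in>A. B a) = (\<Union>a\<in>A. elts (set_code elts (B a)))"
    using assms(2) by simp
  then show ?thesis
    using small_UN_elts[OF assms(1)] by metis
qed

text \<open>Replacement is the union axiom applied to singletons.\<close>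

lemma small_image:
  assumes "small elts A"
  shows "small elts (f ` A)"
proof -
  have "f ` A = (\<Union>a\<in>A. {f a})"
    by auto
  then show ?thesis
    using small_UN[OF assms, of "\<lambda>a. {f a}"] by (simp add: small_singleton)
qed

lemma small_Un:
  assumes "small elts A" "small elts B"
  shows "small elts (A \<union> B)"
proof -
  have "A \<union> B = (\<Union>x\<in>{set_code elts A, set_code elts B}. elts x)"
    using assms by simp
  then show ?thesis
    using small_UN[OF small_insert_pair, of "set_code elts A" "set_code elts B" elts] by simp
qed

text \<open>\<open>power_set\<close> provides some p whose elements decode onto all subsets;
  extensionality puts every code into p. The index set \<open>Ind\<close> of the later colimit
  consists of pairs of such codes, and is small for this reason.\<close>

lemma small_codes:
  assumes "small elts A"
  shows "small elts {z. elts z \<subseteq> A}"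
proof -
  obtain x where x: "elts x = A"
    using assms by (auto simp: small_def)
  then obtain p where p: "elts ` elts p = Pow A"
    using power_set[of x] by auto
  have "{z. elts z \<subseteq> A} = elts p"
  proof (intro subset_antisym subsetI)
    fix z
    assume "z \<in> {z. elts z \<subseteq> A}"
    then have "elts z \<in> elts ` elts p"
      using p by simp
    then show "z \<in> elts p"
      using extensionality by auto
  next
    fix z
    assume "z \<in> elts p"
    then show "z \<in> {z. elts z \<subseteq> A}"
      using p by blast
  qed
  then show ?thesis
    by simp
qed

section \<open>Codes of pairs and of functions\<close>

lemma set_code_inject: "small elts A \<Longrightarrow> small elts B \<Longrightarrow> set_code elts A = set_code elts B \<longleftrightarrow> A = B"
  by (metis elts_set_code)

lemma opair_eq_iff [simp]: "opair elts a b = opair elts c d \<longleftrightarrow> a = c \<and> b = d"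
  unfolding opair_def
  by (simp add: set_code_inject small_insert_pair small_singleton doubleton_eq_iff) auto

definition ofst :: "'u \<Rightarrow> 'u" where "ofst q = (THE a. \<exists>b. q = opair elts a b)"
definition osnd :: "'u \<Rightarrow> 'u" where "osnd q = (THE b. \<exists>a. q = opair elts a b)"

lemma ofst_opair [simp]: "ofst (opair elts a b) = a"
  unfolding ofst_def by auto

lemma osnd_opair [simp]: "osnd (opair elts a b) = b"
  unfolding osnd_def by auto

definition otimes :: "'u set \<Rightarrow> 'u set \<Rightarrow> 'u set"
  where "otimes A B = {opair elts a b | a b. a \<in> A \<and> b \<in> B}"

lemma opair_mem_otimes [simp]: "opair elts a b \<in> otimes A B \<longleftrightarrow> a \<in> A \<and> b \<in> B"
  by (auto simp: otimes_def)

lemma small_otimes: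
  assumes "small elts A" "small elts B"
  shows "small elts (otimes A B)"
proof -
  have "otimes A B = (\<Union>a\<in>A. opair elts a ` B)"
    by (auto simp: otimes_def)
  then show ?thesis
    using assms by (simp add: small_UN small_image)
qed

lemma elts_graph: "small elts A \<Longrightarrow> elts (graph elts A f) = (\<lambda>x. opair elts x (f x)) ` A"
  by (simp add: graph_def small_image)

lemma app_graph [simp]: "small elts A \<Longrightarrow> x \<in> A \<Longrightarrow> app elts (graph elts A f) x = f x"
  unfolding app_def by (rule the_equality) (auto simp: elts_graph)

lemma graph_eq_iff: 
  assumes "small elts A"
  shows "graph elts A f = graph elts A g \<longleftrightarrow> (\<forall>x\<in>A. f x = g x)"
proof
  assume "graph elts A f = graph elts A g"
  then show "\<forall>x\<in>A. f x = g x"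
    using app_graph[OF assms] by metis
qed (auto simp: graph_def intro!: arg_cong[where f = "set_code elts"])

lemma small_graphs:
  assumes "small elts A" "small elts B"
  shows "small elts {graph elts A f | f. f \<in> A \<rightarrow> B}"
  by (rule small_subset[OF small_codes[OF small_otimes[OF assms]]])
    (use assms in \<open>auto simp: elts_graph Pi_iff\<close>)

end

section \<open>Modules\<close>

text \<open>The axioms are equations and existence statements, which pass along any surjection
  respecting the operations, injective or not. This covers records in normal form, encodings of
  functions by graphs, and quotients.\<close>

lemma module_image:
  assumes M: "module K M"
    and car: "carrier N = q ` carrier M"
    and z: "zero N = q (zero M)"
    and a: "\<And>x y. x \<in> carrier M \<Longrightarrow> y \<in> carrier M \<Longrightarrow> q x \<oplus>\<^bsub>N\<^esub> q y = q (x \<oplus>\<^bsub>M\<^esub> y)"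
    and s: "\<And>c x. c \<in> carrier K \<Longrightarrow> x \<in> carrier M \<Longrightarrow> c \<odot>\<^bsub>N\<^esub> q x = q (c \<odot>\<^bsub>M\<^esub> x)"
  shows "module K N"
proof -
  interpret M: module K M by (rule M)
  show ?thesis
  proof (rule moduleI)
    show "cring K" ..
    show "abelian_group N"
    proof (rule abelian_groupI; unfold car z)
      fix x y
      assume "x \<in> q ` carrier M" "y \<in> q ` carrier M"
      then show "x \<oplus>\<^bsub>N\<^esub> y \<in> q ` carrier M" "x \<oplus>\<^bsub>N\<^esub> y = y \<oplus>\<^bsub>N\<^esub> x"
        by (auto simp: a M.a_comm)
      show "\<exists>y\<in>q ` carrier M. y \<oplus>\<^bsub>N\<^esub> x = q \<zero>\<^bsub>M\<^esub>"
      proof -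
        obtain m where "m \<in> carrier M" "x = q m"
          using \<open>x \<in> q ` carrier M\<close> by auto
        then show ?thesis
          using a[of "\<ominus>\<^bsub>M\<^esub> m" m] by (intro bexI[of _ "q (\<ominus>\<^bsub>M\<^esub> m)"]) (auto simp: M.l_neg)
      qed
      show "q \<zero>\<^bsub>M\<^esub> \<oplus>\<^bsub>N\<^esub> x = x"
        using \<open>x \<in> q ` carrier M\<close> by (auto simp: a)
    qed (auto simp: a M.a_assoc)
  qed (auto simp: car a s M.smult_l_distr M.smult_r_distr M.smult_assoc1)
qed

lemma module_mk_space:
  assumes "module K N"
  shows "module K (mk_space (carrier N) (zero N) (add N) (carrier K) (smult N))"
proof -
  interpret N: module K N by (rule assms)
  show ?thesis
    by (rule module_image[OF assms, where q = id]) (auto simp: mk_space_def)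
qed

lemma mk_space_simps [simp]:
  "carrier (mk_space A z pl S sc) = A"
  "zero (mk_space A z pl S sc) = z"
  "x \<in> A \<Longrightarrow> y \<in> A \<Longrightarrow> add (mk_space A z pl S sc) x y = pl x y"
  "c \<in> S \<Longrightarrow> x \<in> A \<Longrightarrow> smult (mk_space A z pl S sc) c x = sc c x"
  by (auto simp: mk_space_def)

lemma mk_space_cong:
  assumes "A = A'" "z = z'" "S = S'"
    "\<And>x y. x \<in> A \<Longrightarrow> y \<in> A \<Longrightarrow> pl x y = pl' x y"
    "\<And>c x. c \<in> S \<Longrightarrow> x \<in> A \<Longrightarrow> sc c x = sc' c x"
  shows "mk_space A z pl S sc = mk_space A' z' pl' S' sc'"
  using assms by (auto simp: mk_space_def fun_eq_iff restrict_def)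

text \<open>The laws hold pointwise, and extensionality turns pointwise equality into equality.
  Negatives are multiples by minus one, so the closure condition for scalars supplies them.\<close>

lemma module_functions:
  fixes W :: "('u, 'w) module" and C :: "('i \<Rightarrow> 'w) set"
  assumes W: "module K W"
    and sub: "C \<subseteq> I \<rightarrow>\<^sub>E carrier W"
    and z: "(\<lambda>i\<in>I. \<zero>\<^bsub>W\<^esub>) \<in> C"
    and a: "\<And>f g. f \<in> C \<Longrightarrow> g \<in> C \<Longrightarrow> (\<lambda>i\<in>I. f i \<oplus>\<^bsub>W\<^esub> g i) \<in> C"
    and s: "\<And>c f. c \<in> carrier K \<Longrightarrow> f \<in> C \<Longrightarrow> (\<lambda>i\<in>I. c \<odot>\<^bsub>W\<^esub> f i) \<in> C"
  shows "module K \<lparr>carrier = C, mult = undefined, one = undefined, zero = (\<lambda>i\<in>I. \<zero>\<^bsub>W\<^esub>),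
    add = (\<lambda>f g. \<lambda>i\<in>I. f i \<oplus>\<^bsub>W\<^esub> g i), smult = (\<lambda>c f. \<lambda>i\<in>I. c \<odot>\<^bsub>W\<^esub> f i)\<rparr>" (is "module K ?M")
proof -
  interpret W: module K W by (rule W)
  have C: "f i \<in> carrier W" if "f \<in> C" "i \<in> I" for f i
    using that sub by auto
  have eqI: "f = g" if "f \<in> I \<rightarrow>\<^sub>E carrier W" "g \<in> I \<rightarrow>\<^sub>E carrier W" "\<And>i. i \<in> I \<Longrightarrow> f i = g i" for f g
    using that by (rule PiE_ext)
  have E: "f \<in> I \<rightarrow>\<^sub>E carrier W" if "f \<in> C" for f
    using that sub by auto
  show ?thesis
  proof (rule moduleI)
    show "cring K" ..
    show "abelian_group ?M"
    proof (rule abelian_groupI)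
      fix f
      assume "f \<in> carrier ?M"
      then have f: "f \<in> C" by simp
      have "(\<lambda>i\<in>I. (\<ominus>\<^bsub>K\<^esub> \<one>\<^bsub>K\<^esub>) \<odot>\<^bsub>W\<^esub> f i) \<in> C"
        using s[of "\<ominus>\<^bsub>K\<^esub> \<one>\<^bsub>K\<^esub>" f] f by simp
      moreover have "(\<lambda>i\<in>I. (\<lambda>i\<in>I. (\<ominus>\<^bsub>K\<^esub> \<one>\<^bsub>K\<^esub>) \<odot>\<^bsub>W\<^esub> f i) i \<oplus>\<^bsub>W\<^esub> f i) = (\<lambda>i\<in>I. \<zero>\<^bsub>W\<^esub>)"
        using C[OF f] by (intro restrict_ext) (simp add: W.smult_l_minus W.l_neg)
      ultimately show "\<exists>g\<in>carrier ?M. g \<oplus>\<^bsub>?M\<^esub> f = \<zero>\<^bsub>?M\<^esub>"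
        by (intro bexI) simp_all
    next
      fix f g h
      assume "f \<in> carrier ?M" "g \<in> carrier ?M" "h \<in> carrier ?M"
      then show "f \<oplus>\<^bsub>?M\<^esub> g \<oplus>\<^bsub>?M\<^esub> h = f \<oplus>\<^bsub>?M\<^esub> (g \<oplus>\<^bsub>?M\<^esub> h)"
        by (auto simp: C W.a_assoc intro!: restrict_ext)
    next
      fix f g
      assume "f \<in> carrier ?M" "g \<in> carrier ?M"
      then show "f \<oplus>\<^bsub>?M\<^esub> g = g \<oplus>\<^bsub>?M\<^esub> f"
        by (auto simp: C W.a_comm intro!: restrict_ext)
    next
      fix f
      assume f: "f \<in> carrier ?M"
      show "\<zero>\<^bsub>?M\<^esub> \<oplus>\<^bsub>?M\<^esub> f = f"
        using f by (intro eqI) (auto simp: C intro!: E)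
    qed (simp_all add: a z)
  next
    fix f
    assume f: "f \<in> carrier ?M"
    show "\<one>\<^bsub>K\<^esub> \<odot>\<^bsub>?M\<^esub> f = f"
      using f by (intro eqI) (auto simp: C intro!: E)
  qed (auto simp: C s W.smult_l_distr W.smult_r_distr W.smult_assoc1 intro!: restrict_ext)
qed


section \<open>Linear algebra over the small field\<close>

locale small_field = grothendieck_universe elts + K: field K
  for elts :: "'u \<Rightarrow> 'u set" and K :: "'u ring" +
  assumes small_K: "small elts (carrier K)"
begin

abbreviation sp :: "'u space \<Rightarrow> bool" where "sp V \<equiv> small_space elts K V"

lemma sp_module: "sp V \<Longrightarrow> module K V"
  by (simp add: small_space_def)

lemma sp_small: "sp V \<Longrightarrow> small elts (carrier V)"
  by (simp add: small_space_def)

lemma sp_mk_space: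
  assumes "module K (mk_space A z pl (carrier K) sc)" "small elts A"
  shows "sp (mk_space A z pl (carrier K) sc)"
  using assms by (auto simp: small_space_def intro!: mk_space_cong)

lemma sp_closed [simp, intro]:
  assumes "sp V"
  shows "\<zero>\<^bsub>V\<^esub> \<in> carrier V"
    and "x \<in> carrier V \<Longrightarrow> y \<in> carrier V \<Longrightarrow> x \<oplus>\<^bsub>V\<^esub> y \<in> carrier V"
    and "c \<in> carrier K \<Longrightarrow> x \<in> carrier V \<Longrightarrow> c \<odot>\<^bsub>V\<^esub> x \<in> carrier V"
    and "x \<in> carrier V \<Longrightarrow> \<ominus>\<^bsub>V\<^esub> x \<in> carrier V"
    and "x \<in> carrier V \<Longrightarrow> y \<in> carrier V \<Longrightarrow> x \<ominus>\<^bsub>V\<^esub> y \<in> carrier V"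
proof -
  interpret V: module K V by (rule sp_module[OF assms])
  show "\<zero>\<^bsub>V\<^esub> \<in> carrier V"
    and "x \<in> carrier V \<Longrightarrow> y \<in> carrier V \<Longrightarrow> x \<oplus>\<^bsub>V\<^esub> y \<in> carrier V"
    and "c \<in> carrier K \<Longrightarrow> x \<in> carrier V \<Longrightarrow> c \<odot>\<^bsub>V\<^esub> x \<in> carrier V"
    and "x \<in> carrier V \<Longrightarrow> \<ominus>\<^bsub>V\<^esub> x \<in> carrier V"
    and "x \<in> carrier V \<Longrightarrow> y \<in> carrier V \<Longrightarrow> x \<ominus>\<^bsub>V\<^esub> y \<in> carrier V"
    by auto
qed

lemma sp_simps [simp]:
  assumes "sp V" "x \<in> carrier V"
  shows "\<zero>\<^bsub>V\<^esub> \<oplus>\<^bsub>V\<^esub> x = x" "x \<oplus>\<^bsub>V\<^esub> \<zero>\<^bsub>V\<^esub> = x" "\<one>\<^bsub>K\<^esub> \<odot>\<^bsub>V\<^esub> x = x" "\<zero>\<^bsub>K\<^esub> \<odot>\<^bsub>V\<^esub> x = \<zero>\<^bsub>V\<^esub>"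
    "x \<ominus>\<^bsub>V\<^esub> x = \<zero>\<^bsub>V\<^esub>" "x \<ominus>\<^bsub>V\<^esub> \<zero>\<^bsub>V\<^esub> = x"
proof -
  interpret V: module K V by (rule sp_module[OF assms(1)])
  show "\<zero>\<^bsub>V\<^esub> \<oplus>\<^bsub>V\<^esub> x = x" "x \<oplus>\<^bsub>V\<^esub> \<zero>\<^bsub>V\<^esub> = x" "\<one>\<^bsub>K\<^esub> \<odot>\<^bsub>V\<^esub> x = x" "\<zero>\<^bsub>K\<^esub> \<odot>\<^bsub>V\<^esub> x = \<zero>\<^bsub>V\<^esub>"
    "x \<ominus>\<^bsub>V\<^esub> x = \<zero>\<^bsub>V\<^esub>" "x \<ominus>\<^bsub>V\<^esub> \<zero>\<^bsub>V\<^esub> = x"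
    using assms by (auto simp: V.minus_eq V.r_neg)
qed

lemma sp_smult_zero [simp]: "sp V \<Longrightarrow> c \<in> carrier K \<Longrightarrow> c \<odot>\<^bsub>V\<^esub> \<zero>\<^bsub>V\<^esub> = \<zero>\<^bsub>V\<^esub>"
  using module.smult_r_null[OF sp_module] .

lemma sp_minus_smult:
  "sp V \<Longrightarrow> x \<in> carrier V \<Longrightarrow> y \<in> carrier V \<Longrightarrow> x \<ominus>\<^bsub>V\<^esub> y = x \<oplus>\<^bsub>V\<^esub> (\<ominus>\<^bsub>K\<^esub> \<one>\<^bsub>K\<^esub>) \<odot>\<^bsub>V\<^esub> y"
proof -
  assume V: "sp V" "x \<in> carrier V" "y \<in> carrier V"
  interpret V: module K V by (rule sp_module[OF V(1)])
  show ?thesis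
    using V by (simp add: V.minus_eq V.smult_l_minus)
qed

lemma sp_minus_eq_zero:
  assumes "sp V" "x \<in> carrier V" "y \<in> carrier V"
  shows "x \<ominus>\<^bsub>V\<^esub> y = \<zero>\<^bsub>V\<^esub> \<longleftrightarrow> x = y"
proof -
  interpret V: module K V by (rule sp_module[OF assms(1)])
  show ?thesis
    using assms by (metis V.add.inv_solve_right' V.l_zero V.minus_eq V.zero_closed)
qed

lemma sp_add_minus:
  assumes "sp V" "x \<in> carrier V" "y \<in> carrier V"
  shows "(x \<ominus>\<^bsub>V\<^esub> y) \<oplus>\<^bsub>V\<^esub> y = x" "y \<oplus>\<^bsub>V\<^esub> (x \<ominus>\<^bsub>V\<^esub> y) = x" "x \<oplus>\<^bsub>V\<^esub> y \<ominus>\<^bsub>V\<^esub> y = x" "y \<oplus>\<^bsub>V\<^esub> x \<ominus>\<^bsub>V\<^esub> y = x"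
proof -
  interpret V: module K V by (rule sp_module[OF assms(1)])
  show "(x \<ominus>\<^bsub>V\<^esub> y) \<oplus>\<^bsub>V\<^esub> y = x" "y \<oplus>\<^bsub>V\<^esub> (x \<ominus>\<^bsub>V\<^esub> y) = x" "x \<oplus>\<^bsub>V\<^esub> y \<ominus>\<^bsub>V\<^esub> y = x" "y \<oplus>\<^bsub>V\<^esub> x \<ominus>\<^bsub>V\<^esub> y = x"
    using assms by (simp_all add: V.minus_eq V.a_assoc V.r_neg V.l_neg V.a_ac V.r_neg1 V.r_neg2)
qed

lemma sp_minus_add_distrib:
  assumes "sp V" "x \<in> carrier V" "y \<in> carrier V" "x' \<in> carrier V" "y' \<in> carrier V"
  shows "(x \<oplus>\<^bsub>V\<^esub> x') \<ominus>\<^bsub>V\<^esub> (y \<oplus>\<^bsub>V\<^esub> y') = (x \<ominus>\<^bsub>V\<^esub> y) \<oplus>\<^bsub>V\<^esub> (x' \<ominus>\<^bsub>V\<^esub> y')"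
proof -
  interpret V: module K V by (rule sp_module[OF assms(1)])
  show ?thesis
    using assms by (simp add: V.minus_eq V.minus_add V.a_ac)
qed

lemma sp_smult_minus:
  assumes "sp V" "x \<in> carrier V" "y \<in> carrier V" "c \<in> carrier K"
  shows "c \<odot>\<^bsub>V\<^esub> (x \<ominus>\<^bsub>V\<^esub> y) = c \<odot>\<^bsub>V\<^esub> x \<ominus>\<^bsub>V\<^esub> c \<odot>\<^bsub>V\<^esub> y"
proof -
  interpret V: module K V by (rule sp_module[OF assms(1)])
  show ?thesis
    using assms by (simp add: V.minus_eq V.smult_r_distr V.smult_r_minus)
qed

subsection \<open>Linear maps and subspaces\<close>

text \<open>In contrast to \<open>linear_map\<close> there is no extensionality: f is a total
  function that is looked at on the carrier only. Sums and composites are then plain lambda terms,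
  and restriction happens once, in \<open>arr\<close>.\<close>

definition lin :: "'u space \<Rightarrow> 'u space \<Rightarrow> ('u \<Rightarrow> 'u) \<Rightarrow> bool"
  where "lin V W f \<longleftrightarrow>
    (\<forall>x\<in>carrier V. f x \<in> carrier W) \<and>
    (\<forall>x\<in>carrier V. \<forall>y\<in>carrier V. f (x \<oplus>\<^bsub>V\<^esub> y) = f x \<oplus>\<^bsub>W\<^esub> f y) \<and>
    (\<forall>c\<in>carrier K. \<forall>x\<in>carrier V. f (c \<odot>\<^bsub>V\<^esub> x) = c \<odot>\<^bsub>W\<^esub> f x)"

lemma linI:
  assumes "\<And>x. x \<in> carrier V \<Longrightarrow> f x \<in> carrier W"
    and "\<And>x y. x \<in> carrier V \<Longrightarrow> y \<in> carrier V \<Longrightarrow> f (x \<oplus>\<^bsub>V\<^esub> y) = f x \<oplus>\<^bsub>W\<^esub> f y"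
    and "\<And>c x. c \<in> carrier K \<Longrightarrow> x \<in> carrier V \<Longrightarrow> f (c \<odot>\<^bsub>V\<^esub> x) = c \<odot>\<^bsub>W\<^esub> f x"
  shows "lin V W f"
  using assms by (simp add: lin_def)

lemma lin_closed: "lin V W f \<Longrightarrow> x \<in> carrier V \<Longrightarrow> f x \<in> carrier W"
  and lin_add: "lin V W f \<Longrightarrow> x \<in> carrier V \<Longrightarrow> y \<in> carrier V \<Longrightarrow> f (x \<oplus>\<^bsub>V\<^esub> y) = f x \<oplus>\<^bsub>W\<^esub> f y"
  and lin_smult: "lin V W f \<Longrightarrow> c \<in> carrier K \<Longrightarrow> x \<in> carrier V \<Longrightarrow> f (c \<odot>\<^bsub>V\<^esub> x) = c \<odot>\<^bsub>W\<^esub> f x"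
  by (simp_all add: lin_def)

lemma lin_cong:
  assumes "sp V" "\<And>x. x \<in> carrier V \<Longrightarrow> f x = g x"
  shows "lin V W f \<longleftrightarrow> lin V W g"
  using assms by (simp add: lin_def)

lemma lin_zero:
  assumes "sp V" "sp W" "lin V W f"
  shows "f \<zero>\<^bsub>V\<^esub> = \<zero>\<^bsub>W\<^esub>"
proof -
  have "f (\<zero>\<^bsub>K\<^esub> \<odot>\<^bsub>V\<^esub> \<zero>\<^bsub>V\<^esub>) = \<zero>\<^bsub>K\<^esub> \<odot>\<^bsub>W\<^esub> f \<zero>\<^bsub>V\<^esub>"
    using assms by (intro lin_smult) auto
  then show ?thesis
    using assms lin_closed[of V W f "\<zero>\<^bsub>V\<^esub>"] by simp
qed

lemma lin_minus:
  assumes "sp V" "sp W" "lin V W f" "x \<in> carrier V" "y \<in> carrier V"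
  shows "f (x \<ominus>\<^bsub>V\<^esub> y) = f x \<ominus>\<^bsub>W\<^esub> f y"
  using assms by (simp add: sp_minus_smult lin_closed lin_add[of V W f] lin_smult[of V W f])

lemma lin_id: "lin V V (\<lambda>x. x)"
  by (simp add: lin_def)

lemma lin_comp: "lin V W f \<Longrightarrow> lin W U g \<Longrightarrow> lin V U (\<lambda>x. g (f x))"
  by (simp add: lin_def)

lemma lin_zero_map: "sp W \<Longrightarrow> lin V W (\<lambda>x. \<zero>\<^bsub>W\<^esub>)"
  by (rule linI) auto

lemma lin_plus:
  assumes "sp W" "lin V W f" "lin V W g"
  shows "lin V W (\<lambda>x. f x \<oplus>\<^bsub>W\<^esub> g x)"
proof -
  interpret W: module K W by (rule sp_module[OF assms(1)])
  show ?thesis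
    using assms(2,3) by (intro linI) (auto simp: lin_def W.a_ac W.smult_r_distr)
qed

lemma lin_scale:
  assumes "sp W" "lin V W f" "c \<in> carrier K"
  shows "lin V W (\<lambda>x. c \<odot>\<^bsub>W\<^esub> f x)"
proof -
  interpret W: module K W by (rule sp_module[OF assms(1)])
  show ?thesis
    using assms(2,3)
    by (intro linI) (auto simp: lin_def W.smult_r_distr K.m_comm simp flip: W.smult_assoc1)
qed

lemma lin_diff:
  assumes "sp W" "sp V" "lin V W f" "lin V W g"
  shows "lin V W (\<lambda>x. f x \<ominus>\<^bsub>W\<^esub> g x)"
proof -
  have "lin V W (\<lambda>x. f x \<oplus>\<^bsub>W\<^esub> (\<ominus>\<^bsub>K\<^esub> \<one>\<^bsub>K\<^esub>) \<odot>\<^bsub>W\<^esub> g x)"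
    using assms by (intro lin_plus lin_scale) auto
  then show ?thesis
    using assms by (subst lin_cong[where g = "\<lambda>x. f x \<oplus>\<^bsub>W\<^esub> (\<ominus>\<^bsub>K\<^esub> \<one>\<^bsub>K\<^esub>) \<odot>\<^bsub>W\<^esub> g x"])
      (auto simp: sp_minus_smult lin_closed)
qed

definition subsp :: "'u space \<Rightarrow> 'u set \<Rightarrow> bool"
  where "subsp V U \<longleftrightarrow> U \<subseteq> carrier V \<and> \<zero>\<^bsub>V\<^esub> \<in> U \<and>
    (\<forall>x\<in>U. \<forall>y\<in>U. x \<oplus>\<^bsub>V\<^esub> y \<in> U) \<and> (\<forall>c\<in>carrier K. \<forall>x\<in>U. c \<odot>\<^bsub>V\<^esub> x \<in> U)"

lemma subspD:
  assumes "subsp V U"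
  shows "x \<in> U \<Longrightarrow> x \<in> carrier V" "\<zero>\<^bsub>V\<^esub> \<in> U" "x \<in> U \<Longrightarrow> y \<in> U \<Longrightarrow> x \<oplus>\<^bsub>V\<^esub> y \<in> U"
    "c \<in> carrier K \<Longrightarrow> x \<in> U \<Longrightarrow> c \<odot>\<^bsub>V\<^esub> x \<in> U"
  using assms by (auto simp: subsp_def)

lemma subsp_minus:
  assumes "sp V" "subsp V U" "x \<in> U" "y \<in> U"
  shows "x \<ominus>\<^bsub>V\<^esub> y \<in> U"
  using assms by (simp add: sp_minus_smult subspD)

definition sub_space :: "'u space \<Rightarrow> 'u set \<Rightarrow> 'u space"
  where "sub_space V U = mk_space U (zero V) (add V) (carrier K) (smult V)"

lemma sub_space_simps [simp]:
  "carrier (sub_space V U) = U" "\<zero>\<^bsub>sub_space V U\<^esub> = \<zero>\<^bsub>V\<^esub>"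
  "x \<in> U \<Longrightarrow> y \<in> U \<Longrightarrow> x \<oplus>\<^bsub>sub_space V U\<^esub> y = x \<oplus>\<^bsub>V\<^esub> y"
  "c \<in> carrier K \<Longrightarrow> x \<in> U \<Longrightarrow> c \<odot>\<^bsub>sub_space V U\<^esub> x = c \<odot>\<^bsub>V\<^esub> x"
  by (simp_all add: sub_space_def)

lemma sp_sub_space:
  assumes "sp V" "subsp V U"
  shows "sp (sub_space V U)"
proof -
  interpret V: module K V by (rule sp_module[OF assms(1)])
  have U: "x \<in> U \<Longrightarrow> x \<in> carrier V" for x
    using subspD[OF assms(2)] by blast
  have "module K (sub_space V U)"
  proof (rule moduleI)
    show "cring K" ..
    show "abelian_group (sub_space V U)"
    proof (rule abelian_groupI)
      fix x
      assume "x \<in> carrier (sub_space V U)"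
      then have x: "x \<in> U" by simp
      have "(\<ominus>\<^bsub>K\<^esub> \<one>\<^bsub>K\<^esub>) \<odot>\<^bsub>V\<^esub> x \<in> U"
        using x subspD(4)[OF assms(2)] by simp
      then show "\<exists>y\<in>carrier (sub_space V U). y \<oplus>\<^bsub>sub_space V U\<^esub> x = \<zero>\<^bsub>sub_space V U\<^esub>"
        using x U by (intro bexI[of _ "(\<ominus>\<^bsub>K\<^esub> \<one>\<^bsub>K\<^esub>) \<odot>\<^bsub>V\<^esub> x"]) (auto simp: V.smult_l_minus V.l_neg)
    qed (auto simp: U subspD[OF assms(2)] V.a_ac)
  qed (auto simp: U subspD[OF assms(2)] V.smult_l_distr V.smult_r_distr V.smult_assoc1)
  moreover have "small elts U"
    using small_subset[OF sp_small[OF assms(1)]] U by blast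
  ultimately show ?thesis
    unfolding sub_space_def by (rule sp_mk_space)
qed

lemma lin_into_sub:
  assumes "lin W V f" "\<And>x. x \<in> carrier W \<Longrightarrow> f x \<in> U"
  shows "lin W (sub_space V U) f"
  using assms by (simp add: lin_def)

lemma lin_on_sub: "subsp V U \<Longrightarrow> lin V W f \<Longrightarrow> lin (sub_space V U) W f"
  by (simp add: lin_def subspD)

lemma lin_incl: "subsp V U \<Longrightarrow> lin (sub_space V U) V (\<lambda>x. x)"
  by (simp add: lin_on_sub lin_id)

lemma subsp_carrier: "sp V \<Longrightarrow> subsp V (carrier V)"
  by (simp add: subsp_def)

text \<open>The normal form demanded by \<open>small_space\<close> makes this an equality of records
  instead of an isomorphism.\<close>

lemma sub_space_carrier: "sp V \<Longrightarrow> sub_space V (carrier V) = V"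
  by (simp add: small_space_def sub_space_def)

lemma subsp_vimage:
  assumes "sp V" "sp W" "lin V W f" "subsp V U" "subsp W U'"
  shows "subsp V {x \<in> U. f x \<in> U'}"
  using assms subspD(1)[OF assms(4)]
  by (auto simp: subsp_def lin_zero[of V W f] lin_add[of V W f] lin_smult[of V W f] subset_iff)

lemma subsp_kernel:
  assumes "sp V" "sp W" "lin V W f" "subsp V U"
  shows "subsp V {x \<in> U. f x = \<zero>\<^bsub>W\<^esub>}"
proof -
  have "subsp W {\<zero>\<^bsub>W\<^esub>}"
    using assms(2) by (auto simp: subsp_def)
  then show ?thesis
    using subsp_vimage[OF assms, of "{\<zero>\<^bsub>W\<^esub>}"] by simp
qed

subsection \<open>Linear selections\<close>

text \<open>Linear relations, that is, subspaces of the product of V and W. They are kept as HOL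
  sets of pairs so that Zorn's lemma applies to inclusion.\<close>

definition lrel :: "'u space \<Rightarrow> 'u space \<Rightarrow> ('u \<times> 'u) set \<Rightarrow> bool"
  where "lrel V W G \<longleftrightarrow> G \<subseteq> carrier V \<times> carrier W \<and> (\<zero>\<^bsub>V\<^esub>, \<zero>\<^bsub>W\<^esub>) \<in> G \<and>
    (\<forall>v w v' w'. (v, w) \<in> G \<longrightarrow> (v', w') \<in> G \<longrightarrow> (v \<oplus>\<^bsub>V\<^esub> v', w \<oplus>\<^bsub>W\<^esub> w') \<in> G) \<and>
    (\<forall>c\<in>carrier K. \<forall>v w. (v, w) \<in> G \<longrightarrow> (c \<odot>\<^bsub>V\<^esub> v, c \<odot>\<^bsub>W\<^esub> w) \<in> G)"

lemma lrelD:
  assumes "lrel V W G"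
  shows "(v, w) \<in> G \<Longrightarrow> v \<in> carrier V" "(v, w) \<in> G \<Longrightarrow> w \<in> carrier W" "(\<zero>\<^bsub>V\<^esub>, \<zero>\<^bsub>W\<^esub>) \<in> G"
    "(v, w) \<in> G \<Longrightarrow> (v', w') \<in> G \<Longrightarrow> (v \<oplus>\<^bsub>V\<^esub> v', w \<oplus>\<^bsub>W\<^esub> w') \<in> G"
    "c \<in> carrier K \<Longrightarrow> (v, w) \<in> G \<Longrightarrow> (c \<odot>\<^bsub>V\<^esub> v, c \<odot>\<^bsub>W\<^esub> w) \<in> G"
  using assms unfolding lrel_def by blast+

lemma lrel_minus:
  assumes "sp V" "sp W" "lrel V W G" "(v, w) \<in> G" "(v', w') \<in> G"
  shows "(v \<ominus>\<^bsub>V\<^esub> v', w \<ominus>\<^bsub>W\<^esub> w') \<in> G"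
  using assms by (simp add: sp_minus_smult lrelD[OF assms(3)])

text \<open>The extension step for Zorn's lemma. G is the graph of a partial linear map that selects
  from R wherever R offers a value. The value w0 at the new vector v0 is constrained only through
  translates of v0 by the domain of G that lie in the domain of R; by linearity, satisfying the
  constraint for one translate satisfies it for all.\<close>

lemma lrel_extend:
  assumes V: "sp V" and W: "sp W" and R: "lrel V W R" and G: "lrel V W G"
    and G0: "\<And>w. (\<zero>\<^bsub>V\<^esub>, w) \<in> G \<Longrightarrow> w = \<zero>\<^bsub>W\<^esub>"
    and GR: "\<And>v w. (v, w) \<in> G \<Longrightarrow> v \<in> Domain R \<Longrightarrow> (v, w) \<in> R"
    and v0: "v0 \<in> carrier V" "v0 \<notin> Domain G"
  shows "\<exists>G'. lrel V W G' \<and> (\<forall>w. (\<zero>\<^bsub>V\<^esub>, w) \<in> G' \<longrightarrow> w = \<zero>\<^bsub>W\<^esub>) \<and>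
    (\<forall>v w. (v, w) \<in> G' \<longrightarrow> v \<in> Domain R \<longrightarrow> (v, w) \<in> R) \<and> G \<subset> G'"
proof -
  interpret V: module K V by (rule sp_module[OF V])
  interpret W: module K W by (rule sp_module[OF W])
  have Gc: "(v, w) \<in> G \<Longrightarrow> v \<in> carrier V \<and> w \<in> carrier W" for v w
    using lrelD[OF G] by blast
  have Rc: "(v, w) \<in> R \<Longrightarrow> v \<in> carrier V \<and> w \<in> carrier W" for v w
    using lrelD[OF R] by blast
  obtain w0 where w0: "w0 \<in> carrier W"
    and w0R: "\<And>v w z. (v, w) \<in> G \<Longrightarrow> (v \<oplus>\<^bsub>V\<^esub> v0, z) \<in> R \<Longrightarrow> (v \<oplus>\<^bsub>V\<^esub> v0, w \<oplus>\<^bsub>W\<^esub> w0) \<in> R"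
  proof (cases "\<exists>v1 w2 w1. (v1, w2) \<in> G \<and> (v1 \<oplus>\<^bsub>V\<^esub> v0, w1) \<in> R")
    case True
    then obtain v1 w2 w1 where 1: "(v1, w2) \<in> G" "(v1 \<oplus>\<^bsub>V\<^esub> v0, w1) \<in> R"
      by blast
    note c1 = Gc[OF 1(1)] Rc[OF 1(2)]
    \<comment> \<open>If G sends v1 to w2 and R relates v1 + v0 to w1, the choice w0 = w1 - w2 makes
      w2 + w0 equal to w1. Any other translate differs from this one by an element of the domain of
      G that lies in the domain of R, where G already follows R.\<close>
    show ?thesis
    proof (rule that[of "w1 \<ominus>\<^bsub>W\<^esub> w2"])
      show "w1 \<ominus>\<^bsub>W\<^esub> w2 \<in> carrier W"
        using c1 W by simp
      fix v w z
      assume 2: "(v, w) \<in> G" "(v \<oplus>\<^bsub>V\<^esub> v0, z) \<in> R"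
      note c2 = Gc[OF 2(1)] Rc[OF 2(2)]
      have "(v \<ominus>\<^bsub>V\<^esub> v1, w \<ominus>\<^bsub>W\<^esub> w2) \<in> G"
        using lrel_minus[OF V W G 2(1) 1(1)] .
      moreover have "((v \<oplus>\<^bsub>V\<^esub> v0) \<ominus>\<^bsub>V\<^esub> (v1 \<oplus>\<^bsub>V\<^esub> v0), z \<ominus>\<^bsub>W\<^esub> w1) \<in> R"
        using lrel_minus[OF V W R 2(2) 1(2)] .
      moreover have e: "(v \<oplus>\<^bsub>V\<^esub> v0) \<ominus>\<^bsub>V\<^esub> (v1 \<oplus>\<^bsub>V\<^esub> v0) = v \<ominus>\<^bsub>V\<^esub> v1"
        using c1 c2 v0 V by (simp add: sp_minus_add_distrib)
      ultimately have "(v \<ominus>\<^bsub>V\<^esub> v1, w \<ominus>\<^bsub>W\<^esub> w2) \<in> R"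
        using GR by auto
      then have "((v \<ominus>\<^bsub>V\<^esub> v1) \<oplus>\<^bsub>V\<^esub> (v1 \<oplus>\<^bsub>V\<^esub> v0), (w \<ominus>\<^bsub>W\<^esub> w2) \<oplus>\<^bsub>W\<^esub> w1) \<in> R"
        using lrelD(4)[OF R _ 1(2)] by blast
      moreover have "(v \<ominus>\<^bsub>V\<^esub> v1) \<oplus>\<^bsub>V\<^esub> (v1 \<oplus>\<^bsub>V\<^esub> v0) = v \<oplus>\<^bsub>V\<^esub> v0"
        using c1 c2 v0 V by (simp add: sp_add_minus flip: V.a_assoc)
      moreover have "(w \<ominus>\<^bsub>W\<^esub> w2) \<oplus>\<^bsub>W\<^esub> w1 = w \<oplus>\<^bsub>W\<^esub> (w1 \<ominus>\<^bsub>W\<^esub> w2)"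
        using c1 c2 by (simp add: W.minus_eq W.a_ac)
      ultimately show "(v \<oplus>\<^bsub>V\<^esub> v0, w \<oplus>\<^bsub>W\<^esub> (w1 \<ominus>\<^bsub>W\<^esub> w2)) \<in> R"
        by simp
    qed
  next
    case False
    then show ?thesis
      using that[of "\<zero>\<^bsub>W\<^esub>"] W by blast
  qed
  define G' where "G' = {(v \<oplus>\<^bsub>V\<^esub> c \<odot>\<^bsub>V\<^esub> v0, w \<oplus>\<^bsub>W\<^esub> c \<odot>\<^bsub>W\<^esub> w0) | v w c. (v, w) \<in> G \<and> c \<in> carrier K}"
  have G'I: "(v \<oplus>\<^bsub>V\<^esub> c \<odot>\<^bsub>V\<^esub> v0, w \<oplus>\<^bsub>W\<^esub> c \<odot>\<^bsub>W\<^esub> w0) \<in> G'" if "(v, w) \<in> G" "c \<in> carrier K" for v w c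
    using that by (auto simp: G'_def)
  have scale: "inv\<^bsub>K\<^esub> c \<odot>\<^bsub>V\<^esub> (v \<oplus>\<^bsub>V\<^esub> c \<odot>\<^bsub>V\<^esub> v0) = (inv\<^bsub>K\<^esub> c \<odot>\<^bsub>V\<^esub> v) \<oplus>\<^bsub>V\<^esub> v0"
    "inv\<^bsub>K\<^esub> c \<in> carrier K" "c \<otimes>\<^bsub>K\<^esub> inv\<^bsub>K\<^esub> c = \<one>\<^bsub>K\<^esub>"
    if "c \<in> carrier K" "c \<noteq> \<zero>\<^bsub>K\<^esub>" "v \<in> carrier V" for c v
    using that v0 by (auto simp: V.smult_r_distr K.field_Units simp flip: V.smult_assoc1)
  have scale': "c \<odot>\<^bsub>V\<^esub> ((inv\<^bsub>K\<^esub> c \<odot>\<^bsub>V\<^esub> v) \<oplus>\<^bsub>V\<^esub> v0) = v \<oplus>\<^bsub>V\<^esub> c \<odot>\<^bsub>V\<^esub> v0"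
    if "c \<in> carrier K" "c \<noteq> \<zero>\<^bsub>K\<^esub>" "v \<in> carrier V" for c v
    using that v0 scale(2,3)[OF that] by (auto simp: V.smult_r_distr simp flip: V.smult_assoc1)
  have scale'': "c \<odot>\<^bsub>W\<^esub> ((inv\<^bsub>K\<^esub> c \<odot>\<^bsub>W\<^esub> w) \<oplus>\<^bsub>W\<^esub> w0) = w \<oplus>\<^bsub>W\<^esub> c \<odot>\<^bsub>W\<^esub> w0"
    if "c \<in> carrier K" "c \<noteq> \<zero>\<^bsub>K\<^esub>" "w \<in> carrier W" for c w
    using that w0 scale(2,3)[OF that(1,2) v0(1)]
    by (auto simp: W.smult_r_distr simp flip: W.smult_assoc1)
  have notdom: "v \<oplus>\<^bsub>V\<^esub> c \<odot>\<^bsub>V\<^esub> v0 \<noteq> \<zero>\<^bsub>V\<^esub>" if "(v, w) \<in> G" "c \<in> carrier K" "c \<noteq> \<zero>\<^bsub>K\<^esub>" for v w c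
  proof
    assume 0: "v \<oplus>\<^bsub>V\<^esub> c \<odot>\<^bsub>V\<^esub> v0 = \<zero>\<^bsub>V\<^esub>"
    note v = Gc[OF that(1)] and s = scale[OF that(2,3), of v]
    have eq: "(inv\<^bsub>K\<^esub> c \<odot>\<^bsub>V\<^esub> v) \<oplus>\<^bsub>V\<^esub> v0 = \<zero>\<^bsub>V\<^esub>"
      using s v 0 by simp
    have m: "(\<ominus>\<^bsub>K\<^esub> \<one>\<^bsub>K\<^esub>) \<odot>\<^bsub>V\<^esub> (inv\<^bsub>K\<^esub> c \<odot>\<^bsub>V\<^esub> v) = \<ominus>\<^bsub>V\<^esub> (inv\<^bsub>K\<^esub> c \<odot>\<^bsub>V\<^esub> v)"
      using s v by (simp add: V.smult_l_minus)
    have "v0 = \<ominus>\<^bsub>V\<^esub> (inv\<^bsub>K\<^esub> c \<odot>\<^bsub>V\<^esub> v)"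
      using eq s v v0 V.minus_equality[of v0 "inv\<^bsub>K\<^esub> c \<odot>\<^bsub>V\<^esub> v"] by (simp add: V.a_comm)
    moreover have "((\<ominus>\<^bsub>K\<^esub> \<one>\<^bsub>K\<^esub>) \<odot>\<^bsub>V\<^esub> (inv\<^bsub>K\<^esub> c \<odot>\<^bsub>V\<^esub> v), (\<ominus>\<^bsub>K\<^esub> \<one>\<^bsub>K\<^esub>) \<odot>\<^bsub>W\<^esub> (inv\<^bsub>K\<^esub> c \<odot>\<^bsub>W\<^esub> w)) \<in> G"
      using that s v by (intro lrelD(5)[OF G]) auto
    ultimately show False
      using v0(2) m by auto
  qed
  have "G' \<subseteq> carrier V \<times> carrier W"
    using v0 w0 by (auto simp: G'_def dest: Gc)
  moreover have "(\<zero>\<^bsub>V\<^esub>, \<zero>\<^bsub>W\<^esub>) \<in> G'"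
    using G'I[OF lrelD(3)[OF G], of "\<zero>\<^bsub>K\<^esub>"] v0 w0 by simp
  moreover have "(v \<oplus>\<^bsub>V\<^esub> v', w \<oplus>\<^bsub>W\<^esub> w') \<in> G'" if "(v, w) \<in> G'" "(v', w') \<in> G'" for v w v' w'
  proof -
    obtain a b c where 1: "v = a \<oplus>\<^bsub>V\<^esub> c \<odot>\<^bsub>V\<^esub> v0" "w = b \<oplus>\<^bsub>W\<^esub> c \<odot>\<^bsub>W\<^esub> w0" "(a, b) \<in> G" "c \<in> carrier K"
      using \<open>(v, w) \<in> G'\<close> by (auto simp: G'_def)
    obtain a' b' c' where 2: "v' = a' \<oplus>\<^bsub>V\<^esub> c' \<odot>\<^bsub>V\<^esub> v0" "w' = b' \<oplus>\<^bsub>W\<^esub> c' \<odot>\<^bsub>W\<^esub> w0" "(a', b') \<in> G" "c' \<in> carrier K"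
      using \<open>(v', w') \<in> G'\<close> by (auto simp: G'_def)
    have "v \<oplus>\<^bsub>V\<^esub> v' = (a \<oplus>\<^bsub>V\<^esub> a') \<oplus>\<^bsub>V\<^esub> (c \<oplus>\<^bsub>K\<^esub> c') \<odot>\<^bsub>V\<^esub> v0"
      "w \<oplus>\<^bsub>W\<^esub> w' = (b \<oplus>\<^bsub>W\<^esub> b') \<oplus>\<^bsub>W\<^esub> (c \<oplus>\<^bsub>K\<^esub> c') \<odot>\<^bsub>W\<^esub> w0"
      using 1 2 Gc[OF 1(3)] Gc[OF 2(3)] v0 w0
      by (simp_all add: V.a_ac W.a_ac V.smult_l_distr W.smult_l_distr)
    then show ?thesis
      using 1 2 G'I[OF lrelD(4)[OF G 1(3) 2(3)], of "c \<oplus>\<^bsub>K\<^esub> c'"] by simp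
  qed
  moreover have "(d \<odot>\<^bsub>V\<^esub> v, d \<odot>\<^bsub>W\<^esub> w) \<in> G'" if "d \<in> carrier K" "(v, w) \<in> G'" for d v w
  proof -
    obtain a b c where 1: "v = a \<oplus>\<^bsub>V\<^esub> c \<odot>\<^bsub>V\<^esub> v0" "w = b \<oplus>\<^bsub>W\<^esub> c \<odot>\<^bsub>W\<^esub> w0" "(a, b) \<in> G" "c \<in> carrier K"
      using \<open>(v, w) \<in> G'\<close> by (auto simp: G'_def)
    have "d \<odot>\<^bsub>V\<^esub> v = d \<odot>\<^bsub>V\<^esub> a \<oplus>\<^bsub>V\<^esub> (d \<otimes>\<^bsub>K\<^esub> c) \<odot>\<^bsub>V\<^esub> v0"
      "d \<odot>\<^bsub>W\<^esub> w = d \<odot>\<^bsub>W\<^esub> b \<oplus>\<^bsub>W\<^esub> (d \<otimes>\<^bsub>K\<^esub> c) \<odot>\<^bsub>W\<^esub> w0"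
      using 1 Gc[OF 1(3)] v0 w0 that(1)
      by (simp_all add: V.smult_r_distr W.smult_r_distr V.smult_assoc1 W.smult_assoc1)
    then show ?thesis
      using 1 that(1) G'I[OF lrelD(5)[OF G that(1) 1(3)], of "d \<otimes>\<^bsub>K\<^esub> c"] by simp
  qed
  ultimately have "lrel V W G'"
    unfolding lrel_def by blast
  moreover have "w = \<zero>\<^bsub>W\<^esub>" if w: "(\<zero>\<^bsub>V\<^esub>, w) \<in> G'" for w
  proof -
    obtain a b c where 1: "\<zero>\<^bsub>V\<^esub> = a \<oplus>\<^bsub>V\<^esub> c \<odot>\<^bsub>V\<^esub> v0" "w = b \<oplus>\<^bsub>W\<^esub> c \<odot>\<^bsub>W\<^esub> w0" "(a, b) \<in> G" "c \<in> carrier K"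
      using w unfolding G'_def by blast
    have "c = \<zero>\<^bsub>K\<^esub>"
      using notdom[OF 1(3,4)] 1(1) by metis
    then show ?thesis
      using 1 Gc[OF 1(3)] v0 w0 G0 by auto
  qed
  moreover have "(v, w) \<in> R" if "(v, w) \<in> G'" and dom: "v \<in> Domain R" for v w
  proof -
    obtain z where z: "(v, z) \<in> R"
      using dom by auto
    obtain a b c where 1: "v = a \<oplus>\<^bsub>V\<^esub> c \<odot>\<^bsub>V\<^esub> v0" "w = b \<oplus>\<^bsub>W\<^esub> c \<odot>\<^bsub>W\<^esub> w0" "(a, b) \<in> G" "c \<in> carrier K"
      using \<open>(v, w) \<in> G'\<close> by (auto simp: G'_def)
    note ab = Gc[OF 1(3)]
    show ?thesis
    proof (cases "c = \<zero>\<^bsub>K\<^esub>")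
      case True
      then show ?thesis
        using 1 ab v0 w0 dom GR by auto
    next
      case False
      \<comment> \<open>Dividing by c reduces to coefficient one at v0, where \<open>w0R\<close>
        applies; the result is scaled back by c.\<close>
      note s = scale[OF 1(4) False, of a]
      have "(inv\<^bsub>K\<^esub> c \<odot>\<^bsub>V\<^esub> a, inv\<^bsub>K\<^esub> c \<odot>\<^bsub>W\<^esub> b) \<in> G"
        using s ab 1(3) lrelD(5)[OF G] by blast
      moreover have "((inv\<^bsub>K\<^esub> c \<odot>\<^bsub>V\<^esub> a) \<oplus>\<^bsub>V\<^esub> v0, inv\<^bsub>K\<^esub> c \<odot>\<^bsub>W\<^esub> z) \<in> R"
        using lrelD(5)[OF R _ z, of "inv\<^bsub>K\<^esub> c"] s ab 1 by simp
      ultimately have "((inv\<^bsub>K\<^esub> c \<odot>\<^bsub>V\<^esub> a) \<oplus>\<^bsub>V\<^esub> v0, (inv\<^bsub>K\<^esub> c \<odot>\<^bsub>W\<^esub> b) \<oplus>\<^bsub>W\<^esub> w0) \<in> R"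
        by (rule w0R)
      from lrelD(5)[OF R 1(4) this] show ?thesis
        using 1 ab False by (simp add: scale' scale'')
    qed
  qed
  moreover have "G \<subseteq> G'"
  proof
    fix p
    assume "p \<in> G"
    moreover obtain v w where "p = (v, w)"
      by fastforce
    ultimately show "p \<in> G'"
      using G'I[of v w "\<zero>\<^bsub>K\<^esub>"] Gc[of v w] v0 w0 by simp
  qed
  moreover have "v0 \<in> Domain G'"
    using G'I[OF lrelD(3)[OF G], of "\<one>\<^bsub>K\<^esub>"] v0 w0 by auto
  ultimately show ?thesis
    using v0(2) by blast
qed

text \<open>Extensions of linear maps, generalized inverses and projections are all instances.\<close>

lemma linear_selection:
  assumes V: "sp V" and W: "sp W" and R: "lrel V W R"
  obtains f where "lin V W f" "\<And>v w. (v, w) \<in> R \<Longrightarrow> (v, f v) \<in> R"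
proof -
  \<comment> \<open>The second condition says that G is single valued. The third binds G only on the
    domain of R; elsewhere the values are free, which is what allows a total map at the end.\<close>
  define \<A> where "\<A> = {G. lrel V W G \<and> (\<forall>w. (\<zero>\<^bsub>V\<^esub>, w) \<in> G \<longrightarrow> w = \<zero>\<^bsub>W\<^esub>) \<and>
    (\<forall>v w. (v, w) \<in> G \<longrightarrow> v \<in> Domain R \<longrightarrow> (v, w) \<in> R)}"
  have "{(\<zero>\<^bsub>V\<^esub>, \<zero>\<^bsub>W\<^esub>)} \<in> \<A>"
    using V W lrelD(3)[OF R] by (auto simp: \<A>_def lrel_def)
  moreover have "\<Union>\<C> \<in> \<A>" if ne: "\<C> \<noteq> {}" and ch: "subset.chain \<A> \<C>" for \<C>
  proof -
    have sub: "\<C> \<subseteq> \<A>" and cmp: "\<And>X Y. X \<in> \<C> \<Longrightarrow> Y \<in> \<C> \<Longrightarrow> X \<subseteq> Y \<or> Y \<subseteq> X"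
      using ch by (auto simp: subset_chain_def)
    have l: "lrel V W X" if "X \<in> \<C>" for X
      using that sub by (auto simp: \<A>_def)
    have "lrel V W (\<Union>\<C>)"
      unfolding lrel_def
    proof (intro conjI allI impI ballI)
      show "\<Union>\<C> \<subseteq> carrier V \<times> carrier W"
        using lrelD(1,2)[OF l] by fast
      show "(\<zero>\<^bsub>V\<^esub>, \<zero>\<^bsub>W\<^esub>) \<in> \<Union>\<C>"
        using ne l lrelD(3) by blast
    next
      fix v w v' w'
      assume "(v, w) \<in> \<Union>\<C>" "(v', w') \<in> \<Union>\<C>"
      then obtain X Y where XY: "X \<in> \<C>" "Y \<in> \<C>" "(v, w) \<in> X" "(v', w') \<in> Y"
        by blast
      then obtain Z where "Z \<in> \<C>" "(v, w) \<in> Z" "(v', w') \<in> Z"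
        using cmp[OF XY(1,2)] by blast
      then show "(v \<oplus>\<^bsub>V\<^esub> v', w \<oplus>\<^bsub>W\<^esub> w') \<in> \<Union>\<C>"
        using lrelD(4)[OF l] by blast
    next
      fix c v w
      assume "c \<in> carrier K" "(v, w) \<in> \<Union>\<C>"
      then show "(c \<odot>\<^bsub>V\<^esub> v, c \<odot>\<^bsub>W\<^esub> w) \<in> \<Union>\<C>"
        using lrelD(5)[OF l] by blast
    qed
    then show ?thesis
      using sub unfolding \<A>_def by blast
  qed
  ultimately obtain G where G: "G \<in> \<A>" and max: "\<And>X. X \<in> \<A> \<Longrightarrow> G \<subseteq> X \<Longrightarrow> X = G"
    using subset_Zorn_nonempty[of \<A>] by blast
  have l: "lrel V W G" and G0: "\<And>w. (\<zero>\<^bsub>V\<^esub>, w) \<in> G \<Longrightarrow> w = \<zero>\<^bsub>W\<^esub>"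
    and GR: "\<And>v w. (v, w) \<in> G \<Longrightarrow> v \<in> Domain R \<Longrightarrow> (v, w) \<in> R"
    using G unfolding \<A>_def by blast+
  have dom: "\<exists>w. (v, w) \<in> G" if v: "v \<in> carrier V" for v
  proof (rule ccontr)
    assume "\<nexists>w. (v, w) \<in> G"
    then have "v \<notin> Domain G"
      by blast
    from lrel_extend[OF V W R l G0 GR v this] obtain G' where "G' \<in> \<A>" "G \<subset> G'"
      unfolding \<A>_def by blast
    then show False
      using max by blast
  qed
  define f where "f v = (SOME w. (v, w) \<in> G)" for v
  have f: "(v, f v) \<in> G" if "v \<in> carrier V" for v
    unfolding f_def using dom[OF that] by (rule someI_ex)
  have sv: "w = w'" if "(v, w) \<in> G" "(v, w') \<in> G" for v w w'
  proof -
    have "(v \<ominus>\<^bsub>V\<^esub> v, w \<ominus>\<^bsub>W\<^esub> w') \<in> G"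
      using lrel_minus[OF V W l that] .
    then have "w \<ominus>\<^bsub>W\<^esub> w' = \<zero>\<^bsub>W\<^esub>"
      using that lrelD(1)[OF l] V G0 by auto
    then show ?thesis
      using that lrelD(2)[OF l] W sp_minus_eq_zero by metis
  qed
  have "lin V W f"
  proof (rule linI)
    show "f x \<in> carrier W" if "x \<in> carrier V" for x
      using f[OF that] lrelD(2)[OF l] by blast
    show "f (x \<oplus>\<^bsub>V\<^esub> y) = f x \<oplus>\<^bsub>W\<^esub> f y" if "x \<in> carrier V" "y \<in> carrier V" for x y
      using f that V lrelD(4)[OF l] by (intro sv[of "x \<oplus>\<^bsub>V\<^esub> y"]) auto
    show "f (c \<odot>\<^bsub>V\<^esub> x) = c \<odot>\<^bsub>W\<^esub> f x" if "c \<in> carrier K" "x \<in> carrier V" for c x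
      using f that V lrelD(5)[OF l] by (intro sv[of "c \<odot>\<^bsub>V\<^esub> x"]) auto
  qed
  moreover have "(v, f v) \<in> R" if "(v, w) \<in> R" for v w
    using GR[OF f] lrelD(1)[OF R that] that by blast
  ultimately show ?thesis
    using that by blast
qed

text \<open>A selection for the converse of the graph of g: on the range of g it picks preimages,
  elsewhere it is any linear continuation. It is a left inverse if g is injective and a right
  inverse if g is surjective, so this one statement splits monomorphisms and epimorphisms
  alike.\<close>

lemma generalized_inverse:
  assumes V: "sp V" and W: "sp W" and g: "lin V W g"
  obtains g' where "lin W V g'" "\<And>v. v \<in> carrier V \<Longrightarrow> g (g' (g v)) = g v"
proof -
  have "lrel W V ((\<lambda>v. (g v, v)) ` carrier V)"
    unfolding lrel_def
  proof (intro conjI)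
    show "(\<lambda>v. (g v, v)) ` carrier V \<subseteq> carrier W \<times> carrier V"
      using g by (auto simp: lin_def)
    show "(\<zero>\<^bsub>W\<^esub>, \<zero>\<^bsub>V\<^esub>) \<in> (\<lambda>v. (g v, v)) ` carrier V"
      using lin_zero[OF assms] V by force
  qed (use V g in \<open>auto simp: lin_def intro!: image_eqI\<close>)
  from linear_selection[OF W V this] obtain f where f: "lin W V f" 
    "\<And>w v. (w, v) \<in> (\<lambda>v. (g v, v)) ` carrier V \<Longrightarrow> (w, f w) \<in> (\<lambda>v. (g v, v)) ` carrier V"
    by blast
  show ?thesis
  proof (rule that[OF f(1)])
    fix v
    assume "v \<in> carrier V"
    then have "(g v, f (g v)) \<in> (\<lambda>v. (g v, v)) ` carrier V"
      using f(2) by blast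
    then show "g (f (g v)) = g v"
      by auto
  qed
qed

text \<open>A generalized inverse of the inclusion of U, read as an endomorphism of V.\<close>

lemma projection:
  assumes V: "sp V" and U: "subsp V U"
  obtains e where "lin V V e" "\<And>v. v \<in> carrier V \<Longrightarrow> e v \<in> U" "\<And>u. u \<in> U \<Longrightarrow> e u = u"
proof -
  obtain g where g: "lin V (sub_space V U) g" "\<And>v. v \<in> U \<Longrightarrow> g v = v"
    using generalized_inverse[OF sp_sub_space[OF V U] V lin_incl[OF U]] by auto
  show ?thesis
  proof (rule that)
    show "lin V V g"
      using lin_comp[OF g(1) lin_incl[OF U]] .
  qed (use g lin_closed[OF g(1)] in auto)
qed


subsection \<open>Direct sums of copies of the field\<close>

abbreviation gr :: "'u space" where "gr \<equiv> ground K"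
abbreviation ds :: "'u \<Rightarrow> 'u space" where "ds \<equiv> dsum elts K"
abbreviation co :: "'u \<Rightarrow> 'u \<Rightarrow> 'u" where "co \<equiv> app elts"
abbreviation bv :: "'u \<Rightarrow> 'u \<Rightarrow> 'u" where "bv \<equiv> basis_vector elts K"

lemma module_K: "module K \<lparr>carrier = carrier K, mult = undefined, one = undefined, zero = zero K,
  add = add K, smult = mult K\<rparr>" (is "module K ?M")
proof (rule moduleI)
  show "cring K" ..
  show "abelian_group ?M"
  proof (rule abelian_groupI)
    fix x
    assume "x \<in> carrier ?M"
    then show "\<exists>y\<in>carrier ?M. y \<oplus>\<^bsub>?M\<^esub> x = \<zero>\<^bsub>?M\<^esub>"
      using K.l_neg by (intro bexI[of _ "\<ominus>\<^bsub>K\<^esub> x"]) auto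
  qed (auto simp: K.a_ac)
qed (auto simp: K.l_distr K.r_distr K.m_assoc)

lemma sp_ground [simp]: "sp gr"
  using sp_mk_space[OF _ small_K] module_mk_space[OF module_K] by (simp add: ground_def)

lemma ground_simps [simp]:
  "carrier gr = carrier K" "\<zero>\<^bsub>gr\<^esub> = \<zero>\<^bsub>K\<^esub>"
  "x \<in> carrier K \<Longrightarrow> y \<in> carrier K \<Longrightarrow> x \<oplus>\<^bsub>gr\<^esub> y = x \<oplus>\<^bsub>K\<^esub> y"
  "c \<in> carrier K \<Longrightarrow> x \<in> carrier K \<Longrightarrow> c \<odot>\<^bsub>gr\<^esub> x = c \<otimes>\<^bsub>K\<^esub> x"
  by (simp_all add: ground_def)

lemma ds_carrier:
  "carrier (ds I) = {graph elts (elts I) f | f. (\<forall>i\<in>elts I. f i \<in> carrier K) \<and> finite {i \<in> elts I. f i \<noteq> \<zero>\<^bsub>K\<^esub>}}"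
  (is "_ = ?R")
proof (intro subset_antisym subsetI)
  fix a
  assume "a \<in> ?R"
  then obtain f where f: "a = graph elts (elts I) f" "\<forall>i\<in>elts I. f i \<in> carrier K"
      "finite {i \<in> elts I. f i \<noteq> \<zero>\<^bsub>K\<^esub>}"
    by auto
  have "a = graph elts (elts I) (restrict f (elts I))"
    using f(1) by (simp add: graph_eq_iff)
  moreover have "{i \<in> elts I. restrict f (elts I) i \<noteq> \<zero>\<^bsub>K\<^esub>} = {i \<in> elts I. f i \<noteq> \<zero>\<^bsub>K\<^esub>}"
    by auto
  ultimately show "a \<in> carrier (ds I)"
    using f(2,3) unfolding dsum_def mk_space_simps by (auto intro!: exI[of _ "restrict f (elts I)"])
qed (auto simp: dsum_def)

lemma ds_mem_graph:
  assumes "\<And>i. i \<in> elts I \<Longrightarrow> f i \<in> carrier K" "finite {i \<in> elts I. f i \<noteq> \<zero>\<^bsub>K\<^esub>}"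
  shows "graph elts (elts I) f \<in> carrier (ds I)"
  using assms by (auto simp: ds_carrier)

lemma ds_co [simp, intro]: "a \<in> carrier (ds I) \<Longrightarrow> i \<in> elts I \<Longrightarrow> co a i \<in> carrier K"
  by (auto simp: ds_carrier)

lemma ds_finite: "a \<in> carrier (ds I) \<Longrightarrow> finite {i \<in> elts I. co a i \<noteq> \<zero>\<^bsub>K\<^esub>}"
  by (auto simp: ds_carrier cong: conj_cong)

lemma ds_eqI:
  assumes "a \<in> carrier (ds I)" "b \<in> carrier (ds I)" "\<And>i. i \<in> elts I \<Longrightarrow> co a i = co b i"
  shows "a = b"
  using assms by (auto simp: ds_carrier graph_eq_iff)

lemma ds_ops:
  "\<zero>\<^bsub>ds I\<^esub> = graph elts (elts I) (\<lambda>i. \<zero>\<^bsub>K\<^esub>)"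
  "a \<in> carrier (ds I) \<Longrightarrow> b \<in> carrier (ds I) \<Longrightarrow> a \<oplus>\<^bsub>ds I\<^esub> b = graph elts (elts I) (\<lambda>i. co a i \<oplus>\<^bsub>K\<^esub> co b i)"
  "c \<in> carrier K \<Longrightarrow> a \<in> carrier (ds I) \<Longrightarrow> c \<odot>\<^bsub>ds I\<^esub> a = graph elts (elts I) (\<lambda>i. c \<otimes>\<^bsub>K\<^esub> co a i)"
  by (simp_all add: dsum_def)

lemma co_ops [simp]:
  "i \<in> elts I \<Longrightarrow> co \<zero>\<^bsub>ds I\<^esub> i = \<zero>\<^bsub>K\<^esub>"
  "i \<in> elts I \<Longrightarrow> a \<in> carrier (ds I) \<Longrightarrow> b \<in> carrier (ds I) \<Longrightarrow> co (a \<oplus>\<^bsub>ds I\<^esub> b) i = co a i \<oplus>\<^bsub>K\<^esub> co b i"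
  "i \<in> elts I \<Longrightarrow> c \<in> carrier K \<Longrightarrow> a \<in> carrier (ds I) \<Longrightarrow> co (c \<odot>\<^bsub>ds I\<^esub> a) i = c \<otimes>\<^bsub>K\<^esub> co a i"
  by (simp_all add: ds_ops)

text \<open>The module laws hold for the finitely supported functions themselves and reach their
  codes through \<open>module_image\<close>. The same scheme serves \<open>sp_hs\<close>.\<close>

lemma sp_ds [simp]: "sp (ds I)"
proof -
  define C where "C = {f \<in> elts I \<rightarrow>\<^sub>E carrier K. finite {i \<in> elts I. f i \<noteq> \<zero>\<^bsub>K\<^esub>}}"
  define W :: "'u space" where "W = \<lparr>carrier = carrier K, mult = undefined, one = undefined, zero = zero K,
    add = add K, smult = mult K\<rparr>"
  have car: "carrier (ds I) = graph elts (elts I) ` C"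
    by (auto simp: dsum_def C_def)
  have fin: "finite {i \<in> elts I. (\<lambda>i\<in>elts I. g i) i \<noteq> \<zero>\<^bsub>K\<^esub>}"
    if "finite {i \<in> elts I. h i \<noteq> \<zero>\<^bsub>K\<^esub>}" "finite {i \<in> elts I. k i \<noteq> \<zero>\<^bsub>K\<^esub>}"
      "\<And>i. i \<in> elts I \<Longrightarrow> h i = \<zero>\<^bsub>K\<^esub> \<Longrightarrow> k i = \<zero>\<^bsub>K\<^esub> \<Longrightarrow> g i = \<zero>\<^bsub>K\<^esub>" for g h k :: "'u \<Rightarrow> 'u"
    by (rule finite_subset[OF _ finite_UnI[OF that(1,2)]]) (use that(3) in auto)
  have "module K \<lparr>carrier = C, mult = undefined, one = undefined, zero = (\<lambda>i\<in>elts I. \<zero>\<^bsub>W\<^esub>),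
      add = (\<lambda>f g. \<lambda>i\<in>elts I. f i \<oplus>\<^bsub>W\<^esub> g i), smult = (\<lambda>c f. \<lambda>i\<in>elts I. c \<odot>\<^bsub>W\<^esub> f i)\<rparr>"
  proof (rule module_functions)
    show "module K W"
      unfolding W_def by (rule module_K)
    show "C \<subseteq> elts I \<rightarrow>\<^sub>E carrier W"
      by (auto simp: C_def W_def)
    show "(\<lambda>i\<in>elts I. \<zero>\<^bsub>W\<^esub>) \<in> C"
      by (simp add: C_def W_def cong: conj_cong)
    show "(\<lambda>i\<in>elts I. f i \<oplus>\<^bsub>W\<^esub> g i) \<in> C" if "f \<in> C" "g \<in> C" for f g
    proof -
      have "finite {i \<in> elts I. (\<lambda>i\<in>elts I. f i \<oplus>\<^bsub>K\<^esub> g i) i \<noteq> \<zero>\<^bsub>K\<^esub>}"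
        using that by (intro fin[of f g]) (auto simp: C_def)
      then show ?thesis
        using that by (auto simp: C_def W_def)
    qed
    show "(\<lambda>i\<in>elts I. c \<odot>\<^bsub>W\<^esub> f i) \<in> C" if "c \<in> carrier K" "f \<in> C" for c f
    proof -
      have "finite {i \<in> elts I. (\<lambda>i\<in>elts I. c \<otimes>\<^bsub>K\<^esub> f i) i \<noteq> \<zero>\<^bsub>K\<^esub>}"
        using that by (intro fin[of f f]) (auto simp: C_def)
      then show ?thesis
        using that by (auto simp: C_def W_def)
    qed
  qed
  then have "module K (ds I)"
  proof (rule module_image[where q = "graph elts (elts I)"])
    fix f g
    assume "f \<in> carrier \<lparr>carrier = C, mult = undefined, one = undefined, zero = (\<lambda>i\<in>elts I. \<zero>\<^bsub>W\<^esub>),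
      add = (\<lambda>f g. \<lambda>i\<in>elts I. f i \<oplus>\<^bsub>W\<^esub> g i), smult = (\<lambda>c f. \<lambda>i\<in>elts I. c \<odot>\<^bsub>W\<^esub> f i)\<rparr>"
     "g \<in> carrier \<lparr>carrier = C, mult = undefined, one = undefined, zero = (\<lambda>i\<in>elts I. \<zero>\<^bsub>W\<^esub>),
      add = (\<lambda>f g. \<lambda>i\<in>elts I. f i \<oplus>\<^bsub>W\<^esub> g i), smult = (\<lambda>c f. \<lambda>i\<in>elts I. c \<odot>\<^bsub>W\<^esub> f i)\<rparr>"
    then have "graph elts (elts I) f \<in> carrier (ds I)" "graph elts (elts I) g \<in> carrier (ds I)"
      by (auto simp: car)
    then show "graph elts (elts I) f \<oplus>\<^bsub>ds I\<^esub> graph elts (elts I) g = graph elts (elts I)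
      (f \<oplus>\<^bsub>\<lparr>carrier = C, mult = undefined, one = undefined, zero = (\<lambda>i\<in>elts I. \<zero>\<^bsub>W\<^esub>),
      add = (\<lambda>f g. \<lambda>i\<in>elts I. f i \<oplus>\<^bsub>W\<^esub> g i), smult = (\<lambda>c f. \<lambda>i\<in>elts I. c \<odot>\<^bsub>W\<^esub> f i)\<rparr>\<^esub> g)"
      by (simp add: ds_ops graph_eq_iff W_def)
  next
    fix c f
    assume "c \<in> carrier K" "f \<in> carrier \<lparr>carrier = C, mult = undefined, one = undefined, zero = (\<lambda>i\<in>elts I. \<zero>\<^bsub>W\<^esub>),
      add = (\<lambda>f g. \<lambda>i\<in>elts I. f i \<oplus>\<^bsub>W\<^esub> g i), smult = (\<lambda>c f. \<lambda>i\<in>elts I. c \<odot>\<^bsub>W\<^esub> f i)\<rparr>"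
    then have "graph elts (elts I) f \<in> carrier (ds I)" "c \<in> carrier K"
      by (auto simp: car)
    then show "c \<odot>\<^bsub>ds I\<^esub> graph elts (elts I) f = graph elts (elts I)
      (c \<odot>\<^bsub>\<lparr>carrier = C, mult = undefined, one = undefined, zero = (\<lambda>i\<in>elts I. \<zero>\<^bsub>W\<^esub>),
      add = (\<lambda>f g. \<lambda>i\<in>elts I. f i \<oplus>\<^bsub>W\<^esub> g i), smult = (\<lambda>c f. \<lambda>i\<in>elts I. c \<odot>\<^bsub>W\<^esub> f i)\<rparr>\<^esub> f)"
      by (simp add: ds_ops graph_eq_iff W_def)
  qed (simp_all add: car ds_ops graph_eq_iff W_def)
  moreover have "small elts (carrier (ds I))"
    by (rule small_subset[OF small_graphs[OF small_elts[of I] small_K]]) (auto simp: ds_carrier)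
  ultimately show ?thesis
    unfolding dsum_def mk_space_simps by (rule sp_mk_space)
qed

lemma lin_co: "i \<in> elts I \<Longrightarrow> lin (ds I) gr (\<lambda>a. co a i)"
  by (rule linI) auto

lemma bv_mem [simp]: "bv I i \<in> carrier (ds I)"
  unfolding basis_vector_def by (rule ds_mem_graph) auto

lemma co_bv [simp]: "j \<in> elts I \<Longrightarrow> co (bv I i) j = (if j = i then \<one>\<^bsub>K\<^esub> else \<zero>\<^bsub>K\<^esub>)"
  by (simp add: basis_vector_def)

text \<open>Transposed monomial matrices.  Where \<open>c i\<close> vanishes, \<open>r i\<close> is irrelevant and may lie outside
  the index set.\<close>

definition pull :: "'u \<Rightarrow> ('u \<Rightarrow> 'u) \<Rightarrow> ('u \<Rightarrow> 'u) \<Rightarrow> 'u \<Rightarrow> 'u"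
  where "pull I c r b =
    graph elts (elts I) (\<lambda>i. if c i = \<zero>\<^bsub>K\<^esub> then \<zero>\<^bsub>K\<^esub> else c i \<otimes>\<^bsub>K\<^esub> co b (r i))"

lemma co_pull: "i \<in> elts I \<Longrightarrow> co (pull I c r b) i = (if c i = \<zero>\<^bsub>K\<^esub> then \<zero>\<^bsub>K\<^esub> else c i \<otimes>\<^bsub>K\<^esub> co b (r i))"
  by (simp add: pull_def)

text \<open>The support of the result lies in the preimage under r of the support of b. Injectivity
  of r where c is nonzero makes this preimage finite.\<close>

lemma pull_mem:
  assumes c: "\<And>i. i \<in> elts I \<Longrightarrow> c i \<in> carrier K"
    and r: "\<And>i. i \<in> elts I \<Longrightarrow> c i \<noteq> \<zero>\<^bsub>K\<^esub> \<Longrightarrow> r i \<in> elts J"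
    and inj: "inj_on r {i \<in> elts I. c i \<noteq> \<zero>\<^bsub>K\<^esub>}"
    and b: "b \<in> carrier (ds J)"
  shows "pull I c r b \<in> carrier (ds I)"
  unfolding pull_def
proof (rule ds_mem_graph)
  show "(if c i = \<zero>\<^bsub>K\<^esub> then \<zero>\<^bsub>K\<^esub> else c i \<otimes>\<^bsub>K\<^esub> co b (r i)) \<in> carrier K" if "i \<in> elts I" for i
    using that c r b by auto
  have "finite (r -` {j \<in> elts J. co b j \<noteq> \<zero>\<^bsub>K\<^esub>} \<inter> {i \<in> elts I. c i \<noteq> \<zero>\<^bsub>K\<^esub>})"
    using finite_vimage_IntI[OF ds_finite[OF b] inj] .
  then show "finite {i \<in> elts I. (if c i = \<zero>\<^bsub>K\<^esub> then \<zero>\<^bsub>K\<^esub> else c i \<otimes>\<^bsub>K\<^esub> co b (r i)) \<noteq> \<zero>\<^bsub>K\<^esub>}"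
    by (rule rev_finite_subset) (use c r in \<open>auto split: if_splits\<close>)
qed

lemma lin_pull:
  assumes c: "\<And>i. i \<in> elts I \<Longrightarrow> c i \<in> carrier K"
    and r: "\<And>i. i \<in> elts I \<Longrightarrow> c i \<noteq> \<zero>\<^bsub>K\<^esub> \<Longrightarrow> r i \<in> elts J"
    and inj: "inj_on r {i \<in> elts I. c i \<noteq> \<zero>\<^bsub>K\<^esub>}"
  shows "lin (ds J) (ds I) (pull I c r)"
proof (rule linI)
  fix a b
  assume ab: "a \<in> carrier (ds J)" "b \<in> carrier (ds J)"
  show "pull I c r (a \<oplus>\<^bsub>ds J\<^esub> b) = pull I c r a \<oplus>\<^bsub>ds I\<^esub> pull I c r b"
    by (rule ds_eqI[where I = I]) (use c r ab pull_mem[where J = J, OF c r inj] in \<open>auto simp: co_pull K.r_distr\<close>)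
next
  fix d a
  assume da: "d \<in> carrier K" "a \<in> carrier (ds J)"
  show "pull I c r (d \<odot>\<^bsub>ds J\<^esub> a) = d \<odot>\<^bsub>ds I\<^esub> pull I c r a"
    by (rule ds_eqI[where I = I]) (use c r da pull_mem[where J = J, OF c r inj] in \<open>auto simp: co_pull K.m_ac\<close>)
qed (auto intro: pull_mem assms)

section \<open>Induction on finitely supported vectors and linear extension from the basis\<close>

lemma ds_induct [consumes 1, case_names zero smult add]:
  assumes a: "a \<in> carrier (ds I)"
    and z: "P \<zero>\<^bsub>ds I\<^esub>"
    and s: "\<And>c i. c \<in> carrier K \<Longrightarrow> i \<in> elts I \<Longrightarrow> P (c \<odot>\<^bsub>ds I\<^esub> bv I i)"
    and p: "\<And>a b. a \<in> carrier (ds I) \<Longrightarrow> b \<in> carrier (ds I) \<Longrightarrow> P a \<Longrightarrow> P b \<Longrightarrow> P (a \<oplus>\<^bsub>ds I\<^esub> b)"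
  shows "P a"
proof -
  \<comment> \<open>The induction runs over a finite superset S of the support. The support itself
    would not do, because the point j removed from S may carry the coefficient zero or lie outside
    the index set.\<close>
  have "P a" if "finite S" "a \<in> carrier (ds I)" "{i \<in> elts I. co a i \<noteq> \<zero>\<^bsub>K\<^esub>} \<subseteq> S" for a S
    using that
  proof (induction S arbitrary: a rule: finite_induct)
    case empty
    have "a = \<zero>\<^bsub>ds I\<^esub>"
      using empty by - (rule ds_eqI[where I = I], auto)
    then show ?case
      using z by simp
  next
    case (insert j S)
    define a' where "a' = graph elts (elts I) (\<lambda>i. if i = j then \<zero>\<^bsub>K\<^esub> else co a i)"
    have a': "a' \<in> carrier (ds I)"
      unfolding a'_def
      by (rule ds_mem_graph) (use insert.prems(1) in \<open>auto intro: finite_subset[OF _ ds_finite]\<close>)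
    have "P a'"
      using insert a' by (intro insert.IH) (auto simp: a'_def split: if_splits)
    show ?case
    proof (cases "j \<in> elts I")
      case True
      have "a = a' \<oplus>\<^bsub>ds I\<^esub> co a j \<odot>\<^bsub>ds I\<^esub> bv I j"
        using insert.prems(1) a' True by - (rule ds_eqI[where I = I], auto simp: a'_def)
      moreover have "P (a' \<oplus>\<^bsub>ds I\<^esub> co a j \<odot>\<^bsub>ds I\<^esub> bv I j)"
        using insert.prems(1) a' True \<open>P a'\<close> by (intro p s) auto
      ultimately show ?thesis
        by simp
    next
      case False
      then have "a = a'"
        using insert.prems(1) a' by - (rule ds_eqI[where I = I], auto simp: a'_def)
      then show ?thesis
        using \<open>P a'\<close> by simp
    qed
  qed
  then show ?thesis
    using a ds_finite by blast
qed

lemma lin_ds_eqI: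
  assumes V: "sp V" and f: "lin (ds I) V f" and g: "lin (ds I) V g"
    and eq: "\<And>i. i \<in> elts I \<Longrightarrow> f (bv I i) = g (bv I i)"
    and a: "a \<in> carrier (ds I)"
  shows "f a = g a"
  using a
proof (induction rule: ds_induct)
  case zero
  then show ?case
    using lin_zero[OF sp_ds V f] lin_zero[OF sp_ds V g] by simp
next
  case (smult c i)
  then show ?case
    using lin_smult[OF f] lin_smult[OF g] eq by simp
next
  case (add a b)
  then show ?case
    using lin_add[OF f] lin_add[OF g] by simp
qed

definition lext :: "'u \<Rightarrow> 'u space \<Rightarrow> ('u \<Rightarrow> 'u) \<Rightarrow> 'u \<Rightarrow> 'u"
  where "lext I V \<phi> a = finsum V (\<lambda>i. co a i \<odot>\<^bsub>V\<^esub> \<phi> i) {i \<in> elts I. co a i \<noteq> \<zero>\<^bsub>K\<^esub>}"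

text \<open>Terms with coefficient zero contribute nothing, so two vectors can be summed over one
  common finite set; this is what makes \<open>lext\<close> additive.\<close>

lemma lext_superset:
  assumes V: "sp V" and \<phi>: "\<And>i. i \<in> elts I \<Longrightarrow> \<phi> i \<in> carrier V"
    and a: "a \<in> carrier (ds I)"
    and F: "finite F" "{i \<in> elts I. co a i \<noteq> \<zero>\<^bsub>K\<^esub>} \<subseteq> F" "F \<subseteq> elts I"
  shows "lext I V \<phi> a = finsum V (\<lambda>i. co a i \<odot>\<^bsub>V\<^esub> \<phi> i) F"
proof -
  interpret V: module K V by (rule sp_module[OF V])
  show ?thesis
    unfolding lext_def
    using F a \<phi> by (intro V.add.finprod_mono_neutral_cong_left) auto
qed

lemma lin_lext:
  assumes V: "sp V" and \<phi>: "\<And>i. i \<in> elts I \<Longrightarrow> \<phi> i \<in> carrier V"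
  shows "lin (ds I) V (lext I V \<phi>)"
proof -
  interpret V: module K V by (rule sp_module[OF V])
  show ?thesis
  proof (rule linI)
    fix a
    assume "a \<in> carrier (ds I)"
    then show "lext I V \<phi> a \<in> carrier V"
      unfolding lext_def using \<phi> by (intro V.finsum_closed) auto
  next
    fix a b
    assume ab: "a \<in> carrier (ds I)" "b \<in> carrier (ds I)"
    define F where "F = {i \<in> elts I. co a i \<noteq> \<zero>\<^bsub>K\<^esub>} \<union> {i \<in> elts I. co b i \<noteq> \<zero>\<^bsub>K\<^esub>}"
    have F: "finite F" "F \<subseteq> elts I"
      using ds_finite ab by (auto simp: F_def)
    have "lext I V \<phi> (a \<oplus>\<^bsub>ds I\<^esub> b) = finsum V (\<lambda>i. co (a \<oplus>\<^bsub>ds I\<^esub> b) i \<odot>\<^bsub>V\<^esub> \<phi> i) F"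
      by (rule lext_superset) (use V \<phi> ab F in \<open>auto simp: F_def\<close>)
    also have "\<dots> = finsum V (\<lambda>i. co a i \<odot>\<^bsub>V\<^esub> \<phi> i \<oplus>\<^bsub>V\<^esub> co b i \<odot>\<^bsub>V\<^esub> \<phi> i) F"
      using F ab \<phi> by (intro V.finsum_cong') (auto simp: subset_iff V.smult_l_distr)
    also have "\<dots> = finsum V (\<lambda>i. co a i \<odot>\<^bsub>V\<^esub> \<phi> i) F \<oplus>\<^bsub>V\<^esub> finsum V (\<lambda>i. co b i \<odot>\<^bsub>V\<^esub> \<phi> i) F"
      using F ab \<phi> by (intro V.finsum_addf) auto
    also have "\<dots> = lext I V \<phi> a \<oplus>\<^bsub>V\<^esub> lext I V \<phi> b"
      using lext_superset[OF V \<phi> _ F(1) _ F(2)] ab by (simp add: F_def)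
    finally show "lext I V \<phi> (a \<oplus>\<^bsub>ds I\<^esub> b) = lext I V \<phi> a \<oplus>\<^bsub>V\<^esub> lext I V \<phi> b" .
  next
    fix c a
    assume ca: "c \<in> carrier K" "a \<in> carrier (ds I)"
    define F where "F = {i \<in> elts I. co a i \<noteq> \<zero>\<^bsub>K\<^esub>}"
    have F: "finite F" "F \<subseteq> elts I"
      using ds_finite ca by (auto simp: F_def)
    have "lext I V \<phi> (c \<odot>\<^bsub>ds I\<^esub> a) = finsum V (\<lambda>i. co (c \<odot>\<^bsub>ds I\<^esub> a) i \<odot>\<^bsub>V\<^esub> \<phi> i) F"
      by (rule lext_superset) (use V \<phi> ca F in \<open>auto simp: F_def\<close>)
    also have "\<dots> = finsum V (\<lambda>i. c \<odot>\<^bsub>V\<^esub> (co a i \<odot>\<^bsub>V\<^esub> \<phi> i)) F"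
      using F ca \<phi> by (intro V.finsum_cong') (auto simp: subset_iff V.smult_assoc1)
    also have "\<dots> = c \<odot>\<^bsub>V\<^esub> finsum V (\<lambda>i. co a i \<odot>\<^bsub>V\<^esub> \<phi> i) F"
      using F ca \<phi> by (subst V.finsum_smult_ldistr) auto
    finally show "lext I V \<phi> (c \<odot>\<^bsub>ds I\<^esub> a) = c \<odot>\<^bsub>V\<^esub> lext I V \<phi> a"
      by (simp add: lext_def F_def)
  qed
qed

lemma lext_bv:
  assumes V: "sp V" and \<phi>: "\<And>i. i \<in> elts I \<Longrightarrow> \<phi> i \<in> carrier V" and i: "i \<in> elts I"
  shows "lext I V \<phi> (bv I i) = \<phi> i"
proof -
  interpret V: module K V by (rule sp_module[OF V])
  have "{j \<in> elts I. co (bv I i) j \<noteq> \<zero>\<^bsub>K\<^esub>} = {i}"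
    using i by (auto split: if_splits)
  then show ?thesis
    using i \<phi> by (simp add: lext_def)
qed

text \<open>All elements of V, instead of a basis, label the copies of the field: the map sending
  the basis vector at \<open>j v\<close> to v is visibly onto, and a generalized inverse splits it.
  The label set J is a parameter so that a whole family of spaces can be retracts of one and the
  same sum.\<close>

lemma retract_of_ds:
  assumes V: "sp V" and J: "small elts J" and j: "inj_on j (carrier V)" "j ` carrier V \<subseteq> J"
  obtains \<alpha> \<beta> where "lin V (ds (set_code elts J)) \<alpha>" "lin (ds (set_code elts J)) V \<beta>"
    "\<And>v. v \<in> carrier V \<Longrightarrow> \<beta> (\<alpha> v) = v"
proof -
  define I where "I = set_code elts J"
  have I: "elts I = J"
    using J by (simp add: I_def)
  define \<phi> where "\<phi> i = (if i \<in> j ` carrier V then the_inv_into (carrier V) j i else \<zero>\<^bsub>V\<^esub>)" for i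
  have \<phi>: "\<phi> i \<in> carrier V" for i
    using V the_inv_into_into[OF j(1)] by (auto simp: \<phi>_def)
  have \<phi>j: "\<phi> (j v) = v" if "v \<in> carrier V" for v
    using that j(1) by (simp add: \<phi>_def the_inv_into_f_f)
  define \<beta> where "\<beta> = lext I V \<phi>"
  have \<beta>: "lin (ds I) V \<beta>"
    unfolding \<beta>_def using V \<phi> by (rule lin_lext)
  obtain \<alpha> where \<alpha>: "lin V (ds I) \<alpha>" "\<And>a. a \<in> carrier (ds I) \<Longrightarrow> \<beta> (\<alpha> (\<beta> a)) = \<beta> a"
    using generalized_inverse[OF sp_ds V \<beta>] by blast
  have "\<beta> (\<alpha> v) = v" if v: "v \<in> carrier V" for v
  proof -
    have "\<beta> (bv I (j v)) = v"
      unfolding \<beta>_def using v j I lext_bv[OF V, of I \<phi> "j v"] \<phi> \<phi>j by auto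
    then show ?thesis
      using \<alpha>(2)[of "bv I (j v)"] by simp
  qed
  then show ?thesis
    using that \<alpha>(1) \<beta> by (simp add: I_def)
qed

end


section \<open>Linear endofunctors, elementwise\<close>

type_synonym 'u vfun = "('u space, 'u linmap, 'u space, 'u linmap) functor_data"
type_synonym 'u vnat = "('u vfun, 'u space \<Rightarrow> 'u linmap) arrow"

context small_field
begin

abbreviation Vt where "Vt \<equiv> Vect elts K"
abbreviation LE where "LE \<equiv> LinEnd elts K"

definition arr :: "'u space \<Rightarrow> 'u space \<Rightarrow> ('u \<Rightarrow> 'u) \<Rightarrow> 'u linmap"
  where "arr V W f = Arrow V W (\<lambda>x\<in>carrier V. f x)"

lemma arr_simps [simp]: "src (arr V W f) = V" "tgt (arr V W f) = W"
  "x \<in> carrier V \<Longrightarrow> body (arr V W f) x = f x"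
  by (simp_all add: arr_def)

lemma arr_eq_iff: "arr V W f = arr V W g \<longleftrightarrow> (\<forall>x\<in>carrier V. f x = g x)"
  by (auto simp: arr_def fun_eq_iff restrict_def)

lemma Obj_Vt [simp]: "V \<in> Obj Vt \<longleftrightarrow> sp V"
  by (simp add: Vect_def)

lemma linear_map_iff: "linear_map K V W f \<longleftrightarrow> lin V W f \<and> f \<in> extensional (carrier V)"
  by (auto simp: linear_map_def lin_def PiE_def)

lemma Arr_Vt_iff: "a \<in> Arr Vt \<longleftrightarrow> (\<exists>V W f. sp V \<and> sp W \<and> lin V W f \<and> a = arr V W f)"
proof
  assume "a \<in> Arr Vt"
  then obtain V W f where a: "a = Arrow V W f" "sp V" "sp W" "lin V W f" "f \<in> extensional (carrier V)"
    by (auto simp: Vect_def linear_map_iff)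
  then have "a = arr V W f"
    by (simp add: arr_def extensional_restrict)
  then show "\<exists>V W f. sp V \<and> sp W \<and> lin V W f \<and> a = arr V W f"
    using a by blast
next
  assume "\<exists>V W f. sp V \<and> sp W \<and> lin V W f \<and> a = arr V W f"
  then obtain V W f where a: "a = arr V W f" "sp V" "sp W" "lin V W f"
    by blast
  moreover have "lin V W (restrict f (carrier V))"
    using a lin_cong[of V "restrict f (carrier V)" f W] by simp
  ultimately show "a \<in> Arr Vt"
    by (auto simp: Vect_def linear_map_iff arr_def)
qed

lemma arr_in_Arr: "sp V \<Longrightarrow> sp W \<Longrightarrow> lin V W f \<Longrightarrow> arr V W f \<in> Arr Vt"
  by (auto simp: Arr_Vt_iff)

lemma Dom_Vt [simp]: "Dom Vt = src" and Cod_Vt [simp]: "Cod Vt = tgt"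
  by (simp_all add: Vect_def)

lemma Hom_Vt_iff: "a \<in> Hom Vt V W \<longleftrightarrow> sp V \<and> sp W \<and> (\<exists>f. lin V W f \<and> a = arr V W f)"
  by (auto simp: Hom_def Arr_Vt_iff)

lemma arr_in_Hom: "sp V \<Longrightarrow> sp W \<Longrightarrow> lin V W f \<Longrightarrow> arr V W f \<in> Hom Vt V W"
  by (auto simp: Hom_Vt_iff)

lemma Id_Vt: "Id Vt V = arr V V (\<lambda>x. x)"
  by (simp add: Vect_def arr_def)

lemma Comp_Vt:
  "lin V W f \<Longrightarrow> Comp Vt (arr W U g) (arr V W f) = arr V U (\<lambda>x. g (f x))"
  by (auto simp: Vect_def arr_def fun_eq_iff restrict_def lin_closed)

lemma arrow_add_arr: "arrow_add (arr V W f) (arr V W g) = arr V W (\<lambda>v. f v \<oplus>\<^bsub>W\<^esub> g v)"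
  by (auto simp: arrow_add_def arr_def fun_eq_iff restrict_def)

lemma arrow_smult_arr: "arrow_smult c (arr V W f) = arr V W (\<lambda>v. c \<odot>\<^bsub>W\<^esub> f v)"
  by (auto simp: arrow_smult_def arr_def fun_eq_iff restrict_def)

abbreviation el :: "'u vfun \<Rightarrow> 'u space \<Rightarrow> 'u set" where "el X V \<equiv> carrier (FObj X V)"

definition act :: "'u vfun \<Rightarrow> 'u space \<Rightarrow> 'u space \<Rightarrow> ('u \<Rightarrow> 'u) \<Rightarrow> 'u \<Rightarrow> 'u"
  where "act X V W f x = body (FArr X (arr V W f)) x"

lemma Obj_LE_iff: "X \<in> Obj LE \<longleftrightarrow> is_functor Vt Vt X \<and> linear_functor elts K X"
  by (simp add: LinEnd_def full_subcategory_def functor_category_def)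

context
  fixes X :: "'u vfun"
  assumes X: "X \<in> Obj LE"
begin

lemma sp_FObj [simp, intro]: "sp V \<Longrightarrow> sp (FObj X V)"
  using X by (auto simp: Obj_LE_iff is_functor_def)

lemma FArr_arr:
  assumes "sp V" "sp W" "lin V W f"
  shows "lin (FObj X V) (FObj X W) (act X V W f)"
    and "FArr X (arr V W f) = arr (FObj X V) (FObj X W) (act X V W f)"
proof -
  have "FArr X (arr V W f) \<in> Hom Vt (FObj X V) (FObj X W)"
    using X arr_in_Arr[OF assms] by (auto simp: Obj_LE_iff is_functor_def)
  then obtain g where g: "lin (FObj X V) (FObj X W) g" "FArr X (arr V W f) = arr (FObj X V) (FObj X W) g"
    by (auto simp: Hom_Vt_iff)
  then have *: "act X V W f x = g x" if "x \<in> el X V" for x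
    using that by (simp add: act_def)
  show "lin (FObj X V) (FObj X W) (act X V W f)"
    using g(1) lin_cong[OF sp_FObj[OF assms(1)] *] by simp
  show "FArr X (arr V W f) = arr (FObj X V) (FObj X W) (act X V W f)"
    using g(2) * by (simp add: arr_eq_iff)
qed

lemmas act_lin = FArr_arr(1)

lemma act_closed [simp, intro]:
  "sp V \<Longrightarrow> sp W \<Longrightarrow> lin V W f \<Longrightarrow> x \<in> el X V \<Longrightarrow> act X V W f x \<in> el X W"
  using lin_closed[OF act_lin] .

lemma act_cong: "(\<And>v. v \<in> carrier V \<Longrightarrow> f v = g v) \<Longrightarrow> act X V W f x = act X V W g x"
  unfolding act_def using arr_eq_iff[of V W f g] by simp

lemma act_comp:
  assumes "sp V" "sp W" "sp U" "lin V W f" "lin W U g" "x \<in> el X V"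
  shows "act X W U g (act X V W f x) = act X V U (\<lambda>v. g (f v)) x"
proof -
  have "FArr X (Comp Vt (arr W U g) (arr V W f)) = Comp Vt (FArr X (arr W U g)) (FArr X (arr V W f))"
    using X arr_in_Arr assms by (simp add: Obj_LE_iff is_functor_def)
  then have "FArr X (arr V U (\<lambda>v. g (f v))) = 
      arr (FObj X V) (FObj X U) (\<lambda>x. act X W U g (act X V W f x))"
    using assms by (simp add: Comp_Vt[where W = W] FArr_arr Comp_Vt[OF act_lin])
  then show ?thesis
    using assms(6) by (simp add: act_def[of X V U])
qed

lemma act_id:
  assumes "sp V" "x \<in> el X V" "\<And>v. v \<in> carrier V \<Longrightarrow> f v = v"
  shows "act X V V f x = x"
proof -
  have "FArr X (Id Vt V) = Id Vt (FObj X V)"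
    using X assms(1) by (auto simp: Obj_LE_iff is_functor_def)
  then have "act X V V (\<lambda>v. v) x = x"
    using assms(2) by (simp add: act_def Id_Vt)
  then show ?thesis
    using act_cong[of V f "\<lambda>v. v"] assms(3) by simp
qed

lemma act_plus:
  assumes "sp V" "sp W" "lin V W f" "lin V W g" "x \<in> el X V"
  shows "act X V W (\<lambda>v. f v \<oplus>\<^bsub>W\<^esub> g v) x = act X V W f x \<oplus>\<^bsub>FObj X W\<^esub> act X V W g x"
proof -
  have "arr V W f \<in> Hom Vt V W" "arr V W g \<in> Hom Vt V W"
    using assms by (auto simp: Hom_Vt_iff)
  then have "FArr X (arrow_add (arr V W f) (arr V W g)) = arrow_add (FArr X (arr V W f)) (FArr X (arr V W g))"
    using X assms(1,2) unfolding Obj_LE_iff linear_functor_def by auto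
  then show ?thesis
    using assms by (simp add: act_def[of X V W "\<lambda>v. f v \<oplus>\<^bsub>W\<^esub> g v"] FArr_arr arrow_add_arr)
qed

lemma act_scale:
  assumes "sp V" "sp W" "lin V W f" "c \<in> carrier K" "x \<in> el X V"
  shows "act X V W (\<lambda>v. c \<odot>\<^bsub>W\<^esub> f v) x = c \<odot>\<^bsub>FObj X W\<^esub> act X V W f x"
proof -
  have "arr V W f \<in> Hom Vt V W"
    using assms by (auto simp: Hom_Vt_iff)
  then have "FArr X (arrow_smult c (arr V W f)) = arrow_smult c (FArr X (arr V W f))"
    using X assms(1,2,4) unfolding Obj_LE_iff linear_functor_def by auto
  then show ?thesis
    using assms by (simp add: act_def[of X V W "\<lambda>v. c \<odot>\<^bsub>W\<^esub> f v"] FArr_arr arrow_smult_arr)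
qed

lemma act_zero_map:
  assumes "sp V" "sp W" "x \<in> el X V" "\<And>v. v \<in> carrier V \<Longrightarrow> f v = \<zero>\<^bsub>W\<^esub>"
  shows "act X V W f x = \<zero>\<^bsub>FObj X W\<^esub>"
proof -
  \<comment> \<open>The zero map is written as zero times itself, so that compatibility of the
    functor with scalars evaluates it.\<close>
  have "act X V W f x = act X V W (\<lambda>v. \<zero>\<^bsub>K\<^esub> \<odot>\<^bsub>W\<^esub> \<zero>\<^bsub>W\<^esub>) x"
    using assms by (intro act_cong) auto
  also have "\<dots> = \<zero>\<^bsub>FObj X W\<^esub>"
    using assms act_closed[OF assms(1,2) lin_zero_map] by (subst act_scale) (auto intro: lin_zero_map)
  finally show ?thesis .
qed

lemma act_zero: "sp V \<Longrightarrow> sp W \<Longrightarrow> lin V W f \<Longrightarrow> act X V W f \<zero>\<^bsub>FObj X V\<^esub> = \<zero>\<^bsub>FObj X W\<^esub>"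
  by (rule lin_zero[OF _ _ act_lin]) auto

lemma act_add:
  "sp V \<Longrightarrow> sp W \<Longrightarrow> lin V W f \<Longrightarrow> x \<in> el X V \<Longrightarrow> y \<in> el X V \<Longrightarrow>
    act X V W f (x \<oplus>\<^bsub>FObj X V\<^esub> y) = act X V W f x \<oplus>\<^bsub>FObj X W\<^esub> act X V W f y"
  by (rule lin_add[OF act_lin])

lemma act_smult:
  "sp V \<Longrightarrow> sp W \<Longrightarrow> lin V W f \<Longrightarrow> c \<in> carrier K \<Longrightarrow> x \<in> el X V \<Longrightarrow>
    act X V W f (c \<odot>\<^bsub>FObj X V\<^esub> x) = c \<odot>\<^bsub>FObj X W\<^esub> act X V W f x"
  by (rule lin_smult[OF act_lin])

lemma act_minus:
  "sp V \<Longrightarrow> sp W \<Longrightarrow> lin V W f \<Longrightarrow> x \<in> el X V \<Longrightarrow> y \<in> el X V \<Longrightarrow>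
    act X V W f (x \<ominus>\<^bsub>FObj X V\<^esub> y) = act X V W f x \<ominus>\<^bsub>FObj X W\<^esub> act X V W f y"
  by (rule lin_minus[OF _ _ act_lin]) auto

lemma act_diff:
  assumes "sp V" "sp W" "lin V W f" "lin V W g" "x \<in> el X V"
  shows "act X V W (\<lambda>v. f v \<ominus>\<^bsub>W\<^esub> g v) x = act X V W f x \<ominus>\<^bsub>FObj X W\<^esub> act X V W g x"
proof -
  have "act X V W (\<lambda>v. f v \<ominus>\<^bsub>W\<^esub> g v) x = act X V W (\<lambda>v. f v \<oplus>\<^bsub>W\<^esub> (\<ominus>\<^bsub>K\<^esub> \<one>\<^bsub>K\<^esub>) \<odot>\<^bsub>W\<^esub> g v) x"
    using assms by (intro act_cong) (auto simp: sp_minus_smult lin_closed)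
  then show ?thesis
    using assms by (simp add: act_plus act_scale lin_scale sp_minus_smult)
qed

end

section \<open>Functors given by elementwise data\<close>

definition mk_fun :: "('u space \<Rightarrow> 'u space) \<Rightarrow> ('u space \<Rightarrow> 'u space \<Rightarrow> ('u \<Rightarrow> 'u) \<Rightarrow> 'u \<Rightarrow> 'u) \<Rightarrow> 'u vfun"
  where "mk_fun Fo Fa = \<lparr>FObj = (\<lambda>V\<in>Obj Vt. Fo V),
    FArr = (\<lambda>a\<in>Arr Vt. arr (Fo (src a)) (Fo (tgt a)) (Fa (src a) (tgt a) (body a)))\<rparr>"

text \<open>An arrow remembers its function on the carrier only, whereas \<open>Fa\<close> receives
  a bare function; \<open>Fcong\<close> bridges this gap. The remaining hypotheses are the laws of a
  linear functor, read on elements.\<close>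

lemma mk_fun:
  assumes Fo: "\<And>V. sp V \<Longrightarrow> sp (Fo V)"
    and Fl: "\<And>V W f. sp V \<Longrightarrow> sp W \<Longrightarrow> lin V W f \<Longrightarrow> lin (Fo V) (Fo W) (Fa V W f)"
    and Fcong: "\<And>V W f g x. sp V \<Longrightarrow> sp W \<Longrightarrow> (\<And>v. v \<in> carrier V \<Longrightarrow> f v = g v) \<Longrightarrow> x \<in> carrier (Fo V) \<Longrightarrow>
      Fa V W f x = Fa V W g x"
    and Fid: "\<And>V x. sp V \<Longrightarrow> x \<in> carrier (Fo V) \<Longrightarrow> Fa V V (\<lambda>v. v) x = x"
    and Fcomp: "\<And>V W U f g x. sp V \<Longrightarrow> sp W \<Longrightarrow> sp U \<Longrightarrow> lin V W f \<Longrightarrow> lin W U g \<Longrightarrow> x \<in> carrier (Fo V) \<Longrightarrow>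
      Fa V U (\<lambda>v. g (f v)) x = Fa W U g (Fa V W f x)"
    and Fadd: "\<And>V W f g x. sp V \<Longrightarrow> sp W \<Longrightarrow> lin V W f \<Longrightarrow> lin V W g \<Longrightarrow> x \<in> carrier (Fo V) \<Longrightarrow>
      Fa V W (\<lambda>v. f v \<oplus>\<^bsub>W\<^esub> g v) x = Fa V W f x \<oplus>\<^bsub>Fo W\<^esub> Fa V W g x"
    and Fsmult: "\<And>V W f c x. sp V \<Longrightarrow> sp W \<Longrightarrow> lin V W f \<Longrightarrow> c \<in> carrier K \<Longrightarrow> x \<in> carrier (Fo V) \<Longrightarrow>
      Fa V W (\<lambda>v. c \<odot>\<^bsub>W\<^esub> f v) x = c \<odot>\<^bsub>Fo W\<^esub> Fa V W f x"
  shows "mk_fun Fo Fa \<in> Obj LE"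
    and "sp V \<Longrightarrow> FObj (mk_fun Fo Fa) V = Fo V"
    and "sp V \<Longrightarrow> sp W \<Longrightarrow> lin V W f \<Longrightarrow> x \<in> carrier (Fo V) \<Longrightarrow> act (mk_fun Fo Fa) V W f x = Fa V W f x"
proof -
  let ?F = "mk_fun Fo Fa"
  have obj: "FObj ?F V = Fo V" if "sp V" for V
    using that by (simp add: mk_fun_def)
  have ar: "FArr ?F (arr V W f) = arr (Fo V) (Fo W) (Fa V W f)" if "sp V" "sp W" "lin V W f" for V W f
    using that arr_in_Arr[OF that]
    by (auto simp: mk_fun_def arr_eq_iff intro!: Fcong)
  have "is_functor Vt Vt ?F"
    unfolding is_functor_def
  proof (intro conjI ballI impI)
    show "FObj ?F \<in> Obj Vt \<rightarrow>\<^sub>E Obj Vt"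
      using Fo by (auto simp: mk_fun_def)
    show "FArr ?F \<in> Arr Vt \<rightarrow>\<^sub>E Arr Vt"
    proof (rule PiE_I)
      fix a
      assume "a \<in> Arr Vt"
      then show "FArr ?F a \<in> Arr Vt"
        by (auto simp: Arr_Vt_iff[of a] ar intro!: arr_in_Arr Fo Fl)
    qed (simp add: mk_fun_def)
    show "FArr ?F f \<in> Hom Vt (FObj ?F (Dom Vt f)) (FObj ?F (Cod Vt f))" if "f \<in> Arr Vt" for f
      using that by (auto simp: Arr_Vt_iff ar obj intro!: arr_in_Hom Fo Fl)
    show "FArr ?F (Id Vt V) = Id Vt (FObj ?F V)" if "V \<in> Obj Vt" for V
      using that by (simp add: Id_Vt ar lin_id obj arr_eq_iff Fid)
    show "FArr ?F (Comp Vt g f) = Comp Vt (FArr ?F g) (FArr ?F f)"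
      if fg: "f \<in> Arr Vt" "g \<in> Arr Vt" "Cod Vt f = Dom Vt g" for f g
    proof -
      obtain V W f' where f: "sp V" "sp W" "lin V W f'" "f = arr V W f'"
        using fg(1) by (auto simp: Arr_Vt_iff)
      obtain W' U g' where g': "sp U" "lin W' U g'" "g = arr W' U g'"
        using fg(2) by (auto simp: Arr_Vt_iff)
      have "W' = W"
        using fg(3) f(4) g'(3) by simp
      note g = g'[unfolded this]
      show ?thesis
        unfolding f(4) g(3) Comp_Vt[OF f(3)] ar[OF f(1-3)] ar[OF f(2) g(1,2)]
          ar[OF f(1) g(1) lin_comp[OF f(3) g(2)]] Comp_Vt[OF Fl[OF f(1-3)]] arr_eq_iff
        using f g Fcomp by blast
    qed
  qed
  moreover have "linear_functor elts K ?F"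
    unfolding linear_functor_def
  proof (intro ballI conjI)
    fix V W f g
    assume VW: "V \<in> Obj Vt" "W \<in> Obj Vt" and "f \<in> Hom Vt V W" "g \<in> Hom Vt V W"
    then obtain f' g' where f: "lin V W f'" "f = arr V W f'" and g: "lin V W g'" "g = arr V W g'"
      by (auto simp: Hom_Vt_iff)
    show "FArr ?F (arrow_add f g) = arrow_add (FArr ?F f) (FArr ?F g)"
      using VW f(1) g(1) unfolding f(2) g(2) arrow_add_arr
      by (simp add: ar lin_plus arrow_add_arr arr_eq_iff Fadd)
  next
    fix V W f c
    assume VW: "V \<in> Obj Vt" "W \<in> Obj Vt" and "f \<in> Hom Vt V W" and c: "c \<in> carrier K"
    then obtain f' where f: "lin V W f'" "f = arr V W f'"
      by (auto simp: Hom_Vt_iff)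
    show "FArr ?F (arrow_smult c f) = arrow_smult c (FArr ?F f)"
      using VW f(1) c unfolding f(2) arrow_smult_arr
      by (simp add: ar lin_scale arrow_smult_arr arr_eq_iff Fsmult)
  qed
  ultimately show "?F \<in> Obj LE"
    by (simp add: Obj_LE_iff)
  show "sp V \<Longrightarrow> FObj ?F V = Fo V"
    by (rule obj)
  show "sp V \<Longrightarrow> sp W \<Longrightarrow> lin V W f \<Longrightarrow> x \<in> carrier (Fo V) \<Longrightarrow> act ?F V W f x = Fa V W f x"
    by (simp add: act_def ar)
qed

subsection \<open>Natural transformations\<close>

definition nt :: "'u vfun \<Rightarrow> 'u vfun \<Rightarrow> ('u space \<Rightarrow> 'u \<Rightarrow> 'u) \<Rightarrow> bool"
  where "nt X Y t \<longleftrightarrow> (\<forall>V. sp V \<longrightarrow> lin (FObj X V) (FObj Y V) (t V)) \<and>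
    (\<forall>V W f x. sp V \<longrightarrow> sp W \<longrightarrow> lin V W f \<longrightarrow> x \<in> el X V \<longrightarrow>
      t W (act X V W f x) = act Y V W f (t V x))"

definition mk_nat :: "'u vfun \<Rightarrow> 'u vfun \<Rightarrow> ('u space \<Rightarrow> 'u \<Rightarrow> 'u) \<Rightarrow> 'u vnat"
  where "mk_nat X Y t = Arrow X Y (\<lambda>V\<in>Obj Vt. arr (FObj X V) (FObj Y V) (t V))"

definition cmp :: "'u vnat \<Rightarrow> 'u space \<Rightarrow> 'u \<Rightarrow> 'u"
  where "cmp a V x = body (body a V) x"

lemma ntI:
  assumes "\<And>V. sp V \<Longrightarrow> lin (FObj X V) (FObj Y V) (t V)"
    and "\<And>V W f x. sp V \<Longrightarrow> sp W \<Longrightarrow> lin V W f \<Longrightarrow> x \<in> el X V \<Longrightarrow>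
      t W (act X V W f x) = act Y V W f (t V x)"
  shows "nt X Y t"
  using assms by (simp add: nt_def)

lemma nt_lin: "nt X Y t \<Longrightarrow> sp V \<Longrightarrow> lin (FObj X V) (FObj Y V) (t V)"
  by (simp add: nt_def)

lemma nt_nat: "nt X Y t \<Longrightarrow> sp V \<Longrightarrow> sp W \<Longrightarrow> lin V W f \<Longrightarrow> x \<in> el X V \<Longrightarrow>
      t W (act X V W f x) = act Y V W f (t V x)"
  by (simp add: nt_def)

lemma nt_closed: "nt X Y t \<Longrightarrow> sp V \<Longrightarrow> x \<in> el X V \<Longrightarrow> t V x \<in> el Y V"
  using lin_closed[OF nt_lin] .

lemma nt_add: "nt X Y t \<Longrightarrow> sp V \<Longrightarrow> x \<in> el X V \<Longrightarrow> y \<in> el X V \<Longrightarrow>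
    t V (x \<oplus>\<^bsub>FObj X V\<^esub> y) = t V x \<oplus>\<^bsub>FObj Y V\<^esub> t V y"
  using lin_add[OF nt_lin] .

lemma nt_smult: "nt X Y t \<Longrightarrow> sp V \<Longrightarrow> c \<in> carrier K \<Longrightarrow> x \<in> el X V \<Longrightarrow>
    t V (c \<odot>\<^bsub>FObj X V\<^esub> x) = c \<odot>\<^bsub>FObj Y V\<^esub> t V x"
  using lin_smult[OF nt_lin] .

lemma nt_minus: "X \<in> Obj LE \<Longrightarrow> Y \<in> Obj LE \<Longrightarrow> nt X Y t \<Longrightarrow> sp V \<Longrightarrow> x \<in> el X V \<Longrightarrow> y \<in> el X V \<Longrightarrow>
    t V (x \<ominus>\<^bsub>FObj X V\<^esub> y) = t V x \<ominus>\<^bsub>FObj Y V\<^esub> t V y"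
  using lin_minus[OF sp_FObj sp_FObj nt_lin] .

lemma nt_zero: "X \<in> Obj LE \<Longrightarrow> Y \<in> Obj LE \<Longrightarrow> nt X Y t \<Longrightarrow> sp V \<Longrightarrow> t V \<zero>\<^bsub>FObj X V\<^esub> = \<zero>\<^bsub>FObj Y V\<^esub>"
  using lin_zero[OF sp_FObj sp_FObj nt_lin] .

lemma nt_id: "nt X X (\<lambda>V x. x)"
  by (simp add: nt_def lin_id)

lemma nt_comp: "nt X Y s \<Longrightarrow> nt Y Z t \<Longrightarrow> nt X Z (\<lambda>V x. t V (s V x))"
  by (rule ntI) (auto simp: nt_nat nt_closed intro: lin_comp nt_lin)

lemma nt_zero_map:
  assumes "X \<in> Obj LE" "Y \<in> Obj LE"
  shows "nt X Y (\<lambda>V x. \<zero>\<^bsub>FObj Y V\<^esub>)"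
  by (rule ntI) (use assms in \<open>auto simp: act_zero intro: lin_zero_map\<close>)

lemma nt_cong:
  assumes "X \<in> Obj LE" "\<And>V x. sp V \<Longrightarrow> x \<in> el X V \<Longrightarrow> s V x = t V x" "nt X Y s"
  shows "nt X Y t"
proof (rule ntI)
  show "lin (FObj X V) (FObj Y V) (t V)" if "sp V" for V
    using nt_lin[OF assms(3) that] lin_cong[of "FObj X V" "s V" "t V"] assms(1,2) that by auto
  show "t W (act X V W f x) = act Y V W f (t V x)"
    if "sp V" "sp W" "lin V W f" "x \<in> el X V" for V W f x
    using nt_nat[OF assms(3) that] assms(1,2) that by simp
qed

lemma mk_nat_simps [simp]: "src (mk_nat X Y t) = X" "tgt (mk_nat X Y t) = Y"
  "sp V \<Longrightarrow> x \<in> el X V \<Longrightarrow> cmp (mk_nat X Y t) V x = t V x"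
  by (simp_all add: mk_nat_def cmp_def)

lemma mk_nat_eq_iff: "mk_nat X Y s = mk_nat X Y t \<longleftrightarrow> (\<forall>V x. sp V \<longrightarrow> x \<in> el X V \<longrightarrow> s V x = t V x)"
proof
  assume "mk_nat X Y s = mk_nat X Y t"
  then show "\<forall>V x. sp V \<longrightarrow> x \<in> el X V \<longrightarrow> s V x = t V x"
    by (metis mk_nat_simps(3))
qed (auto simp: mk_nat_def arr_eq_iff intro!: restrict_ext)

lemma Dom_LE [simp]: "Dom LE = src" and Cod_LE [simp]: "Cod LE = tgt"
  by (simp_all add: LinEnd_def full_subcategory_def functor_category_def)

text \<open>This is the passage between encoded arrows and elementwise transformations. Because
  components are extensional, an arrow is recovered from its values on elements.\<close>

lemma Arr_LE_iff: "a \<in> Arr LE \<longleftrightarrow> (\<exists>X Y t. X \<in> Obj LE \<and> Y \<in> Obj LE \<and> nt X Y t \<and> a = mk_nat X Y t)"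
proof
  assume "a \<in> Arr LE"
  then obtain X Y s where a: "a = Arrow X Y s" "X \<in> Obj LE" "Y \<in> Obj LE" "nat_trans Vt Vt X Y s"
    by (auto simp: LinEnd_def full_subcategory_def functor_category_def)
  have s: "lin (FObj X V) (FObj Y V) (body (s V))" "s V = arr (FObj X V) (FObj Y V) (body (s V))"
    if "sp V" for V
  proof -
    have "s V \<in> Hom Vt (FObj X V) (FObj Y V)"
      using a(4) that by (auto simp: nat_trans_def)
    then obtain g where g: "lin (FObj X V) (FObj Y V) g" "s V = arr (FObj X V) (FObj Y V) g"
      by (auto simp: Hom_Vt_iff)
    have *: "body (s V) x = g x" if "x \<in> el X V" for x
      using that g by simp
    show "lin (FObj X V) (FObj Y V) (body (s V))"
      using g(1) lin_cong[OF sp_FObj[OF a(2) that] *] by simp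
    show "s V = arr (FObj X V) (FObj Y V) (body (s V))"
      using g(2) * by (simp add: arr_eq_iff)
  qed
  have "nt X Y (\<lambda>V. body (s V))"
  proof (rule ntI)
    fix V W f x
    assume VW: "sp V" "sp W" "lin V W f" "x \<in> el X V"
    have "Comp Vt (FArr Y (arr V W f)) (s V) = Comp Vt (s W) (FArr X (arr V W f))"
      using a(4) arr_in_Arr[OF VW(1-3)] by (auto simp: nat_trans_def)
    then have "Comp Vt (arr (FObj Y V) (FObj Y W) (act Y V W f)) (arr (FObj X V) (FObj Y V) (body (s V))) =
      Comp Vt (arr (FObj X W) (FObj Y W) (body (s W))) (arr (FObj X V) (FObj X W) (act X V W f))"
      using s(2) VW a FArr_arr by metis
    then have "arr (FObj X V) (FObj Y W) (\<lambda>x. act Y V W f (body (s V) x)) =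
      arr (FObj X V) (FObj Y W) (\<lambda>x. body (s W) (act X V W f x))"
      using s(1) VW a act_lin by (simp add: Comp_Vt)
    then show "body (s W) (act X V W f x) = act Y V W f (body (s V) x)"
      using VW(4) by (simp add: arr_eq_iff)
  qed (rule s)
  moreover have "a = mk_nat X Y (\<lambda>V. body (s V))"
  proof -
    have "s = (\<lambda>V\<in>Obj Vt. s V)"
      using a(4) by (auto simp: nat_trans_def PiE_def extensional_restrict)
    also have "\<dots> = (\<lambda>V\<in>Obj Vt. arr (FObj X V) (FObj Y V) (body (s V)))"
      using s(2) by (intro restrict_ext) auto
    finally show ?thesis
      using a(1) by (simp add: mk_nat_def)
  qed
  ultimately show "\<exists>X Y t. X \<in> Obj LE \<and> Y \<in> Obj LE \<and> nt X Y t \<and> a = mk_nat X Y t"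
    using a by blast
next
  assume "\<exists>X Y t. X \<in> Obj LE \<and> Y \<in> Obj LE \<and> nt X Y t \<and> a = mk_nat X Y t"
  then obtain X Y t where a: "X \<in> Obj LE" "Y \<in> Obj LE" "nt X Y t" "a = mk_nat X Y t"
    by blast
  define s where "s = (\<lambda>V\<in>Obj Vt. arr (FObj X V) (FObj Y V) (t V))"
  have s: "s V = arr (FObj X V) (FObj Y V) (t V)" if "sp V" for V
    using that by (simp add: s_def)
  have "nat_trans Vt Vt X Y s"
    unfolding nat_trans_def
  proof (intro conjI ballI)
    show "s \<in> Obj Vt \<rightarrow>\<^sub>E Arr Vt"
      using a nt_lin by (auto simp: s_def intro!: arr_in_Arr)
    show "s V \<in> Hom Vt (FObj X V) (FObj Y V)" if "V \<in> Obj Vt" for V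
      using that a nt_lin by (auto simp: s_def intro!: arr_in_Hom)
    show "Comp Vt (FArr Y f) (s (Dom Vt f)) = Comp Vt (s (Cod Vt f)) (FArr X f)" if f: "f \<in> Arr Vt" for f
    proof -
      obtain V W g where f: "sp V" "sp W" "lin V W g" "f = arr V W g"
        using f by (auto simp: Arr_Vt_iff)
      show ?thesis
        using f a by (auto simp: s FArr_arr Comp_Vt[OF nt_lin[OF a(3)]] Comp_Vt[OF act_lin] arr_eq_iff nt_nat)
    qed
  qed
  then show "a \<in> Arr LE"
    using a by (auto simp: LinEnd_def full_subcategory_def functor_category_def mk_nat_def s_def)
qed

lemma Hom_LE_iff: "a \<in> Hom LE X Y \<longleftrightarrow> X \<in> Obj LE \<and> Y \<in> Obj LE \<and> (\<exists>t. nt X Y t \<and> a = mk_nat X Y t)"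
  by (auto simp: Hom_def Arr_LE_iff)

lemma Hom_LE_cmp:
  assumes "a \<in> Hom LE X Y"
  shows "nt X Y (cmp a)" "a = mk_nat X Y (cmp a)"
proof -
  obtain t where t: "X \<in> Obj LE" "nt X Y t" "a = mk_nat X Y t"
    using assms by (auto simp: Hom_LE_iff)
  then show "nt X Y (cmp a)"
    by (intro nt_cong[OF t(1) _ t(2)]) auto
  show "a = mk_nat X Y (cmp a)"
    using t by (auto simp: mk_nat_eq_iff)
qed

lemma mk_nat_in_Hom: "X \<in> Obj LE \<Longrightarrow> Y \<in> Obj LE \<Longrightarrow> nt X Y t \<Longrightarrow> mk_nat X Y t \<in> Hom LE X Y"
  by (auto simp: Hom_LE_iff)

lemma Hom_LE_eqI:
  assumes "a \<in> Hom LE X Y" "b \<in> Hom LE X Y" "\<And>V x. sp V \<Longrightarrow> x \<in> el X V \<Longrightarrow> cmp a V x = cmp b V x"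
  shows "a = b"
  using Hom_LE_cmp(2)[OF assms(1)] Hom_LE_cmp(2)[OF assms(2)] assms(3) mk_nat_eq_iff by metis

lemma Comp_mk_nat:
  assumes "nt X Y s"
  shows "Comp LE (mk_nat Y Z t) (mk_nat X Y s) = mk_nat X Z (\<lambda>V x. t V (s V x))"
  by (auto simp: LinEnd_def full_subcategory_def functor_category_def mk_nat_def Comp_Vt[OF nt_lin[OF assms]]
    intro!: restrict_ext)

lemma Id_LE: "Id LE X = mk_nat X X (\<lambda>V x. x)"
  by (auto simp: LinEnd_def full_subcategory_def functor_category_def mk_nat_def Id_Vt)

lemma Comp_LE:
  assumes "a \<in> Hom LE X Y" "b \<in> Hom LE Y Z"
  shows "Comp LE b a \<in> Hom LE X Z" "sp V \<Longrightarrow> x \<in> el X V \<Longrightarrow> cmp (Comp LE b a) V x = cmp b V (cmp a V x)"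
proof -
  have c: "Comp LE b a = mk_nat X Z (\<lambda>V x. cmp b V (cmp a V x))"
    using Comp_mk_nat[OF Hom_LE_cmp(1)[OF assms(1)], of Z "cmp b"] Hom_LE_cmp(2)[OF assms(1)]
      Hom_LE_cmp(2)[OF assms(2)] by simp
  show "Comp LE b a \<in> Hom LE X Z"
    unfolding c using assms nt_comp[OF Hom_LE_cmp(1)[OF assms(1)] Hom_LE_cmp(1)[OF assms(2)]]
    by (auto simp: Hom_LE_iff)
  show "sp V \<Longrightarrow> x \<in> el X V \<Longrightarrow> cmp (Comp LE b a) V x = cmp b V (cmp a V x)"
    by (simp add: c)
qed

text \<open>A total linear relation that relates zero to zero alone is the graph of a linear map, by
  subtraction, and if it is stable under the action the map is natural. Maps out of quotients and
  colimits, diagonal fillers and maps into pullbacks are all defined by such relations, which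
  replaces each check of independence of choices by one check at zero.\<close>

lemma nt_of_rel:
  assumes X: "X \<in> Obj LE" and Y: "Y \<in> Obj LE"
    and R: "\<And>V x y. sp V \<Longrightarrow> R V x y \<Longrightarrow> x \<in> el X V \<and> y \<in> el Y V"
    and total: "\<And>V x. sp V \<Longrightarrow> x \<in> el X V \<Longrightarrow> \<exists>y. R V x y"
    and single: "\<And>V y. sp V \<Longrightarrow> R V \<zero>\<^bsub>FObj X V\<^esub> y \<Longrightarrow> y = \<zero>\<^bsub>FObj Y V\<^esub>"
    and add: "\<And>V x y x' y'. sp V \<Longrightarrow> R V x y \<Longrightarrow> R V x' y' \<Longrightarrow> R V (x \<oplus>\<^bsub>FObj X V\<^esub> x') (y \<oplus>\<^bsub>FObj Y V\<^esub> y')"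
    and smult: "\<And>V c x y. sp V \<Longrightarrow> c \<in> carrier K \<Longrightarrow> R V x y \<Longrightarrow> R V (c \<odot>\<^bsub>FObj X V\<^esub> x) (c \<odot>\<^bsub>FObj Y V\<^esub> y)"
    and act: "\<And>V W f x y. sp V \<Longrightarrow> sp W \<Longrightarrow> lin V W f \<Longrightarrow> R V x y \<Longrightarrow> R W (act X V W f x) (act Y V W f y)"
  shows "\<exists>t. nt X Y t \<and> (\<forall>V x y. sp V \<longrightarrow> (R V x y \<longleftrightarrow> x \<in> el X V \<and> y = t V x))"
proof -
  define t where "t V x = (SOME y. R V x y)" for V x
  have t: "R V x (t V x)" if "sp V" "x \<in> el X V" for V x
    unfolding t_def using total[OF that] by (rule someI_ex)
  have sv: "y = y'" if V: "sp V" and y: "R V x y" "R V x y'" for V x y y'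
  proof -
    note c = R[OF V y(1)] R[OF V y(2)]
    note sX = sp_FObj[OF X V] and sY = sp_FObj[OF Y V]
    have "R V (x \<ominus>\<^bsub>FObj X V\<^esub> x) (y \<ominus>\<^bsub>FObj Y V\<^esub> y')"
      using add[OF V y(1) smult[OF V _ y(2), of "\<ominus>\<^bsub>K\<^esub> \<one>\<^bsub>K\<^esub>"]] c sX sY by (simp flip: sp_minus_smult)
    then have "y \<ominus>\<^bsub>FObj Y V\<^esub> y' = \<zero>\<^bsub>FObj Y V\<^esub>"
      using single[OF V] c sX by simp
    then show ?thesis
      using sp_minus_eq_zero[OF sY] c by blast
  qed
  have iff: "R V x y \<longleftrightarrow> x \<in> el X V \<and> y = t V x" if "sp V" for V x y
    using t sv R that by blast
  have "nt X Y t"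
  proof (rule ntI, rule linI)
    fix V
    assume V: "sp V"
    show "t V x \<in> el Y V" if "x \<in> el X V" for x
      using R t that V by blast
    show "t V (x \<oplus>\<^bsub>FObj X V\<^esub> y) = t V x \<oplus>\<^bsub>FObj Y V\<^esub> t V y" if "x \<in> el X V" "y \<in> el X V" for x y
      using add[OF V t[OF V that(1)] t[OF V that(2)]] iff[OF V] by metis
    show "t V (c \<odot>\<^bsub>FObj X V\<^esub> x) = c \<odot>\<^bsub>FObj Y V\<^esub> t V x" if "c \<in> carrier K" "x \<in> el X V" for c x
      using smult[OF V that(1) t[OF V that(2)]] iff[OF V] by metis
  next
    show "t W (act X V W f x) = act Y V W f (t V x)" if "sp V" "sp W" "lin V W f" "x \<in> el X V" for V W f x
      using act[OF that(1-3) t[OF that(1,4)]] iff that by metis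
  qed
  then show ?thesis
    using iff by blast
qed


subsection \<open>Representable functors\<close>

abbreviation hs :: "'u space \<Rightarrow> 'u space \<Rightarrow> 'u space" where "hs \<equiv> hom_space elts K"
abbreviation Yo :: "'u space \<Rightarrow> 'u vfun" where "Yo \<equiv> Yoneda elts K"

definition idg :: "'u space \<Rightarrow> 'u" where "idg V = graph elts (carrier V) (\<lambda>v. v)"

lemma hs_carrier:
  assumes "sp V" "sp W"
  shows "carrier (hs V W) = {graph elts (carrier V) f | f. lin V W f}"
proof (intro subset_antisym subsetI)
  fix a
  assume "a \<in> carrier (hs V W)"
  then obtain b where b: "a = graph elts (carrier V) (body b)" "b \<in> Hom Vt V W"
    by (auto simp: hom_space_def)
  then obtain f where f: "lin V W f" "b = arr V W f"
    by (auto simp: Hom_Vt_iff)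
  then have "a = graph elts (carrier V) f"
    using b by (simp add: graph_eq_iff sp_small[OF assms(1)])
  then show "a \<in> {graph elts (carrier V) f | f. lin V W f}"
    using f by blast
next
  fix a
  assume "a \<in> {graph elts (carrier V) f | f. lin V W f}"
  then obtain f where f: "lin V W f" "a = graph elts (carrier V) f"
    by blast
  then have "a = graph elts (carrier V) (body (arr V W f))"
    by (simp add: graph_eq_iff sp_small[OF assms(1)])
  then show "a \<in> carrier (hs V W)"
    using f arr_in_Hom[OF assms] by (auto simp: hom_space_def)
qed

lemma hs_graph: "sp V \<Longrightarrow> sp W \<Longrightarrow> lin V W f \<Longrightarrow> graph elts (carrier V) f \<in> carrier (hs V W)"
  by (auto simp: hs_carrier)

lemma hs_lin:
  assumes "sp V" "sp W" "a \<in> carrier (hs V W)"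
  shows "lin V W (co a)"
proof -
  obtain f where "lin V W f" "a = graph elts (carrier V) f"
    using assms by (auto simp: hs_carrier)
  then show ?thesis
    using lin_cong[OF assms(1), of "co a" f] by (simp add: sp_small[OF assms(1)])
qed

lemma hs_ops:
  "\<zero>\<^bsub>hs V W\<^esub> = graph elts (carrier V) (\<lambda>v. \<zero>\<^bsub>W\<^esub>)"
  "a \<in> carrier (hs V W) \<Longrightarrow> b \<in> carrier (hs V W) \<Longrightarrow>
    a \<oplus>\<^bsub>hs V W\<^esub> b = graph elts (carrier V) (\<lambda>v. co a v \<oplus>\<^bsub>W\<^esub> co b v)"
  "c \<in> carrier K \<Longrightarrow> a \<in> carrier (hs V W) \<Longrightarrow>
    c \<odot>\<^bsub>hs V W\<^esub> a = graph elts (carrier V) (\<lambda>v. c \<odot>\<^bsub>W\<^esub> co a v)"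
  by (simp_all add: hom_space_def)

lemma sp_hs [simp]:
  assumes V: "sp V" and W: "sp W"
  shows "sp (hs V W)"
proof -
  note small = sp_small[OF V]
  define C where "C = {f \<in> extensional (carrier V). lin V W f}"
  define M :: "('u, 'u \<Rightarrow> 'u) module" where "M = \<lparr>carrier = C, mult = undefined, one = undefined,
    zero = (\<lambda>v\<in>carrier V. \<zero>\<^bsub>W\<^esub>), add = (\<lambda>f g. \<lambda>v\<in>carrier V. f v \<oplus>\<^bsub>W\<^esub> g v),
    smult = (\<lambda>c f. \<lambda>v\<in>carrier V. c \<odot>\<^bsub>W\<^esub> f v)\<rparr>"
  have r: "restrict f (carrier V) \<in> C" if "lin V W f" for f
    using that lin_cong[OF V, of "restrict f (carrier V)" f W] by (simp add: C_def)
  have car: "carrier (hs V W) = graph elts (carrier V) ` C"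
  proof -
    have "graph elts (carrier V) f \<in> graph elts (carrier V) ` C" if "lin V W f" for f
      using r[OF that] by (intro image_eqI[of _ _ "restrict f (carrier V)"]) (simp_all add: graph_eq_iff small)
    then show ?thesis
      using V W by (auto simp: hs_carrier C_def)
  qed
  have "module K M"
    unfolding M_def
  proof (rule module_functions[OF sp_module[OF W]])
    show "C \<subseteq> carrier V \<rightarrow>\<^sub>E carrier W"
      by (auto simp: C_def lin_def extensional_def)
    show "(\<lambda>v\<in>carrier V. \<zero>\<^bsub>W\<^esub>) \<in> C"
      using W by (intro r lin_zero_map)
    show "(\<lambda>v\<in>carrier V. f v \<oplus>\<^bsub>W\<^esub> g v) \<in> C" if "f \<in> C" "g \<in> C" for f g
      using W that by (intro r lin_plus) (auto simp: C_def)
    show "(\<lambda>v\<in>carrier V. c \<odot>\<^bsub>W\<^esub> f v) \<in> C" if "c \<in> carrier K" "f \<in> C" for c f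
      using W that by (intro r lin_scale) (auto simp: C_def)
  qed
  then have "module K (hs V W)"
  proof (rule module_image[where q = "graph elts (carrier V)"])
    have mem: "graph elts (carrier V) f \<in> carrier (hs V W)" if "f \<in> carrier M" for f
      using that by (simp add: car M_def)
    show "graph elts (carrier V) f \<oplus>\<^bsub>hs V W\<^esub> graph elts (carrier V) g = graph elts (carrier V) (f \<oplus>\<^bsub>M\<^esub> g)"
      if "f \<in> carrier M" "g \<in> carrier M" for f g
      using mem[OF that(1)] mem[OF that(2)] by (simp add: M_def hs_ops graph_eq_iff small)
    show "c \<odot>\<^bsub>hs V W\<^esub> graph elts (carrier V) f = graph elts (carrier V) (c \<odot>\<^bsub>M\<^esub> f)"
      if "c \<in> carrier K" "f \<in> carrier M" for c f
      using mem[OF that(2)] that(1) by (simp add: M_def hs_ops graph_eq_iff small)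
  qed (auto simp: M_def car hs_ops graph_eq_iff small)
  moreover have "small elts (carrier (hs V W))"
    by (rule small_subset[OF small_graphs[OF small sp_small[OF W]]])
      (use V W in \<open>auto simp: hs_carrier lin_def\<close>)
  ultimately show ?thesis
    unfolding hom_space_def mk_space_simps by (rule sp_mk_space)
qed

text \<open>\<open>Yoneda\<close> literally has the shape of \<open>mk_fun\<close>, so its functor
  laws can be read off elementwise.\<close>

lemma Yo_mk_fun: "Yo V = mk_fun (hs V) (\<lambda>W U g a. graph elts (carrier V) (\<lambda>v. g (co a v)))"
  by (simp add: Yoneda_def mk_fun_def arr_def)

lemma Yo:
  assumes V: "sp V"
  shows "Yo V \<in> Obj LE"
    and "sp W \<Longrightarrow> FObj (Yo V) W = hs V W"
    and "sp W \<Longrightarrow> sp U \<Longrightarrow> lin W U f \<Longrightarrow> a \<in> carrier (hs V W) \<Longrightarrow>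
      act (Yo V) W U f a = graph elts (carrier V) (\<lambda>v. f (co a v))"
proof -
  note small = sp_small[OF V]
  have m: "graph elts (carrier V) (\<lambda>v. f (co a v)) \<in> carrier (hs V U)"
    if "sp W" "sp U" "lin W U f" "a \<in> carrier (hs V W)" for W U f a
    using that V by (intro hs_graph lin_comp[OF hs_lin]) auto
  have c: "co a v \<in> carrier W" if "sp W" "a \<in> carrier (hs V W)" "v \<in> carrier V" for W a v
    using that V lin_closed[OF hs_lin] by blast
  have l: "lin (hs V W) (hs V U) (\<lambda>a. graph elts (carrier V) (\<lambda>v. f (co a v)))"
    if WU: "sp W" "sp U" and f: "lin W U f" for W U f
  proof (rule linI)
    show "graph elts (carrier V) (\<lambda>v. f (co x v)) \<in> carrier (hs V U)" if "x \<in> carrier (hs V W)" for x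
      using m WU f that by blast
  qed (use V WU f m[OF WU f] c[OF WU(1)] lin_add[OF f] lin_smult[OF f] in \<open>simp_all add: hs_ops graph_eq_iff small\<close>)
  have i: "graph elts (carrier V) (\<lambda>v. co x v) = x" if "sp W" "x \<in> carrier (hs V W)" for W x
    using that V by (auto simp: hs_carrier graph_eq_iff small)
  note F = mk_fun[of "hs V" "\<lambda>W U g a. graph elts (carrier V) (\<lambda>v. g (co a v))"]
  have hyps: "sp W \<Longrightarrow> sp (hs V W)" for W
    using V by simp
  show "Yo V \<in> Obj LE"
    unfolding Yo_mk_fun
    by (rule F(1)) (use V in \<open>auto simp: l i c m hs_ops graph_eq_iff small\<close>)
  show "FObj (Yo V) W = hs V W" if "sp W"
    unfolding Yo_mk_fun using that by (simp add: mk_fun_def)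
  show "act (Yo V) W U f a = graph elts (carrier V) (\<lambda>v. f (co a v))"
    if "sp W" "sp U" "lin W U f" "a \<in> carrier (hs V W)"
    unfolding Yo_mk_fun
    by (rule F(3)) (use V that in \<open>auto simp: l i c m hs_ops graph_eq_iff small\<close>)
qed

lemma idg_mem [simp]: "sp V \<Longrightarrow> idg V \<in> carrier (hs V V)"
  unfolding idg_def by (intro hs_graph lin_id)

lemma co_idg [simp]: "sp V \<Longrightarrow> v \<in> carrier V \<Longrightarrow> co (idg V) v = v"
  by (simp add: idg_def sp_small)

text \<open>The transformation that the Yoneda lemma assigns to the element x.\<close>

definition yo :: "'u space \<Rightarrow> 'u vfun \<Rightarrow> 'u \<Rightarrow> 'u vnat"
  where "yo V X x = mk_nat (Yo V) X (\<lambda>W a. act X V W (co a) x)"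

lemma nt_yo:
  assumes V: "sp V" and X: "X \<in> Obj LE" and x: "x \<in> el X V"
  shows "nt (Yo V) X (\<lambda>W a. act X V W (co a) x)"
proof (rule ntI)
  note small = sp_small[OF V]
  fix W
  assume W: "sp W"
  show "lin (FObj (Yo V) W) (FObj X W) (\<lambda>a. act X V W (co a) x)"
  proof (rule linI)
    fix a b
    assume ab: "a \<in> el (Yo V) W" "b \<in> el (Yo V) W"
    have "act X V W (co (a \<oplus>\<^bsub>hs V W\<^esub> b)) x = act X V W (\<lambda>v. co a v \<oplus>\<^bsub>W\<^esub> co b v) x"
      using ab V W by (intro act_cong[OF X]) (simp add: hs_ops small Yo)
    then show "act X V W (co (a \<oplus>\<^bsub>FObj (Yo V) W\<^esub> b)) x = act X V W (co a) x \<oplus>\<^bsub>FObj X W\<^esub> act X V W (co b) x"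
      using ab V W X x by (simp add: Yo act_plus hs_lin)
  next
    fix c a
    assume ca: "c \<in> carrier K" "a \<in> el (Yo V) W"
    have "act X V W (co (c \<odot>\<^bsub>hs V W\<^esub> a)) x = act X V W (\<lambda>v. c \<odot>\<^bsub>W\<^esub> co a v) x"
      using ca V W by (intro act_cong[OF X]) (simp add: hs_ops small Yo)
    then show "act X V W (co (c \<odot>\<^bsub>FObj (Yo V) W\<^esub> a)) x = c \<odot>\<^bsub>FObj X W\<^esub> act X V W (co a) x"
      using ca V W X x by (simp add: Yo act_scale hs_lin)
  qed (use V W X x in \<open>auto simp: Yo hs_lin\<close>)
next
  fix W U f a
  assume WU: "sp W" "sp U" "lin W U f" and "a \<in> el (Yo V) W"
  then have a: "a \<in> carrier (hs V W)"
    using V by (simp add: Yo)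
  have "act X V U (co (act (Yo V) W U f a)) x = act X V U (\<lambda>v. f (co a v)) x"
    using a V WU by (intro act_cong[OF X]) (simp add: Yo sp_small)
  also have "\<dots> = act X W U f (act X V W (co a) x)"
    using act_comp[OF X V WU(1,2) hs_lin[OF V WU(1) a] WU(3) x] by simp
  finally show "act X V U (co (act (Yo V) W U f a)) x = act X W U f (act X V W (co a) x)" .
qed

lemma yo_Hom: "sp V \<Longrightarrow> X \<in> Obj LE \<Longrightarrow> x \<in> el X V \<Longrightarrow> yo V X x \<in> Hom LE (Yo V) X"
  unfolding yo_def using Yo(1) nt_yo by (intro mk_nat_in_Hom)

lemma cmp_yo: "sp V \<Longrightarrow> sp W \<Longrightarrow> a \<in> carrier (hs V W) \<Longrightarrow> cmp (yo V X x) W a = act X V W (co a) x"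
  by (simp add: yo_def Yo)

lemma cmp_yo_idg:
  assumes "sp V" "X \<in> Obj LE" "x \<in> el X V"
  shows "cmp (yo V X x) V (idg V) = x"
  using assms by (simp add: cmp_yo act_id)

lemma yoneda:
  assumes V: "sp V" and W: "sp W" and X: "X \<in> Obj LE"
    and t: "nt (Yo V) X t" and a: "a \<in> carrier (hs V W)"
  shows "t W a = act X V W (co a) (t V (idg V))"
proof -
  have l: "lin V W (co a)"
    using hs_lin[OF V W a] .
  have m: "graph elts (carrier V) (\<lambda>v. co a (co (idg V) v)) = a"
  proof -
    obtain f where "lin V W f" "a = graph elts (carrier V) f"
      using a V W by (auto simp: hs_carrier)
    then show ?thesis
      using V by (simp add: graph_eq_iff sp_small)
  qed
  have "act X V W (co a) (t V (idg V)) = t W (act (Yo V) V W (co a) (idg V))"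
    using nt_nat[OF t V W l, of "idg V"] V by (simp add: Yo)
  also have "act (Yo V) V W (co a) (idg V) = a"
    using V W l m by (simp add: Yo)
  finally show ?thesis
    by simp
qed

lemma yo_eqI:
  assumes V: "sp V" and a: "a \<in> Hom LE (Yo V) X" and b: "b \<in> Hom LE (Yo V) X"
    and eq: "cmp a V (idg V) = cmp b V (idg V)"
  shows "a = b"
proof (rule Hom_LE_eqI[OF a b])
  fix W x
  assume W: "sp W" "x \<in> el (Yo V) W"
  have X: "X \<in> Obj LE"
    using a by (simp add: Hom_LE_iff)
  show "cmp a W x = cmp b W x"
    using W V yoneda[OF V W(1) X Hom_LE_cmp(1)[OF a]] yoneda[OF V W(1) X Hom_LE_cmp(1)[OF b]] eq
    by (simp add: Yo)
qed

section \<open>Torsion\<close>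

text \<open>The premise of \<open>close\<close> asks for torsion coordinates where zero coordinates
  might be expected. This is what lets a preimage of an element with zero coordinates in the
  quotient be recognized as torsion.\<close>

inductive tors :: "'u vfun \<Rightarrow> 'u space \<Rightarrow> 'u \<Rightarrow> bool" for X where
  zero: "sp V \<Longrightarrow> tors X V \<zero>\<^bsub>FObj X V\<^esub>"
| add: "tors X V x \<Longrightarrow> tors X V y \<Longrightarrow> tors X V (x \<oplus>\<^bsub>FObj X V\<^esub> y)"
| smult: "c \<in> carrier K \<Longrightarrow> tors X V x \<Longrightarrow> tors X V (c \<odot>\<^bsub>FObj X V\<^esub> x)"
| act: "tors X V x \<Longrightarrow> sp W \<Longrightarrow> lin V W f \<Longrightarrow> tors X W (act X V W f x)"
| close: "x \<in> el X (ds I) \<Longrightarrow> (\<And>i. i \<in> elts I \<Longrightarrow> tors X gr (act X (ds I) gr (\<lambda>a. co a i) x)) \<Longrightarrow>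
    tors X (ds I) x"

lemma tors_el:
  assumes X: "X \<in> Obj LE" and x: "tors X V x"
  shows "sp V \<and> x \<in> el X V"
  using x by induction (use X in auto)

lemma tors_minus: "X \<in> Obj LE \<Longrightarrow> tors X V x \<Longrightarrow> tors X V y \<Longrightarrow> tors X V (x \<ominus>\<^bsub>FObj X V\<^esub> y)"
  using tors.add[of X V x "(\<ominus>\<^bsub>K\<^esub> \<one>\<^bsub>K\<^esub>) \<odot>\<^bsub>FObj X V\<^esub> y"] tors.smult[of "\<ominus>\<^bsub>K\<^esub> \<one>\<^bsub>K\<^esub>" X V y] tors_el
  by (simp add: sp_minus_smult)

lemma tors_nt:
  assumes X: "X \<in> Obj LE" and Y: "Y \<in> Obj LE" and t: "nt X Y t" and x: "tors X V x"
  shows "tors Y V (t V x)"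
  using x
proof induction
  case (zero V)
  then show ?case
    using X Y t by (simp add: nt_zero[of X Y] tors.zero)
next
  case (add V x y)
  then show ?case
    using tors_el[OF X] by (simp add: nt_add[OF t] tors.add)
next
  case (smult c V x)
  then show ?case
    using tors_el[OF X] by (simp add: nt_smult[OF t] tors.smult)
next
  case (act V x W f)
  then show ?case
    using tors_el[OF X act.hyps(1)] by (simp add: nt_nat[OF t] tors.act)
next
  case (close x I)
  show ?case
  proof (rule tors.close)
    show "t (ds I) x \<in> el Y (ds I)"
      using close nt_closed[OF t] by simp
    show "tors Y gr (act Y (ds I) gr (\<lambda>a. co a i) (t (ds I) x))" if "i \<in> elts I" for i
      using close.IH[OF that] nt_nat[OF t sp_ds sp_ground lin_co[OF that] close.hyps(1)] by simp
  qed
qed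

section \<open>Strong functors are the torsion-free ones\<close>

definition torsion_free :: "'u vfun \<Rightarrow> bool"
  where "torsion_free X \<longleftrightarrow> (\<forall>V x. tors X V x \<longrightarrow> x = \<zero>\<^bsub>FObj X V\<^esub>)"

text \<open>The difference of x and y has zero coordinates, so \<open>close\<close> makes it
  torsion. In this form torsion-freeness turns questions over \<open>ds I\<close> into questions
  about single coordinates.\<close>

lemma torsion_free_eqI:
  assumes X: "X \<in> Obj LE" and tf: "torsion_free X" and xy: "x \<in> el X (ds I)" "y \<in> el X (ds I)"
    and eq: "\<And>i. i \<in> elts I \<Longrightarrow> act X (ds I) gr (\<lambda>a. co a i) x = act X (ds I) gr (\<lambda>a. co a i) y"
  shows "x = y"
proof -
  have "tors X (ds I) (x \<ominus>\<^bsub>FObj X (ds I)\<^esub> y)"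
  proof (rule tors.close)
    show "tors X gr (act X (ds I) gr (\<lambda>a. co a i) (x \<ominus>\<^bsub>FObj X (ds I)\<^esub> y))" if "i \<in> elts I" for i
      using eq[OF that] X xy lin_co[OF that] by (simp add: act_minus tors.zero)
  qed (use X xy in auto)
  then have "x \<ominus>\<^bsub>FObj X (ds I)\<^esub> y = \<zero>\<^bsub>FObj X (ds I)\<^esub>"
    using tf by (simp add: torsion_free_def)
  then show ?thesis
    using sp_minus_eq_zero[OF sp_FObj[OF X sp_ds]] xy by blast
qed

abbreviation sumf :: "'u \<Rightarrow> 'u \<Rightarrow> 'u" where "sumf I \<equiv> lext I gr (\<lambda>i. \<one>\<^bsub>K\<^esub>)"

lemma lin_sumf: "lin (ds I) gr (sumf I)"
  by (rule lin_lext) auto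

lemma sumf_bv: "i \<in> elts I \<Longrightarrow> sumf I (bv I i) = \<one>\<^bsub>K\<^esub>"
  by (rule lext_bv) auto

lemma delta_arr: "delta elts K I i = arr (ds I) gr (\<lambda>a. co a i)"
  by (simp add: delta_def arr_def)

text \<open>A linear map on \<open>ds I\<close> is determined by its values on the basis vectors, so
  the definite description of \<open>sigma\<close> is met by the explicit
  \<open>sumf\<close>.\<close>

lemma sigma_arr: "sigma elts K I = arr (ds I) gr (sumf I)"
  unfolding sigma_def
proof (rule the_equality)
  show "arr (ds I) gr (sumf I) \<in> Hom Vt (ds I) gr \<and>
      (\<forall>i\<in>elts I. body (arr (ds I) gr (sumf I)) (bv I i) = \<one>\<^bsub>K\<^esub>)"
    using lin_sumf sumf_bv by (simp add: arr_in_Hom)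
next
  fix s
  assume s: "s \<in> Hom Vt (ds I) gr \<and> (\<forall>i\<in>elts I. body s (bv I i) = \<one>\<^bsub>K\<^esub>)"
  then obtain f where f: "lin (ds I) gr f" "s = arr (ds I) gr f"
    by (auto simp: Hom_Vt_iff)
  have "f a = sumf I a" if "a \<in> carrier (ds I)" for a
    using s f by (intro lin_ds_eqI[OF sp_ground f(1) lin_sumf _ that]) (auto simp: sumf_bv)
  then show "s = arr (ds I) gr (sumf I)"
    using f by (simp add: arr_eq_iff)
qed

lemma witness_iff:
  "summability_witness elts K X I x t \<longleftrightarrow>
    t \<in> el X (ds I) \<and> (\<forall>i\<in>elts I. act X (ds I) gr (\<lambda>a. co a i) t = x i)"
  by (simp add: summability_witness_def delta_arr act_def)

lemma is_sum_iff:
  "is_sum elts K X I x s \<longleftrightarrow> (\<exists>t. summability_witness elts K X I x t \<and> s = act X (ds I) gr (sumf I) t)"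
  by (simp add: is_sum_def sigma_arr act_def)

lemma concrete_functorD:
  "concrete_functor elts K X \<Longrightarrow> sp V \<Longrightarrow> body f gr = body g gr \<Longrightarrow>
    f \<in> Hom LE (Yo V) X \<Longrightarrow> g \<in> Hom LE (Yo V) X \<Longrightarrow> f = g"
  by (simp add: concrete_functor_def)

text \<open>Every functional is the composite of a diagonal map with \<open>\<sigma>\<close>, so vanishing of the
  coordinates forces all functionals to vanish.\<close>

lemma strong_coordinates:
  assumes X: "X \<in> Obj LE" and S: "strong_space elts K X" and x: "x \<in> el X (ds I)"
    and z: "\<And>i. i \<in> elts I \<Longrightarrow> act X (ds I) gr (\<lambda>a. co a i) x = \<zero>\<^bsub>FObj X gr\<^esub>"
  shows "x = \<zero>\<^bsub>FObj X (ds I)\<^esub>"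
proof -
  have fz: "act X (ds I) gr \<phi> x = \<zero>\<^bsub>FObj X gr\<^esub>" if \<phi>: "lin (ds I) gr \<phi>" for \<phi>
  proof -
    define c where "c i = \<phi> (bv I i)" for i
    have c: "c i \<in> carrier K" for i
      using lin_closed[OF \<phi>, of "bv I i"] by (simp add: c_def)
    \<comment> \<open>D scales the i-th coordinate by the value of \<phi> on the i-th basis vector,
      so that \<open>sumf I\<close> after D is \<phi>. The coordinates of D applied to x are
      multiples of those of x, hence still zero.\<close>
    define D where "D = pull I c (\<lambda>i. i)"
    have D: "lin (ds I) (ds I) D"
      unfolding D_def by (rule lin_pull) (auto simp: c)
    define y where "y = act X (ds I) (ds I) D x"
    have y: "y \<in> el X (ds I)"
      using X D x by (simp add: y_def)
    have wy: "summability_witness elts K X I (\<lambda>i\<in>elts I. \<zero>\<^bsub>FObj X gr\<^esub>) y"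
      unfolding witness_iff
    proof (intro conjI ballI y)
      fix i
      assume i: "i \<in> elts I"
      have "act X (ds I) gr (\<lambda>a. co a i) y = act X (ds I) gr (\<lambda>a. co (D a) i) x"
        unfolding y_def using act_comp[OF X sp_ds sp_ds sp_ground D lin_co[OF i] x] .
      also have "\<dots> = act X (ds I) gr (\<lambda>a. c i \<odot>\<^bsub>gr\<^esub> co a i) x"
        using i c[of i] by (intro act_cong[OF X]) (auto simp: D_def co_pull)
      also have "\<dots> = \<zero>\<^bsub>FObj X gr\<^esub>"
        using X x i c z lin_co[OF i] by (simp add: act_scale)
      finally show "act X (ds I) gr (\<lambda>a. co a i) y = (\<lambda>i\<in>elts I. \<zero>\<^bsub>FObj X gr\<^esub>) i"
        using i by simp
    qed
    have w0: "summability_witness elts K X I (\<lambda>i\<in>elts I. \<zero>\<^bsub>FObj X gr\<^esub>) \<zero>\<^bsub>FObj X (ds I)\<^esub>"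
      using X lin_co by (auto simp: witness_iff act_zero)
    have "\<exists>!s. is_sum elts K X I (\<lambda>i\<in>elts I. \<zero>\<^bsub>FObj X gr\<^esub>) s"
    proof -
      have "(\<lambda>i\<in>elts I. \<zero>\<^bsub>FObj X gr\<^esub>) \<in> elts I \<rightarrow>\<^sub>E el X gr"
        using X by simp
      moreover have "summable_family elts K X I (\<lambda>i\<in>elts I. \<zero>\<^bsub>FObj X gr\<^esub>)"
        using wy unfolding summable_family_def by blast
      ultimately show ?thesis
        using S unfolding strong_space_def by blast
    qed
    \<comment> \<open>Both y and zero witness summability of the zero family; uniqueness of the sum
      identifies their images under \<open>sumf I\<close>.\<close>
    then have "act X (ds I) gr (sumf I) y = act X (ds I) gr (sumf I) \<zero>\<^bsub>FObj X (ds I)\<^esub>"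
      using wy w0 unfolding is_sum_iff by blast
    also have "\<dots> = \<zero>\<^bsub>FObj X gr\<^esub>"
      using X by (simp add: act_zero lin_sumf)
    finally have "act X (ds I) gr (\<lambda>a. sumf I (D a)) x = \<zero>\<^bsub>FObj X gr\<^esub>"
      unfolding y_def using act_comp[OF X sp_ds sp_ds sp_ground D lin_sumf x] by simp
    moreover have "sumf I (D a) = \<phi> a" if "a \<in> carrier (ds I)" for a
    proof (rule lin_ds_eqI[OF sp_ground lin_comp[OF D lin_sumf] \<phi> _ that])
      fix i
      assume i: "i \<in> elts I"
      have "D (bv I i) = c i \<odot>\<^bsub>ds I\<^esub> bv I i"
        by (rule ds_eqI[where I = I]) (use c lin_closed[OF D] in \<open>auto simp: D_def co_pull\<close>)
      then show "sumf I (D (bv I i)) = \<phi> (bv I i)"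
        using i c[of i] lin_smult[OF lin_sumf, of "c i" "bv I i"] by (simp add: sumf_bv c_def)
    qed
    ultimately show ?thesis
      using act_cong[OF X, of "ds I" "\<lambda>a. sumf I (D a)" \<phi>] by simp
  qed
  \<comment> \<open>At the field, the transformation belonging to x evaluates functionals on x. All
    these values vanish, so concreteness identifies it with the transformation belonging to
    zero.\<close>
  have "yo (ds I) X x = yo (ds I) X \<zero>\<^bsub>FObj X (ds I)\<^esub>"
  proof -
    have "body (yo (ds I) X x) gr = body (yo (ds I) X \<zero>\<^bsub>FObj X (ds I)\<^esub>) gr"
      using X by (simp add: yo_def mk_nat_def arr_eq_iff Yo fz hs_lin act_zero)
    moreover have "yo (ds I) X x \<in> Hom LE (Yo (ds I)) X" "yo (ds I) X \<zero>\<^bsub>FObj X (ds I)\<^esub> \<in> Hom LE (Yo (ds I)) X"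
      using X x by (auto intro!: yo_Hom)
    ultimately show ?thesis
      using S concrete_functorD[of X "ds I"] unfolding strong_space_def by simp
  qed
  then show ?thesis
    using cmp_yo_idg[OF sp_ds X x] cmp_yo_idg[OF sp_ds X, of "\<zero>\<^bsub>FObj X (ds I)\<^esub>"] X by simp
qed

text \<open>V is a retract of some \<open>ds I\<close>, where coordinates decide equality, and the
  coordinates pull back to functionals on V.\<close>

lemma torsion_free_functionals:
  assumes X: "X \<in> Obj LE" and tf: "torsion_free X" and V: "sp V" and xy: "x \<in> el X V" "y \<in> el X V"
    and eq: "\<And>\<phi>. lin V gr \<phi> \<Longrightarrow> act X V gr \<phi> x = act X V gr \<phi> y"
  shows "x = y"
proof -
  obtain I \<alpha> \<beta> where \<alpha>: "lin V (ds I) \<alpha>" and \<beta>: "lin (ds I) V \<beta>" and \<beta>\<alpha>: "\<And>v. v \<in> carrier V \<Longrightarrow> \<beta> (\<alpha> v) = v"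
    using retract_of_ds[OF V sp_small[OF V], of "\<lambda>v. v"] by (metis image_ident inj_on_id2 order_refl)
  have "act X V (ds I) \<alpha> x = act X V (ds I) \<alpha> y"
  proof (rule torsion_free_eqI[OF X tf])
    fix i
    assume i: "i \<in> elts I"
    show "act X (ds I) gr (\<lambda>a. co a i) (act X V (ds I) \<alpha> x) = act X (ds I) gr (\<lambda>a. co a i) (act X V (ds I) \<alpha> y)"
      using eq[OF lin_comp[OF \<alpha> lin_co[OF i]]] V xy \<alpha> lin_co[OF i]
      by (simp add: act_comp[OF X V sp_ds sp_ground \<alpha>])
  qed (use X V \<alpha> xy in auto)
  then have "act X (ds I) V \<beta> (act X V (ds I) \<alpha> x) = act X (ds I) V \<beta> (act X V (ds I) \<alpha> y)"
    by simp
  then show ?thesis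
    using V xy \<alpha> \<beta> \<beta>\<alpha> X by (simp add: act_comp act_id)
qed

text \<open>In a strong functor \<open>strong_coordinates\<close> settles each use of
  \<open>close\<close>, so the induction over \<open>tors\<close> never leaves zero. Conversely, in
  a torsion-free functor the witness of summability is itself unique, and hence so is the sum;
  concreteness is the fact that functionals separate elements.\<close>

lemma strong_iff:
  assumes X: "X \<in> Obj LE"
  shows "strong_space elts K X \<longleftrightarrow> torsion_free X"
proof
  assume S: "strong_space elts K X"
  have "x = \<zero>\<^bsub>FObj X V\<^esub>" if "tors X V x" for V x
    using that
  proof induction
    case (close x I)
    show ?case
      by (rule strong_coordinates[OF X S close.hyps(1)]) (use close in auto)
  qed (use X tors_el[OF X] in \<open>auto simp: act_zero\<close>)
  then show "torsion_free X"
    by (simp add: torsion_free_def)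
next
  assume tf: "torsion_free X"
  have "\<exists>!s. is_sum elts K X I x s" if x: "summable_family elts K X I x" for I x
  proof -
    obtain t where t: "summability_witness elts K X I x t"
      using x by (auto simp: summable_family_def)
    have "t' = t" if "summability_witness elts K X I x t'" for t'
      by (rule torsion_free_eqI[OF X tf]) (use t that in \<open>auto simp: witness_iff\<close>)
    then show ?thesis
      using t unfolding is_sum_iff by metis
  qed
  moreover have "concrete_functor elts K X"
    unfolding concrete_functor_def
  proof (intro ballI iffI)
    fix V f g
    assume "V \<in> Obj Vt" and f: "f \<in> Hom LE (Yo V) X" and g: "g \<in> Hom LE (Yo V) X"
      and eq: "body f gr = body g gr"
    then have V: "sp V" by simp
    have m: "cmp f V (idg V) \<in> el X V" "cmp g V (idg V) \<in> el X V"
      using nt_closed[OF Hom_LE_cmp(1)[OF f] V] nt_closed[OF Hom_LE_cmp(1)[OF g] V] V by (auto simp: Yo)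
    have "cmp f V (idg V) = cmp g V (idg V)"
    proof (rule torsion_free_functionals[OF X tf V m])
      fix \<phi>
      assume \<phi>: "lin V gr \<phi>"
      \<comment> \<open>By the Yoneda lemma, the component of f at the field sends the code of
        \<phi> to \<phi> acting on the element that represents f; equal components thus mean equal
        values of all functionals.\<close>
      define a where "a = graph elts (carrier V) \<phi>"
      have a: "a \<in> carrier (hs V gr)"
        unfolding a_def using V \<phi> by (simp add: hs_graph)
      have "act X V gr \<phi> z = act X V gr (co a) z" for z
        using V by (intro act_cong[OF X]) (simp add: a_def sp_small)
      moreover have "cmp f gr a = cmp g gr a"
        using eq by (simp add: cmp_def)
      ultimately show "act X V gr \<phi> (cmp f V (idg V)) = act X V gr \<phi> (cmp g V (idg V))"
        using yoneda[OF V sp_ground X Hom_LE_cmp(1)[OF f] a] yoneda[OF V sp_ground X Hom_LE_cmp(1)[OF g] a]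
        by simp
    qed
    then show "f = g"
      by (rule yo_eqI[OF V f g])
  qed simp
  ultimately show "strong_space elts K X"
    by (simp add: strong_space_def)
qed


section \<open>Bounded functors\<close>

text \<open>Each element is carried by a space of dimension at most the size of I. The condition
  could also say that x comes from an element over \<open>ds I\<close>, but being fixed by an
  endomorphism mentions x alone and is therefore inherited by quotients as well as by
  subobjects.\<close>

definition bounded_by :: "'u \<Rightarrow> 'u vfun \<Rightarrow> bool"
  where "bounded_by I X \<longleftrightarrow> (\<forall>V x. sp V \<longrightarrow> x \<in> el X V \<longrightarrow>
    (\<exists>g f. lin V (ds I) g \<and> lin (ds I) V f \<and> act X V V (\<lambda>v. f (g v)) x = x))"

definition bdd :: "'u vfun \<Rightarrow> bool" where "bdd X \<longleftrightarrow> (\<exists>I. bounded_by I X)"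

text \<open>With g a generalized inverse of f, the endomorphism f g is the identity on the range of
  f, and x comes from there.\<close>

lemma fixed_of_source:
  assumes X: "X \<in> Obj LE" and V: "sp V" and f: "lin (ds I) V f" and y: "y \<in> el X (ds I)"
    and x: "x = act X (ds I) V f y"
  shows "\<exists>g f. lin V (ds I) g \<and> lin (ds I) V f \<and> act X V V (\<lambda>v. f (g v)) x = x"
proof -
  obtain g where g: "lin V (ds I) g" "\<And>a. a \<in> carrier (ds I) \<Longrightarrow> f (g (f a)) = f a"
    using generalized_inverse[OF sp_ds V f] by blast
  have "act X V V (\<lambda>v. f (g v)) x = act X (ds I) V (\<lambda>a. f (g (f a))) y"
    unfolding x using act_comp[OF X sp_ds V V f lin_comp[OF g(1) f] y] .
  also have "\<dots> = x"
    unfolding x using g(2) by (rule act_cong[OF X])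
  finally show ?thesis
    using f g(1) by blast
qed

text \<open>The space W carrying x may vary with x. Its own injection into J makes it a retract of
  the fixed sum over J, and x comes from that sum.\<close>

lemma bounded_byI:
  assumes X: "X \<in> Obj LE" and J: "small elts J"
    and src: "\<And>V x. sp V \<Longrightarrow> x \<in> el X V \<Longrightarrow> \<exists>W f y j. sp W \<and> lin W V f \<and> y \<in> el X W \<and>
      x = act X W V f y \<and> inj_on j (carrier W) \<and> j ` carrier W \<subseteq> J"
  shows "bounded_by (set_code elts J) X"
  unfolding bounded_by_def
proof (intro allI impI)
  fix V x
  assume V: "sp V" and x: "x \<in> el X V"
  from src[OF V x] obtain W f y j where W: "sp W" and f: "lin W V f" and y: "y \<in> el X W"
    and xy: "x = act X W V f y" and j: "inj_on j (carrier W)" "j ` carrier W \<subseteq> J"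
    by blast
  from retract_of_ds[OF W J j] obtain \<alpha> \<beta> where \<alpha>: "lin W (ds (set_code elts J)) \<alpha>"
    and \<beta>: "lin (ds (set_code elts J)) W \<beta>" and \<beta>\<alpha>: "\<And>w. w \<in> carrier W \<Longrightarrow> \<beta> (\<alpha> w) = w"
    by blast
  show "\<exists>g f. lin V (ds (set_code elts J)) g \<and> lin (ds (set_code elts J)) V f \<and> act X V V (\<lambda>v. f (g v)) x = x"
  proof (rule fixed_of_source[OF X V lin_comp[OF \<beta> f]])
    show "act X W (ds (set_code elts J)) \<alpha> y \<in> el X (ds (set_code elts J))"
      using X W \<alpha> y by simp
    have "act X (ds (set_code elts J)) V (\<lambda>x. f (\<beta> x)) (act X W (ds (set_code elts J)) \<alpha> y) =
      act X W V (\<lambda>w. f (\<beta> (\<alpha> w))) y"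
      using act_comp[OF X W sp_ds V \<alpha> lin_comp[OF \<beta> f] y] .
    also have "\<dots> = x"
      unfolding xy using \<beta>\<alpha> by (intro act_cong[OF X]) simp
    finally show "x = act X (ds (set_code elts J)) V (\<lambda>x. f (\<beta> x)) (act X W (ds (set_code elts J)) \<alpha> y)" ..
  qed
qed

lemma bdd_quotient:
  assumes "nt X Y q" "\<And>V y. sp V \<Longrightarrow> y \<in> el Y V \<Longrightarrow> \<exists>x\<in>el X V. q V x = y" "bdd X"
  shows "bdd Y"
proof -
  obtain I where I: "bounded_by I X"
    using assms(3) by (auto simp: bdd_def)
  have "bounded_by I Y"
    unfolding bounded_by_def
  proof (intro allI impI)
    fix V y
    assume V: "sp V" and "y \<in> el Y V"
    then obtain x where x: "x \<in> el X V" "q V x = y"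
      using assms(2) by blast
    then obtain g f where gf: "lin V (ds I) g" "lin (ds I) V f" "act X V V (\<lambda>v. f (g v)) x = x"
      using I V unfolding bounded_by_def by blast
    have "act Y V V (\<lambda>v. f (g v)) y = y"
      using nt_nat[OF assms(1) V V lin_comp[OF gf(1,2)] x(1)] gf(3) x(2) by simp
    then show "\<exists>g f. lin V (ds I) g \<and> lin (ds I) V f \<and> act Y V V (\<lambda>v. f (g v)) y = y"
      using gf by blast
  qed
  then show ?thesis
    by (auto simp: bdd_def)
qed

section \<open>Relabelling coordinates, and bounds for jointly injective pairs\<close>

definition chi :: "'u set \<Rightarrow> 'u \<Rightarrow> 'u" where "chi D i = (if i \<in> D then \<one>\<^bsub>K\<^esub> else \<zero>\<^bsub>K\<^esub>)"

lemma lin_pull_chi: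
  assumes "\<And>i. i \<in> elts I \<Longrightarrow> i \<in> D \<Longrightarrow> r i \<in> elts J" "inj_on r (elts I \<inter> D)"
  shows "lin (ds J) (ds I) (pull I (chi D) r)"
proof (rule lin_pull)
  have "{i \<in> elts I. chi D i \<noteq> \<zero>\<^bsub>K\<^esub>} \<subseteq> elts I \<inter> D"
    by (auto simp: chi_def)
  then show "inj_on r {i \<in> elts I. chi D i \<noteq> \<zero>\<^bsub>K\<^esub>}"
    using assms(2) inj_on_subset by blast
qed (use assms(1) in \<open>auto simp: chi_def split: if_splits\<close>)

lemma co_pull_chi:
  assumes "i \<in> elts I" "i \<in> D \<Longrightarrow> r i \<in> elts J" "b \<in> carrier (ds J)"
  shows "co (pull I (chi D) r b) i = (if i \<in> D then co b (r i) else \<zero>\<^bsub>K\<^esub>)"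
  using assms by (auto simp: co_pull chi_def)

text \<open>The two images of x are fixed by endomorphisms passing through \<open>ds I\<close> and
  \<open>ds J\<close>. Their outgoing maps f and f' combine to one map h from a sum containing both,
  and for a generalized inverse k the endomorphism h k is the identity on the ranges of f and f'. It
  therefore fixes both images of x, and joint injectivity makes it fix x.\<close>

lemma bdd_pair:
  assumes P: "P \<in> Obj LE" and A: "A \<in> Obj LE" and B: "B \<in> Obj LE"
    and p: "nt P A p" and q: "nt P B q"
    and joint: "\<And>V x y. sp V \<Longrightarrow> x \<in> el P V \<Longrightarrow> y \<in> el P V \<Longrightarrow> p V x = p V y \<Longrightarrow> q V x = q V y \<Longrightarrow> x = y"
    and bA: "bdd A" and bB: "bdd B"
  shows "bdd P"
proof -
  obtain I where I: "bounded_by I A" using bA by (auto simp: bdd_def)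
  obtain J where J: "bounded_by J B" using bB by (auto simp: bdd_def)
  \<comment> \<open>Zero and one of the field serve as two distinct tags. I is placed among the
    labels tagged zero and J among those tagged one, so that they become disjoint.\<close>
  define L where "L = set_code elts (otimes (elts I \<union> elts J) {\<zero>\<^bsub>K\<^esub>, \<one>\<^bsub>K\<^esub>})"
  have L: "elts L = otimes (elts I \<union> elts J) {\<zero>\<^bsub>K\<^esub>, \<one>\<^bsub>K\<^esub>}"
    unfolding L_def by (intro elts_set_code small_otimes small_Un) (auto simp: small_insert_pair)
  have *: "\<exists>\<pi> \<iota>. lin (ds L) (ds I) \<pi> \<and> lin (ds I) (ds L) \<iota> \<and> (\<forall>a\<in>carrier (ds I). \<pi> (\<iota> a) = a) \<and>
      (\<forall>b\<in>carrier (ds L). (\<forall>i\<in>elts I. co b (opair elts i u) = \<zero>\<^bsub>K\<^esub>) \<longrightarrow> \<pi> b = \<zero>\<^bsub>ds I\<^esub>) \<and>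
      (\<forall>a\<in>carrier (ds I). \<forall>i w. opair elts i w \<in> elts L \<longrightarrow> w \<noteq> u \<longrightarrow> co (\<iota> a) (opair elts i w) = \<zero>\<^bsub>K\<^esub>)"
    if u: "u \<in> {\<zero>\<^bsub>K\<^esub>, \<one>\<^bsub>K\<^esub>}" and IL: "elts I \<subseteq> elts I' \<union> elts J'" "elts L = otimes (elts I' \<union> elts J') {\<zero>\<^bsub>K\<^esub>, \<one>\<^bsub>K\<^esub>}"
    for I u I' J'
  proof -
    define \<pi> where "\<pi> = pull I (chi (elts I)) (\<lambda>i. opair elts i u)"
    define \<iota> where "\<iota> = pull L (chi (otimes (elts I) {u})) ofst"
    have opL: "opair elts i u \<in> elts L" if "i \<in> elts I" for i
      using that u IL by auto
    have \<pi>: "lin (ds L) (ds I) \<pi>"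
      unfolding \<pi>_def by (rule lin_pull_chi) (auto simp: opL inj_on_def)
    have \<iota>: "lin (ds I) (ds L) \<iota>"
      unfolding \<iota>_def by (rule lin_pull_chi) (auto simp: inj_on_def otimes_def)
    have co\<iota>: "co (\<iota> a) k = (if k \<in> otimes (elts I) {u} then co a (ofst k) else \<zero>\<^bsub>K\<^esub>)"
      if "k \<in> elts L" "a \<in> carrier (ds I)" for a k
      unfolding \<iota>_def using that by (intro co_pull_chi[where J = I]) (auto simp: otimes_def)
    have co\<pi>: "co (\<pi> b) i = co b (opair elts i u)" if "i \<in> elts I" "b \<in> carrier (ds L)" for b i
      unfolding \<pi>_def using that opL by (simp add: co_pull_chi[where J = L])
    have 1: "\<pi> (\<iota> a) = a" if "a \<in> carrier (ds I)" for a
      by (rule ds_eqI[where I = I])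
        (use that lin_closed[OF \<pi>] lin_closed[OF \<iota>] co\<pi> co\<iota> opL in auto)
    have 2: "\<pi> b = \<zero>\<^bsub>ds I\<^esub>" if "b \<in> carrier (ds L)" "\<forall>i\<in>elts I. co b (opair elts i u) = \<zero>\<^bsub>K\<^esub>" for b
      by (rule ds_eqI[where I = I]) (use that lin_closed[OF \<pi>] co\<pi> in auto)
    show ?thesis
      using \<pi> \<iota> 1 2 co\<iota> by (intro exI[of _ \<pi>] exI[of _ \<iota>]) auto
  qed
  obtain \<pi> \<iota> where \<pi>: "lin (ds L) (ds I) \<pi>" and \<iota>: "lin (ds I) (ds L) \<iota>"
    and 1: "\<And>a. a \<in> carrier (ds I) \<Longrightarrow> \<pi> (\<iota> a) = a"
      "\<And>b. b \<in> carrier (ds L) \<Longrightarrow> (\<And>i. i \<in> elts I \<Longrightarrow> co b (opair elts i \<zero>\<^bsub>K\<^esub>) = \<zero>\<^bsub>K\<^esub>) \<Longrightarrow> \<pi> b = \<zero>\<^bsub>ds I\<^esub>"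
      "\<And>a i w. a \<in> carrier (ds I) \<Longrightarrow> opair elts i w \<in> elts L \<Longrightarrow> w \<noteq> \<zero>\<^bsub>K\<^esub> \<Longrightarrow> co (\<iota> a) (opair elts i w) = \<zero>\<^bsub>K\<^esub>"
    using *[of "\<zero>\<^bsub>K\<^esub>" I I J] L by (metis Un_upper1 insertI1)
  obtain \<pi>' \<iota>' where \<pi>': "lin (ds L) (ds J) \<pi>'" and \<iota>': "lin (ds J) (ds L) \<iota>'"
    and 2: "\<And>a. a \<in> carrier (ds J) \<Longrightarrow> \<pi>' (\<iota>' a) = a"
      "\<And>b. b \<in> carrier (ds L) \<Longrightarrow> (\<And>i. i \<in> elts J \<Longrightarrow> co b (opair elts i \<one>\<^bsub>K\<^esub>) = \<zero>\<^bsub>K\<^esub>) \<Longrightarrow> \<pi>' b = \<zero>\<^bsub>ds J\<^esub>"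
      "\<And>a i w. a \<in> carrier (ds J) \<Longrightarrow> opair elts i w \<in> elts L \<Longrightarrow> w \<noteq> \<one>\<^bsub>K\<^esub> \<Longrightarrow> co (\<iota>' a) (opair elts i w) = \<zero>\<^bsub>K\<^esub>"
    using *[of "\<one>\<^bsub>K\<^esub>" J I J] L by (metis Un_upper2 insertI1 insertI2)
  have z: "\<pi>' (\<iota> a) = \<zero>\<^bsub>ds J\<^esub>" if "a \<in> carrier (ds I)" for a
    by (rule 2(2)) (use that lin_closed[OF \<iota>] 1(3) L in auto)
  have z': "\<pi> (\<iota>' a) = \<zero>\<^bsub>ds I\<^esub>" if "a \<in> carrier (ds J)" for a
    by (rule 1(2)) (use that lin_closed[OF \<iota>'] 2(3) L in auto)
  have "bounded_by L P"
    unfolding bounded_by_def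
  proof (intro allI impI)
    fix V x
    assume V: "sp V" and x: "x \<in> el P V"
    note px = nt_closed[OF p V x] and qx = nt_closed[OF q V x]
    obtain g f where gf: "lin V (ds I) g" "lin (ds I) V f" "act A V V (\<lambda>v. f (g v)) (p V x) = p V x"
      using I V px unfolding bounded_by_def by blast
    obtain g' f' where gf': "lin V (ds J) g'" "lin (ds J) V f'" "act B V V (\<lambda>v. f' (g' v)) (q V x) = q V x"
      using J V qx unfolding bounded_by_def by blast
    \<comment> \<open>On the copy of \<open>ds I\<close> this is f and on the copy of
      \<open>ds J\<close> it is f', because each projection kills the other copy.\<close>
    define h where "h b = f (\<pi> b) \<oplus>\<^bsub>V\<^esub> f' (\<pi>' b)" for b
    have h: "lin (ds L) V h"
      unfolding h_def using lin_plus[OF V lin_comp[OF \<pi> gf(2)] lin_comp[OF \<pi>' gf'(2)]] .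
    obtain k where k: "lin V (ds L) k" "\<And>a. a \<in> carrier (ds L) \<Longrightarrow> h (k (h a)) = h a"
      using generalized_inverse[OF sp_ds V h] by blast
    have hf: "h (\<iota> a) = f a" if "a \<in> carrier (ds I)" for a
      using that V 1(1) z lin_closed[OF gf(2)] lin_zero[OF sp_ds V gf'(2)] by (simp add: h_def)
    have hf': "h (\<iota>' a) = f' a" if "a \<in> carrier (ds J)" for a
      using that V 2(1) z' lin_closed[OF gf'(2)] lin_zero[OF sp_ds V gf(2)] by (simp add: h_def)
    have hk: "lin V V (\<lambda>v. h (k v))"
      using k(1) h by (rule lin_comp)
    have "act A V V (\<lambda>v. h (k v)) (p V x) = act A V V (\<lambda>v. h (k (f (g v)))) (p V x)"
      using act_comp[OF A V V V lin_comp[OF gf(1,2)] hk px] gf(3) by simp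
    also have "\<dots> = act A V V (\<lambda>v. f (g v)) (p V x)"
    proof (rule act_cong[OF A])
      fix v
      assume "v \<in> carrier V"
      then have gv: "g v \<in> carrier (ds I)"
        by (rule lin_closed[OF gf(1)])
      show "h (k (f (g v))) = f (g v)"
        using k(2)[of "\<iota> (g v)"] hf[OF gv] lin_closed[OF \<iota> gv] by simp
    qed
    finally have pe: "p V (act P V V (\<lambda>v. h (k v)) x) = p V x"
      using nt_nat[OF p V V hk x] gf(3) by simp
    have "act B V V (\<lambda>v. h (k v)) (q V x) = act B V V (\<lambda>v. h (k (f' (g' v)))) (q V x)"
      using act_comp[OF B V V V lin_comp[OF gf'(1,2)] hk qx] gf'(3) by simp
    also have "\<dots> = act B V V (\<lambda>v. f' (g' v)) (q V x)"
    proof (rule act_cong[OF B])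
      fix v
      assume "v \<in> carrier V"
      then have gv: "g' v \<in> carrier (ds J)"
        by (rule lin_closed[OF gf'(1)])
      show "h (k (f' (g' v))) = f' (g' v)"
        using k(2)[of "\<iota>' (g' v)"] hf'[OF gv] lin_closed[OF \<iota>' gv] by simp
    qed
    finally have qe: "q V (act P V V (\<lambda>v. h (k v)) x) = q V x"
      using nt_nat[OF q V V hk x] gf'(3) by simp
    have "act P V V (\<lambda>v. h (k v)) x = x"
      using joint[OF V _ x pe qe] P V hk x by simp
    then show "\<exists>g f. lin V (ds L) g \<and> lin (ds L) V f \<and> act P V V (\<lambda>v. f (g v)) x = x"
      using h k(1) by blast
  qed
  then show ?thesis
    by (auto simp: bdd_def)
qed

text \<open>Hilbert's hotel: a shift along an infinite set of coordinates with value \<open>h\<close> fixes the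
  element but changes its sum by \<open>h\<close>.\<close>

lemma torsion_free_finite_fibres:
  assumes X: "X \<in> Obj LE" and tf: "torsion_free X" and x: "x \<in> el X (ds I)"
    and h: "h \<noteq> \<zero>\<^bsub>FObj X gr\<^esub>"
  shows "finite {i \<in> elts I. act X (ds I) gr (\<lambda>a. co a i) x = h}" (is "finite ?N")
proof (rule ccontr)
  assume "infinite ?N"
  then obtain e :: "nat \<Rightarrow> 'u" where e: "inj e" "range e \<subseteq> ?N"
    using infinite_countable_subset by blast
  define R where "R = range e"
  \<comment> \<open>The shift from e n to e (n + 1). Outside the range of e the value is arbitrary
    and gets masked by \<open>chi R\<close>.\<close>
  define s where "s i = e (Suc (inv_into UNIV e i))" for i
  have eI: "e n \<in> elts I" and eh: "act X (ds I) gr (\<lambda>a. co a (e n)) x = h" for n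
    using e(2) by auto
  have se: "s (e n) = e (Suc n)" for n
    by (simp add: s_def inv_f_f[OF e(1)])
  have e_eq: "e m = e n \<longleftrightarrow> m = n" for m n
    using e(1) by (auto simp: inj_eq)
  \<comment> \<open>Both maps discard the coordinates outside R. On R, q keeps them and t reads the
    next one; since all coordinates of x on R equal h, the two maps agree on x.\<close>
  define q where "q = pull I (chi R) (\<lambda>i. i)"
  define t where "t = pull I (chi R) s"
  have q: "lin (ds I) (ds I) q"
    unfolding q_def by (rule lin_pull_chi) auto
  have t: "lin (ds I) (ds I) t"
    unfolding t_def by (rule lin_pull_chi) (auto simp: R_def se eI inj_on_def e_eq)
  have coq: "co (q a) i = (if i \<in> R then co a i else \<zero>\<^bsub>K\<^esub>)" if "i \<in> elts I" "a \<in> carrier (ds I)" for a i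
    unfolding q_def using that by (intro co_pull_chi[where J = I]) auto
  have cot: "co (t a) i = (if i \<in> R then co a (s i) else \<zero>\<^bsub>K\<^esub>)" if "i \<in> elts I" "a \<in> carrier (ds I)" for a i
    unfolding t_def using that by (intro co_pull_chi[where J = I]) (auto simp: R_def se eI)
  have lco: "lin (ds I) gr (\<lambda>a. co a (e 0))"
    using eI by (rule lin_co)
  interpret XK: module K "FObj X gr"
    using X by (intro sp_module) simp
  have "act X (ds I) (ds I) q x = act X (ds I) (ds I) t x"
  proof (rule torsion_free_eqI[OF X tf])
    fix i
    assume i: "i \<in> elts I"
    have "act X (ds I) gr (\<lambda>a. co (q a) i) x = act X (ds I) gr (\<lambda>a. co (t a) i) x"
    proof (cases "i \<in> R")
      case True
      then obtain n where n: "i = e n"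
        by (auto simp: R_def)
      have "act X (ds I) gr (\<lambda>a. co (q a) i) x = act X (ds I) gr (\<lambda>a. co a (e n)) x"
        using True n i by (intro act_cong[OF X]) (simp add: coq)
      also have "\<dots> = act X (ds I) gr (\<lambda>a. co a (e (Suc n))) x"
        by (simp add: eh)
      also have "\<dots> = act X (ds I) gr (\<lambda>a. co (t a) i) x"
        using True n i by (intro act_cong[OF X]) (simp add: cot se)
      finally show ?thesis .
    next
      case False
      then show ?thesis
        using i by (intro act_cong[OF X]) (simp add: coq cot)
    qed
    then show "act X (ds I) gr (\<lambda>a. co a i) (act X (ds I) (ds I) q x) =
      act X (ds I) gr (\<lambda>a. co a i) (act X (ds I) (ds I) t x)"
      using act_comp[OF X sp_ds sp_ds sp_ground q lin_co[OF i] x]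
        act_comp[OF X sp_ds sp_ds sp_ground t lin_co[OF i] x] by simp
  qed (use X q t x in auto)
  then have e1: "act X (ds I) gr (\<lambda>a. sumf I (q a)) x = act X (ds I) gr (\<lambda>a. sumf I (t a)) x"
    using act_comp[OF X sp_ds sp_ds sp_ground q lin_sumf x]
      act_comp[OF X sp_ds sp_ds sp_ground t lin_sumf x] by simp
  \<comment> \<open>As functionals, the sum after q exceeds the sum after t by exactly the
    coordinate at e 0, which the shift loses. Its value on x is h.\<close>
  have e2: "act X (ds I) gr (\<lambda>a. sumf I (q a)) x =
      act X (ds I) gr (\<lambda>a. sumf I (t a) \<oplus>\<^bsub>gr\<^esub> co a (e 0)) x"
  proof (rule act_cong[OF X])
    fix a
    assume a: "a \<in> carrier (ds I)"
    show "sumf I (q a) = sumf I (t a) \<oplus>\<^bsub>gr\<^esub> co a (e 0)"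
    proof (rule lin_ds_eqI[OF sp_ground lin_comp[OF q lin_sumf] lin_plus[OF sp_ground lin_comp[OF t lin_sumf] lco] _ a])
      fix i
      assume i: "i \<in> elts I"
      have z: "sumf I \<zero>\<^bsub>ds I\<^esub> = \<zero>\<^bsub>K\<^esub>"
        using lin_zero[OF sp_ds sp_ground lin_sumf] by simp
      have qe: "q (bv I i) = (if i \<in> R then bv I i else \<zero>\<^bsub>ds I\<^esub>)"
        by (rule ds_eqI[where I = I]) (use i lin_closed[OF q] in \<open>auto simp: coq\<close>)
      \<comment> \<open>On basis vectors t is the backward shift: e (n + 1) goes to e n, and the
        vector at e 0 is killed. The truncated subtraction is harmless because e 0 is
        excluded.\<close>
      have te: "t (bv I i) = (if i \<in> R \<and> i \<noteq> e 0 then bv I (e (inv_into UNIV e i - 1)) else \<zero>\<^bsub>ds I\<^esub>)"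
      proof (rule ds_eqI[where I = I])
        show "t (bv I i) \<in> carrier (ds I)"
          using lin_closed[OF t] by simp
        fix j
        assume j: "j \<in> elts I"
        show "co (t (bv I i)) j = co (if i \<in> R \<and> i \<noteq> e 0 then bv I (e (inv_into UNIV e i - 1)) else \<zero>\<^bsub>ds I\<^esub>) j"
        proof (cases "j \<in> R")
          case True
          then obtain n where n: "j = e n"
            by (auto simp: R_def)
          have "(e (Suc n) = i) \<longleftrightarrow> i \<in> R \<and> i \<noteq> e 0 \<and> j = e (inv_into UNIV e i - 1)"
            unfolding n R_def using e(1) by (auto simp: e_eq inv_f_f gr0_conv_Suc elim: not0_implies_Suc)
          then show ?thesis
            using True n j eI by (auto simp: cot se)
        next
          case False
          then have "j \<noteq> e n" for n
            by (auto simp: R_def)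
          then show ?thesis
            using False j by (auto simp: cot)
        qed
      qed auto
      have "e 0 \<in> R"
        by (simp add: R_def)
      then show "sumf I (q (bv I i)) = sumf I (t (bv I i)) \<oplus>\<^bsub>gr\<^esub> co (bv I i) (e 0)"
        unfolding qe te using i eI z by (auto simp: sumf_bv)
    qed
  qed
  have e3: "act X (ds I) gr (\<lambda>a. sumf I (t a) \<oplus>\<^bsub>gr\<^esub> co a (e 0)) x =
      act X (ds I) gr (\<lambda>a. sumf I (t a)) x \<oplus>\<^bsub>FObj X gr\<^esub> h"
    using act_plus[OF X sp_ds sp_ground lin_comp[OF t lin_sumf] lco x] eh by simp
  have c: "act X (ds I) gr (\<lambda>a. sumf I (t a)) x \<in> el X gr"
    using X x lin_comp[OF t lin_sumf] by simp
  have hX: "h \<in> el X gr"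
    using act_closed[OF X sp_ds sp_ground lco x] by (simp add: eh)
  have "h \<oplus>\<^bsub>FObj X gr\<^esub> act X (ds I) gr (\<lambda>a. sumf I (t a)) x = act X (ds I) gr (\<lambda>a. sumf I (t a)) x"
    using trans[OF trans[OF e1[symmetric] e2] e3] XK.a_comm[OF c hX] by simp
  then have "h = \<zero>\<^bsub>FObj X gr\<^esub>"
    using sp_add_minus(3)[OF sp_FObj[OF X sp_ground] hX c] X c by simp
  with h show False ..
qed

text \<open>In a torsion-free functor only the coordinates with nonzero value matter. Each such
  value is taken finitely often, so these coordinates embed into the product of X(k) with an
  infinite small set, which depends neither on the element nor on its space. Nontriviality of the
  universe provides that infinite set.\<close>

lemma torsion_free_bdd:
  assumes X: "X \<in> Obj LE" and tf: "torsion_free X"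
  shows "bdd X"
proof -
  obtain \<Omega> where \<Omega>: "infinite (elts \<Omega>)"
    using nontrivial by blast
  define A where "A = set_code elts (otimes (el X gr) (elts \<Omega>))"
  have A: "elts A = otimes (el X gr) (elts \<Omega>)"
    unfolding A_def using X by (intro elts_set_code small_otimes sp_small) auto
  have "bounded_by A X"
    unfolding bounded_by_def
  proof (intro allI impI)
    fix V x
    assume V: "sp V" and x: "x \<in> el X V"
    obtain I \<alpha> \<beta> where \<alpha>: "lin V (ds I) \<alpha>" and \<beta>: "lin (ds I) V \<beta>" and \<beta>\<alpha>: "\<And>v. v \<in> carrier V \<Longrightarrow> \<beta> (\<alpha> v) = v"
      using retract_of_ds[OF V sp_small[OF V], of "\<lambda>v. v"] by (metis image_ident inj_on_id2 order_refl)
    define a where "a = act X V (ds I) \<alpha> x"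
    have a: "a \<in> el X (ds I)"
      unfolding a_def using X V \<alpha> x by simp
    define h where "h i = act X (ds I) gr (\<lambda>a. co a i) a" for i
    have hX: "h i \<in> el X gr" if "i \<in> elts I" for i
      using X a lin_co[OF that] by (simp add: h_def)
    define D where "D = {i \<in> elts I. h i \<noteq> \<zero>\<^bsub>FObj X gr\<^esub>}"
    have "\<forall>c\<in>{c. c \<noteq> \<zero>\<^bsub>FObj X gr\<^esub>}.
      \<exists>j. inj_on j {i \<in> elts I. h i = c} \<and> j ` {i \<in> elts I. h i = c} \<subseteq> elts \<Omega>"
    proof
      fix c
      assume "c \<in> {c. c \<noteq> \<zero>\<^bsub>FObj X gr\<^esub>}"
      then have c: "c \<noteq> \<zero>\<^bsub>FObj X gr\<^esub>"
        by simp
      have fin: "finite {i \<in> elts I. h i = c}"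
        unfolding h_def by (rule torsion_free_finite_fibres[OF X tf a c])
      obtain T where T: "T \<subseteq> elts \<Omega>" "finite T" "card T = card {i \<in> elts I. h i = c}"
        using infinite_arbitrarily_large[OF \<Omega>] by blast
      then obtain j where "bij_betw j {i \<in> elts I. h i = c} T"
        using finite_same_card_bij[OF fin] by metis
      then show "\<exists>j. inj_on j {i \<in> elts I. h i = c} \<and> j ` {i \<in> elts I. h i = c} \<subseteq> elts \<Omega>"
        using T(1) by (auto simp: bij_betw_def)
    qed
    from bchoice[OF this] obtain j where j: "\<And>c. c \<noteq> \<zero>\<^bsub>FObj X gr\<^esub> \<Longrightarrow> inj_on (j c) {i \<in> elts I. h i = c}"
      "\<And>c. c \<noteq> \<zero>\<^bsub>FObj X gr\<^esub> \<Longrightarrow> j c ` {i \<in> elts I. h i = c} \<subseteq> elts \<Omega>"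
      by blast
    \<comment> \<open>A coordinate is recorded by its value together with its place in the finite
      fibre over that value.\<close>
    define \<kappa> where "\<kappa> i = opair elts (h i) (j (h i) i)" for i
    have \<kappa>: "inj_on \<kappa> D"
    proof (rule inj_onI)
      fix i i'
      assume i: "i \<in> D" "i' \<in> D" "\<kappa> i = \<kappa> i'"
      then have "h i' = h i" "j (h i) i = j (h i) i'" "h i \<noteq> \<zero>\<^bsub>FObj X gr\<^esub>"
        by (auto simp: \<kappa>_def D_def)
      then show "i = i'"
        using inj_onD[OF j(1)[of "h i"], of i i'] i by (simp add: D_def)
    qed
    have \<kappa>A: "\<kappa> i \<in> elts A" if "i \<in> D" for i
      using that hX j(2)[of "h i"] by (auto simp: A \<kappa>_def D_def)
    \<comment> \<open>The coordinates in D are relabelled by \<kappa> and back again. The composite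
      m l erases the coordinates outside D, where those of a vanish anyway, and so fixes a.\<close>
    define l where "l = pull A (chi (\<kappa> ` D)) (the_inv_into D \<kappa>)"
    define m where "m = pull I (chi D) \<kappa>"
    have iI: "the_inv_into D \<kappa> (\<kappa> i) = i" if "i \<in> D" for i
      using the_inv_into_f_f[OF \<kappa> that] .
    have DI: "D \<subseteq> elts I"
      by (auto simp: D_def)
    have l: "lin (ds I) (ds A) l"
      unfolding l_def by (rule lin_pull_chi) (use iI DI in \<open>auto simp: inj_on_def\<close>)
    have m: "lin (ds A) (ds I) m"
      unfolding m_def by (rule lin_pull_chi) (use \<kappa>A \<kappa> in \<open>auto simp: inj_on_def\<close>)
    have ml: "co (m (l b)) i = (if i \<in> D then co b i else \<zero>\<^bsub>K\<^esub>)"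
      if "b \<in> carrier (ds I)" "i \<in> elts I" for b i
    proof -
      have "co (m (l b)) i = (if i \<in> D then co (l b) (\<kappa> i) else \<zero>\<^bsub>K\<^esub>)"
        unfolding m_def using that \<kappa>A lin_closed[OF l] by (intro co_pull_chi[where J = A]) auto
      moreover have "co (l b) (\<kappa> i) = co b i" if "i \<in> D"
      proof -
        have "co (l b) (\<kappa> i) = (if \<kappa> i \<in> \<kappa> ` D then co b (the_inv_into D \<kappa> (\<kappa> i)) else \<zero>\<^bsub>K\<^esub>)"
          unfolding l_def using \<open>b \<in> carrier (ds I)\<close> \<open>i \<in> elts I\<close> that \<kappa>A iI
          by (intro co_pull_chi[where J = I]) auto
        then show ?thesis
          using that iI by simp
      qed
      ultimately show ?thesis
        by simp
    qed
    have "act X (ds I) (ds I) (\<lambda>b. m (l b)) a = a"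
    proof (rule torsion_free_eqI[OF X tf])
      fix i
      assume i: "i \<in> elts I"
      have "act X (ds I) gr (\<lambda>a. co a i) (act X (ds I) (ds I) (\<lambda>b. m (l b)) a) =
          act X (ds I) gr (\<lambda>b. co (m (l b)) i) a"
        using act_comp[OF X sp_ds sp_ds sp_ground lin_comp[OF l m] lin_co[OF i] a] .
      also have "\<dots> = h i"
      proof (cases "i \<in> D")
        case True
        then show ?thesis
          unfolding h_def using i by (intro act_cong[OF X]) (simp add: ml)
      next
        case False
        then have "act X (ds I) gr (\<lambda>b. co (m (l b)) i) a = \<zero>\<^bsub>FObj X gr\<^esub>"
          using i by (intro act_zero_map[OF X sp_ds sp_ground a]) (simp add: ml)
        then show ?thesis
          using False i by (simp add: D_def)
      qed
      finally show "act X (ds I) gr (\<lambda>a. co a i) (act X (ds I) (ds I) (\<lambda>b. m (l b)) a) =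
          act X (ds I) gr (\<lambda>a. co a i) a"
        by (simp add: h_def)
    qed (use X a lin_comp[OF l m] in auto)
    moreover have "act X (ds I) V \<beta> a = x"
      unfolding a_def using X V \<alpha> \<beta> \<beta>\<alpha> x by (simp add: act_comp act_id)
    ultimately have "x = act X (ds I) V \<beta> (act X (ds I) (ds I) (\<lambda>b. m (l b)) a)"
      by simp
    also have "\<dots> = act X (ds I) V \<beta> (act X (ds A) (ds I) m (act X (ds I) (ds A) l a))"
      using act_comp[OF X sp_ds sp_ds sp_ds l m a] by simp
    also have "\<dots> = act X (ds A) V (\<lambda>b. \<beta> (m b)) (act X (ds I) (ds A) l a)"
      using X a l by (intro act_comp[OF X sp_ds sp_ds V m \<beta>]) simp
    finally show "\<exists>g f. lin V (ds A) g \<and> lin (ds A) V f \<and> act X V V (\<lambda>v. f (g v)) x = x"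
      using X a l by (intro fixed_of_source[OF X V lin_comp[OF m \<beta>]]) auto
  qed
  then show ?thesis
    by (auto simp: bdd_def)
qed

section \<open>Quotients and pullbacks\<close>

definition subfun :: "'u vfun \<Rightarrow> ('u space \<Rightarrow> 'u set) \<Rightarrow> bool"
  where "subfun X S \<longleftrightarrow> (\<forall>V. sp V \<longrightarrow> subsp (FObj X V) (S V)) \<and>
    (\<forall>V W f x. sp V \<longrightarrow> sp W \<longrightarrow> lin V W f \<longrightarrow> x \<in> S V \<longrightarrow> act X V W f x \<in> S W)"

text \<open>One representative is chosen per coset. The quotient thus consists of elements of M and
  is small as an image of M, with no coding of cosets.\<close>

definition cls :: "'u space \<Rightarrow> 'u set \<Rightarrow> 'u \<Rightarrow> 'u"
  where "cls M N x = (SOME y. y \<in> carrier M \<and> x \<ominus>\<^bsub>M\<^esub> y \<in> N)"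

context
  fixes M N
  assumes M: "sp M" and N: "subsp M N"
begin

lemma cls_mem: "x \<in> carrier M \<Longrightarrow> cls M N x \<in> carrier M"
  and cls_diff: "x \<in> carrier M \<Longrightarrow> x \<ominus>\<^bsub>M\<^esub> cls M N x \<in> N"
proof -
  assume x: "x \<in> carrier M"
  then have "\<exists>y. y \<in> carrier M \<and> x \<ominus>\<^bsub>M\<^esub> y \<in> N"
    using M subspD(2)[OF N] by (intro exI[of _ x]) simp
  from someI_ex[OF this] show "cls M N x \<in> carrier M" "x \<ominus>\<^bsub>M\<^esub> cls M N x \<in> N"
    by (auto simp: cls_def)
qed

lemma cls_eq_iff:
  assumes x: "x \<in> carrier M" and y: "y \<in> carrier M"
  shows "cls M N x = cls M N y \<longleftrightarrow> x \<ominus>\<^bsub>M\<^esub> y \<in> N"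
proof
  interpret M: module K M by (rule sp_module[OF M])
  have ac: "(a \<ominus>\<^bsub>M\<^esub> b) \<oplus>\<^bsub>M\<^esub> (b \<ominus>\<^bsub>M\<^esub> c) = a \<ominus>\<^bsub>M\<^esub> c" if "a \<in> carrier M" "b \<in> carrier M" "c \<in> carrier M" for a b c
    using that M by (simp add: M.minus_eq M.a_assoc M.r_neg1 M.r_neg2)
  have neg: "b \<ominus>\<^bsub>M\<^esub> a \<in> N" if "a \<in> carrier M" "b \<in> carrier M" "a \<ominus>\<^bsub>M\<^esub> b \<in> N" for a b
  proof -
    have "\<zero>\<^bsub>M\<^esub> \<ominus>\<^bsub>M\<^esub> (a \<ominus>\<^bsub>M\<^esub> b) \<in> N"
      using subsp_minus[OF M N subspD(2)[OF N] that(3)] .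
    moreover have "\<zero>\<^bsub>M\<^esub> \<ominus>\<^bsub>M\<^esub> (a \<ominus>\<^bsub>M\<^esub> b) = b \<ominus>\<^bsub>M\<^esub> a"
      using that by (simp add: M.minus_eq M.minus_add M.a_comm)
    ultimately show ?thesis
      by simp
  qed
  {
    assume "cls M N x = cls M N y"
    then have "(x \<ominus>\<^bsub>M\<^esub> cls M N x) \<oplus>\<^bsub>M\<^esub> (cls M N x \<ominus>\<^bsub>M\<^esub> y) \<in> N"
      using x y cls_diff neg cls_mem by (metis subspD(3)[OF N])
    then show "x \<ominus>\<^bsub>M\<^esub> y \<in> N"
      using ac x y cls_mem by simp
  next
    assume xy: "x \<ominus>\<^bsub>M\<^esub> y \<in> N"
    have "x \<ominus>\<^bsub>M\<^esub> z \<in> N \<longleftrightarrow> y \<ominus>\<^bsub>M\<^esub> z \<in> N" if z: "z \<in> carrier M" for z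
      using ac[OF x y z] ac[OF y x z] xy neg[OF x y xy] subspD(3)[OF N] by metis
    then have "(\<lambda>z. z \<in> carrier M \<and> x \<ominus>\<^bsub>M\<^esub> z \<in> N) = (\<lambda>z. z \<in> carrier M \<and> y \<ominus>\<^bsub>M\<^esub> z \<in> N)"
      by auto
    \<comment> \<open>The choice sees x only through this predicate, so congruent elements receive
      the same representative.\<close>
    then show "cls M N x = cls M N y"
      by (simp add: cls_def)
  }
qed

lemma cls_add: 
  assumes "x \<in> carrier M" "y \<in> carrier M"
  shows "cls M N (cls M N x \<oplus>\<^bsub>M\<^esub> cls M N y) = cls M N (x \<oplus>\<^bsub>M\<^esub> y)"
proof -
  have "(x \<oplus>\<^bsub>M\<^esub> y) \<ominus>\<^bsub>M\<^esub> (cls M N x \<oplus>\<^bsub>M\<^esub> cls M N y) \<in> N"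
    using assms M cls_mem cls_diff subspD(3)[OF N] by (simp add: sp_minus_add_distrib)
  then show ?thesis
    using cls_eq_iff[of "x \<oplus>\<^bsub>M\<^esub> y" "cls M N x \<oplus>\<^bsub>M\<^esub> cls M N y"] assms M cls_mem by simp
qed

lemma cls_smult:
  assumes "c \<in> carrier K" "x \<in> carrier M"
  shows "cls M N (c \<odot>\<^bsub>M\<^esub> cls M N x) = cls M N (c \<odot>\<^bsub>M\<^esub> x)"
proof -
  have "c \<odot>\<^bsub>M\<^esub> x \<ominus>\<^bsub>M\<^esub> c \<odot>\<^bsub>M\<^esub> cls M N x \<in> N"
    using assms M cls_mem cls_diff subspD(4)[OF N] by (simp flip: sp_smult_minus)
  then show ?thesis
    using cls_eq_iff[of "c \<odot>\<^bsub>M\<^esub> x" "c \<odot>\<^bsub>M\<^esub> cls M N x"] assms M cls_mem by simp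
qed

end

section \<open>Quotient functors and their universal property\<close>

definition quot :: "'u space \<Rightarrow> 'u set \<Rightarrow> 'u space"
  where "quot M N = mk_space (cls M N ` carrier M) (cls M N \<zero>\<^bsub>M\<^esub>)
    (\<lambda>x y. cls M N (x \<oplus>\<^bsub>M\<^esub> y)) (carrier K) (\<lambda>c x. cls M N (c \<odot>\<^bsub>M\<^esub> x))"

lemma quot:
  assumes M: "sp M" and N: "subsp M N"
  shows "sp (quot M N)" and "lin M (quot M N) (cls M N)"
proof -
  have "module K (quot M N)"
    by (rule module_image[OF sp_module[OF M], where q = "cls M N"])
      (use cls_add[OF M N] cls_smult[OF M N] in \<open>auto simp: quot_def\<close>)
  moreover have "small elts (cls M N ` carrier M)"
    using sp_small[OF M] by (rule small_image)
  ultimately show "sp (quot M N)"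
    unfolding quot_def by (rule sp_mk_space)
  show "lin M (quot M N) (cls M N)"
    using cls_add[OF M N] cls_smult[OF M N] by (auto simp: lin_def quot_def)
qed

lemma quotient_functor:
  assumes X: "X \<in> Obj LE" and S: "subfun X S"
  obtains Q q where "Q \<in> Obj LE" "nt X Q q"
    "\<And>V y. sp V \<Longrightarrow> y \<in> el Q V \<Longrightarrow> \<exists>x\<in>el X V. q V x = y"
    "\<And>V x. sp V \<Longrightarrow> x \<in> el X V \<Longrightarrow> q V x = \<zero>\<^bsub>FObj Q V\<^esub> \<longleftrightarrow> x \<in> S V"
proof -
  define Fo where "Fo V = quot (FObj X V) (S V)" for V
  define c where "c V = cls (FObj X V) (S V)" for V
  define Fa where "Fa V W f x = c W (act X V W f x)" for V W f x
  have sX: "sp (FObj X V)" and sS: "subsp (FObj X V) (S V)" if "sp V" for V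
    using X S that by (auto simp: subfun_def)
  have Fo: "sp (Fo V)" and cl: "lin (FObj X V) (Fo V) (c V)" if "sp V" for V
    unfolding Fo_def c_def using quot[OF sX[OF that] sS[OF that]] by auto
  have car: "carrier (Fo V) = c V ` el X V" for V
    by (simp add: Fo_def c_def quot_def)
  have cm: "c V x \<in> el X V" and ceq: "y \<in> el X V \<Longrightarrow> c V x = c V y \<longleftrightarrow> x \<ominus>\<^bsub>FObj X V\<^esub> y \<in> S V"
    and cdiff: "x \<ominus>\<^bsub>FObj X V\<^esub> c V x \<in> S V"
    if "sp V" "x \<in> el X V" for V x y
    unfolding c_def using cls_mem[OF sX sS] cls_eq_iff[OF sX sS] cls_diff[OF sX sS] that by auto
  \<comment> \<open>Independence of the representative, from stability of S under the action. It
    reduces each functor law for the quotient to the same law for X.\<close>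
  have Fac: "Fa V W f (c V x) = c W (act X V W f x)"
    if VW: "sp V" "sp W" and f: "lin V W f" and x: "x \<in> el X V" for V W f x
  proof -
    have "act X V W f (x \<ominus>\<^bsub>FObj X V\<^esub> c V x) \<in> S W"
      using S VW f cdiff[OF VW(1) x] by (simp add: subfun_def)
    then have "c W (act X V W f x) = c W (act X V W f (c V x))"
      using X VW f x cm by (simp add: ceq act_minus)
    then show ?thesis
      by (simp add: Fa_def)
  qed
  have Fal: "lin (Fo V) (Fo W) (Fa V W f)" if VW: "sp V" "sp W" and f: "lin V W f" for V W f
  proof (rule linI)
    show "Fa V W f x \<in> carrier (Fo W)" if "x \<in> carrier (Fo V)" for x
      using that X VW f by (auto simp: car Fac)
    show "Fa V W f (x \<oplus>\<^bsub>Fo V\<^esub> y) = Fa V W f x \<oplus>\<^bsub>Fo W\<^esub> Fa V W f y"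
      if "x \<in> carrier (Fo V)" "y \<in> carrier (Fo V)" for x y
      using that X VW f sX by (auto simp: car Fac act_add simp flip: lin_add[OF cl])
    show "Fa V W f (d \<odot>\<^bsub>Fo V\<^esub> x) = d \<odot>\<^bsub>Fo W\<^esub> Fa V W f x"
      if "d \<in> carrier K" "x \<in> carrier (Fo V)" for d x
      using that X VW f sX by (auto simp: car Fac act_smult simp flip: lin_smult[OF cl])
  qed
  have hyps: "mk_fun Fo Fa \<in> Obj LE"
    "\<And>V. sp V \<Longrightarrow> FObj (mk_fun Fo Fa) V = Fo V"
    "\<And>V W f x. sp V \<Longrightarrow> sp W \<Longrightarrow> lin V W f \<Longrightarrow> x \<in> carrier (Fo V) \<Longrightarrow> act (mk_fun Fo Fa) V W f x = Fa V W f x"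
  proof -
    have 1: "Fa V W f x = Fa V W g x" if "\<And>v. v \<in> carrier V \<Longrightarrow> f v = g v" for V W f g x
      unfolding Fa_def using act_cong[OF X that] by simp
    have 2: "Fa V V (\<lambda>v. v) x = x" if "sp V" "x \<in> carrier (Fo V)" for V x
      using that X by (auto simp: car Fac lin_id act_id)
    have 3: "Fa V U (\<lambda>v. g (f v)) x = Fa W U g (Fa V W f x)"
      if "sp V" "sp W" "sp U" "lin V W f" "lin W U g" "x \<in> carrier (Fo V)" for V W U f g x
      using that X act_comp[OF X that(1-5)] lin_comp[OF that(4,5)] by (auto simp: car Fac)
    have 4: "Fa V W (\<lambda>v. f v \<oplus>\<^bsub>W\<^esub> g v) x = Fa V W f x \<oplus>\<^bsub>Fo W\<^esub> Fa V W g x"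
      if "sp V" "sp W" "lin V W f" "lin V W g" "x \<in> carrier (Fo V)" for V W f g x
      using that X by (auto simp: car Fac act_plus lin_plus simp flip: lin_add[OF cl])
    have 5: "Fa V W (\<lambda>v. d \<odot>\<^bsub>W\<^esub> f v) x = d \<odot>\<^bsub>Fo W\<^esub> Fa V W f x"
      if "sp V" "sp W" "lin V W f" "d \<in> carrier K" "x \<in> carrier (Fo V)" for V W f d x
      using that X by (auto simp: car Fac act_scale lin_scale simp flip: lin_smult[OF cl])
    note F = mk_fun[of Fo Fa, OF Fo Fal 1 2 3 4 5]
    show "mk_fun Fo Fa \<in> Obj LE"
      by (rule F(1))
    show "FObj (mk_fun Fo Fa) V = Fo V" if "sp V" for V
      using that by (simp add: mk_fun_def)
    show "act (mk_fun Fo Fa) V W f x = Fa V W f x"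
      if "sp V" "sp W" "lin V W f" "x \<in> carrier (Fo V)" for V W f x
      by (rule F(3), (assumption | fact that)+)
  qed
  show ?thesis
  proof (rule that[OF hyps(1), of c])
    show "nt X (mk_fun Fo Fa) c"
      by (rule ntI) (use X cl in \<open>auto simp: hyps Fac car\<close>)
    show "\<exists>x\<in>el X V. c V x = y" if "sp V" "y \<in> el (mk_fun Fo Fa) V" for V y
      using that by (auto simp: hyps car)
    show "c V x = \<zero>\<^bsub>FObj (mk_fun Fo Fa) V\<^esub> \<longleftrightarrow> x \<in> S V" if "sp V" "x \<in> el X V" for V x
    proof -
      have "\<zero>\<^bsub>FObj (mk_fun Fo Fa) V\<^esub> = c V \<zero>\<^bsub>FObj X V\<^esub>"
        using that(1) lin_zero[OF sX Fo cl] by (simp add: hyps)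
      then show ?thesis
        using that X sX by (simp add: ceq)
    qed
  qed
qed

text \<open>The pairs (q x, t x) form the graph of the induced map; the condition on kernels is
  single-valuedness at zero.\<close>

lemma quotient_universal:
  assumes X: "X \<in> Obj LE" and Q: "Q \<in> Obj LE" and Z: "Z \<in> Obj LE"
    and q: "nt X Q q" and surj: "\<And>V y. sp V \<Longrightarrow> y \<in> el Q V \<Longrightarrow> \<exists>x\<in>el X V. q V x = y"
    and t: "nt X Z t" and ker: "\<And>V x. sp V \<Longrightarrow> x \<in> el X V \<Longrightarrow> q V x = \<zero>\<^bsub>FObj Q V\<^esub> \<Longrightarrow> t V x = \<zero>\<^bsub>FObj Z V\<^esub>"
  obtains u where "nt Q Z u" "\<And>V x. sp V \<Longrightarrow> x \<in> el X V \<Longrightarrow> u V (q V x) = t V x"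
proof -
  define R where "R V y z \<longleftrightarrow> (\<exists>x\<in>el X V. y = q V x \<and> z = t V x)" for V y z
  have RI: "R V (q V x) (t V x)" if "x \<in> el X V" for V x
    using that by (auto simp: R_def)
  have RE: "\<exists>x\<in>el X V. y = q V x \<and> z = t V x" if "R V y z" for V y z
    using that by (auto simp: R_def)
  have "\<exists>u. nt Q Z u \<and> (\<forall>V y z. sp V \<longrightarrow> (R V y z \<longleftrightarrow> y \<in> el Q V \<and> z = u V y))"
  proof (rule nt_of_rel[OF Q Z, of R])
    show "y \<in> el Q V \<and> z \<in> el Z V" if "sp V" "R V y z" for V y z
      using RE[OF that(2)] that(1) nt_closed[OF q] nt_closed[OF t] by auto
    show "\<exists>z. R V y z" if "sp V" "y \<in> el Q V" for V y
      using surj[OF that] RI by blast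
    show "z = \<zero>\<^bsub>FObj Z V\<^esub>" if "sp V" "R V \<zero>\<^bsub>FObj Q V\<^esub> z" for V z
      using RE[OF that(2)] ker[OF that(1)] by metis
    show "R V (y \<oplus>\<^bsub>FObj Q V\<^esub> y') (z \<oplus>\<^bsub>FObj Z V\<^esub> z')" if V: "sp V" and "R V y z" "R V y' z'" for V y z y' z'
    proof -
      obtain x x' where x: "x \<in> el X V" "y = q V x" "z = t V x" "x' \<in> el X V" "y' = q V x'" "z' = t V x'"
        using RE[OF \<open>R V y z\<close>] RE[OF \<open>R V y' z'\<close>] by blast
      then show ?thesis
        using RI[of "x \<oplus>\<^bsub>FObj X V\<^esub> x'" V] V X by (simp add: nt_add[OF q] nt_add[OF t])
    qed
    show "R V (d \<odot>\<^bsub>FObj Q V\<^esub> y) (d \<odot>\<^bsub>FObj Z V\<^esub> z)" if V: "sp V" and d: "d \<in> carrier K" and "R V y z" for V d y z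
    proof -
      obtain x where x: "x \<in> el X V" "y = q V x" "z = t V x"
        using RE[OF \<open>R V y z\<close>] by blast
      then show ?thesis
        using RI[of "d \<odot>\<^bsub>FObj X V\<^esub> x" V] V X d by (simp add: nt_smult[OF q] nt_smult[OF t])
    qed
    show "R W (act Q V W f y) (act Z V W f z)" if V: "sp V" "sp W" "lin V W f" and "R V y z" for V W f y z
    proof -
      obtain x where x: "x \<in> el X V" "y = q V x" "z = t V x"
        using RE[OF \<open>R V y z\<close>] by blast
      then show ?thesis
        using RI[of "act X V W f x" W] V X by (simp add: nt_nat[OF q] nt_nat[OF t])
    qed
  qed
  then obtain u where u: "nt Q Z u" "\<And>V y z. sp V \<Longrightarrow> R V y z \<longleftrightarrow> y \<in> el Q V \<and> z = u V y"
    by blast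
  have "u V (q V x) = t V x" if "sp V" "x \<in> el X V" for V x
    using u(2)[OF that(1), of "q V x" "t V x"] RI[OF that(2)] by simp
  then show ?thesis
    using that u(1) by blast
qed

text \<open>Pairs with equal image in C, formed at each space separately. The conclusion records
  existence and joint injectivity on elements in place of a universal property, since maps into P
  are later built from relations and the bound on P comes from \<open>bdd_pair\<close>.\<close>

lemma pullback_functor:
  assumes A: "A \<in> Obj LE" and B: "B \<in> Obj LE" and C: "C \<in> Obj LE"
    and s: "nt A C s" and t: "nt B C t"
  obtains P p q where "P \<in> Obj LE" "nt P A p" "nt P B q"
    "\<And>V x. sp V \<Longrightarrow> x \<in> el P V \<Longrightarrow> s V (p V x) = t V (q V x)"
    "\<And>V x y. sp V \<Longrightarrow> x \<in> el P V \<Longrightarrow> y \<in> el P V \<Longrightarrow> p V x = p V y \<Longrightarrow> q V x = q V y \<Longrightarrow> x = y"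
    "\<And>V a b. sp V \<Longrightarrow> a \<in> el A V \<Longrightarrow> b \<in> el B V \<Longrightarrow> s V a = t V b \<Longrightarrow> \<exists>x\<in>el P V. p V x = a \<and> q V x = b"
proof -
  define Fo where "Fo V = mk_space {opair elts a b | a b. a \<in> el A V \<and> b \<in> el B V \<and> s V a = t V b}
    (opair elts \<zero>\<^bsub>FObj A V\<^esub> \<zero>\<^bsub>FObj B V\<^esub>)
    (\<lambda>x y. opair elts (ofst x \<oplus>\<^bsub>FObj A V\<^esub> ofst y) (osnd x \<oplus>\<^bsub>FObj B V\<^esub> osnd y)) (carrier K)
    (\<lambda>c x. opair elts (c \<odot>\<^bsub>FObj A V\<^esub> ofst x) (c \<odot>\<^bsub>FObj B V\<^esub> osnd x))" for V
  define Fa where "Fa V W f x = opair elts (act A V W f (ofst x)) (act B V W f (osnd x))" for V W f x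
  have mem: "opair elts a b \<in> carrier (Fo V) \<longleftrightarrow> a \<in> el A V \<and> b \<in> el B V \<and> s V a = t V b" for V a b
    by (auto simp: Fo_def)
  have memE: "\<exists>a b. x = opair elts a b \<and> a \<in> el A V \<and> b \<in> el B V \<and> s V a = t V b" if "x \<in> carrier (Fo V)" for V x
    using that by (auto simp: Fo_def)
  have addF: "opair elts a b \<oplus>\<^bsub>Fo V\<^esub> opair elts a' b' = opair elts (a \<oplus>\<^bsub>FObj A V\<^esub> a') (b \<oplus>\<^bsub>FObj B V\<^esub> b')"
    if "opair elts a b \<in> carrier (Fo V)" "opair elts a' b' \<in> carrier (Fo V)" for V a b a' b'
    using that unfolding Fo_def by simp
  have smultF: "c \<odot>\<^bsub>Fo V\<^esub> opair elts a b = opair elts (c \<odot>\<^bsub>FObj A V\<^esub> a) (c \<odot>\<^bsub>FObj B V\<^esub> b)"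
    if "c \<in> carrier K" "opair elts a b \<in> carrier (Fo V)" for V a b c
    using that unfolding Fo_def by simp
  have zeroF: "\<zero>\<^bsub>Fo V\<^esub> = opair elts \<zero>\<^bsub>FObj A V\<^esub> \<zero>\<^bsub>FObj B V\<^esub>" for V
    by (simp add: Fo_def)
  have Fo: "sp (Fo V)" if V: "sp V" for V
  proof -
    have sA: "sp (FObj A V)" and sB: "sp (FObj B V)"
      using A B V by auto
    interpret A: module K "FObj A V" by (rule sp_module[OF sA])
    interpret B: module K "FObj B V" by (rule sp_module[OF sB])
    have "module K (Fo V)"
    proof (rule moduleI)
      show "cring K" ..
      show "abelian_group (Fo V)"
      proof (rule abelian_groupI)
        show "\<zero>\<^bsub>Fo V\<^esub> \<in> carrier (Fo V)"
          unfolding zeroF mem using A B C V s t sA sB by (auto simp: nt_zero)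
        fix x
        assume x: "x \<in> carrier (Fo V)"
        then obtain a b where ab: "x = opair elts a b" "a \<in> el A V" "b \<in> el B V" "s V a = t V b"
          using memE by blast
        show "\<exists>y\<in>carrier (Fo V). y \<oplus>\<^bsub>Fo V\<^esub> x = \<zero>\<^bsub>Fo V\<^esub>"
        proof (rule bexI)
          let ?m = "\<ominus>\<^bsub>K\<^esub> \<one>\<^bsub>K\<^esub>"
          show m: "opair elts (?m \<odot>\<^bsub>FObj A V\<^esub> a) (?m \<odot>\<^bsub>FObj B V\<^esub> b) \<in> carrier (Fo V)"
            using ab sA sB V by (auto simp: mem nt_smult[OF s] nt_smult[OF t])
          show "opair elts (?m \<odot>\<^bsub>FObj A V\<^esub> a) (?m \<odot>\<^bsub>FObj B V\<^esub> b) \<oplus>\<^bsub>Fo V\<^esub> x = \<zero>\<^bsub>Fo V\<^esub>"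
            using ab x m by (simp add: addF zeroF A.smult_l_minus B.smult_l_minus A.l_neg B.l_neg)
        qed
        show "\<zero>\<^bsub>Fo V\<^esub> \<oplus>\<^bsub>Fo V\<^esub> x = x"
          using ab x \<open>\<zero>\<^bsub>Fo V\<^esub> \<in> carrier (Fo V)\<close> by (simp add: addF zeroF)
        fix y
        assume y: "y \<in> carrier (Fo V)"
        then obtain a' b' where ab': "y = opair elts a' b'" "a' \<in> el A V" "b' \<in> el B V" "s V a' = t V b'"
          using memE by blast
        show xy: "x \<oplus>\<^bsub>Fo V\<^esub> y \<in> carrier (Fo V)"
          using ab ab' x y V by (simp add: addF mem nt_add[OF s] nt_add[OF t])
        show "x \<oplus>\<^bsub>Fo V\<^esub> y = y \<oplus>\<^bsub>Fo V\<^esub> x"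
          using ab ab' x y V by (simp add: addF A.a_comm B.a_comm)
        fix z
        assume z: "z \<in> carrier (Fo V)"
        then obtain a'' b'' where ab'': "z = opair elts a'' b''" "a'' \<in> el A V" "b'' \<in> el B V" "s V a'' = t V b''"
          using memE by blast
        show "x \<oplus>\<^bsub>Fo V\<^esub> y \<oplus>\<^bsub>Fo V\<^esub> z = x \<oplus>\<^bsub>Fo V\<^esub> (y \<oplus>\<^bsub>Fo V\<^esub> z)"
          using ab ab' ab'' V by (simp add: addF mem nt_add[OF s] nt_add[OF t] A.a_assoc B.a_assoc)
      qed
    next
      fix c d x y
      assume c: "c \<in> carrier K" and d: "d \<in> carrier K" and x: "x \<in> carrier (Fo V)" and y: "y \<in> carrier (Fo V)"
      obtain a b where ab: "x = opair elts a b" "a \<in> el A V" "b \<in> el B V" "s V a = t V b"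
        using memE[OF x] by blast
      obtain a' b' where ab': "y = opair elts a' b'" "a' \<in> el A V" "b' \<in> el B V" "s V a' = t V b'"
        using memE[OF y] by blast
      note simps = addF smultF mem nt_add[OF s] nt_add[OF t] nt_smult[OF s] nt_smult[OF t]
      show "c \<odot>\<^bsub>Fo V\<^esub> x \<in> carrier (Fo V)" "(c \<oplus>\<^bsub>K\<^esub> d) \<odot>\<^bsub>Fo V\<^esub> x = c \<odot>\<^bsub>Fo V\<^esub> x \<oplus>\<^bsub>Fo V\<^esub> d \<odot>\<^bsub>Fo V\<^esub> x"
        "c \<odot>\<^bsub>Fo V\<^esub> (x \<oplus>\<^bsub>Fo V\<^esub> y) = c \<odot>\<^bsub>Fo V\<^esub> x \<oplus>\<^bsub>Fo V\<^esub> c \<odot>\<^bsub>Fo V\<^esub> y"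
        "(c \<otimes>\<^bsub>K\<^esub> d) \<odot>\<^bsub>Fo V\<^esub> x = c \<odot>\<^bsub>Fo V\<^esub> (d \<odot>\<^bsub>Fo V\<^esub> x)"
        using ab ab' c d V by (simp_all add: simps A.smult_l_distr B.smult_l_distr A.smult_r_distr B.smult_r_distr
          A.smult_assoc1 B.smult_assoc1)
    next
      fix x
      assume x: "x \<in> carrier (Fo V)"
      then show "\<one>\<^bsub>K\<^esub> \<odot>\<^bsub>Fo V\<^esub> x = x"
        using memE[OF x] by (auto simp: smultF)
    qed
    moreover have "small elts {opair elts a b | a b. a \<in> el A V \<and> b \<in> el B V \<and> s V a = t V b}"
      by (rule small_subset[OF small_otimes[OF sp_small[OF sA] sp_small[OF sB]]]) (auto simp: otimes_def)
    ultimately show ?thesis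
      unfolding Fo_def by (rule sp_mk_space)
  qed
  have Fac: "Fa V W f (opair elts a b) = opair elts (act A V W f a) (act B V W f b)" for V W f a b
    by (simp add: Fa_def)
  have Fam: "Fa V W f x \<in> carrier (Fo W)" if "sp V" "sp W" "lin V W f" "x \<in> carrier (Fo V)" for V W f x
    using memE[OF that(4)] that A B by (auto simp: Fac mem nt_nat[OF s] nt_nat[OF t])
  have Fal: "lin (Fo V) (Fo W) (Fa V W f)" if VW: "sp V" "sp W" and f: "lin V W f" for V W f
  proof (rule linI)
    show "Fa V W f x \<in> carrier (Fo W)" if "x \<in> carrier (Fo V)" for x
      using Fam VW f that by blast
    show "Fa V W f (x \<oplus>\<^bsub>Fo V\<^esub> y) = Fa V W f x \<oplus>\<^bsub>Fo W\<^esub> Fa V W f y"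
      if xy: "x \<in> carrier (Fo V)" "y \<in> carrier (Fo V)" for x y
    proof -
      obtain a b where ab: "x = opair elts a b" "a \<in> el A V" "b \<in> el B V"
        using memE[OF xy(1)] by blast
      obtain a' b' where ab': "y = opair elts a' b'" "a' \<in> el A V" "b' \<in> el B V"
        using memE[OF xy(2)] by blast
      show ?thesis
        using Fam[OF VW f xy(1)] Fam[OF VW f xy(2)] xy VW f A B
        unfolding ab(1) ab'(1) using ab ab' by (simp add: addF Fac act_add)
    qed
    show "Fa V W f (d \<odot>\<^bsub>Fo V\<^esub> x) = d \<odot>\<^bsub>Fo W\<^esub> Fa V W f x"
      if d: "d \<in> carrier K" and x: "x \<in> carrier (Fo V)" for d x
    proof -
      obtain a b where ab: "x = opair elts a b" "a \<in> el A V" "b \<in> el B V"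
        using memE[OF x] by blast
      show ?thesis
        using Fam[OF VW f x] x d VW f A B
        unfolding ab(1) using ab by (simp add: smultF Fac act_smult)
    qed
  qed
  have 1: "Fa V W f x = Fa V W g x" if "\<And>v. v \<in> carrier V \<Longrightarrow> f v = g v" for V W f g x
    unfolding Fa_def using act_cong[OF A that] act_cong[OF B that] by simp
  have 2: "Fa V V (\<lambda>v. v) x = x" if "sp V" "x \<in> carrier (Fo V)" for V x
    using memE[OF that(2)] that(1) A B by (auto simp: Fac act_id)
  have 3: "Fa V U (\<lambda>v. g (f v)) x = Fa W U g (Fa V W f x)"
    if "sp V" "sp W" "sp U" "lin V W f" "lin W U g" "x \<in> carrier (Fo V)" for V W U f g x
    using memE[OF that(6)] act_comp[OF A that(1-5)] act_comp[OF B that(1-5)] by (auto simp: Fac)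
  have 4: "Fa V W (\<lambda>v. f v \<oplus>\<^bsub>W\<^esub> g v) x = Fa V W f x \<oplus>\<^bsub>Fo W\<^esub> Fa V W g x"
    if "sp V" "sp W" "lin V W f" "lin V W g" "x \<in> carrier (Fo V)" for V W f g x
    using memE[OF that(5)] that(1-4) A B Fam[OF that(1-3,5)] Fam[OF that(1,2,4,5)]
    by (auto simp: Fac act_plus addF)
  have 5: "Fa V W (\<lambda>v. d \<odot>\<^bsub>W\<^esub> f v) x = d \<odot>\<^bsub>Fo W\<^esub> Fa V W f x"
    if "sp V" "sp W" "lin V W f" "d \<in> carrier K" "x \<in> carrier (Fo V)" for V W f d x
    using memE[OF that(5)] that(1-4) A B Fam[OF that(1-3,5)] by (auto simp: Fac act_scale smultF)
  note F = mk_fun[of Fo Fa, OF Fo Fal 1 2 3 4 5]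
  have obj: "FObj (mk_fun Fo Fa) V = Fo V" if "sp V" for V
    using that by (simp add: mk_fun_def)
  have actF: "act (mk_fun Fo Fa) V W f x = Fa V W f x"
    if "sp V" "sp W" "lin V W f" "x \<in> carrier (Fo V)" for V W f x
    by (rule F(3), (assumption | fact that)+)
  show ?thesis
  proof (rule that[of "mk_fun Fo Fa" "\<lambda>V. ofst" "\<lambda>V. osnd"])
    show "mk_fun Fo Fa \<in> Obj LE"
      by (rule F(1))
    have fst: "lin (Fo V) (FObj A V) ofst" for V
      by (rule linI) (auto dest!: memE simp: addF smultF mem)
    have snd: "lin (Fo V) (FObj B V) osnd" for V
      by (rule linI) (auto dest!: memE simp: addF smultF mem)
    show "nt (mk_fun Fo Fa) A (\<lambda>V. ofst)"
      by (rule ntI) (simp_all add: obj actF fst, simp add: Fa_def)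
    show "nt (mk_fun Fo Fa) B (\<lambda>V. osnd)"
      by (rule ntI) (simp_all add: obj actF snd, simp add: Fa_def)
    show "s V (ofst x) = t V (osnd x)" if "sp V" "x \<in> el (mk_fun Fo Fa) V" for V x
      using that memE[of x V] by (auto simp: obj)
    show "x = y" if "sp V" "x \<in> el (mk_fun Fo Fa) V" "y \<in> el (mk_fun Fo Fa) V" "ofst x = ofst y" "osnd x = osnd y" for V x y
      using that memE[of x V] memE[of y V] by (auto simp: obj)
    show "\<exists>x\<in>el (mk_fun Fo Fa) V. ofst x = a \<and> osnd x = b"
      if "sp V" "a \<in> el A V" "b \<in> el B V" "s V a = t V b" for V a b
      using that by (intro bexI[of _ "opair elts a b"]) (auto simp: obj mem)
  qed
qed

end


section \<open>Small functors are the bounded functors\<close>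

lemma poset_category_simps [simp]:
  "Obj (poset_category I r) = I" "Arr (poset_category I r) = r"
  "Dom (poset_category I r) = fst" "Cod (poset_category I r) = snd"
  "Id (poset_category I r) = (\<lambda>i. (i, i))" "Comp (poset_category I r) = (\<lambda>g f. (fst f, snd g))"
  by (simp_all add: poset_category_def)

context small_field
begin

text \<open>The union of the images of a colimit cocone of representables is the whole functor,
  because the quotient map and the zero map agree on the cocone.\<close>

lemma small_functor_bdd:
  assumes X: "X \<in> Obj LE" and sm: "small_functor elts K X"
  shows "bdd X"
proof -
  obtain I r D where I: "small elts I" and dir: "directed_poset I r"
    and D: "is_functor (poset_category I r) LE D"
    and rep: "\<forall>i\<in>I. \<exists>V\<in>Obj Vt. FObj D i = Yo V"
    and colim: "is_colimit (poset_category I r) LE D X"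
    using sm unfolding small_functor_def by blast
  have "\<forall>i\<in>I. \<exists>V. sp V \<and> FObj D i = Yo V"
    using rep Obj_Vt by blast
  from bchoice[OF this] obtain V where V: "\<And>i. i \<in> I \<Longrightarrow> sp (V i)" "\<And>i. i \<in> I \<Longrightarrow> FObj D i = Yo (V i)"
    by auto
  obtain \<iota> where coc: "cocone (poset_category I r) LE D X \<iota>"
    and univ: "\<And>Y \<kappa>. cocone (poset_category I r) LE D Y \<kappa> \<Longrightarrow>
      \<exists>!h. h \<in> Hom LE X Y \<and> (\<forall>i\<in>I. Comp LE h (\<iota> i) = \<kappa> i)"
    using colim unfolding is_colimit_def by auto
  have \<iota>: "\<iota> i \<in> Hom LE (Yo (V i)) X" if "i \<in> I" for i
    using coc that V by (auto simp: cocone_def)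
  have rI: "i \<in> I" "j \<in> I" if "(i, j) \<in> r" for i j
    using dir that partial_order_onD(4) unfolding directed_poset_def by blast+
  have Dr: "FArr D (i, j) \<in> Hom LE (Yo (V i)) (Yo (V j))" if "(i, j) \<in> r" for i j
    using D that V rI[OF that] by (fastforce simp: is_functor_def)
  have \<iota>r: "Comp LE (\<iota> j) (FArr D (i, j)) = \<iota> i" if "(i, j) \<in> r" for i j
    using coc that by (fastforce simp: cocone_def)
  \<comment> \<open>The union of the images of the legs. Directedness moves two elements to a common
    leg, which makes the union closed under sums.\<close>
  define S where "S W = {cmp (\<iota> i) W a | i a. i \<in> I \<and> a \<in> carrier (hs (V i) W)}" for W
  have nt\<iota>: "nt (Yo (V i)) X (cmp (\<iota> i))" if "i \<in> I" for i
    using Hom_LE_cmp(1)[OF \<iota>[OF that]] .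
  have el: "el (Yo (V i)) W = carrier (hs (V i) W)" if "i \<in> I" "sp W" for i W
    using that V by (simp add: Yo)
  have lift: "\<exists>b. b \<in> carrier (hs (V j) W) \<and> cmp (\<iota> i) W a = cmp (\<iota> j) W b"
    if ij: "(i, j) \<in> r" and W: "sp W" and a: "a \<in> carrier (hs (V i) W)" for i j W a
  proof (intro exI conjI)
    note i = rI(1)[OF ij] and j = rI(2)[OF ij]
    show "cmp (FArr D (i, j)) W a \<in> carrier (hs (V j) W)"
      using nt_closed[OF Hom_LE_cmp(1)[OF Dr[OF ij]] W, of a] a el[OF i W] el[OF j W] by simp
    show "cmp (\<iota> i) W a = cmp (\<iota> j) W (cmp (FArr D (i, j)) W a)"
      using Comp_LE(2)[OF Dr[OF ij] \<iota>[OF j] W, of a] \<iota>r[OF ij] a el[OF i W] by simp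
  qed
  have "subfun X S"
    unfolding subfun_def subsp_def
  proof (intro conjI allI impI ballI subsetI)
    fix W
    assume W: "sp W"
    show "x \<in> el X W" if "x \<in> S W" for x
      using that nt_closed[OF nt\<iota> W] el W by (auto simp: S_def)
    obtain i where i: "i \<in> I"
      using dir by (auto simp: directed_poset_def)
    have "cmp (\<iota> i) W \<zero>\<^bsub>FObj (Yo (V i)) W\<^esub> = \<zero>\<^bsub>FObj X W\<^esub>"
      using nt_zero[OF Yo(1)[OF V(1)[OF i]] X nt\<iota>[OF i] W] .
    moreover have "\<zero>\<^bsub>FObj (Yo (V i)) W\<^esub> \<in> carrier (hs (V i) W)"
      using W V i by (simp add: Yo)
    ultimately show "\<zero>\<^bsub>FObj X W\<^esub> \<in> S W"
      unfolding S_def using i by force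
    show "x \<oplus>\<^bsub>FObj X W\<^esub> y \<in> S W" if x: "x \<in> S W" and y: "y \<in> S W" for x y
    proof -
      obtain i a where 1: "i \<in> I" "a \<in> carrier (hs (V i) W)" "x = cmp (\<iota> i) W a"
        using x by (auto simp: S_def)
      obtain j b where 2: "j \<in> I" "b \<in> carrier (hs (V j) W)" "y = cmp (\<iota> j) W b"
        using y by (auto simp: S_def)
      obtain k where k: "k \<in> I" "(i, k) \<in> r" "(j, k) \<in> r"
        using dir 1(1) 2(1) unfolding directed_poset_def by blast
      obtain a' where a': "a' \<in> carrier (hs (V k) W)" "x = cmp (\<iota> k) W a'"
        using lift[OF k(2) W 1(2)] 1(3) by auto
      obtain b' where b': "b' \<in> carrier (hs (V k) W)" "y = cmp (\<iota> k) W b'"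
        using lift[OF k(3) W 2(2)] 2(3) by auto
      have "cmp (\<iota> k) W (a' \<oplus>\<^bsub>hs (V k) W\<^esub> b') = x \<oplus>\<^bsub>FObj X W\<^esub> y"
        using nt_add[OF nt\<iota>[OF k(1)] W, of a' b'] a' b' V[OF k(1)] W by (simp add: Yo)
      moreover have "a' \<oplus>\<^bsub>hs (V k) W\<^esub> b' \<in> carrier (hs (V k) W)"
        using a' b' V k W by simp
      ultimately show ?thesis
        unfolding S_def using k(1) by force
    qed
    show "c \<odot>\<^bsub>FObj X W\<^esub> x \<in> S W" if c: "c \<in> carrier K" and x: "x \<in> S W" for c x
    proof -
      obtain i a where 1: "i \<in> I" "a \<in> carrier (hs (V i) W)" "x = cmp (\<iota> i) W a"
        using x by (auto simp: S_def)
      have "cmp (\<iota> i) W (c \<odot>\<^bsub>hs (V i) W\<^esub> a) = c \<odot>\<^bsub>FObj X W\<^esub> x"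
        using nt_smult[OF nt\<iota>[OF 1(1)] W c, of a] 1 V[OF 1(1)] W by (simp add: Yo)
      moreover have "c \<odot>\<^bsub>hs (V i) W\<^esub> a \<in> carrier (hs (V i) W)"
        using 1 V W c by simp
      ultimately show ?thesis
        unfolding S_def using 1(1) by force
    qed
  next
    fix W U f x
    assume W: "sp W" and U: "sp U" and f: "lin W U f" and x: "x \<in> S W"
    obtain i a where 1: "i \<in> I" "a \<in> carrier (hs (V i) W)" "x = cmp (\<iota> i) W a"
      using x by (auto simp: S_def)
    have "act (Yo (V i)) W U f a \<in> carrier (hs (V i) U)"
      using act_closed[OF Yo(1)[OF V(1)[OF 1(1)]] W U f, of a] 1 V W U by (simp add: Yo(2))
    moreover have "cmp (\<iota> i) U (act (Yo (V i)) W U f a) = act X W U f x"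
      using nt_nat[OF nt\<iota>[OF 1(1)] W U f, of a] 1 el[OF 1(1) W] by simp
    ultimately show "act X W U f x \<in> S U"
      unfolding S_def using 1(1) by force
  qed
  then obtain Q q where Q: "Q \<in> Obj LE" and q: "nt X Q q"
    and ker: "\<And>W x. sp W \<Longrightarrow> x \<in> el X W \<Longrightarrow> q W x = \<zero>\<^bsub>FObj Q W\<^esub> \<longleftrightarrow> x \<in> S W"
    using quotient_functor[OF X] by metis
  define \<kappa> where "\<kappa> i = mk_nat (Yo (V i)) Q (\<lambda>W x. \<zero>\<^bsub>FObj Q W\<^esub>)" for i
  have \<kappa>: "\<kappa> i \<in> Hom LE (Yo (V i)) Q" if "i \<in> I" for i
    unfolding \<kappa>_def using V that Q by (intro mk_nat_in_Hom nt_zero_map Yo(1)) auto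
  have "cocone (poset_category I r) LE D Q \<kappa>"
    unfolding cocone_def
  proof (intro conjI ballI Q)
    show "\<kappa> i \<in> Hom LE (FObj D i) Q" if "i \<in> Obj (poset_category I r)" for i
      using that \<kappa> V by simp
    fix u
    assume "u \<in> Arr (poset_category I r)"
    then obtain i j where u: "u = (i, j)" "(i, j) \<in> r"
      by (cases u) auto
    note i = rI(1)[OF u(2)] and j = rI(2)[OF u(2)]
    have "Comp LE (\<kappa> j) (FArr D (i, j)) = \<kappa> i"
    proof (rule Hom_LE_eqI[OF Comp_LE(1)[OF Dr[OF u(2)] \<kappa>[OF j]] \<kappa>[OF i]])
      fix W x
      assume W: "sp W" "x \<in> el (Yo (V i)) W"
      then show "cmp (Comp LE (\<kappa> j) (FArr D (i, j))) W x = cmp (\<kappa> i) W x"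
        using Comp_LE(2)[OF Dr[OF u(2)] \<kappa>[OF j] W] nt_closed[OF Hom_LE_cmp(1)[OF Dr[OF u(2)]] W]
        by (simp add: \<kappa>_def)
    qed
    then show "Comp LE (\<kappa> (Cod (poset_category I r) u)) (FArr D u) = \<kappa> (Dom (poset_category I r) u)"
      by (simp add: u)
  qed
  from univ[OF this] have uniq: "h = h'"
    if "h \<in> Hom LE X Q" "h' \<in> Hom LE X Q" "\<And>i. i \<in> I \<Longrightarrow> Comp LE h (\<iota> i) = \<kappa> i"
      "\<And>i. i \<in> I \<Longrightarrow> Comp LE h' (\<iota> i) = \<kappa> i" for h h'
    using that by blast
  have hom: "mk_nat X Q q \<in> Hom LE X Q" "mk_nat X Q (\<lambda>W x. \<zero>\<^bsub>FObj Q W\<^esub>) \<in> Hom LE X Q"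
    using X Q q nt_zero_map by (auto intro!: mk_nat_in_Hom)
  have "mk_nat X Q q = mk_nat X Q (\<lambda>W x. \<zero>\<^bsub>FObj Q W\<^esub>)"
  proof (rule uniq[OF hom])
    fix i
    assume i: "i \<in> I"
    have c: "cmp (\<iota> i) W a \<in> S W" "cmp (\<iota> i) W a \<in> el X W" if "sp W" "a \<in> el (Yo (V i)) W" for W a
      using that i el nt_closed[OF nt\<iota>[OF i]] unfolding S_def by auto
    show "Comp LE (mk_nat X Q q) (\<iota> i) = \<kappa> i"
      by (rule Hom_LE_eqI[OF Comp_LE(1)[OF \<iota>[OF i] hom(1)] \<kappa>[OF i]])
        (simp add: Comp_LE(2)[OF \<iota>[OF i] hom(1)] c ker \<kappa>_def)
    show "Comp LE (mk_nat X Q (\<lambda>W x. \<zero>\<^bsub>FObj Q W\<^esub>)) (\<iota> i) = \<kappa> i"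
      by (rule Hom_LE_eqI[OF Comp_LE(1)[OF \<iota>[OF i] hom(2)] \<kappa>[OF i]])
        (simp add: Comp_LE(2)[OF \<iota>[OF i] hom(2)] c \<kappa>_def)
  qed
  then have all: "x \<in> S W" if "sp W" "x \<in> el X W" for W x
    using ker[OF that] that by (simp add: mk_nat_eq_iff)
  \<comment> \<open>Each element comes from some \<open>V i\<close>, by the Yoneda lemma for the
    i-th leg. All these spaces embed into the union of their carriers, which is small because the
    index set is.\<close>
  have "bounded_by (set_code elts (\<Union>i\<in>I. carrier (V i))) X"
  proof (rule bounded_byI[OF X])
    show "small elts (\<Union>i\<in>I. carrier (V i))"
      using V by (intro small_UN[OF I] sp_small) auto
    fix W x
    assume W: "sp W" and x: "x \<in> el X W"
    obtain i a where 1: "i \<in> I" "a \<in> carrier (hs (V i) W)" "x = cmp (\<iota> i) W a"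
      using all[OF W x] by (auto simp: S_def)
    note Vi = V(1)[OF 1(1)]
    have "x = act X (V i) W (co a) (cmp (\<iota> i) (V i) (idg (V i)))"
      unfolding 1(3) by (rule yoneda[OF Vi W X nt\<iota>[OF 1(1)] 1(2)])
    moreover have "cmp (\<iota> i) (V i) (idg (V i)) \<in> el X (V i)"
      using nt_closed[OF nt\<iota>[OF 1(1)] Vi] Vi by (simp add: Yo)
    moreover have "inj_on (\<lambda>v. v) (carrier (V i))" "(\<lambda>v. v) ` carrier (V i) \<subseteq> (\<Union>i\<in>I. carrier (V i))"
      using 1(1) by auto
    ultimately show "\<exists>W' f y j. sp W' \<and> lin W' W f \<and> y \<in> el X W' \<and> x = act X W' W f y \<and>
        inj_on j (carrier W') \<and> j ` carrier W' \<subseteq> (\<Union>i\<in>I. carrier (V i))"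
      using Vi hs_lin[OF Vi W 1(2)] by blast
  qed
  then show ?thesis
    by (auto simp: bdd_def)
qed

section \<open>Elements supported on a subspace\<close>

definition insupp :: "'u vfun \<Rightarrow> 'u space \<Rightarrow> 'u set \<Rightarrow> 'u \<Rightarrow> bool"
  where "insupp X V U x \<longleftrightarrow> (\<exists>y\<in>el X (sub_space V U). act X (sub_space V U) V (\<lambda>u. u) y = x)"

lemma insupp_carrier: "X \<in> Obj LE \<Longrightarrow> sp V \<Longrightarrow> x \<in> el X V \<Longrightarrow> insupp X V (carrier V) x"
  by (auto simp: insupp_def sub_space_carrier act_id)

text \<open>Linear functors on vector spaces preserve kernels, as every short exact sequence splits.\<close>

lemma insupp_kernel:
  assumes X: "X \<in> Obj LE" and V: "sp V" and U: "subsp V U" and Z: "sp Z" and g: "lin V Z g"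
    and x: "insupp X V U x" and gx: "act X V Z g x = \<zero>\<^bsub>FObj X Z\<^esub>"
  shows "insupp X V {u \<in> U. g u = \<zero>\<^bsub>Z\<^esub>} x"
proof -
  define V1 where "V1 = sub_space V U"
  define U' where "U' = {u \<in> U. g u = \<zero>\<^bsub>Z\<^esub>}"
  have V1: "sp V1" and V1c: "carrier V1 = U"
    unfolding V1_def using sp_sub_space[OF V U] by auto
  have U': "subsp V U'"
    unfolding U'_def by (rule subsp_kernel[OF V Z g U])
  have V2: "sp (sub_space V U')"
    by (rule sp_sub_space[OF V U'])
  have incl: "lin V1 V (\<lambda>u. u)"
    unfolding V1_def by (rule lin_incl[OF U])
  have g1: "lin V1 Z g"
    unfolding V1_def by (rule lin_on_sub[OF U g])
  obtain y where y: "y \<in> el X V1" "act X V1 V (\<lambda>u. u) y = x"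
    using x by (auto simp: insupp_def V1_def)
  have gy: "act X V1 Z g y = \<zero>\<^bsub>FObj X Z\<^esub>"
    using act_comp[OF X V1 V Z incl g y(1)] y(2) gx by simp
  obtain g' where g': "lin Z V1 g'" "\<And>v. v \<in> carrier V1 \<Longrightarrow> g (g' (g v)) = g v"
    using generalized_inverse[OF V1 Z g1] by blast
  note g'g = lin_comp[OF g1 g'(1)]
  \<comment> \<open>This maps U into the kernel of g, because g g' g = g. It fixes y because the
    subtracted part passes through the action of g on y, which is zero.\<close>
  define e where "e u = u \<ominus>\<^bsub>V1\<^esub> g' (g u)" for u
  have e: "lin V1 V1 e"
    unfolding e_def by (rule lin_diff[OF V1 V1 lin_id g'g])
  have eU': "e u \<in> U'" if "u \<in> U" for u
  proof -
    have u: "u \<in> carrier V1"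
      using that V1c by simp
    have "g (e u) = \<zero>\<^bsub>Z\<^esub>"
      unfolding e_def using u V1 Z g'(2)[OF u] lin_closed[OF g'g u] lin_closed[OF g1 u]
      by (simp add: lin_minus[OF V1 Z g1])
    then show ?thesis
      using lin_closed[OF e u] V1c by (simp add: U'_def)
  qed
  have e2: "lin V1 (sub_space V U') e"
    using lin_into_sub[OF lin_comp[OF e incl]] eU' V1c by simp
  have "act X V1 V1 e y = act X V1 V1 (\<lambda>u. u) y \<ominus>\<^bsub>FObj X V1\<^esub> act X V1 V1 (\<lambda>u. g' (g u)) y"
    unfolding e_def by (rule act_diff[OF X V1 V1 lin_id g'g y(1)])
  also have "act X V1 V1 (\<lambda>u. g' (g u)) y = \<zero>\<^bsub>FObj X V1\<^esub>"
    using act_comp[OF X V1 Z V1 g1 g'(1) y(1)] gy act_zero[OF X Z V1 g'(1)] by simp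
  finally have ey: "act X V1 V1 e y = y"
    using y X V1 by (simp add: act_id)
  have "act X (sub_space V U') V (\<lambda>u. u) (act X V1 (sub_space V U') e y) = act X V1 V e y"
    by (rule act_comp[OF X V1 V2 V e2 lin_incl[OF U'] y(1)])
  also have "\<dots> = x"
    using act_comp[OF X V1 V1 V e incl y(1)] ey y(2) by simp
  finally show ?thesis
    unfolding insupp_def U'_def[symmetric] using act_closed[OF X V1 V2 e2 y(1)] by blast
qed

end

section \<open>A bounded functor as a directed colimit of representables\<close>

locale bounded_functor = small_field +
  fixes X :: "'a vfun" and A :: 'a
  assumes X: "X \<in> Obj LE" and bounded: "bounded_by A X"
begin

text \<open>The ambient space \<open>amb\<close> is a direct sum of copies of \<open>ds A\<close>, one for each element of
  \<open>X (ds A)\<close>; the summand of \<open>g\<close> carries \<open>g\<close> itself.\<close>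

abbreviation gens :: "'a set" where "gens \<equiv> el X (ds A)"

definition pos :: 'a where "pos = set_code elts (otimes (elts A) gens)"

abbreviation amb :: "'a space" where "amb \<equiv> ds pos"

text \<open>\<open>inn g\<close> and \<open>prj g\<close> are the injection and the projection of
  the summand of g; \<open>msk S\<close> projects onto the summands of the generators in S but stays
  an endomorphism of \<open>amb\<close>, so that subspaces for different S can be compared.\<close>

definition inn :: "'a \<Rightarrow> 'a \<Rightarrow> 'a" where "inn g = pull pos (chi (otimes (elts A) {g})) ofst"
definition prj :: "'a \<Rightarrow> 'a \<Rightarrow> 'a" where "prj g = pull A (chi (elts A)) (\<lambda>a. opair elts a g)"
definition msk :: "'a set \<Rightarrow> 'a \<Rightarrow> 'a" where "msk S = pull pos (chi (otimes (elts A) S)) (\<lambda>q. q)"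

lemma elts_pos: "elts pos = otimes (elts A) gens"
  unfolding pos_def using X by (intro elts_set_code small_otimes sp_small) auto

lemma lin_inn: "lin (ds A) amb (inn g)"
  unfolding inn_def by (rule lin_pull_chi) (auto simp: otimes_def inj_on_def)

lemma co_inn: "k \<in> elts pos \<Longrightarrow> a \<in> carrier (ds A) \<Longrightarrow>
    co (inn g a) k = (if k \<in> otimes (elts A) {g} then co a (ofst k) else \<zero>\<^bsub>K\<^esub>)"
  unfolding inn_def by (rule co_pull_chi[where J = A]) (auto simp: otimes_def)

lemma lin_prj: "g \<in> gens \<Longrightarrow> lin amb (ds A) (prj g)"
  unfolding prj_def by (rule lin_pull_chi) (auto simp: elts_pos inj_on_def)

lemma co_prj: "g \<in> gens \<Longrightarrow> i \<in> elts A \<Longrightarrow> w \<in> carrier amb \<Longrightarrow> co (prj g w) i = co w (opair elts i g)"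
  unfolding prj_def by (subst co_pull_chi[where J = pos]) (auto simp: elts_pos)

lemma lin_msk: "lin amb amb (msk S)"
  unfolding msk_def by (rule lin_pull_chi) auto

lemma co_msk: "k \<in> elts pos \<Longrightarrow> w \<in> carrier amb \<Longrightarrow>
    co (msk S w) k = (if k \<in> otimes (elts A) S then co w k else \<zero>\<^bsub>K\<^esub>)"
  unfolding msk_def by (rule co_pull_chi[where J = pos]) auto

lemma prj_inn:
  assumes "g \<in> gens" "a \<in> carrier (ds A)"
  shows "prj g (inn g a) = a"
  by (rule ds_eqI[where I = A])
    (use assms lin_closed[OF lin_inn assms(2)] lin_closed[OF lin_prj lin_closed[OF lin_inn]] in
      \<open>auto simp: co_prj co_inn elts_pos\<close>)

lemma msk_inn:
  assumes "a \<in> carrier (ds A)"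
  shows "msk S (inn g a) = (if g \<in> S then inn g a else \<zero>\<^bsub>amb\<^esub>)"
proof (rule ds_eqI[where I = pos])
  note i = lin_closed[OF lin_inn assms]
  show "msk S (inn g a) \<in> carrier amb" "(if g \<in> S then inn g a else \<zero>\<^bsub>amb\<^esub>) \<in> carrier amb"
    using lin_closed[OF lin_msk i] i by auto
  show "co (msk S (inn g a)) k = co (if g \<in> S then inn g a else \<zero>\<^bsub>amb\<^esub>) k" if "k \<in> elts pos" for k
    using that i assms by (auto simp: co_msk co_inn otimes_def)
qed

lemma msk_msk:
  assumes "w \<in> carrier amb"
  shows "msk S (msk T w) = msk (S \<inter> T) w"
  by (rule ds_eqI[where I = pos])
    (use assms lin_closed[OF lin_msk] in \<open>auto simp: co_msk otimes_def\<close>)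

text \<open>Each generator is placed in its own summand, so one element over \<open>amb\<close>
  remembers all generators in S, and \<open>msk\<close> extracts the part belonging to any
  subset.\<close>

definition xs :: "'a set \<Rightarrow> 'a"
  where "xs S = finsum (FObj X amb) (\<lambda>g. act X (ds A) amb (inn g) g) S"

lemma xs_mem:
  assumes "S \<subseteq> gens"
  shows "xs S \<in> el X amb"
proof -
  interpret M: module K "FObj X amb"
    using X by (intro sp_module) simp
  show ?thesis
    unfolding xs_def using assms X lin_inn by (intro M.finsum_closed) auto
qed

lemma act_msk_xs:
  assumes "finite S" "S \<subseteq> gens"
  shows "act X amb amb (msk T) (xs S) = xs (T \<inter> S)"
  using assms
proof (induction S rule: finite_induct)
  case empty
  interpret M: module K "FObj X amb"
    using X by (intro sp_module) simp
  show ?case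
    using X lin_msk by (simp add: xs_def act_zero)
next
  case (insert g S)
  interpret M: module K "FObj X amb"
    using X by (intro sp_module) simp
  let ?f = "\<lambda>g. act X (ds A) amb (inn g) g"
  have f: "?f h \<in> el X amb" if "h \<in> gens" for h
    using X lin_inn that by simp
  have ins: "xs (Set.insert g S') = ?f g \<oplus>\<^bsub>FObj X amb\<^esub> xs S'" if "S' \<subseteq> S" for S'
    unfolding xs_def using that insert f finite_subset[OF that insert.hyps(1)]
    by (subst M.finsum_insert) auto
  have m: "act X amb amb (msk T) (?f g) = (if g \<in> T then ?f g else \<zero>\<^bsub>FObj X amb\<^esub>)"
  proof -
    have g: "g \<in> gens"
      using insert.prems by simp
    have "act X amb amb (msk T) (?f g) = act X (ds A) amb (\<lambda>a. msk T (inn g a)) g"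
      by (rule act_comp[OF X sp_ds sp_ds sp_ds lin_inn lin_msk g])
    also have "\<dots> = (if g \<in> T then ?f g else \<zero>\<^bsub>FObj X amb\<^esub>)"
      using act_cong[OF X, of "ds A" "\<lambda>a. msk T (inn g a)" "inn g"]
        act_zero_map[OF X sp_ds sp_ds g, of "\<lambda>a. msk T (inn g a)"] msk_inn by simp
    finally show ?thesis .
  qed
  have "act X amb amb (msk T) (xs (Set.insert g S)) =
      act X amb amb (msk T) (?f g) \<oplus>\<^bsub>FObj X amb\<^esub> xs (T \<inter> S)"
    using insert f xs_mem[of S] X lin_msk by (simp add: ins act_add)
  also have "\<dots> = xs (T \<inter> Set.insert g S)"
  proof -
    have "xs (T \<inter> S) \<in> el X amb"
      by (rule xs_mem) (use insert.prems in auto)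
    then show ?thesis
      using ins[of "T \<inter> S"] X by (simp add: m Int_insert_right)
  qed
  finally show ?case .
qed

text \<open>Being fixed by \<open>msk S\<close> confines U to the summands of S. The space on U will
  represent the functor at this index, and the support condition provides the element of X over it
  that defines the leg of the cocone.\<close>

definition good :: "'a set \<Rightarrow> 'a set \<Rightarrow> bool"
  where "good S U \<longleftrightarrow> finite S \<and> S \<subseteq> gens \<and> subsp amb U \<and> (\<forall>u\<in>U. msk S u = u) \<and> insupp X amb U (xs S)"

text \<open>The index poset: an index codes a finite set of generators together with a subspace of the
  corresponding summands that supports their sum.\<close>

definition Ind :: "'a set"
  where "Ind = {i. i = opair elts (ofst i) (osnd i) \<and> good (elts (ofst i)) (elts (osnd i))}"

abbreviation gS :: "'a \<Rightarrow> 'a set" where "gS i \<equiv> elts (ofst i)"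
abbreviation gU :: "'a \<Rightarrow> 'a set" where "gU i \<equiv> elts (osnd i)"

text \<open>A later index has more generators, and masking sends its subspace into the earlier one.
  That map runs from \<open>gU j\<close> to \<open>gU i\<close>; representables are contravariant,
  so it induces an arrow from i to j.\<close>

definition rel :: "('a \<times> 'a) set"
  where "rel = {(i, j). i \<in> Ind \<and> j \<in> Ind \<and> gS i \<subseteq> gS j \<and> msk (gS i) ` gU j \<subseteq> gU i}"

lemma relD: 
  assumes "(i, j) \<in> rel"
  shows "i \<in> Ind" "j \<in> Ind" "gS i \<subseteq> gS j" "u \<in> gU j \<Longrightarrow> msk (gS i) u \<in> gU i"
  using assms by (auto simp: rel_def)

lemma IndD:
  assumes "i \<in> Ind"
  shows "finite (gS i)" "gS i \<subseteq> gens" "subsp amb (gU i)" "u \<in> gU i \<Longrightarrow> msk (gS i) u = u"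
    "insupp X amb (gU i) (xs (gS i))"
  using assms by (auto simp: Ind_def good_def)

lemma Ind_code:
  assumes "good S U"
  obtains i where "i \<in> Ind" "gS i = S" "gU i = U"
proof -
  have s: "small elts S" "small elts U"
    using assms small_subset[OF sp_small[OF sp_FObj[OF X sp_ds]], of S A]
      small_subset[OF sp_small[OF sp_ds], of U pos]
    by (auto simp: good_def subsp_def)
  show ?thesis
    by (rule that[of "opair elts (set_code elts S) (set_code elts U)"])
      (use s assms in \<open>auto simp: Ind_def\<close>)
qed

lemma small_Ind: "small elts Ind"
proof (rule small_subset)
  show "small elts (otimes {z. elts z \<subseteq> gens} {z. elts z \<subseteq> carrier amb})"
    using X by (intro small_otimes small_codes sp_small) auto
  show "Ind \<subseteq> otimes {z. elts z \<subseteq> gens} {z. elts z \<subseteq> carrier amb}"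
  proof
    fix i
    assume i: "i \<in> Ind"
    then have "i = opair elts (ofst i) (osnd i)"
      by (simp add: Ind_def)
    then show "i \<in> otimes {z. elts z \<subseteq> gens} {z. elts z \<subseteq> carrier amb}"
      using IndD(2,3)[OF i] unfolding otimes_def subsp_def by blast
  qed
qed

text \<open>Any linear equation satisfied by \<open>xs S\<close> can be imposed on the supporting
  subspace, because supports pass to kernels. This is the only way in which subspaces are
  shrunk.\<close>

lemma good_kernel:
  assumes i: "good S U" and Z: "sp Z" and g: "lin amb Z g" and gx: "act X amb Z g (xs S) = \<zero>\<^bsub>FObj X Z\<^esub>"
  shows "good S {u \<in> U. g u = \<zero>\<^bsub>Z\<^esub>}"
  using i subsp_kernel[OF sp_ds Z g, of U] insupp_kernel[OF X sp_ds _ Z g _ gx, of U]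
  by (simp add: good_def)

text \<open>The largest admissible subspace, the fixed vectors of the mask. Writing it as a kernel
  gives the support condition from \<open>insupp_kernel\<close>.\<close>

lemma good_full:
  assumes S: "finite S" "S \<subseteq> gens"
  shows "good S {w \<in> carrier amb. w \<ominus>\<^bsub>amb\<^esub> msk S w = \<zero>\<^bsub>amb\<^esub>}"
proof -
  have l: "lin amb amb (\<lambda>w. w \<ominus>\<^bsub>amb\<^esub> msk S w)"
    by (rule lin_diff[OF sp_ds sp_ds lin_id lin_msk])
  have xS: "xs S \<in> el X amb"
    by (rule xs_mem[OF S(2)])
  have "act X amb amb (\<lambda>w. w \<ominus>\<^bsub>amb\<^esub> msk S w) (xs S) = act X amb amb (\<lambda>w. w) (xs S) \<ominus>\<^bsub>FObj X amb\<^esub> act X amb amb (msk S) (xs S)"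
    by (rule act_diff[OF X sp_ds sp_ds lin_id lin_msk xS])
  also have "\<dots> = \<zero>\<^bsub>FObj X amb\<^esub>"
    using xS X act_msk_xs[OF S, of S] by (simp add: act_id)
  finally have "insupp X amb {w \<in> carrier amb. w \<ominus>\<^bsub>amb\<^esub> msk S w = \<zero>\<^bsub>amb\<^esub>} (xs S)"
    using insupp_kernel[OF X sp_ds subsp_carrier sp_ds l insupp_carrier] X xS by simp
  then show ?thesis
    using S subsp_kernel[OF sp_ds sp_ds l subsp_carrier] lin_closed[OF lin_msk]
    by (auto simp: good_def sp_minus_eq_zero)
qed

text \<open>An upper bound of i and j takes the union of their generators and, inside the full
  subspace, those vectors whose masks lie in \<open>gU i\<close> and \<open>gU j\<close>. With
  projections onto these two subspaces both conditions become kernels. The sum of generators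
  satisfies them since its masks are \<open>xs (gS i)\<close> and \<open>xs (gS j)\<close>, which
  are supported there.\<close>

lemma directed: "directed_poset Ind rel"
  unfolding directed_poset_def
proof (intro conjI ballI)
  show "partial_order_on Ind rel"
    unfolding partial_order_on_def preorder_on_def
  proof (intro conjI)
    show "rel \<subseteq> Ind \<times> Ind"
      by (auto simp: rel_def)
    show "refl_on Ind rel"
      by (auto simp: refl_on_def rel_def IndD)
    show "trans rel"
    proof (rule transI)
      fix i j k
      assume ij: "(i, j) \<in> rel" and jk: "(j, k) \<in> rel"
      have "msk (gS i) u \<in> gU i" if u: "u \<in> gU k" for u
      proof -
        have "u \<in> carrier amb"
          using subspD(1)[OF IndD(3)] relD(2)[OF jk] u by blast
        then have "msk (gS i) u = msk (gS i) (msk (gS j) u)"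
          using relD(3)[OF ij] by (simp add: msk_msk Int_absorb2)
        then show ?thesis
          using relD(4)[OF ij] relD(4)[OF jk u] by simp
      qed
      then show "(i, k) \<in> rel"
        using relD(1,3)[OF ij] relD(2,3)[OF jk] by (auto simp: rel_def)
    qed
    show "antisym rel"
    proof (rule antisymI)
      fix i j
      assume ij: "(i, j) \<in> rel" and ji: "(j, i) \<in> rel"
      have S: "gS i = gS j"
        using relD(3)[OF ij] relD(3)[OF ji] by blast
      \<comment> \<open>With equal sets of generators the mask is the identity on both subspaces, so
        the two relations are opposite inclusions.\<close>
      have "gU i = gU j"
        using relD(4)[OF ij] relD(4)[OF ji] IndD(4)[OF relD(1)[OF ij]] IndD(4)[OF relD(2)[OF ij]] S by auto
      then show "i = j"
        using S extensionality relD(1,2)[OF ij] unfolding Ind_def by (metis (lifting) mem_Collect_eq)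
    qed
  qed
  have "good {} {w \<in> carrier amb. w \<ominus>\<^bsub>amb\<^esub> msk {} w = \<zero>\<^bsub>amb\<^esub>}"
    by (rule good_full) auto
  then show "Ind \<noteq> {}"
    using Ind_code by blast
  fix i j
  assume i: "i \<in> Ind" and j: "j \<in> Ind"
  define S where "S = gS i \<union> gS j"
  have S: "finite S" "S \<subseteq> gens"
    using IndD[OF i] IndD[OF j] by (auto simp: S_def)
  have ext: "good S {u \<in> U. msk (gS k) u \<ominus>\<^bsub>amb\<^esub> e (msk (gS k) u) = \<zero>\<^bsub>amb\<^esub>}"
    if good: "good S U" and k: "k \<in> Ind" "gS k \<subseteq> S" and e: "lin amb amb e" "\<And>u. u \<in> gU k \<Longrightarrow> e u = u" for U k e
  proof (rule good_kernel[OF good sp_ds])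
    note em = lin_comp[OF lin_msk e(1)]
    show "lin amb amb (\<lambda>u. msk (gS k) u \<ominus>\<^bsub>amb\<^esub> e (msk (gS k) u))"
      by (rule lin_diff[OF sp_ds sp_ds lin_msk em])
    have xS: "xs S \<in> el X amb"
      by (rule xs_mem[OF S(2)])
    obtain y where y: "y \<in> el X (sub_space amb (gU k))" "act X (sub_space amb (gU k)) amb (\<lambda>u. u) y = xs (gS k)"
      using IndD(5)[OF k(1)] by (auto simp: insupp_def)
    have "act X amb amb e (xs (gS k)) = act X (sub_space amb (gU k)) amb (\<lambda>u. e u) y"
      unfolding y(2)[symmetric]
      by (rule act_comp[OF X sp_sub_space[OF sp_ds IndD(3)[OF k(1)]] sp_ds sp_ds lin_incl[OF IndD(3)[OF k(1)]] e(1) y(1)])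
    also have "\<dots> = xs (gS k)"
      unfolding y(2)[symmetric] using e(2) by (intro act_cong[OF X]) simp
    finally have ex: "act X amb amb e (xs (gS k)) = xs (gS k)" .
    have mx: "act X amb amb (msk (gS k)) (xs S) = xs (gS k)"
      using act_msk_xs[OF S, of "gS k"] k(2) by (simp add: Int_absorb2)
    have "act X amb amb (\<lambda>u. msk (gS k) u \<ominus>\<^bsub>amb\<^esub> e (msk (gS k) u)) (xs S) =
        act X amb amb (msk (gS k)) (xs S) \<ominus>\<^bsub>FObj X amb\<^esub> act X amb amb (\<lambda>u. e (msk (gS k) u)) (xs S)"
      by (rule act_diff[OF X sp_ds sp_ds lin_msk em xS])
    also have "act X amb amb (\<lambda>u. e (msk (gS k) u)) (xs S) = xs (gS k)"
      using act_comp[OF X sp_ds sp_ds sp_ds lin_msk[of "gS k"] e(1) xS] mx ex by simp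
    finally show "act X amb amb (\<lambda>u. msk (gS k) u \<ominus>\<^bsub>amb\<^esub> e (msk (gS k) u)) (xs S) = \<zero>\<^bsub>FObj X amb\<^esub>"
      using mx X xs_mem[OF IndD(2)[OF k(1)]] by simp
  qed
  obtain e where e: "lin amb amb e" "\<And>v. v \<in> carrier amb \<Longrightarrow> e v \<in> gU i" "\<And>u. u \<in> gU i \<Longrightarrow> e u = u"
    using projection[OF sp_ds IndD(3)[OF i]] by blast
  obtain e' where e': "lin amb amb e'" "\<And>v. v \<in> carrier amb \<Longrightarrow> e' v \<in> gU j" "\<And>u. u \<in> gU j \<Longrightarrow> e' u = u"
    using projection[OF sp_ds IndD(3)[OF j]] by blast
  define U where "U = {u \<in> {u \<in> {w \<in> carrier amb. w \<ominus>\<^bsub>amb\<^esub> msk S w = \<zero>\<^bsub>amb\<^esub>}.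
      msk (gS i) u \<ominus>\<^bsub>amb\<^esub> e (msk (gS i) u) = \<zero>\<^bsub>amb\<^esub>}. msk (gS j) u \<ominus>\<^bsub>amb\<^esub> e' (msk (gS j) u) = \<zero>\<^bsub>amb\<^esub>}"
  have "good S U"
    unfolding U_def
    by (intro ext good_full S i j e e') (auto simp: S_def)
  then obtain k where k: "k \<in> Ind" "gS k = S" "gU k = U"
    using Ind_code by blast
  have "msk (gS i) u \<in> gU i" "msk (gS j) u \<in> gU j" if "u \<in> U" for u
  proof -
    have u: "u \<in> carrier amb" "msk (gS i) u \<ominus>\<^bsub>amb\<^esub> e (msk (gS i) u) = \<zero>\<^bsub>amb\<^esub>"
      "msk (gS j) u \<ominus>\<^bsub>amb\<^esub> e' (msk (gS j) u) = \<zero>\<^bsub>amb\<^esub>"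
      using that by (auto simp: U_def)
    note m = lin_closed[OF lin_msk u(1)]
    show "msk (gS i) u \<in> gU i"
      using u(2) e(2)[OF m] sp_minus_eq_zero[OF sp_ds m lin_closed[OF e(1) m]] by metis
    show "msk (gS j) u \<in> gU j"
      using u(3) e'(2)[OF m] sp_minus_eq_zero[OF sp_ds m lin_closed[OF e'(1) m]] by metis
  qed
  then show "\<exists>k\<in>Ind. (i, k) \<in> rel \<and> (j, k) \<in> rel"
    using i j k by (intro bexI[of _ k]) (auto simp: rel_def S_def)
qed

abbreviation Us :: "'a \<Rightarrow> 'a space" where "Us i \<equiv> sub_space amb (gU i)"

lemma sp_Us: "i \<in> Ind \<Longrightarrow> sp (Us i)"
  by (rule sp_sub_space[OF sp_ds IndD(3)])

lemma lin_Us: "i \<in> Ind \<Longrightarrow> lin (Us i) amb (\<lambda>u. u)"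
  by (rule lin_incl[OF IndD(3)])

lemma lin_trans:
  assumes "(i, j) \<in> rel"
  shows "lin (Us j) (Us i) (msk (gS i))"
  using lin_into_sub[OF lin_comp[OF lin_Us[OF relD(2)[OF assms]] lin_msk]] relD(4)[OF assms] by simp

text \<open>A projection onto \<open>gU i\<close> is a linear retraction of the inclusion, and
  functors preserve retractions.\<close>

lemma incl_inj:
  assumes i: "i \<in> Ind" and x: "x \<in> el X (Us i)" and y: "y \<in> el X (Us i)"
    and eq: "act X (Us i) amb (\<lambda>u. u) x = act X (Us i) amb (\<lambda>u. u) y"
  shows "x = y"
proof -
  obtain e where e: "lin amb amb e" "\<And>v. v \<in> carrier amb \<Longrightarrow> e v \<in> gU i" "\<And>u. u \<in> gU i \<Longrightarrow> e u = u"
    using projection[OF sp_ds IndD(3)[OF i]] by blast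
  have l: "lin amb (Us i) e"
    by (rule lin_into_sub[OF e(1,2)])
  have "act X amb (Us i) e (act X (Us i) amb (\<lambda>u. u) z) = z" if "z \<in> el X (Us i)" for z
    using act_comp[OF X sp_Us[OF i] sp_ds sp_Us[OF i] lin_Us[OF i] l that]
      act_id[OF X sp_Us[OF i] that, of e] e(3) by simp
  then show ?thesis
    using x y eq by metis
qed

text \<open>The lift of \<open>xs\<close> to the supporting subspace, unique by
  \<open>incl_inj\<close>. Under the Yoneda lemma it is the leg of the cocone at i.\<close>

definition zz :: "'a \<Rightarrow> 'a"
  where "zz i = (SOME y. y \<in> el X (Us i) \<and> act X (Us i) amb (\<lambda>u. u) y = xs (gS i))"

lemma zz:
  assumes "i \<in> Ind"
  shows "zz i \<in> el X (Us i)" "act X (Us i) amb (\<lambda>u. u) (zz i) = xs (gS i)"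
proof -
  have "\<exists>y. y \<in> el X (Us i) \<and> act X (Us i) amb (\<lambda>u. u) y = xs (gS i)"
    using IndD(5)[OF assms] by (auto simp: insupp_def)
  from someI_ex[OF this] show "zz i \<in> el X (Us i)" "act X (Us i) amb (\<lambda>u. u) (zz i) = xs (gS i)"
    by (auto simp: zz_def)
qed

lemma zz_trans:
  assumes ij: "(i, j) \<in> rel"
  shows "act X (Us j) (Us i) (msk (gS i)) (zz j) = zz i"
proof (rule incl_inj)
  note i = relD(1)[OF ij] and j = relD(2)[OF ij]
  show "i \<in> Ind" "zz i \<in> el X (Us i)"
    using i zz by auto
  show "act X (Us j) (Us i) (msk (gS i)) (zz j) \<in> el X (Us i)"
    by (rule act_closed[OF X sp_Us[OF j] sp_Us[OF i] lin_trans[OF ij] zz(1)[OF j]])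
  have "act X (Us i) amb (\<lambda>u. u) (act X (Us j) (Us i) (msk (gS i)) (zz j)) = act X (Us j) amb (\<lambda>u. msk (gS i) u) (zz j)"
    by (rule act_comp[OF X sp_Us[OF j] sp_Us[OF i] sp_ds lin_trans[OF ij] lin_Us[OF i] zz(1)[OF j]])
  also have "\<dots> = act X amb amb (msk (gS i)) (act X (Us j) amb (\<lambda>u. u) (zz j))"
    using act_comp[OF X sp_Us[OF j] sp_ds sp_ds lin_Us[OF j] lin_msk zz(1)[OF j]] by simp
  also have "\<dots> = xs (gS i)"
    unfolding zz(2)[OF j] using act_msk_xs[OF IndD(1,2)[OF j], of "gS i"] relD(3)[OF ij]
    by (simp add: Int_absorb2)
  finally show "act X (Us i) amb (\<lambda>u. u) (act X (Us j) (Us i) (msk (gS i)) (zz j)) = act X (Us i) amb (\<lambda>u. u) (zz i)"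
    by (simp add: zz(2)[OF i])
qed

section \<open>The diagram of representables and its cocone\<close>

definition tr :: "'a \<Rightarrow> 'a \<Rightarrow> 'a" where "tr i j = graph elts (gU j) (msk (gS i))"

lemma tr:
  assumes "(i, j) \<in> rel"
  shows "tr i j \<in> carrier (hs (Us j) (Us i))" "u \<in> gU j \<Longrightarrow> co (tr i j) u = msk (gS i) u"
proof -
  show "tr i j \<in> carrier (hs (Us j) (Us i))"
    using hs_graph[OF sp_Us sp_Us lin_trans[OF assms]] relD(1,2)[OF assms] by (simp add: tr_def)
  show "u \<in> gU j \<Longrightarrow> co (tr i j) u = msk (gS i) u"
    by (simp add: tr_def)
qed

definition dia :: "('a, 'a \<times> 'a, 'a vfun, 'a vnat) functor_data"
  where "dia = \<lparr>FObj = (\<lambda>i\<in>Ind. Yo (Us i)),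
    FArr = (\<lambda>u\<in>rel. yo (Us (fst u)) (Yo (Us (snd u))) (tr (fst u) (snd u)))\<rparr>"

lemma dia_obj: "i \<in> Ind \<Longrightarrow> FObj dia i = Yo (Us i)"
  by (simp add: dia_def)

lemma dia_arr:
  assumes ij: "(i, j) \<in> rel"
  shows "FArr dia (i, j) \<in> Hom LE (Yo (Us i)) (Yo (Us j))"
    and "cmp (FArr dia (i, j)) (Us i) (idg (Us i)) = tr i j"
proof -
  note i = sp_Us[OF relD(1)[OF ij]] and j = sp_Us[OF relD(2)[OF ij]]
  have d: "FArr dia (i, j) = yo (Us i) (Yo (Us j)) (tr i j)"
    using ij by (simp add: dia_def)
  have t: "tr i j \<in> el (Yo (Us j)) (Us i)"
    using tr(1)[OF ij] i j by (simp add: Yo)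
  show "FArr dia (i, j) \<in> Hom LE (Yo (Us i)) (Yo (Us j))"
    unfolding d by (rule yo_Hom[OF i Yo(1)[OF j] t])
  show "cmp (FArr dia (i, j)) (Us i) (idg (Us i)) = tr i j"
    unfolding d by (rule cmp_yo_idg[OF i Yo(1)[OF j] t])
qed

lemma rel_refl: "i \<in> Ind \<Longrightarrow> (i, i) \<in> rel"
  by (auto simp: rel_def IndD)

lemma dia_functor: "is_functor (poset_category Ind rel) LE dia"
  unfolding is_functor_def poset_category_simps
proof (intro conjI ballI impI)
  show "FObj dia \<in> Ind \<rightarrow>\<^sub>E Obj LE"
    using Yo(1) sp_Us by (auto simp: dia_def)
  show "FArr dia \<in> rel \<rightarrow>\<^sub>E Arr LE"
  proof (rule PiE_I)
    show "FArr dia u \<in> Arr LE" if "u \<in> rel" for u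
      using that dia_arr(1)[of "fst u" "snd u"] by (simp add: Hom_def)
  qed (simp add: dia_def)
  show "FArr dia u \<in> Hom LE (FObj dia (fst u)) (FObj dia (snd u))" if "u \<in> rel" for u
    using that dia_arr(1)[of "fst u" "snd u"] relD(1,2)[of "fst u" "snd u"] by (simp add: dia_obj)
  show "FArr dia (i, i) = Id LE (FObj dia i)" if i: "i \<in> Ind" for i
  proof (rule yo_eqI[OF sp_Us[OF i] dia_arr(1)[OF rel_refl[OF i]]])
    note Y = Yo(1)[OF sp_Us[OF i]]
    show "Id LE (FObj dia i) \<in> Hom LE (Yo (Us i)) (Yo (Us i))"
      unfolding dia_obj[OF i] Id_LE using mk_nat_in_Hom[OF Y Y nt_id] .
    have "tr i i = idg (Us i)"
      using IndD(4)[OF i] by (simp add: tr_def idg_def graph_eq_iff)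
    then show "cmp (FArr dia (i, i)) (Us i) (idg (Us i)) = cmp (Id LE (FObj dia i)) (Us i) (idg (Us i))"
      using dia_arr(2)[OF rel_refl[OF i]] sp_Us[OF i] by (simp add: Id_LE dia_obj[OF i] Yo(2))
  qed
  fix f g
  assume f: "f \<in> rel" and g: "g \<in> rel" and fg: "snd f = fst g"
  obtain i j k where ijk: "f = (i, j)" "g = (j, k)"
    using fg by (metis prod.collapse)
  have ij: "(i, j) \<in> rel" and jk: "(j, k) \<in> rel"
    using f g ijk by auto
  have ik: "(i, k) \<in> rel"
    using directed ij jk unfolding directed_poset_def by (meson partial_order_onD(2) transD)
  note i = sp_Us[OF relD(1)[OF ij]] and j = sp_Us[OF relD(2)[OF ij]] and k = sp_Us[OF relD(2)[OF jk]]
  have "FArr dia (i, k) = Comp LE (FArr dia (j, k)) (FArr dia (i, j))"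
  proof (rule yo_eqI[OF i dia_arr(1)[OF ik] Comp_LE(1)[OF dia_arr(1)[OF ij] dia_arr(1)[OF jk]]])
    have "cmp (Comp LE (FArr dia (j, k)) (FArr dia (i, j))) (Us i) (idg (Us i)) = cmp (FArr dia (j, k)) (Us i) (tr i j)"
      using Comp_LE(2)[OF dia_arr(1)[OF ij] dia_arr(1)[OF jk] i, of "idg (Us i)"] i
      by (simp add: Yo(2) dia_arr(2)[OF ij])
    also have "\<dots> = act (Yo (Us k)) (Us j) (Us i) (co (tr i j)) (tr j k)"
      using yoneda[OF j i Yo(1)[OF k] Hom_LE_cmp(1)[OF dia_arr(1)[OF jk]] tr(1)[OF ij]] dia_arr(2)[OF jk] by simp
    also have "\<dots> = graph elts (gU k) (\<lambda>v. co (tr i j) (co (tr j k) v))"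
      using Yo(3)[OF k j i hs_lin[OF j i tr(1)[OF ij]] tr(1)[OF jk]] by simp
    also have "\<dots> = tr i k"
      using relD(3)[OF ij] relD(4)[OF jk] subspD(1)[OF IndD(3)[OF relD(2)[OF jk]]]
      by (simp add: tr_def[of i k] graph_eq_iff tr(2)[OF ij] tr(2)[OF jk] msk_msk Int_absorb2)
    finally show "cmp (FArr dia (i, k)) (Us i) (idg (Us i)) =
        cmp (Comp LE (FArr dia (j, k)) (FArr dia (i, j))) (Us i) (idg (Us i))"
      using dia_arr(2)[OF ik] by simp
  qed
  then show "FArr dia (fst f, snd g) = Comp LE (FArr dia g) (FArr dia f)"
    by (simp add: ijk)
qed

definition leg :: "'a \<Rightarrow> 'a vnat" where "leg i = yo (Us i) X (zz i)"

lemma leg_Hom: "i \<in> Ind \<Longrightarrow> leg i \<in> Hom LE (Yo (Us i)) X"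
  unfolding leg_def using yo_Hom[OF sp_Us X zz(1)] .

lemma leg_idg: "i \<in> Ind \<Longrightarrow> cmp (leg i) (Us i) (idg (Us i)) = zz i"
  unfolding leg_def using cmp_yo_idg[OF sp_Us X zz(1)] .

text \<open>Testing on the identity of \<open>Us i\<close> translates commutation into a condition
  on elements: a cocone with tip Z is a family of elements of Z over the spaces \<open>Us i\<close>
  that is compatible under the masks.\<close>

lemma cocone_trans:
  assumes Z: "Z \<in> Obj LE" and \<kappa>: "\<And>i. i \<in> Ind \<Longrightarrow> \<kappa> i \<in> Hom LE (Yo (Us i)) Z" and ij: "(i, j) \<in> rel"
  shows "Comp LE (\<kappa> j) (FArr dia (i, j)) = \<kappa> i \<longleftrightarrow>
    act Z (Us j) (Us i) (msk (gS i)) (cmp (\<kappa> j) (Us j) (idg (Us j))) = cmp (\<kappa> i) (Us i) (idg (Us i))"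
proof -
  note i = sp_Us[OF relD(1)[OF ij]] and j = sp_Us[OF relD(2)[OF ij]]
  note \<kappa>i = \<kappa>[OF relD(1)[OF ij]] and \<kappa>j = \<kappa>[OF relD(2)[OF ij]]
  have "cmp (Comp LE (\<kappa> j) (FArr dia (i, j))) (Us i) (idg (Us i)) = cmp (\<kappa> j) (Us i) (tr i j)"
    using Comp_LE(2)[OF dia_arr(1)[OF ij] \<kappa>j i, of "idg (Us i)"] i by (simp add: Yo(2) dia_arr(2)[OF ij])
  also have "\<dots> = act Z (Us j) (Us i) (co (tr i j)) (cmp (\<kappa> j) (Us j) (idg (Us j)))"
    by (rule yoneda[OF j i Z Hom_LE_cmp(1)[OF \<kappa>j] tr(1)[OF ij]])
  also have "\<dots> = act Z (Us j) (Us i) (msk (gS i)) (cmp (\<kappa> j) (Us j) (idg (Us j)))"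
    using tr(2)[OF ij] by (intro act_cong[OF Z]) simp
  finally show ?thesis
    using yo_eqI[OF i Comp_LE(1)[OF dia_arr(1)[OF ij] \<kappa>j] \<kappa>i] by metis
qed

text \<open>The bound exhibits x as an image of one element y over \<open>ds A\<close>. The index
  with the single generator y and its full subspace suffices, since \<open>prj y\<close> leads back
  from the ambient space to \<open>ds A\<close>.\<close>

lemma generated:
  assumes V: "sp V" and x: "x \<in> el X V"
  shows "\<exists>i\<in>Ind. \<exists>f. lin (Us i) V f \<and> x = act X (Us i) V f (zz i)"
proof -
  obtain g f where gf: "lin V (ds A) g" "lin (ds A) V f" "act X V V (\<lambda>v. f (g v)) x = x"
    using bounded V x unfolding bounded_by_def by blast
  define y where "y = act X V (ds A) g x"
  have y: "y \<in> gens"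
    using X V gf x by (simp add: y_def)
  have "good {y} {w \<in> carrier amb. w \<ominus>\<^bsub>amb\<^esub> msk {y} w = \<zero>\<^bsub>amb\<^esub>}"
    using y by (intro good_full) auto
  then obtain i where i: "i \<in> Ind" "gS i = {y}"
    using Ind_code by blast
  have fy: "act X (ds A) V f y = x"
    unfolding y_def using act_comp[OF X V sp_ds V gf(1,2) x] gf(3) by simp
  have fp: "lin amb V (\<lambda>w. f (prj y w))"
    by (rule lin_comp[OF lin_prj[OF y] gf(2)])
  interpret M: module K "FObj X amb"
    using X by (intro sp_module) simp
  have xy: "xs {y} = act X (ds A) amb (inn y) y"
    unfolding xs_def using X y lin_inn by (subst M.finsum_insert) auto
  have "act X (Us i) V (\<lambda>w. f (prj y w)) (zz i) = act X amb V (\<lambda>w. f (prj y w)) (xs {y})"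
    using act_comp[OF X sp_Us[OF i(1)] sp_ds V lin_Us[OF i(1)] fp zz(1)[OF i(1)]] zz(2)[OF i(1)] i(2) by simp
  also have "\<dots> = act X (ds A) V (\<lambda>a. f (prj y (inn y a))) y"
    unfolding xy by (rule act_comp[OF X sp_ds sp_ds V lin_inn fp y])
  also have "\<dots> = x"
    unfolding fy[symmetric] using y by (intro act_cong[OF X]) (simp add: prj_inn)
  finally show ?thesis
    using i(1) lin_comp[OF lin_Us[OF i(1)] fp] by auto
qed

text \<open>Every element of X is an image of some \<open>zz i\<close>, so the induced map is forced
  to send it to the same image of the given element \<open>z i\<close> of Z. What has to be shown is
  that zero goes to zero: if f annihilates \<open>zz i\<close>, a larger index with its subspace
  inside the kernel of f shows that f annihilates \<open>z i\<close> too.\<close>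

lemma colimit: "is_colimit (poset_category Ind rel) LE dia X"
  unfolding is_colimit_def poset_category_simps
proof (intro exI conjI allI impI)
  show "cocone (poset_category Ind rel) LE dia X leg"
    unfolding cocone_def poset_category_simps
  proof (intro conjI ballI X)
    show "leg i \<in> Hom LE (FObj dia i) X" if "i \<in> Ind" for i
      using that leg_Hom by (simp add: dia_obj)
    show "Comp LE (leg (snd u)) (FArr dia u) = leg (fst u)" if "u \<in> rel" for u
    proof -
      obtain i j where u: "u = (i, j)"
        by (cases u)
      then have ij: "(i, j) \<in> rel"
        using that by simp
      have "Comp LE (leg j) (FArr dia (i, j)) = leg i"
        using cocone_trans[of X leg, OF X leg_Hom ij] zz_trans[OF ij] relD(1,2)[OF ij]
        by (simp add: leg_idg)
      then show ?thesis
        by (simp add: u)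
    qed
  qed
next
  fix Z \<kappa>
  assume "cocone (poset_category Ind rel) LE dia Z \<kappa>"
  then have Z: "Z \<in> Obj LE" and \<kappa>: "\<And>i. i \<in> Ind \<Longrightarrow> \<kappa> i \<in> Hom LE (Yo (Us i)) Z"
    and \<kappa>r: "\<And>i j. (i, j) \<in> rel \<Longrightarrow> Comp LE (\<kappa> j) (FArr dia (i, j)) = \<kappa> i"
    unfolding cocone_def poset_category_simps by (auto simp: dia_obj)
  define z where "z i = cmp (\<kappa> i) (Us i) (idg (Us i))" for i
  have z: "z i \<in> el Z (Us i)" if "i \<in> Ind" for i
    using nt_closed[OF Hom_LE_cmp(1)[OF \<kappa>[OF that]] sp_Us[OF that], of "idg (Us i)"] sp_Us[OF that]
    by (simp add: z_def Yo(2))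
  have z_trans: "act Z (Us j) (Us i) (msk (gS i)) (z j) = z i" if "(i, j) \<in> rel" for i j
    using cocone_trans[of Z \<kappa>, OF Z \<kappa> that] \<kappa>r[OF that] by (simp add: z_def)
  define R where "R V x w \<longleftrightarrow> (\<exists>i\<in>Ind. \<exists>f. lin (Us i) V f \<and> x = act X (Us i) V f (zz i) \<and> w = act Z (Us i) V f (z i))"
    for V x w
  have RI: "R V (act X (Us i) V f (zz i)) (act Z (Us i) V f (z i))" if "i \<in> Ind" "lin (Us i) V f" for V i f
    using that unfolding R_def by blast
  have RE: "\<exists>i\<in>Ind. \<exists>f. lin (Us i) V f \<and> x = act X (Us i) V f (zz i) \<and> w = act Z (Us i) V f (z i)" if "R V x w" for V x w
    using that unfolding R_def .
  \<comment> \<open>Passing to a larger index changes neither element. Two presentations can thus be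
    brought to a common index before they are added.\<close>
  have lift: "act X (Us i) V f (zz i) = act X (Us k) V (\<lambda>u. f (msk (gS i) u)) (zz k)"
    "act Z (Us i) V f (z i) = act Z (Us k) V (\<lambda>u. f (msk (gS i) u)) (z k)"
    "lin (Us k) V (\<lambda>u. f (msk (gS i) u))"
    if ik: "(i, k) \<in> rel" and V: "sp V" and f: "lin (Us i) V f" for V i k f
  proof -
    note i = sp_Us[OF relD(1)[OF ik]] and k = sp_Us[OF relD(2)[OF ik]]
    show "lin (Us k) V (\<lambda>u. f (msk (gS i) u))"
      by (rule lin_comp[OF lin_trans[OF ik] f])
    show "act X (Us i) V f (zz i) = act X (Us k) V (\<lambda>u. f (msk (gS i) u)) (zz k)"
      using act_comp[OF X k i V lin_trans[OF ik] f zz(1)[OF relD(2)[OF ik]]] zz_trans[OF ik] by simp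
    show "act Z (Us i) V f (z i) = act Z (Us k) V (\<lambda>u. f (msk (gS i) u)) (z k)"
      using act_comp[OF Z k i V lin_trans[OF ik] f z[OF relD(2)[OF ik]]] z_trans[OF ik] by simp
  qed
  have "\<exists>t. nt X Z t \<and> (\<forall>V x w. sp V \<longrightarrow> (R V x w \<longleftrightarrow> x \<in> el X V \<and> w = t V x))"
  proof (rule nt_of_rel[OF X Z])
    show "x \<in> el X V \<and> w \<in> el Z V" if V: "sp V" and "R V x w" for V x w
      using RE[OF \<open>R V x w\<close>] V X Z zz(1) z sp_Us by auto
    show "\<exists>w. R V x w" if "sp V" "x \<in> el X V" for V x
      using generated[OF that] RI by blast
    show "w = \<zero>\<^bsub>FObj Z V\<^esub>" if V: "sp V" and R: "R V \<zero>\<^bsub>FObj X V\<^esub> w" for V w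
    proof -
      obtain i f where i: "i \<in> Ind" and f: "lin (Us i) V f"
        and 0: "act X (Us i) V f (zz i) = \<zero>\<^bsub>FObj X V\<^esub>" and w: "w = act Z (Us i) V f (z i)"
        using RE[OF R] by metis
      obtain e where e: "lin amb amb e" "\<And>v. v \<in> carrier amb \<Longrightarrow> e v \<in> gU i" "\<And>u. u \<in> gU i \<Longrightarrow> e u = u"
        using projection[OF sp_ds IndD(3)[OF i]] by blast
      \<comment> \<open>The projection e extends f to the ambient space, where
        \<open>good_kernel\<close> needs it. The index k obtained below has the same generators as
        i, so the mask between them is the identity on \<open>gU k\<close>, and f vanishes
        there.\<close>
      have fe: "lin amb V (\<lambda>w. f (e w))"
        by (rule lin_comp[OF lin_into_sub[OF e(1,2)] f])
      have "act X amb V (\<lambda>w. f (e w)) (xs (gS i)) = act X (Us i) V (\<lambda>u. f (e u)) (zz i)"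
        unfolding zz(2)[OF i, symmetric]
        by (rule act_comp[OF X sp_Us[OF i] sp_ds V lin_Us[OF i] fe zz(1)[OF i]])
      also have "\<dots> = \<zero>\<^bsub>FObj X V\<^esub>"
        unfolding 0[symmetric] using e(3) by (intro act_cong[OF X]) simp
      finally have "good (gS i) {u \<in> gU i. f (e u) = \<zero>\<^bsub>V\<^esub>}"
        using i by (intro good_kernel[OF _ V fe]) (simp add: Ind_def)
      then obtain k where k: "k \<in> Ind" "gS k = gS i" "gU k = {u \<in> gU i. f (e u) = \<zero>\<^bsub>V\<^esub>}"
        using Ind_code by blast
      have ik: "(i, k) \<in> rel"
        using i k IndD(4)[OF i] by (auto simp: rel_def)
      have "w = act Z (Us k) V (\<lambda>u. f (msk (gS i) u)) (z k)"
        unfolding w by (rule lift(2)[OF ik V f])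
      also have "\<dots> = \<zero>\<^bsub>FObj Z V\<^esub>"
        using k(3) e(3) IndD(4)[OF i] by (intro act_zero_map[OF Z sp_Us[OF k(1)] V z[OF k(1)]]) auto
      finally show ?thesis .
    qed
    show "R V (x \<oplus>\<^bsub>FObj X V\<^esub> x') (w \<oplus>\<^bsub>FObj Z V\<^esub> w')" if V: "sp V" and R: "R V x w" and R': "R V x' w'" for V x w x' w'
    proof -
      obtain i f where i: "i \<in> Ind" "lin (Us i) V f" "x = act X (Us i) V f (zz i)" "w = act Z (Us i) V f (z i)"
        using RE[OF R] by blast
      obtain j g where j: "j \<in> Ind" "lin (Us j) V g" "x' = act X (Us j) V g (zz j)" "w' = act Z (Us j) V g (z j)"
        using RE[OF R'] by blast
      obtain k where k: "k \<in> Ind" "(i, k) \<in> rel" "(j, k) \<in> rel"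
        using directed i(1) j(1) unfolding directed_poset_def by blast
      note li = lift[OF k(2) V i(2)] and lj = lift[OF k(3) V j(2)]
      show ?thesis
        unfolding i(3,4) j(3,4) li(1,2) lj(1,2)
          act_plus[OF X sp_Us[OF k(1)] V li(3) lj(3) zz(1)[OF k(1)], symmetric]
          act_plus[OF Z sp_Us[OF k(1)] V li(3) lj(3) z[OF k(1)], symmetric]
        by (rule RI[OF k(1) lin_plus[OF V li(3) lj(3)]])
    qed
    show "R V (c \<odot>\<^bsub>FObj X V\<^esub> x) (c \<odot>\<^bsub>FObj Z V\<^esub> w)" if V: "sp V" and c: "c \<in> carrier K" and R: "R V x w" for V c x w
    proof -
      obtain i f where i: "i \<in> Ind" "lin (Us i) V f" "x = act X (Us i) V f (zz i)" "w = act Z (Us i) V f (z i)"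
        using RE[OF R] by blast
      show ?thesis
        unfolding i(3,4) act_scale[OF X sp_Us[OF i(1)] V i(2) c zz(1)[OF i(1)], symmetric]
          act_scale[OF Z sp_Us[OF i(1)] V i(2) c z[OF i(1)], symmetric]
        by (rule RI[OF i(1) lin_scale[OF V i(2) c]])
    qed
    show "R W (act X V W f x) (act Z V W f w)" if VW: "sp V" "sp W" "lin V W f" and R: "R V x w" for V W f x w
    proof -
      obtain i g where i: "i \<in> Ind" "lin (Us i) V g" "x = act X (Us i) V g (zz i)" "w = act Z (Us i) V g (z i)"
        using RE[OF R] by blast
      show ?thesis
        unfolding i(3,4) act_comp[OF X sp_Us[OF i(1)] VW(1,2) i(2) VW(3) zz(1)[OF i(1)]]
          act_comp[OF Z sp_Us[OF i(1)] VW(1,2) i(2) VW(3) z[OF i(1)]]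
        by (rule RI[OF i(1) lin_comp[OF i(2) VW(3)]])
    qed
  qed
  then obtain t where t: "nt X Z t" and tR: "\<And>V x w. sp V \<Longrightarrow> R V x w \<Longrightarrow> w = t V x"
    by blast
  have hom: "mk_nat X Z t \<in> Hom LE X Z"
    by (rule mk_nat_in_Hom[OF X Z t])
  have legc: "cmp (Comp LE h (leg i)) (Us i) (idg (Us i)) = cmp h (Us i) (zz i)"
    if "h \<in> Hom LE X Z" "i \<in> Ind" for h i
    using Comp_LE(2)[OF leg_Hom[OF that(2)] that(1) sp_Us[OF that(2)], of "idg (Us i)"] sp_Us[OF that(2)]
    by (simp add: Yo(2) leg_idg[OF that(2)])
  show "\<exists>!h. h \<in> Hom LE X Z \<and> (\<forall>i\<in>Ind. Comp LE h (leg i) = \<kappa> i)"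
  proof (rule ex1I)
    show "mk_nat X Z t \<in> Hom LE X Z \<and> (\<forall>i\<in>Ind. Comp LE (mk_nat X Z t) (leg i) = \<kappa> i)"
    proof (intro conjI ballI hom)
      fix i
      assume i: "i \<in> Ind"
      show "Comp LE (mk_nat X Z t) (leg i) = \<kappa> i"
      proof (rule yo_eqI[OF sp_Us[OF i] Comp_LE(1)[OF leg_Hom[OF i] hom] \<kappa>[OF i]])
        have "z i = t (Us i) (zz i)"
          using tR[OF sp_Us[OF i] RI[OF i lin_id]] act_id[OF X sp_Us[OF i] zz(1)[OF i]]
            act_id[OF Z sp_Us[OF i] z[OF i]] by simp
        then show "cmp (Comp LE (mk_nat X Z t) (leg i)) (Us i) (idg (Us i)) = cmp (\<kappa> i) (Us i) (idg (Us i))"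
          using sp_Us[OF i] zz(1)[OF i] by (simp add: legc[OF hom i] z_def)
      qed
    qed
    fix h
    assume h: "h \<in> Hom LE X Z \<and> (\<forall>i\<in>Ind. Comp LE h (leg i) = \<kappa> i)"
    then have hH: "h \<in> Hom LE X Z"
      by simp
    have hz: "cmp h (Us i) (zz i) = z i" if "i \<in> Ind" for i
      using legc[OF hH that] h that by (simp add: z_def)
    show "h = mk_nat X Z t"
    proof (rule Hom_LE_eqI[OF hH hom])
      fix V x
      assume V: "sp V" and x: "x \<in> el X V"
      obtain i f where i: "i \<in> Ind" "lin (Us i) V f" "x = act X (Us i) V f (zz i)"
        using generated[OF V x] by blast
      have "cmp h V x = act Z (Us i) V f (z i)"
        using nt_nat[OF Hom_LE_cmp(1)[OF hH] sp_Us[OF i(1)] V i(2) zz(1)[OF i(1)]] hz[OF i(1)] i(3) by simp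
      also have "\<dots> = t V x"
        using tR[OF V RI[OF i(1,2)]] i(3) by simp
      finally show "cmp h V x = cmp (mk_nat X Z t) V x"
        using V x by simp
    qed
  qed
qed

lemma is_small: "small_functor elts K X"
  unfolding small_functor_def
proof (intro exI conjI ballI)
  show "small elts Ind" "directed_poset Ind rel" "is_functor (poset_category Ind rel) LE dia"
    "is_colimit (poset_category Ind rel) LE dia X"
    by (fact small_Ind directed dia_functor colimit)+
  show "\<exists>V\<in>Obj Vt. FObj dia i = Yo V" if "i \<in> Ind" for i
    using that sp_Us dia_obj by auto
qed

end

context small_field
begin

lemma small_functor_iff: "X \<in> Obj LE \<Longrightarrow> small_functor elts K X \<longleftrightarrow> bdd X"
  using small_functor_bdd bounded_functor.is_small[OF bounded_functor.intro[OF small_field_axioms]]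
  unfolding bdd_def bounded_functor_axioms_def by blast


section \<open>The reflection\<close>

abbreviation IE where "IE \<equiv> IndVectOp elts K"
abbreviation SV where "SV \<equiv> SigmaVect elts K"

section \<open>Objects and arrows of the two full subcategories\<close>

lemma Obj_IE: "X \<in> Obj IE \<longleftrightarrow> X \<in> Obj LE \<and> bdd X"
  using small_functor_iff by (auto simp: IndVectOp_def full_subcategory_def)

lemma Obj_SV: "X \<in> Obj SV \<longleftrightarrow> X \<in> Obj LE \<and> torsion_free X"
  using strong_iff by (auto simp: SigmaVect_def full_subcategory_def)

lemma SV_IE: "X \<in> Obj SV \<Longrightarrow> X \<in> Obj IE"
  by (simp add: Obj_SV Obj_IE torsion_free_bdd)

lemma IE_simps [simp]: "Dom IE = src" "Cod IE = tgt" "Comp IE = Comp LE" "Id IE = Id LE"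
  using Dom_LE Cod_LE by (simp_all add: IndVectOp_def full_subcategory_def)

lemma SV_simps [simp]: "Dom SV = src" "Cod SV = tgt" "Comp SV = Comp LE" "Id SV = Id LE"
  using Dom_LE Cod_LE by (simp_all add: SigmaVect_def full_subcategory_def)

lemma Arr_LE_ends:
  assumes "a \<in> Arr LE"
  shows "src a \<in> Obj LE" "tgt a \<in> Obj LE"
  using assms by (auto simp: Arr_LE_iff)

lemma Arr_IE: "a \<in> Arr IE \<longleftrightarrow> a \<in> Hom LE (src a) (tgt a) \<and> src a \<in> Obj IE \<and> tgt a \<in> Obj IE"
  using Arr_LE_ends[of a] small_functor_iff
  by (auto simp: IndVectOp_def full_subcategory_def Hom_def)

lemma Arr_SV: "a \<in> Arr SV \<longleftrightarrow> a \<in> Hom LE (src a) (tgt a) \<and> src a \<in> Obj SV \<and> tgt a \<in> Obj SV"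
  using Arr_LE_ends[of a] by (auto simp: SigmaVect_def full_subcategory_def Hom_def)

lemma Hom_IE: "X \<in> Obj IE \<Longrightarrow> Y \<in> Obj IE \<Longrightarrow> Hom IE X Y = Hom LE X Y"
  by (auto simp: Hom_def[of IE] Arr_IE) (auto simp: Hom_def)

lemma Hom_SV: "X \<in> Obj SV \<Longrightarrow> Y \<in> Obj SV \<Longrightarrow> Hom SV X Y = Hom LE X Y"
  by (auto simp: Hom_def[of SV] Arr_SV) (auto simp: Hom_def)

text \<open>An equality of category records. Both sides are updates of \<open>LE\<close>, so only
  the sets of objects and of arrows have to be compared, and \<open>SV_IE\<close> is the content of
  that comparison.\<close>

lemma SV_full: "is_full_subcategory SV IE"
proof -
  have eq1: "Obj LE \<inter> {X. strong_space elts K X} = Obj IE \<inter> Obj SV"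
    using SV_IE by (auto simp: SigmaVect_def full_subcategory_def IndVectOp_def)
  have eq2: "{f \<in> Arr LE. Dom LE f \<in> {X. strong_space elts K X} \<and> Cod LE f \<in> {X. strong_space elts K X}} =
      {f \<in> Arr IE. Dom IE f \<in> Obj SV \<and> Cod IE f \<in> Obj SV}"
  proof -
    have "strong_space elts K (src f) \<longleftrightarrow> src f \<in> Obj SV" "strong_space elts K (tgt f) \<longleftrightarrow> tgt f \<in> Obj SV"
      if "f \<in> Arr LE" for f
      using Arr_LE_ends[OF that] strong_iff by (auto simp: Obj_SV)
    then show ?thesis
      using SV_IE by (auto simp: Arr_IE) (auto simp: Hom_def)
  qed
  have 1: "SV = LE\<lparr>Obj := Obj LE \<inter> {X. strong_space elts K X},
      Arr := {f \<in> Arr LE. Dom LE f \<in> {X. strong_space elts K X} \<and> Cod LE f \<in> {X. strong_space elts K X}}\<rparr>"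
    unfolding SigmaVect_def full_subcategory_def by (rule refl)
  have 2: "full_subcategory IE S = LE\<lparr>Obj := Obj IE \<inter> S, Arr := {f \<in> Arr IE. Dom IE f \<in> S \<and> Cod IE f \<in> S}\<rparr>" for S
  proof -
    have "IE\<lparr>Obj := A, Arr := B\<rparr> = LE\<lparr>Obj := A, Arr := B\<rparr>" for A B
      unfolding IndVectOp_def full_subcategory_def by simp
    then show ?thesis
      unfolding full_subcategory_def[of IE] .
  qed
  have "SV = full_subcategory IE (Obj SV)"
    unfolding 2 by (rule 1[unfolded eq1 eq2])
  then show ?thesis
    using SV_IE by (auto simp: is_full_subcategory_def)
qed

lemma Comp_LE_assoc:
  assumes a: "a \<in> Hom LE X Y" and b: "b \<in> Hom LE Y Z" and c: "c \<in> Hom LE Z W"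
  shows "Comp LE c (Comp LE b a) = Comp LE (Comp LE c b) a"
proof (rule Hom_LE_eqI[OF Comp_LE(1)[OF Comp_LE(1)[OF a b] c] Comp_LE(1)[OF a Comp_LE(1)[OF b c]]])
  show "cmp (Comp LE c (Comp LE b a)) V x = cmp (Comp LE (Comp LE c b) a) V x"
    if "sp V" "x \<in> el X V" for V x
    using that nt_closed[OF Hom_LE_cmp(1)[OF a] that]
    by (simp add: Comp_LE(2)[OF Comp_LE(1)[OF a b] c] Comp_LE(2)[OF a b]
        Comp_LE(2)[OF a Comp_LE(1)[OF b c]] Comp_LE(2)[OF b c])
qed

lemma Id_LE_Hom: "X \<in> Obj LE \<Longrightarrow> Id LE X \<in> Hom LE X X"
  unfolding Id_LE using mk_nat_in_Hom[OF _ _ nt_id] .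

lemma cmp_Id [simp]: "sp V \<Longrightarrow> x \<in> el X V \<Longrightarrow> cmp (Id LE X) V x = x"
  by (simp add: Id_LE)

lemma Comp_LE_Id:
  assumes a: "a \<in> Hom LE X Y"
  shows "Comp LE a (Id LE X) = a" "Comp LE (Id LE Y) a = a"
proof -
  have XY: "Id LE X \<in> Hom LE X X" "Id LE Y \<in> Hom LE Y Y"
    using a Id_LE_Hom by (auto simp: Hom_LE_iff)
  show "Comp LE a (Id LE X) = a"
    by (rule Hom_LE_eqI[OF Comp_LE(1)[OF XY(1) a] a]) (simp add: Comp_LE(2)[OF XY(1) a])
  show "Comp LE (Id LE Y) a = a"
    by (rule Hom_LE_eqI[OF Comp_LE(1)[OF a XY(2)] a])
      (simp add: Comp_LE(2)[OF a XY(2)] nt_closed[OF Hom_LE_cmp(1)[OF a]])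
qed

text \<open>By induction over its generation, torsion of the quotient is zero. For
  \<open>close\<close>, the coordinates of y are zero by induction, so those of a preimage x are
  torsion; the rule \<open>close\<close> in X makes x torsion and y zero.\<close>

lemma reflection_exists:
  assumes X: "X \<in> Obj LE"
  shows "\<exists>Q q. Q \<in> Obj LE \<and> nt X Q q \<and> (\<forall>V y. sp V \<longrightarrow> y \<in> el Q V \<longrightarrow> (\<exists>x\<in>el X V. q V x = y)) \<and>
    (\<forall>V x. sp V \<longrightarrow> x \<in> el X V \<longrightarrow> (q V x = \<zero>\<^bsub>FObj Q V\<^esub> \<longleftrightarrow> tors X V x)) \<and> torsion_free Q"
proof -
  have "subfun X (\<lambda>V. {x. tors X V x})"
    unfolding subfun_def subsp_def
    using X tors_el by (auto intro: tors.intros)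
  then obtain Q q where Q: "Q \<in> Obj LE" and q: "nt X Q q"
    and surj: "\<And>V y. sp V \<Longrightarrow> y \<in> el Q V \<Longrightarrow> \<exists>x\<in>el X V. q V x = y"
    and ker: "\<And>V x. sp V \<Longrightarrow> x \<in> el X V \<Longrightarrow> q V x = \<zero>\<^bsub>FObj Q V\<^esub> \<longleftrightarrow> x \<in> {x. tors X V x}"
    using quotient_functor[OF X] by blast
  have "y = \<zero>\<^bsub>FObj Q V\<^esub>" if "tors Q V y" for V y
    using that
  proof induction
    case (close y I)
    obtain x where x: "x \<in> el X (ds I)" "q (ds I) x = y"
      using surj[OF sp_ds close.hyps(1)] by blast
    have "tors X (ds I) x"
    proof (rule tors.close[OF x(1)])
      fix i
      assume i: "i \<in> elts I"
      have "q gr (act X (ds I) gr (\<lambda>a. co a i) x) = \<zero>\<^bsub>FObj Q gr\<^esub>"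
        using nt_nat[OF q sp_ds sp_ground lin_co[OF i] x(1)] x(2) close.IH[OF i] by simp
      then show "tors X gr (act X (ds I) gr (\<lambda>a. co a i) x)"
        using ker[OF sp_ground act_closed[OF X sp_ds sp_ground lin_co[OF i] x(1)]] by simp
    qed
    then show ?case
      using ker[OF sp_ds x(1)] x(2) by simp
  qed (use Q tors_el[OF Q] in \<open>auto simp: act_zero\<close>)
  then show ?thesis
    using Q q surj ker by (intro exI[of _ Q] exI[of _ q]) (auto simp: torsion_free_def)
qed

text \<open>Object and map are chosen together, so that \<open>rf\<close> and \<open>eta\<close>
  belong to the same quotient.\<close>

definition rf_pair :: "'u vfun \<Rightarrow> 'u vfun \<times> ('u space \<Rightarrow> 'u \<Rightarrow> 'u)"
  where "rf_pair X = (SOME (Q, q). Q \<in> Obj LE \<and> nt X Q q \<and>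
    (\<forall>V y. sp V \<longrightarrow> y \<in> el Q V \<longrightarrow> (\<exists>x\<in>el X V. q V x = y)) \<and>
    (\<forall>V x. sp V \<longrightarrow> x \<in> el X V \<longrightarrow> (q V x = \<zero>\<^bsub>FObj Q V\<^esub> \<longleftrightarrow> tors X V x)) \<and> torsion_free Q)"

definition rf :: "'u vfun \<Rightarrow> 'u vfun" where "rf X = fst (rf_pair X)"
definition eta :: "'u vfun \<Rightarrow> 'u space \<Rightarrow> 'u \<Rightarrow> 'u" where "eta X = snd (rf_pair X)"

lemma rf:
  assumes "X \<in> Obj LE"
  shows "rf X \<in> Obj LE" "nt X (rf X) (eta X)" "sp V \<Longrightarrow> y \<in> el (rf X) V \<Longrightarrow> \<exists>x\<in>el X V. eta X V x = y"
    "sp V \<Longrightarrow> x \<in> el X V \<Longrightarrow> eta X V x = \<zero>\<^bsub>FObj (rf X) V\<^esub> \<longleftrightarrow> tors X V x" "torsion_free (rf X)"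
proof -
  have "\<exists>p. case p of (Q, q) \<Rightarrow> Q \<in> Obj LE \<and> nt X Q q \<and>
      (\<forall>V y. sp V \<longrightarrow> y \<in> el Q V \<longrightarrow> (\<exists>x\<in>el X V. q V x = y)) \<and>
      (\<forall>V x. sp V \<longrightarrow> x \<in> el X V \<longrightarrow> (q V x = \<zero>\<^bsub>FObj Q V\<^esub> \<longleftrightarrow> tors X V x)) \<and> torsion_free Q"
    using reflection_exists[OF assms] by auto
  from someI_ex[OF this] have "case rf_pair X of (Q, q) \<Rightarrow> Q \<in> Obj LE \<and> nt X Q q \<and>
      (\<forall>V y. sp V \<longrightarrow> y \<in> el Q V \<longrightarrow> (\<exists>x\<in>el X V. q V x = y)) \<and>
      (\<forall>V x. sp V \<longrightarrow> x \<in> el X V \<longrightarrow> (q V x = \<zero>\<^bsub>FObj Q V\<^esub> \<longleftrightarrow> tors X V x)) \<and> torsion_free Q"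
    unfolding rf_pair_def .
  then have *: "rf X \<in> Obj LE \<and> nt X (rf X) (eta X) \<and>
      (\<forall>V y. sp V \<longrightarrow> y \<in> el (rf X) V \<longrightarrow> (\<exists>x\<in>el X V. eta X V x = y)) \<and>
      (\<forall>V x. sp V \<longrightarrow> x \<in> el X V \<longrightarrow> (eta X V x = \<zero>\<^bsub>FObj (rf X) V\<^esub> \<longleftrightarrow> tors X V x)) \<and> torsion_free (rf X)"
    unfolding rf_def eta_def by (simp add: case_prod_beta)
  then show "rf X \<in> Obj LE" "nt X (rf X) (eta X)" "sp V \<Longrightarrow> y \<in> el (rf X) V \<Longrightarrow> \<exists>x\<in>el X V. eta X V x = y"
    "sp V \<Longrightarrow> x \<in> el X V \<Longrightarrow> eta X V x = \<zero>\<^bsub>FObj (rf X) V\<^esub> \<longleftrightarrow> tors X V x" "torsion_free (rf X)"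
    by blast+
qed

lemma rf_SV: "X \<in> Obj LE \<Longrightarrow> rf X \<in> Obj SV"
  by (simp add: Obj_SV rf)

definition unit :: "'u vfun \<Rightarrow> 'u vnat" where "unit X = mk_nat X (rf X) (eta X)"

lemma unit_Hom: "X \<in> Obj LE \<Longrightarrow> unit X \<in> Hom LE X (rf X)"
  unfolding unit_def using mk_nat_in_Hom[OF _ rf(1,2)] .

text \<open>Transformations preserve torsion, so a map to a torsion-free functor kills it and
  factors through the quotient; surjectivity of \<open>eta\<close> gives uniqueness.\<close>

lemma unit_universal:
  assumes X: "X \<in> Obj LE" and Z: "Z \<in> Obj SV" and a: "a \<in> Hom LE X Z"
  shows "\<exists>!h. h \<in> Hom LE (rf X) Z \<and> Comp LE h (unit X) = a"
proof -
  have ZL: "Z \<in> Obj LE" and tf: "torsion_free Z"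
    using Z by (auto simp: Obj_SV)
  have cu: "cmp (Comp LE h (unit X)) V x = cmp h V (eta X V x)"
    if "h \<in> Hom LE (rf X) Z" "sp V" "x \<in> el X V" for h V x
    using Comp_LE(2)[OF unit_Hom[OF X] that] that by (simp add: unit_def)
  note na = Hom_LE_cmp(1)[OF a]
  have "cmp a V x = \<zero>\<^bsub>FObj Z V\<^esub>" if "sp V" "x \<in> el X V" "eta X V x = \<zero>\<^bsub>FObj (rf X) V\<^esub>" for V x
    using rf(4)[OF X that(1,2)] that(3) tors_nt[OF X ZL na] tf by (simp add: torsion_free_def)
  then obtain u where u: "nt (rf X) Z u" "\<And>V x. sp V \<Longrightarrow> x \<in> el X V \<Longrightarrow> u V (eta X V x) = cmp a V x"
    using quotient_universal[OF X rf(1)[OF X] ZL rf(2)[OF X] rf(3)[OF X] na] by metis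
  have uH: "mk_nat (rf X) Z u \<in> Hom LE (rf X) Z"
    by (rule mk_nat_in_Hom[OF rf(1)[OF X] ZL u(1)])
  show ?thesis
  proof (rule ex1I)
    show "mk_nat (rf X) Z u \<in> Hom LE (rf X) Z \<and> Comp LE (mk_nat (rf X) Z u) (unit X) = a"
    proof (intro conjI uH)
      show "Comp LE (mk_nat (rf X) Z u) (unit X) = a"
        by (rule Hom_LE_eqI[OF Comp_LE(1)[OF unit_Hom[OF X] uH] a])
          (simp add: cu[OF uH] u(2) nt_closed[OF rf(2)[OF X]])
    qed
    fix h
    assume h: "h \<in> Hom LE (rf X) Z \<and> Comp LE h (unit X) = a"
    then have hH: "h \<in> Hom LE (rf X) Z"
      by simp
    show "h = mk_nat (rf X) Z u"
    proof (rule Hom_LE_eqI[OF hH uH])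
      fix V y
      assume V: "sp V" and y: "y \<in> el (rf X) V"
      obtain x where x: "x \<in> el X V" "eta X V x = y"
        using rf(3)[OF X V y] by blast
      then show "cmp h V y = cmp (mk_nat (rf X) Z u) V y"
        using cu[OF hH V x(1)] h u(2)[OF V x(1)] V y by simp
    qed
  qed
qed

definition extend :: "'u vfun \<Rightarrow> 'u vfun \<Rightarrow> 'u vnat \<Rightarrow> 'u vnat"
  where "extend X Z a = (THE h. h \<in> Hom LE (rf X) Z \<and> Comp LE h (unit X) = a)"

lemma extend:
  assumes "X \<in> Obj LE" "Z \<in> Obj SV" "a \<in> Hom LE X Z"
  shows "extend X Z a \<in> Hom LE (rf X) Z" "Comp LE (extend X Z a) (unit X) = a"
  using theI'[OF unit_universal[OF assms]] by (auto simp: extend_def)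

lemma unit_epi:
  assumes "X \<in> Obj LE" "Z \<in> Obj SV" "g \<in> Hom LE (rf X) Z" "h \<in> Hom LE (rf X) Z"
    "Comp LE g (unit X) = Comp LE h (unit X)"
  shows "g = h"
  using unit_universal[OF assms(1,2) Comp_LE(1)[OF unit_Hom[OF assms(1)] assms(3)]] assms by metis

section \<open>The reflector and its adjunction\<close>

definition reflector where
  "reflector = \<lparr>FObj = (\<lambda>X\<in>Obj IE. rf X),
    FArr = (\<lambda>a\<in>Arr IE. extend (src a) (rf (tgt a)) (Comp LE (unit (tgt a)) a))\<rparr>"

lemma IE_LE: "X \<in> Obj IE \<Longrightarrow> X \<in> Obj LE"
  by (simp add: Obj_IE)

lemma SV_LE: "X \<in> Obj SV \<Longrightarrow> X \<in> Obj LE"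
  by (simp add: Obj_SV)

lemma reflector_arr:
  assumes X: "X \<in> Obj IE" and Y: "Y \<in> Obj IE" and a: "a \<in> Hom LE X Y"
  shows "FArr reflector a \<in> Hom LE (rf X) (rf Y)"
    "Comp LE (FArr reflector a) (unit X) = Comp LE (unit Y) a"
proof -
  have st: "src a = X" "tgt a = Y"
    using a by (auto simp: Hom_def)
  then have "a \<in> Arr IE"
    using X Y a by (simp add: Arr_IE)
  then have R: "FArr reflector a = extend X (rf Y) (Comp LE (unit Y) a)"
    by (simp add: reflector_def st)
  note e = extend[OF IE_LE[OF X] rf_SV[OF IE_LE[OF Y]] Comp_LE(1)[OF a unit_Hom[OF IE_LE[OF Y]]]]
  show "FArr reflector a \<in> Hom LE (rf X) (rf Y)"
    "Comp LE (FArr reflector a) (unit X) = Comp LE (unit Y) a"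
    unfolding R using e by auto
qed

lemma reflector_functor: "is_functor IE SV reflector"
  unfolding is_functor_def
proof (intro conjI ballI impI)
  show "FObj reflector \<in> Obj IE \<rightarrow>\<^sub>E Obj SV"
    using rf_SV IE_LE by (auto simp: reflector_def)
  have H: "FArr reflector a \<in> Hom SV (FObj reflector (Dom IE a)) (FObj reflector (Cod IE a))"
    if "a \<in> Arr IE" for a
    using that reflector_arr(1)[of "src a" "tgt a" a] Hom_SV[OF rf_SV rf_SV] IE_LE
    by (auto simp: Arr_IE reflector_def[THEN arg_cong[where f = FObj]])
  then show "FArr reflector a \<in> Hom SV (FObj reflector (Dom IE a)) (FObj reflector (Cod IE a))"
    if "a \<in> Arr IE" for a
    using that by blast
  show "FArr reflector \<in> Arr IE \<rightarrow>\<^sub>E Arr SV"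
  proof (rule PiE_I)
    show "FArr reflector a \<in> Arr SV" if "a \<in> Arr IE" for a
      using H[OF that] by (simp add: Hom_def)
  qed (simp add: reflector_def)
  show "FArr reflector (Id IE X) = Id SV (FObj reflector X)" if X: "X \<in> Obj IE" for X
  proof -
    note I = Id_LE_Hom[OF IE_LE[OF X]] and u = unit_Hom[OF IE_LE[OF X]]
    note S = rf_SV[OF IE_LE[OF X]]
    note r = reflector_arr[OF X X I]
    have "FArr reflector (Id LE X) = Id LE (rf X)"
      using r Comp_LE_Id[OF u] by (intro unit_epi[OF IE_LE[OF X] S r(1) Id_LE_Hom[OF SV_LE[OF S]]]) simp
    then show ?thesis
      using X by (simp add: reflector_def)
  qed
  fix a b
  assume a: "a \<in> Arr IE" and b: "b \<in> Arr IE" and ab: "Cod IE a = Dom IE b"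
  define X Y Z where "X = src a" and "Y = tgt a" and "Z = tgt b"
  have XYZ: "X \<in> Obj IE" "Y \<in> Obj IE" "Z \<in> Obj IE" and aH: "a \<in> Hom LE X Y" and bH: "b \<in> Hom LE Y Z"
    using a b ab by (auto simp: Arr_IE X_def Y_def Z_def)
  note u = unit_Hom[OF IE_LE[OF XYZ(1)]] unit_Hom[OF IE_LE[OF XYZ(2)]] unit_Hom[OF IE_LE[OF XYZ(3)]]
  note ra = reflector_arr[OF XYZ(1,2) aH] and rb = reflector_arr[OF XYZ(2,3) bH]
  note c = Comp_LE(1)[OF aH bH]
  note rc = reflector_arr[OF XYZ(1,3) c]
  have "FArr reflector (Comp LE b a) = Comp LE (FArr reflector b) (FArr reflector a)"
  proof (rule unit_epi[OF IE_LE[OF XYZ(1)] rf_SV[OF IE_LE[OF XYZ(3)]] rc(1) Comp_LE(1)[OF ra(1) rb(1)]])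
    show "Comp LE (FArr reflector (Comp LE b a)) (unit X) = Comp LE (Comp LE (FArr reflector b) (FArr reflector a)) (unit X)"
      using rc(2) Comp_LE_assoc[OF aH bH u(3)] rb(2) Comp_LE_assoc[OF aH u(2) rb(1)] ra(2)
        Comp_LE_assoc[OF u(1) ra(1) rb(1)] by simp
  qed
  then show "FArr reflector (Comp IE b a) = Comp SV (FArr reflector b) (FArr reflector a)"
    by simp
qed

text \<open>The bijections of the adjunction are precomposition with the unit. Naturality in Z is
  associativity; naturality in X also uses the square that defines the reflector on arrows.\<close>

lemma SV_reflective: "reflective_subcategory SV IE"
  unfolding reflective_subcategory_def
proof (intro conjI exI)
  show "is_full_subcategory SV IE"
    by (rule SV_full)
  show "adjunction IE SV reflector (inclusion_functor SV) (\<lambda>X Z h. Comp LE h (unit X))"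
    unfolding adjunction_def
  proof (intro conjI ballI reflector_functor)
    let ?G = "inclusion_functor SV"
    have Go: "FObj ?G Z = Z" if "Z \<in> Obj SV" for Z
      using that by (simp add: inclusion_functor_def)
    have Ga: "FArr ?G a = a" if "a \<in> Arr SV" for a
      using that by (simp add: inclusion_functor_def)
    have Ro: "FObj reflector X = rf X" if "X \<in> Obj IE" for X
      using that by (simp add: reflector_def)
    have SA: "a \<in> Hom IE (src a) (tgt a)" "src a \<in> Obj SV" "tgt a \<in> Obj SV" if "a \<in> Arr SV" for a
      using that SV_IE Hom_IE by (auto simp: Arr_SV)
    have IdS: "Id LE X \<in> Arr SV" if "X \<in> Obj SV" for X
      using that Id_LE_Hom[OF SV_LE[OF that]] by (auto simp: Arr_SV Id_LE)
    have CoS: "Comp LE b a \<in> Arr SV" if "a \<in> Arr SV" "b \<in> Arr SV" "tgt a = src b" for a b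
    proof -
      have "Comp LE b a \<in> Hom LE (src a) (tgt b)"
        using that by (intro Comp_LE(1)[of _ _ "tgt a"]) (auto simp: Arr_SV)
      moreover from this have "src (Comp LE b a) = src a" "tgt (Comp LE b a) = tgt b"
        by (auto simp: Hom_def)
      ultimately show ?thesis
        using that by (simp add: Arr_SV)
    qed
    show "is_functor SV IE ?G"
      unfolding is_functor_def
    proof (intro conjI ballI impI)
      show "FObj ?G \<in> Obj SV \<rightarrow>\<^sub>E Obj IE"
        using SV_IE by (auto simp: inclusion_functor_def)
      show "FArr ?G \<in> Arr SV \<rightarrow>\<^sub>E Arr IE"
        using SV_IE by (auto simp: inclusion_functor_def Arr_SV Arr_IE)
      show "FArr ?G a \<in> Hom IE (FObj ?G (Dom SV a)) (FObj ?G (Cod SV a))" if "a \<in> Arr SV" for a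
        using SA[OF that] that by (simp add: Ga Go)
      show "FArr ?G (Id SV X) = Id IE (FObj ?G X)" if "X \<in> Obj SV" for X
        using that IdS[OF that] by (simp add: Ga Go)
      show "FArr ?G (Comp SV b a) = Comp IE (FArr ?G b) (FArr ?G a)"
        if "a \<in> Arr SV" "b \<in> Arr SV" "Cod SV a = Dom SV b" for a b
        using that CoS[of a b] by (simp add: Ga)
    qed
    fix X Z
    assume X: "X \<in> Obj IE" and Z: "Z \<in> Obj SV"
    note u = unit_Hom[OF IE_LE[OF X]]
    have H1: "Hom SV (FObj reflector X) Z = Hom LE (rf X) Z"
      using Hom_SV[OF rf_SV[OF IE_LE[OF X]] Z] Ro[OF X] by simp
    have H2: "Hom IE X (FObj ?G Z) = Hom LE X Z"
      using Hom_IE[OF X SV_IE[OF Z]] Go[OF Z] by simp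
    show "bij_betw (\<lambda>h. Comp LE h (unit X)) (Hom SV (FObj reflector X) Z) (Hom IE X (FObj ?G Z))"
      unfolding H1 H2 bij_betw_def
    proof (intro conjI inj_onI subset_antisym subsetI)
      show "g = h" if "g \<in> Hom LE (rf X) Z" "h \<in> Hom LE (rf X) Z" "Comp LE g (unit X) = Comp LE h (unit X)" for g h
        using unit_epi[OF IE_LE[OF X] Z that] .
      show "a \<in> Hom LE X Z" if "a \<in> (\<lambda>h. Comp LE h (unit X)) ` Hom LE (rf X) Z" for a
        using that Comp_LE(1)[OF u] by auto
      show "a \<in> (\<lambda>h. Comp LE h (unit X)) ` Hom LE (rf X) Z" if "a \<in> Hom LE X Z" for a
        using imageI[OF extend(1)[OF IE_LE[OF X] Z that], of "\<lambda>h. Comp LE h (unit X)"]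
        unfolding extend(2)[OF IE_LE[OF X] Z that] .
    qed
    fix Z' f g
    assume Z': "Z' \<in> Obj SV" and f: "f \<in> Hom SV (FObj reflector X) Z" and g: "g \<in> Hom SV Z Z'"
    have g': "g \<in> Hom LE Z Z'" and gA: "g \<in> Arr SV"
      using g Hom_SV[OF Z Z'] by (auto simp: Hom_def[of SV])
    show "Comp LE (Comp SV g f) (unit X) = Comp IE (FArr ?G g) (Comp LE f (unit X))"
      using Comp_LE_assoc[OF u _ g'] f H1 by (simp add: Ga[OF gA])
  next
    fix X X' Z f h
    assume X: "X \<in> Obj IE" and X': "X' \<in> Obj IE" and Z: "Z \<in> Obj SV"
      and f: "f \<in> Hom SV (FObj reflector X) Z" and h: "h \<in> Hom IE X' X"
    have f': "f \<in> Hom LE (rf X) Z"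
      using f Hom_SV[OF rf_SV[OF IE_LE[OF X]] Z] X by (simp add: reflector_def)
    have h': "h \<in> Hom LE X' X"
      using h Hom_IE[OF X' X] by simp
    note r = reflector_arr[OF X' X h']
    show "Comp LE (Comp SV f (FArr reflector h)) (unit X') = Comp IE (Comp LE f (unit X)) h"
      using Comp_LE_assoc[OF unit_Hom[OF IE_LE[OF X']] r(1) f'] r(2)
        Comp_LE_assoc[OF h' unit_Hom[OF IE_LE[OF X]] f'] by simp
  qed
qed

section \<open>The torsion theory\<close>

text \<open>\<open>Ecl\<close> says that the map induced on torsion-free quotients is bijective, \<open>Mcl\<close> that the map
  induced on torsion parts is bijective.\<close>

definition Ecl :: "'u vfun \<Rightarrow> 'u vfun \<Rightarrow> ('u space \<Rightarrow> 'u \<Rightarrow> 'u) \<Rightarrow> bool"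
  where "Ecl X Y t \<longleftrightarrow> (\<forall>V. sp V \<longrightarrow> (\<forall>x\<in>el X V. tors Y V (t V x) \<longrightarrow> tors X V x) \<and>
    (\<forall>y\<in>el Y V. \<exists>x\<in>el X V. tors Y V (y \<ominus>\<^bsub>FObj Y V\<^esub> t V x)))"

definition Mcl :: "'u vfun \<Rightarrow> 'u vfun \<Rightarrow> ('u space \<Rightarrow> 'u \<Rightarrow> 'u) \<Rightarrow> bool"
  where "Mcl X Y t \<longleftrightarrow> (\<forall>V. sp V \<longrightarrow> (\<forall>x. tors X V x \<longrightarrow> t V x = \<zero>\<^bsub>FObj Y V\<^esub> \<longrightarrow> x = \<zero>\<^bsub>FObj X V\<^esub>) \<and>
    (\<forall>y. tors Y V y \<longrightarrow> (\<exists>x. tors X V x \<and> t V x = y)))"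

lemma EclD:
  assumes "Ecl X Y t" "sp V"
  shows "x \<in> el X V \<Longrightarrow> tors Y V (t V x) \<Longrightarrow> tors X V x"
    "y \<in> el Y V \<Longrightarrow> \<exists>x\<in>el X V. tors Y V (y \<ominus>\<^bsub>FObj Y V\<^esub> t V x)"
  using assms by (auto simp: Ecl_def)

lemma MclD:
  assumes "Mcl X Y t" "sp V"
  shows "tors X V x \<Longrightarrow> t V x = \<zero>\<^bsub>FObj Y V\<^esub> \<Longrightarrow> x = \<zero>\<^bsub>FObj X V\<^esub>"
    "tors Y V y \<Longrightarrow> \<exists>x. tors X V x \<and> t V x = y"
  using assms by (auto simp: Mcl_def)

lemma Mcl_mk_nat:
  assumes "X \<in> Obj LE"
  shows "Mcl X Y (cmp (mk_nat X Y t)) \<longleftrightarrow> Mcl X Y t"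
proof -
  have "cmp (mk_nat X Y t) V x = t V x" if "sp V" "tors X V x" for V x
    using tors_el[OF assms that(2)] by simp
  then show ?thesis
    unfolding Mcl_def by (simp cong: conj_cong)
qed

lemma Mcl_inj:
  assumes X: "X \<in> Obj LE" and Y: "Y \<in> Obj LE" and t: "nt X Y t" and M: "Mcl X Y t" and V: "sp V"
    and x: "tors X V x" and x': "tors X V x'" and eq: "t V x = t V x'"
  shows "x = x'"
proof -
  have m: "x \<in> el X V" "x' \<in> el X V"
    using tors_el[OF X] x x' by auto
  have "t V (x \<ominus>\<^bsub>FObj X V\<^esub> x') = \<zero>\<^bsub>FObj Y V\<^esub>"
    using nt_minus[OF X Y t V m] eq nt_closed[OF t V m(2)] Y V by simp
  then have "x \<ominus>\<^bsub>FObj X V\<^esub> x' = \<zero>\<^bsub>FObj X V\<^esub>"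
    using MclD(1)[OF M V tors_minus[OF X x x']] by simp
  then show ?thesis
    using m X V by (simp add: sp_minus_eq_zero)
qed

lemma tors_add_minus:
  assumes X: "X \<in> Obj LE" and V: "sp V" and m: "x \<in> el X V" "y \<in> el X V"
    and t: "tors X V (x \<ominus>\<^bsub>FObj X V\<^esub> y)"
  shows "tors X V x \<longleftrightarrow> tors X V y"
proof
  have s: "sp (FObj X V)"
    using X V by simp
  interpret M: module K "FObj X V"
    by (rule sp_module[OF s])
  show "tors X V x" if "tors X V y"
    using tors.add[OF t that] sp_add_minus(1)[OF s m] by simp
  show "tors X V y" if "tors X V x"
  proof -
    have "x \<ominus>\<^bsub>FObj X V\<^esub> (x \<ominus>\<^bsub>FObj X V\<^esub> y) = y"
      using m by (simp add: M.minus_eq M.minus_add M.r_neg1 M.r_neg2)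
    then show ?thesis
      using tors_minus[OF X that t] by simp
  qed
qed

text \<open>Given b, choose a with b - e a torsion. The filler must send b to l a + c for the one
  torsion element c with m c = k (b - e a), available because m is bijective on torsion. The
  relation R expresses this without choices: b and c correspond if m c = k b and, for a common a,
  they are congruent to e a and l a modulo torsion.\<close>

lemma orthogonal_Ecl_Mcl:
  assumes A: "A \<in> Obj LE" and B: "B \<in> Obj LE" and C: "C \<in> Obj LE" and D: "D \<in> Obj LE"
    and e: "nt A B e" and m: "nt C D m" and l: "nt A C l" and k: "nt B D k"
    and E: "Ecl A B e" and M: "Mcl C D m"
    and sq: "\<And>V a. sp V \<Longrightarrow> a \<in> el A V \<Longrightarrow> m V (l V a) = k V (e V a)"
  shows "\<exists>h. nt B C h \<and> (\<forall>V a. sp V \<longrightarrow> a \<in> el A V \<longrightarrow> h V (e V a) = l V a) \<and>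
    (\<forall>V b. sp V \<longrightarrow> b \<in> el B V \<longrightarrow> m V (h V b) = k V b)"
proof -
  define R where "R V b c \<longleftrightarrow> b \<in> el B V \<and> c \<in> el C V \<and> m V c = k V b \<and>
    (\<exists>a\<in>el A V. tors B V (b \<ominus>\<^bsub>FObj B V\<^esub> e V a) \<and> tors C V (c \<ominus>\<^bsub>FObj C V\<^esub> l V a))" for V b c
  have RI: "R V b c" if "b \<in> el B V" "c \<in> el C V" "m V c = k V b" "a \<in> el A V"
    "tors B V (b \<ominus>\<^bsub>FObj B V\<^esub> e V a)" "tors C V (c \<ominus>\<^bsub>FObj C V\<^esub> l V a)" for V a b c
    using that unfolding R_def by blast
  have RE: "b \<in> el B V \<and> c \<in> el C V \<and> m V c = k V b \<and>
    (\<exists>a\<in>el A V. tors B V (b \<ominus>\<^bsub>FObj B V\<^esub> e V a) \<and> tors C V (c \<ominus>\<^bsub>FObj C V\<^esub> l V a))" if "R V b c" for V b c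
    using that unfolding R_def .
  have "\<exists>h. nt B C h \<and> (\<forall>V b c. sp V \<longrightarrow> (R V b c \<longleftrightarrow> b \<in> el B V \<and> c = h V b))"
  proof (rule nt_of_rel[OF B C])
    show "b \<in> el B V \<and> c \<in> el C V" if "R V b c" for V b c
      using RE[OF that] by blast
    show "\<exists>c. R V b c" if V: "sp V" and b: "b \<in> el B V" for V b
    proof -
      have sB: "sp (FObj B V)" and sC: "sp (FObj C V)" and sD: "sp (FObj D V)"
        using B C D V by auto
      obtain a where a: "a \<in> el A V" "tors B V (b \<ominus>\<^bsub>FObj B V\<^esub> e V a)"
        using EclD(2)[OF E V b] by blast
      obtain c where c: "tors C V c" "m V c = k V (b \<ominus>\<^bsub>FObj B V\<^esub> e V a)"
        using MclD(2)[OF M V tors_nt[OF B D k a(2)]] by blast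
      have mem: "c \<in> el C V" "l V a \<in> el C V" "e V a \<in> el B V"
        using tors_el[OF C c(1)] nt_closed[OF l V a(1)] nt_closed[OF e V a(1)] by auto
      have "m V (l V a \<oplus>\<^bsub>FObj C V\<^esub> c) = k V (e V a) \<oplus>\<^bsub>FObj D V\<^esub> (k V b \<ominus>\<^bsub>FObj D V\<^esub> k V (e V a))"
        using nt_add[OF m V mem(2,1)] sq[OF V a(1)] c(2) nt_minus[OF B D k V b mem(3)] by simp
      also have "\<dots> = k V b"
        using sp_add_minus(2)[OF sD] nt_closed[OF k V] b mem(3) by simp
      finally have "R V b (l V a \<oplus>\<^bsub>FObj C V\<^esub> c)"
        using a b c mem sC sp_add_minus(4)[OF sC mem(1,2)] by (intro RI[where a = a]) auto
      then show ?thesis ..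
    qed
    show "c = \<zero>\<^bsub>FObj C V\<^esub>" if V: "sp V" and R: "R V \<zero>\<^bsub>FObj B V\<^esub> c" for V c
    proof -
      obtain a where a: "a \<in> el A V" "tors B V (\<zero>\<^bsub>FObj B V\<^esub> \<ominus>\<^bsub>FObj B V\<^esub> e V a)" "tors C V (c \<ominus>\<^bsub>FObj C V\<^esub> l V a)"
        and c: "c \<in> el C V" "m V c = k V \<zero>\<^bsub>FObj B V\<^esub>"
        using RE[OF R] by blast
      \<comment> \<open>For b = 0 torsion travels around the square: e a is torsion, hence so are a,
        l a and c, and m is injective on torsion.\<close>
      have "tors B V (e V a)"
        using tors_add_minus[OF B V _ nt_closed[OF e V a(1)] a(2)] B V by (simp add: tors.zero)
      then have "tors C V (l V a)"
        using EclD(1)[OF E V a(1)] tors_nt[OF A C l] by blast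
      then have "tors C V c"
        using tors_add_minus[OF C V c(1) nt_closed[OF l V a(1)] a(3)] by simp
      then show ?thesis
        using MclD(1)[OF M V] c(2) nt_zero[OF B D k V] by simp
    qed
    show "R V (b \<oplus>\<^bsub>FObj B V\<^esub> b') (c \<oplus>\<^bsub>FObj C V\<^esub> c')" if V: "sp V" and R: "R V b c" and R': "R V b' c'" for V b c b' c'
    proof -
      obtain a where a: "a \<in> el A V" "tors B V (b \<ominus>\<^bsub>FObj B V\<^esub> e V a)" "tors C V (c \<ominus>\<^bsub>FObj C V\<^esub> l V a)"
        and bc: "b \<in> el B V" "c \<in> el C V" "m V c = k V b"
        using RE[OF R] by blast
      obtain a' where a': "a' \<in> el A V" "tors B V (b' \<ominus>\<^bsub>FObj B V\<^esub> e V a')" "tors C V (c' \<ominus>\<^bsub>FObj C V\<^esub> l V a')"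
        and bc': "b' \<in> el B V" "c' \<in> el C V" "m V c' = k V b'"
        using RE[OF R'] by blast
      have sA: "sp (FObj A V)" and sB: "sp (FObj B V)" and sC: "sp (FObj C V)"
        using A B C V by auto
      have em: "e V a \<in> el B V" "e V a' \<in> el B V" "l V a \<in> el C V" "l V a' \<in> el C V"
        using nt_closed[OF e V] nt_closed[OF l V] a(1) a'(1) by auto
      show ?thesis
      proof (rule RI[where a = "a \<oplus>\<^bsub>FObj A V\<^esub> a'"])
        show "m V (c \<oplus>\<^bsub>FObj C V\<^esub> c') = k V (b \<oplus>\<^bsub>FObj B V\<^esub> b')"
          using bc bc' V by (simp add: nt_add[OF m] nt_add[OF k])
        show "tors B V (b \<oplus>\<^bsub>FObj B V\<^esub> b' \<ominus>\<^bsub>FObj B V\<^esub> e V (a \<oplus>\<^bsub>FObj A V\<^esub> a'))"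
          using tors.add[OF a(2) a'(2)] nt_add[OF e V a(1) a'(1)] sp_minus_add_distrib[OF sB bc(1) em(1) bc'(1) em(2)] by simp
        show "tors C V (c \<oplus>\<^bsub>FObj C V\<^esub> c' \<ominus>\<^bsub>FObj C V\<^esub> l V (a \<oplus>\<^bsub>FObj A V\<^esub> a'))"
          using tors.add[OF a(3) a'(3)] nt_add[OF l V a(1) a'(1)] sp_minus_add_distrib[OF sC bc(2) em(3) bc'(2) em(4)] by simp
      qed (use a a' bc bc' sA sB sC in auto)
    qed
    show "R V (d \<odot>\<^bsub>FObj B V\<^esub> b) (d \<odot>\<^bsub>FObj C V\<^esub> c)" if V: "sp V" and d: "d \<in> carrier K" and R: "R V b c" for V d b c
    proof -
      obtain a where a: "a \<in> el A V" "tors B V (b \<ominus>\<^bsub>FObj B V\<^esub> e V a)" "tors C V (c \<ominus>\<^bsub>FObj C V\<^esub> l V a)"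
        and bc: "b \<in> el B V" "c \<in> el C V" "m V c = k V b"
        using RE[OF R] by blast
      have sA: "sp (FObj A V)" and sB: "sp (FObj B V)" and sC: "sp (FObj C V)"
        using A B C V by auto
      show ?thesis
      proof (rule RI[where a = "d \<odot>\<^bsub>FObj A V\<^esub> a"])
        show "m V (d \<odot>\<^bsub>FObj C V\<^esub> c) = k V (d \<odot>\<^bsub>FObj B V\<^esub> b)"
          using bc V d by (simp add: nt_smult[OF m] nt_smult[OF k])
        show "tors B V (d \<odot>\<^bsub>FObj B V\<^esub> b \<ominus>\<^bsub>FObj B V\<^esub> e V (d \<odot>\<^bsub>FObj A V\<^esub> a))"
          using tors.smult[OF d a(2)] nt_smult[OF e V d a(1)] sp_smult_minus[OF sB bc(1) nt_closed[OF e V a(1)] d] by simp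
        show "tors C V (d \<odot>\<^bsub>FObj C V\<^esub> c \<ominus>\<^bsub>FObj C V\<^esub> l V (d \<odot>\<^bsub>FObj A V\<^esub> a))"
          using tors.smult[OF d a(3)] nt_smult[OF l V d a(1)] sp_smult_minus[OF sC bc(2) nt_closed[OF l V a(1)] d] by simp
      qed (use a bc sA sB sC d in auto)
    qed
    show "R W (act B V W f b) (act C V W f c)" if VW: "sp V" "sp W" "lin V W f" and R: "R V b c" for V W f b c
    proof -
      obtain a where a: "a \<in> el A V" "tors B V (b \<ominus>\<^bsub>FObj B V\<^esub> e V a)" "tors C V (c \<ominus>\<^bsub>FObj C V\<^esub> l V a)"
        and bc: "b \<in> el B V" "c \<in> el C V" "m V c = k V b"
        using RE[OF R] by blast
      show ?thesis
      proof (rule RI[where a = "act A V W f a"])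
        show "m W (act C V W f c) = k W (act B V W f b)"
          using bc VW by (simp add: nt_nat[OF m] nt_nat[OF k])
        show "tors B W (act B V W f b \<ominus>\<^bsub>FObj B W\<^esub> e W (act A V W f a))"
          using tors.act[OF a(2) VW(2,3)] act_minus[OF B VW bc(1) nt_closed[OF e VW(1) a(1)]] nt_nat[OF e VW a(1)] by simp
        show "tors C W (act C V W f c \<ominus>\<^bsub>FObj C W\<^esub> l W (act A V W f a))"
          using tors.act[OF a(3) VW(2,3)] act_minus[OF C VW bc(2) nt_closed[OF l VW(1) a(1)]] nt_nat[OF l VW a(1)] by simp
      qed (use A B C a bc VW in auto)
    qed
  qed
  then obtain h where h: "nt B C h" and hR: "\<And>V b c. sp V \<Longrightarrow> R V b c \<longleftrightarrow> b \<in> el B V \<and> c = h V b"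
    by blast
  have "h V (e V a) = l V a" if V: "sp V" and a: "a \<in> el A V" for V a
  proof -
    have "R V (e V a) (l V a)"
      using a V B C nt_closed[OF e V a] nt_closed[OF l V a] sq[OF V a]
      by (intro RI[where a = a]) (auto simp: tors.zero)
    then show ?thesis
      using hR[OF V] by simp
  qed
  moreover have "m V (h V b) = k V b" if "sp V" "b \<in> el B V" for V b
    using hR[OF that(1), of b "h V b"] that(2) RE by blast
  ultimately show ?thesis
    using h by blast
qed

text \<open>The fillers agree on e a. On the torsion element b - e a both take torsion values with
  the same image under m, where m is injective.\<close>

lemma orthogonal_Ecl_Mcl_unique:
  assumes A: "A \<in> Obj LE" and B: "B \<in> Obj LE" and C: "C \<in> Obj LE" and D: "D \<in> Obj LE"
    and e: "nt A B e" and m: "nt C D m" and E: "Ecl A B e" and M: "Mcl C D m"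
    and h: "nt B C h" and h': "nt B C h'"
    and he: "\<And>V a. sp V \<Longrightarrow> a \<in> el A V \<Longrightarrow> h V (e V a) = h' V (e V a)"
    and mh: "\<And>V b. sp V \<Longrightarrow> b \<in> el B V \<Longrightarrow> m V (h V b) = m V (h' V b)"
    and V: "sp V" and b: "b \<in> el B V"
  shows "h V b = h' V b"
proof -
  obtain a where a: "a \<in> el A V" "tors B V (b \<ominus>\<^bsub>FObj B V\<^esub> e V a)"
    using EclD(2)[OF E V b] by blast
  note ea = nt_closed[OF e V a(1)]
  have bm: "b \<ominus>\<^bsub>FObj B V\<^esub> e V a \<in> el B V"
    using B V b ea by simp
  have "h V (b \<ominus>\<^bsub>FObj B V\<^esub> e V a) = h' V (b \<ominus>\<^bsub>FObj B V\<^esub> e V a)"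
    by (rule Mcl_inj[OF C D m M V tors_nt[OF B C h a(2)] tors_nt[OF B C h' a(2)] mh[OF V bm]])
  moreover have "b = (b \<ominus>\<^bsub>FObj B V\<^esub> e V a) \<oplus>\<^bsub>FObj B V\<^esub> e V a"
    using sp_add_minus(1)[OF sp_FObj[OF B V] b ea] by simp
  ultimately show ?thesis
    using nt_add[OF h V bm ea] nt_add[OF h' V bm ea] he[OF V a(1)] by simp
qed

text \<open>An element of P is an element b of B with a class in A/tA having the same image in B/tB.
  Torsion of P has trivial class, since A/tA is torsion-free, and consists of the pairs (b, 0) with
  b torsion; so P and B have the same torsion. Every class comes from A, so P agrees with A modulo
  torsion.\<close>

lemma Ecl_Mcl_factorization:
  assumes A: "A \<in> Obj LE" and B: "B \<in> Obj LE" and f: "nt A B f" and bA: "bdd A" and bB: "bdd B"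
  obtains P e m where "P \<in> Obj LE" "bdd P" "nt A P e" "nt P B m" "Ecl A P e" "Mcl P B m"
    "\<And>V a. sp V \<Longrightarrow> a \<in> el A V \<Longrightarrow> m V (e V a) = f V a"
proof -
  note RA = rf[OF A] and RB = rf[OF B]
  have nf: "nt A (rf B) (\<lambda>V a. eta B V (f V a))"
    by (rule nt_comp[OF f RB(2)])
  have "eta B V (f V a) = \<zero>\<^bsub>FObj (rf B) V\<^esub>" if "sp V" "a \<in> el A V" "eta A V a = \<zero>\<^bsub>FObj (rf A) V\<^esub>" for V a
    using RA(4)[OF that(1,2)] that(3) RB(4)[OF that(1) nt_closed[OF f that(1,2)]] tors_nt[OF A B f] by simp
  then obtain g where g: "nt (rf A) (rf B) g" "\<And>V a. sp V \<Longrightarrow> a \<in> el A V \<Longrightarrow> g V (eta A V a) = eta B V (f V a)"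
    using quotient_universal[OF A RA(1) RB(1) RA(2,3) nf] by metis
  obtain P p q where P: "P \<in> Obj LE" and p: "nt P B p" and q: "nt P (rf A) q"
    and pq: "\<And>V x. sp V \<Longrightarrow> x \<in> el P V \<Longrightarrow> eta B V (p V x) = g V (q V x)"
    and joint: "\<And>V x y. sp V \<Longrightarrow> x \<in> el P V \<Longrightarrow> y \<in> el P V \<Longrightarrow> p V x = p V y \<Longrightarrow> q V x = q V y \<Longrightarrow> x = y"
    and ex: "\<And>V b c. sp V \<Longrightarrow> b \<in> el B V \<Longrightarrow> c \<in> el (rf A) V \<Longrightarrow> eta B V b = g V c \<Longrightarrow>
      \<exists>x\<in>el P V. p V x = b \<and> q V x = c"
    using pullback_functor[OF B RA(1) RB(1) RB(2) g(1)] by blast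
  have bR: "bdd (rf A)"
    by (rule bdd_quotient[OF RA(2) _ bA]) (rule RA(3))
  have bP: "bdd P"
    by (rule bdd_pair[OF P B RA(1) p q _ bB bR]) (rule joint)
  define R where "R V a x \<longleftrightarrow> a \<in> el A V \<and> x \<in> el P V \<and> p V x = f V a \<and> q V x = eta A V a" for V a x
  have "\<exists>e. nt A P e \<and> (\<forall>V a x. sp V \<longrightarrow> (R V a x \<longleftrightarrow> a \<in> el A V \<and> x = e V a))"
  proof (rule nt_of_rel[OF A P])
    show "\<exists>x. R V a x" if V: "sp V" and a: "a \<in> el A V" for V a
      using ex[OF V nt_closed[OF f V a] nt_closed[OF RA(2) V a]] g(2)[OF V a] a by (auto simp: R_def)
    show "x = \<zero>\<^bsub>FObj P V\<^esub>" if V: "sp V" and R: "R V \<zero>\<^bsub>FObj A V\<^esub> x" for V x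
      by (rule joint[OF V])
        (use R V P A B RA(1) nt_zero[OF P B p V] nt_zero[OF P RA(1) q V] nt_zero[OF A B f V] nt_zero[OF A RA(1,2) V]
          in \<open>auto simp: R_def\<close>)
    show "R V (a \<oplus>\<^bsub>FObj A V\<^esub> a') (x \<oplus>\<^bsub>FObj P V\<^esub> x')" if "sp V" "R V a x" "R V a' x'" for V a x a' x'
      using that P A by (auto simp: R_def nt_add[OF p] nt_add[OF q] nt_add[OF f] nt_add[OF RA(2)])
    show "R V (c \<odot>\<^bsub>FObj A V\<^esub> a) (c \<odot>\<^bsub>FObj P V\<^esub> x)" if "sp V" "c \<in> carrier K" "R V a x" for V c a x
      using that P A by (auto simp: R_def nt_smult[OF p] nt_smult[OF q] nt_smult[OF f] nt_smult[OF RA(2)])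
    show "R W (act A V W l a) (act P V W l x)" if "sp V" "sp W" "lin V W l" "R V a x" for V W l a x
      using that P A by (auto simp: R_def nt_nat[OF p] nt_nat[OF q] nt_nat[OF f] nt_nat[OF RA(2)])
  qed (auto simp: R_def)
  then obtain e where e: "nt A P e" and "\<And>V a x. sp V \<Longrightarrow> R V a x \<longleftrightarrow> a \<in> el A V \<and> x = e V a"
    by blast
  then have pe: "p V (e V a) = f V a" and qe: "q V (e V a) = eta A V a" if "sp V" "a \<in> el A V" for V a
    using that by (auto simp: R_def)
  \<comment> \<open>Membership of (b, 0) in P is clear, but that it is torsion in P needs an
    induction over the generation of b. In the case \<open>close\<close> the coordinates of the pair
    are, by joint injectivity, the torsion lifts provided by the induction.\<close>
  have kerq: "\<exists>x. tors P V x \<and> p V x = b \<and> q V x = \<zero>\<^bsub>FObj (rf A) V\<^esub>" if "tors B V b" for V b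
    using that
  proof induction
    case (zero V)
    then show ?case
      using nt_zero[OF P B p] nt_zero[OF P RA(1) q] tors.zero by blast
  next
    case (add V b b')
    then obtain x x' where x: "tors P V x" "p V x = b" "q V x = \<zero>\<^bsub>FObj (rf A) V\<^esub>"
      "tors P V x'" "p V x' = b'" "q V x' = \<zero>\<^bsub>FObj (rf A) V\<^esub>"
      by blast
    have "sp V" "x \<in> el P V" "x' \<in> el P V"
      using tors_el[OF P] x by auto
    then show ?case
      using x RA(1) tors.add[OF x(1,4)] by (intro exI[of _ "x \<oplus>\<^bsub>FObj P V\<^esub> x'"]) (simp add: nt_add[OF p] nt_add[OF q])
  next
    case (smult c V b)
    then obtain x where x: "tors P V x" "p V x = b" "q V x = \<zero>\<^bsub>FObj (rf A) V\<^esub>"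
      by blast
    have "sp V" "x \<in> el P V"
      using tors_el[OF P] x by auto
    then show ?case
      using x RA(1) smult.hyps(1) tors.smult[OF smult.hyps(1) x(1)]
      by (intro exI[of _ "c \<odot>\<^bsub>FObj P V\<^esub> x"]) (simp add: nt_smult[OF p] nt_smult[OF q])
  next
    case (act V b W l)
    then obtain x where x: "tors P V x" "p V x = b" "q V x = \<zero>\<^bsub>FObj (rf A) V\<^esub>"
      by blast
    have "sp V" "x \<in> el P V"
      using tors_el[OF P] x by auto
    then show ?case
      using x RA(1) act.hyps(2,3) tors.act[OF x(1) act.hyps(2,3)]
      by (intro exI[of _ "act P V W l x"]) (simp add: nt_nat[OF p] nt_nat[OF q] act_zero)
  next
    case (close b I)
    have "tors B (ds I) b"
      using tors.close[OF close.hyps] .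
    then have "eta B (ds I) b = g (ds I) \<zero>\<^bsub>FObj (rf A) (ds I)\<^esub>"
      using RB(4)[OF sp_ds close.hyps(1)] nt_zero[OF RA(1) RB(1) g(1) sp_ds] by simp
    then obtain x where x: "x \<in> el P (ds I)" "p (ds I) x = b" "q (ds I) x = \<zero>\<^bsub>FObj (rf A) (ds I)\<^esub>"
      using ex[OF sp_ds close.hyps(1) sp_closed(1)[OF sp_FObj[OF RA(1) sp_ds]]] by blast
    have "tors P (ds I) x"
    proof (rule tors.close[OF x(1)])
      fix i
      assume i: "i \<in> elts I"
      obtain y where y: "tors P gr y" "p gr y = act B (ds I) gr (\<lambda>a. co a i) b" "q gr y = \<zero>\<^bsub>FObj (rf A) gr\<^esub>"
        using close.IH[OF i] by blast
      have "act P (ds I) gr (\<lambda>a. co a i) x = y"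
        by (rule joint[OF sp_ground])
          (use tors_el[OF P y(1)] y(2,3) act_closed[OF P sp_ds sp_ground lin_co[OF i] x(1)]
          nt_nat[OF p sp_ds sp_ground lin_co[OF i] x(1)] nt_nat[OF q sp_ds sp_ground lin_co[OF i] x(1)]
          act_zero[OF RA(1) sp_ds sp_ground lin_co[OF i]] x(2,3) in auto)
      then show "tors P gr (act P (ds I) gr (\<lambda>a. co a i) x)"
        using y(1) by simp
    qed
    then show ?case
      using x by blast
  qed
  have "Ecl A P e"
    unfolding Ecl_def
  proof (intro allI impI conjI ballI)
    fix V
    assume V: "sp V"
    show "tors A V a" if a: "a \<in> el A V" and t: "tors P V (e V a)" for a
      using tors_nt[OF P RA(1) q t] RA(5) qe[OF V a] RA(4)[OF V a] by (simp add: torsion_free_def)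
    show "\<exists>a\<in>el A V. tors P V (x \<ominus>\<^bsub>FObj P V\<^esub> e V a)" if x: "x \<in> el P V" for x
    proof -
      obtain a where a: "a \<in> el A V" "eta A V a = q V x"
        using RA(3)[OF V nt_closed[OF q V x]] by blast
      \<comment> \<open>Subtracting e a removes the class of x, so y is a pair with second entry
        zero and torsion first entry; joint injectivity identifies it with a lift from
        \<open>kerq\<close>.\<close>
      define y where "y = x \<ominus>\<^bsub>FObj P V\<^esub> e V a"
      have y: "y \<in> el P V"
        using P V x nt_closed[OF e V a(1)] by (simp add: y_def)
      have qy: "q V y = \<zero>\<^bsub>FObj (rf A) V\<^esub>"
        unfolding y_def using nt_minus[OF P RA(1) q V x nt_closed[OF e V a(1)]] qe[OF V a(1)] a(2)
          nt_closed[OF q V x] RA(1) V by simp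
      have "tors B V (p V y)"
        using pq[OF V y] qy nt_zero[OF RA(1) RB(1) g(1) V] RB(4)[OF V nt_closed[OF p V y]] by simp
      then obtain z where z: "tors P V z" "p V z = p V y" "q V z = \<zero>\<^bsub>FObj (rf A) V\<^esub>"
        using kerq by blast
      have "z = y"
        using joint[OF V _ y z(2)] z(3) qy tors_el[OF P z(1)] by simp
      then show ?thesis
        using a(1) z(1) by (auto simp: y_def)
    qed
  qed
  moreover have "Mcl P B p"
    unfolding Mcl_def
  proof (intro allI impI conjI)
    fix V x
    assume V: "sp V" and t: "tors P V x" and px: "p V x = \<zero>\<^bsub>FObj B V\<^esub>"
    have qx: "q V x = \<zero>\<^bsub>FObj (rf A) V\<^esub>"
      using tors_nt[OF P RA(1) q t] RA(5) by (simp add: torsion_free_def)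
    show "x = \<zero>\<^bsub>FObj P V\<^esub>"
      by (rule joint[OF V])
        (use px qx P V tors_el[OF P t] nt_zero[OF P B p V] nt_zero[OF P RA(1) q V] in auto)
  next
    show "\<exists>x. tors P V x \<and> p V x = b" if "tors B V b" for V b
      using kerq[OF that] by blast
  qed
  ultimately show ?thesis
    using that P bP e p pe by blast
qed

section \<open>The factorization system\<close>

definition Eclass :: "'u vnat set" where "Eclass = {a \<in> Arr IE. Ecl (src a) (tgt a) (cmp a)}"
definition Mclass :: "'u vnat set" where "Mclass = {a \<in> Arr IE. Mcl (src a) (tgt a) (cmp a)}"

lemma ArrE:
  assumes "a \<in> Arr IE"
  shows "a \<in> Hom LE (src a) (tgt a)" "src a \<in> Obj LE" "tgt a \<in> Obj LE" "nt (src a) (tgt a) (cmp a)"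
  using assms IE_LE Hom_LE_cmp(1) by (auto simp: Arr_IE)

lemma class_orthogonal:
  assumes e: "e \<in> Eclass" and m: "m \<in> Mclass"
  shows "orthogonal IE e m"
  unfolding orthogonal_def IE_simps
proof (intro ballI impI)
  define A B C D where "A = src e" and "B = tgt e" and "C = src m" and "D = tgt m"
  have O: "A \<in> Obj IE" "B \<in> Obj IE" "C \<in> Obj IE" "D \<in> Obj IE"
    using e m by (auto simp: Eclass_def Mclass_def Arr_IE A_def B_def C_def D_def)
  note L = O[THEN IE_LE]
  have eH: "e \<in> Hom LE A B" and E: "Ecl A B (cmp e)" and mH: "m \<in> Hom LE C D" and M: "Mcl C D (cmp m)"
    using e m by (auto simp: Eclass_def Mclass_def Arr_IE A_def B_def C_def D_def)
  note ne = Hom_LE_cmp(1)[OF eH] and nm = Hom_LE_cmp(1)[OF mH]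
  fix l k
  assume "l \<in> Hom IE (src e) (src m)" "k \<in> Hom IE (tgt e) (tgt m)" and eq: "Comp LE m l = Comp LE k e"
  then have lH: "l \<in> Hom LE A C" and kH: "k \<in> Hom LE B D"
    using Hom_IE O by (auto simp: A_def B_def C_def D_def)
  have sq: "cmp m V (cmp l V a) = cmp k V (cmp e V a)" if "sp V" "a \<in> el A V" for V a
    using Comp_LE(2)[OF lH mH that] Comp_LE(2)[OF eH kH that] eq by simp
  obtain h where h: "nt B C h" "\<And>V a. sp V \<Longrightarrow> a \<in> el A V \<Longrightarrow> h V (cmp e V a) = cmp l V a"
    "\<And>V b. sp V \<Longrightarrow> b \<in> el B V \<Longrightarrow> cmp m V (h V b) = cmp k V b"
    using orthogonal_Ecl_Mcl[OF L ne nm Hom_LE_cmp(1)[OF lH] Hom_LE_cmp(1)[OF kH] E M sq] by blast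
  have hH: "mk_nat B C h \<in> Hom LE B C"
    by (rule mk_nat_in_Hom[OF L(2,3) h(1)])
  have ea: "cmp e V a \<in> el B V" if "sp V" "a \<in> el A V" for V a
    using nt_closed[OF ne that] .
  have "\<exists>!h. h \<in> Hom LE B C \<and> Comp LE h e = l \<and> Comp LE m h = k"
  proof (rule ex1I)
    show "mk_nat B C h \<in> Hom LE B C \<and> Comp LE (mk_nat B C h) e = l \<and> Comp LE m (mk_nat B C h) = k"
    proof (intro conjI hH)
      show "Comp LE (mk_nat B C h) e = l"
        by (rule Hom_LE_eqI[OF Comp_LE(1)[OF eH hH] lH]) (simp add: Comp_LE(2)[OF eH hH] ea h(2))
      show "Comp LE m (mk_nat B C h) = k"
        by (rule Hom_LE_eqI[OF Comp_LE(1)[OF hH mH] kH]) (simp add: Comp_LE(2)[OF hH mH] h(3))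
    qed
    fix h'
    assume h': "h' \<in> Hom LE B C \<and> Comp LE h' e = l \<and> Comp LE m h' = k"
    then have h'H: "h' \<in> Hom LE B C"
      by simp
    have 1: "cmp h' V (cmp e V a) = cmp l V a" if "sp V" "a \<in> el A V" for V a
      using Comp_LE(2)[OF eH h'H that] h' by simp
    have 2: "cmp m V (cmp h' V b) = cmp k V b" if "sp V" "b \<in> el B V" for V b
      using Comp_LE(2)[OF h'H mH that] h' by simp
    show "h' = mk_nat B C h"
    proof (rule Hom_LE_eqI[OF h'H hH])
      show "cmp h' V b = cmp (mk_nat B C h) V b" if "sp V" "b \<in> el B V" for V b
        using orthogonal_Ecl_Mcl_unique[OF L ne nm E M Hom_LE_cmp(1)[OF h'H] h(1) _ _ that] 1 2 h(2,3) that
        by simp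
    qed
  qed
  then show "\<exists>!h. h \<in> Hom IE (tgt e) (src m) \<and> Comp LE h e = l \<and> Comp LE m h = k"
    using Hom_IE[OF O(2,3)] by (simp add: B_def C_def)
qed

lemma class_factorization:
  assumes f: "f \<in> Arr IE"
  obtains P e m where "P \<in> Obj IE" "e \<in> Hom LE (src f) P" "m \<in> Hom LE P (tgt f)"
    "e \<in> Eclass" "m \<in> Mclass" "f = Comp LE m e"
proof -
  define A B where "A = src f" and "B = tgt f"
  have O: "A \<in> Obj IE" "B \<in> Obj IE" and fH: "f \<in> Hom LE A B"
    using f by (auto simp: Arr_IE A_def B_def)
  note L = O[THEN IE_LE]
  obtain P e m where P: "P \<in> Obj LE" "bdd P" and e: "nt A P e" and m: "nt P B m" and E: "Ecl A P e" and M: "Mcl P B m"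
    and me: "\<And>V a. sp V \<Longrightarrow> a \<in> el A V \<Longrightarrow> m V (e V a) = cmp f V a"
    using Ecl_Mcl_factorization[OF L Hom_LE_cmp(1)[OF fH]] O by (auto simp: Obj_IE)
  have PI: "P \<in> Obj IE"
    using P by (simp add: Obj_IE)
  have eH: "mk_nat A P e \<in> Hom LE A P" and mH: "mk_nat P B m \<in> Hom LE P B"
    using mk_nat_in_Hom L P e m by auto
  have eE: "mk_nat A P e \<in> Eclass"
    using eH E O PI by (auto simp: Eclass_def Arr_IE Ecl_def)
  have mM: "mk_nat P B m \<in> Mclass"
    using mH M O PI Mcl_mk_nat[OF P(1)] by (simp add: Mclass_def Arr_IE)
  have fac: "f = Comp LE (mk_nat P B m) (mk_nat A P e)"
    by (rule Hom_LE_eqI[OF fH Comp_LE(1)[OF eH mH]])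
      (simp add: Comp_LE(2)[OF eH mH] me nt_closed[OF e])
  show ?thesis
    by (rule that[OF PI eH[unfolded A_def] mH[unfolded B_def]
          eE[unfolded A_def] mM[unfolded B_def] fac[unfolded A_def B_def]])
qed

text \<open>The converse inclusions are retract arguments. An arrow orthogonal to one class is
  factored, and orthogonality to its own factor in that class exhibits it as a retract of the other
  factor, from which the defining condition is inherited.\<close>

lemma factorization_system: "orthogonal_factorization_system IE Eclass Mclass"
  unfolding orthogonal_factorization_system_def
proof (intro conjI subset_antisym subsetI ballI)
  show "m \<in> {m \<in> Arr IE. \<forall>e\<in>Eclass. orthogonal IE e m}" if "m \<in> Mclass" for m
    using that class_orthogonal by (auto simp: Mclass_def)
  show "e \<in> {e \<in> Arr IE. \<forall>m\<in>Mclass. orthogonal IE e m}" if "e \<in> Eclass" for e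
    using that class_orthogonal by (auto simp: Eclass_def)
  show "\<exists>e\<in>Eclass. \<exists>m\<in>Mclass. Cod IE e = Dom IE m \<and> f = Comp IE m e" if f: "f \<in> Arr IE" for f
  proof -
    obtain P e m where 1: "e \<in> Hom LE (src f) P" "m \<in> Hom LE P (tgt f)" "e \<in> Eclass" "m \<in> Mclass" "f = Comp LE m e"
      using class_factorization[OF f] by metis
    then have "tgt e = src m"
      by (simp add: Hom_def)
    then show ?thesis
      using 1 by auto
  qed
next
  fix m
  assume "m \<in> {m \<in> Arr IE. \<forall>e\<in>Eclass. orthogonal IE e m}"
  then have m: "m \<in> Arr IE" and orth: "\<And>e. e \<in> Eclass \<Longrightarrow> orthogonal IE e m"
    by auto
  define C D where "C = src m" and "D = tgt m"
  have O: "C \<in> Obj IE" "D \<in> Obj IE" and mH: "m \<in> Hom LE C D"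
    using m by (auto simp: Arr_IE C_def D_def)
  note L = O[THEN IE_LE]
  obtain P e' m' where P: "P \<in> Obj IE" and e': "e' \<in> Hom LE C P" and m': "m' \<in> Hom LE P D"
    and E: "e' \<in> Eclass" and M: "m' \<in> Mclass" and fac: "m = Comp LE m' e'"
    using class_factorization[OF m] unfolding C_def D_def by metis
  have st: "src e' = C" "tgt e' = P" "src m' = P" "tgt m' = D"
    using e' m' by (auto simp: Hom_def)
  have "Comp IE m (Id LE C) = Comp IE m' e'"
    using Comp_LE_Id(1)[OF mH] fac by simp
  \<comment> \<open>The filler of the square made of the identity of C and m'. It splits e', and it
    carries torsion lifts along m' back to lifts along m.\<close>
  then obtain h where h: "h \<in> Hom LE P C" "Comp LE h e' = Id LE C" "Comp LE m h = m'"
    using orth[OF E] Id_LE_Hom[OF L(1)] m' Hom_IE O P st C_def D_def unfolding orthogonal_def IE_simps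
    by metis
  have M': "Mcl P D (cmp m')"
    using M st by (simp add: Mclass_def)
  have "Mcl C D (cmp m)"
    unfolding Mcl_def
  proof (intro allI impI conjI)
    fix V x
    assume V: "sp V" and x: "tors C V x" and mx: "cmp m V x = \<zero>\<^bsub>FObj D V\<^esub>"
    have xC: "x \<in> el C V"
      using tors_el[OF L(1) x] by simp
    have "cmp e' V x = \<zero>\<^bsub>FObj P V\<^esub>"
      using MclD(1)[OF M' V tors_nt[OF L(1) IE_LE[OF P] Hom_LE_cmp(1)[OF e'] x]] mx
        Comp_LE(2)[OF e' m' V xC] fac by simp
    moreover have "cmp h V (cmp e' V x) = x"
      using Comp_LE(2)[OF e' h(1) V xC] h(2) V xC by simp
    ultimately show "x = \<zero>\<^bsub>FObj C V\<^esub>"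
      using nt_zero[OF IE_LE[OF P] L(1) Hom_LE_cmp(1)[OF h(1)] V] by simp
  next
    fix V y
    assume V: "sp V" and y: "tors D V y"
    obtain p where p: "tors P V p" "cmp m' V p = y"
      using MclD(2)[OF M' V y] by blast
    have "cmp m V (cmp h V p) = y"
      using Comp_LE(2)[OF h(1) mH V] tors_el[OF IE_LE[OF P] p(1)] h(3) p(2) by simp
    then show "\<exists>x. tors C V x \<and> cmp m V x = y"
      using tors_nt[OF IE_LE[OF P] L(1) Hom_LE_cmp(1)[OF h(1)] p(1)] by blast
  qed
  then show "m \<in> Mclass"
    using m by (simp add: Mclass_def C_def D_def)
next
  fix e
  assume "e \<in> {e \<in> Arr IE. \<forall>m\<in>Mclass. orthogonal IE e m}"
  then have e: "e \<in> Arr IE" and orth: "\<And>m. m \<in> Mclass \<Longrightarrow> orthogonal IE e m"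
    by auto
  define A B where "A = src e" and "B = tgt e"
  have O: "A \<in> Obj IE" "B \<in> Obj IE" and eH: "e \<in> Hom LE A B"
    using e by (auto simp: Arr_IE A_def B_def)
  note L = O[THEN IE_LE]
  obtain P e' m' where P: "P \<in> Obj IE" and e': "e' \<in> Hom LE A P" and m': "m' \<in> Hom LE P B"
    and E: "e' \<in> Eclass" and M: "m' \<in> Mclass" and fac: "e = Comp LE m' e'"
    using class_factorization[OF e] unfolding A_def B_def by metis
  have st: "src e' = A" "tgt e' = P" "src m' = P" "tgt m' = B"
    using e' m' by (auto simp: Hom_def)
  have "Comp IE m' e' = Comp IE (Id LE B) e"
    using Comp_LE_Id(2)[OF eH] fac by simp
  \<comment> \<open>Dually, the filler of the square made of e' and the identity of B. It splits m'
    and carries e to e'.\<close>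
  then obtain h where h: "h \<in> Hom LE B P" "Comp LE h e = e'" "Comp LE m' h = Id LE B"
    using orth[OF M] Id_LE_Hom[OF L(2)] e' Hom_IE O P st A_def B_def unfolding orthogonal_def IE_simps
    by metis
  note PL = IE_LE[OF P]
  have E': "Ecl A P (cmp e')"
    using E st by (simp add: Eclass_def)
  have "Ecl A B (cmp e)"
    unfolding Ecl_def
  proof (intro allI impI conjI ballI)
    fix V a
    assume V: "sp V" and a: "a \<in> el A V" and t: "tors B V (cmp e V a)"
    show "tors A V a"
      using EclD(1)[OF E' V a] tors_nt[OF L(2) PL Hom_LE_cmp(1)[OF h(1)] t]
        Comp_LE(2)[OF eH h(1) V a] h(2) by simp
  next
    fix V b
    assume V: "sp V" and b: "b \<in> el B V"
    note hb = nt_closed[OF Hom_LE_cmp(1)[OF h(1)] V b]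
    obtain a where a: "a \<in> el A V" "tors P V (cmp h V b \<ominus>\<^bsub>FObj P V\<^esub> cmp e' V a)"
      using EclD(2)[OF E' V hb] by blast
    have "cmp m' V (cmp h V b \<ominus>\<^bsub>FObj P V\<^esub> cmp e' V a) = b \<ominus>\<^bsub>FObj B V\<^esub> cmp e V a"
      using nt_minus[OF PL L(2) Hom_LE_cmp(1)[OF m'] V hb nt_closed[OF Hom_LE_cmp(1)[OF e'] V a(1)]]
        Comp_LE(2)[OF h(1) m' V b] h(3) V b Comp_LE(2)[OF e' m' V a(1)] fac by simp
    then show "\<exists>a\<in>el A V. tors B V (b \<ominus>\<^bsub>FObj B V\<^esub> cmp e V a)"
      using tors_nt[OF PL L(2) Hom_LE_cmp(1)[OF m'] a(2)] a(1) by auto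
  qed
  then show "e \<in> Eclass"
    using e by (simp add: Eclass_def A_def B_def)
qed

section \<open>The three-for-two property\<close>

lemma composable:
  assumes f: "f \<in> Arr IE" and g: "g \<in> Arr IE" and fg: "tgt f = src g"
  shows "Comp LE g f \<in> Arr IE" "src (Comp LE g f) = src f" "tgt (Comp LE g f) = tgt g"
    "sp V \<Longrightarrow> x \<in> el (src f) V \<Longrightarrow> cmp (Comp LE g f) V x = cmp g V (cmp f V x)"
proof -
  have H: "f \<in> Hom LE (src f) (tgt f)" "g \<in> Hom LE (tgt f) (tgt g)"
    using f g fg by (auto simp: Arr_IE)
  show s: "src (Comp LE g f) = src f" "tgt (Comp LE g f) = tgt g"
    using Comp_LE(1)[OF H] by (auto simp: Hom_def)
  show "Comp LE g f \<in> Arr IE"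
    using Comp_LE(1)[OF H] f g by (simp add: Arr_IE s)
  show "sp V \<Longrightarrow> x \<in> el (src f) V \<Longrightarrow> cmp (Comp LE g f) V x = cmp g V (cmp f V x)"
    by (rule Comp_LE(2)[OF H])
qed

text \<open>Three-for-two for bijections between torsion-free quotients. It is carried out with
  congruence modulo torsion, so that no induced maps have to be composed.\<close>

lemma three_for_two_E: "three_for_two IE Eclass"
  unfolding three_for_two_def
proof (intro ballI impI)
  fix f g
  assume f: "f \<in> Arr IE" and g: "g \<in> Arr IE" and "Cod IE f = Dom IE g"
  then have fg: "tgt f = src g"
    by simp
  define X Y Z where "X = src f" and "Y = tgt f" and "Z = tgt g"
  have L: "X \<in> Obj LE" "Y \<in> Obj LE" "Z \<in> Obj LE" and nf: "nt X Y (cmp f)" and ng: "nt Y Z (cmp g)"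
    using ArrE[OF f] ArrE[OF g] fg by (auto simp: X_def Y_def Z_def)
  note c = composable[OF f g fg]
  have cc: "cmp (Comp LE g f) V x = cmp g V (cmp f V x)" if "sp V" "x \<in> el X V" for V x
    using c(4) that by (simp add: X_def)
  have fE: "f \<in> Eclass \<longleftrightarrow> Ecl X Y (cmp f)" and gE: "g \<in> Eclass \<longleftrightarrow> Ecl Y Z (cmp g)"
    and gfE: "Comp IE g f \<in> Eclass \<longleftrightarrow> Ecl X Z (cmp (Comp LE g f))"
    using f g c fg by (auto simp: Eclass_def X_def Y_def Z_def)
  have diff: "cmp g V (y \<ominus>\<^bsub>FObj Y V\<^esub> cmp f V x) = cmp g V y \<ominus>\<^bsub>FObj Z V\<^esub> cmp g V (cmp f V x)"
    if "sp V" "y \<in> el Y V" "x \<in> el X V" for V x y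
    using nt_minus[OF L(2,3) ng that(1,2) nt_closed[OF nf that(1,3)]] .
  have trn: "tors Z V (z \<ominus>\<^bsub>FObj Z V\<^esub> cmp g V (cmp f V x))"
    if "sp V" "z \<in> el Z V" "y \<in> el Y V" "x \<in> el X V" "tors Z V (z \<ominus>\<^bsub>FObj Z V\<^esub> cmp g V y)" "tors Y V (y \<ominus>\<^bsub>FObj Y V\<^esub> cmp f V x)"
    for V x y z
  proof -
    have sZ: "sp (FObj Z V)"
      using L that(1) by simp
    interpret M: module K "FObj Z V"
      by (rule sp_module[OF sZ])
    have m: "cmp g V y \<in> el Z V" "cmp g V (cmp f V x) \<in> el Z V"
      using nt_closed[OF ng that(1)] nt_closed[OF nf that(1)] that by auto
    have "(z \<ominus>\<^bsub>FObj Z V\<^esub> cmp g V y) \<oplus>\<^bsub>FObj Z V\<^esub> (cmp g V y \<ominus>\<^bsub>FObj Z V\<^esub> cmp g V (cmp f V x)) = z \<ominus>\<^bsub>FObj Z V\<^esub> cmp g V (cmp f V x)"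
      using that(2) m by (simp add: M.minus_eq M.a_assoc M.r_neg1 M.r_neg2)
    then show ?thesis
      using tors.add[OF that(5) tors_nt[OF L(2,3) ng that(6)]] diff[OF that(1,3,4)] by simp
  qed
  show "(f \<in> Eclass \<and> g \<in> Eclass \<longrightarrow> Comp IE g f \<in> Eclass) \<and>
      (f \<in> Eclass \<and> Comp IE g f \<in> Eclass \<longrightarrow> g \<in> Eclass) \<and>
      (g \<in> Eclass \<and> Comp IE g f \<in> Eclass \<longrightarrow> f \<in> Eclass)"
    unfolding fE gE gfE
  proof (intro conjI impI; elim conjE)
    assume F: "Ecl X Y (cmp f)" and G: "Ecl Y Z (cmp g)"
    show "Ecl X Z (cmp (Comp LE g f))"
      unfolding Ecl_def
    proof (intro allI impI conjI ballI)
      show "tors X V x" if V: "sp V" and x: "x \<in> el X V" and "tors Z V (cmp (Comp LE g f) V x)" for V x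
        using that EclD(1)[OF F V x] EclD(1)[OF G V nt_closed[OF nf V x]] cc[OF V x] by simp
      show "\<exists>x\<in>el X V. tors Z V (z \<ominus>\<^bsub>FObj Z V\<^esub> cmp (Comp LE g f) V x)" if V: "sp V" and z: "z \<in> el Z V" for V z
      proof -
        obtain y where y: "y \<in> el Y V" "tors Z V (z \<ominus>\<^bsub>FObj Z V\<^esub> cmp g V y)"
          using EclD(2)[OF G V z] by blast
        obtain x where x: "x \<in> el X V" "tors Y V (y \<ominus>\<^bsub>FObj Y V\<^esub> cmp f V x)"
          using EclD(2)[OF F V y(1)] by blast
        show ?thesis
          by (rule bexI[OF _ x(1)]) (simp add: cc[OF V x(1)] trn[OF V z y(1) x(1) y(2) x(2)])
      qed
    qed
  next
    assume F: "Ecl X Y (cmp f)" and GF: "Ecl X Z (cmp (Comp LE g f))"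
    show "Ecl Y Z (cmp g)"
      unfolding Ecl_def
    proof (intro allI impI conjI ballI)
      show "tors Y V y" if V: "sp V" and y: "y \<in> el Y V" and t: "tors Z V (cmp g V y)" for V y
      proof -
        obtain x where x: "x \<in> el X V" "tors Y V (y \<ominus>\<^bsub>FObj Y V\<^esub> cmp f V x)"
          using EclD(2)[OF F V y] by blast
        note fx = nt_closed[OF nf V x(1)]
        have "tors Z V (cmp g V y \<ominus>\<^bsub>FObj Z V\<^esub> cmp g V (cmp f V x))"
          using tors_nt[OF L(2,3) ng x(2)] diff[OF V y x(1)] by simp
        then have "tors Z V (cmp g V (cmp f V x))"
          using tors_add_minus[OF L(3) V nt_closed[OF ng V y] nt_closed[OF ng V fx]] t by simp
        then have "tors Y V (cmp f V x)"
          using EclD(1)[OF GF V x(1)] cc[OF V x(1)] tors_nt[OF L(1,2) nf] by simp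
        then show ?thesis
          using tors_add_minus[OF L(2) V y fx x(2)] by simp
      qed
      show "\<exists>y\<in>el Y V. tors Z V (z \<ominus>\<^bsub>FObj Z V\<^esub> cmp g V y)" if V: "sp V" and z: "z \<in> el Z V" for V z
        using EclD(2)[OF GF V z] cc[OF V] nt_closed[OF nf V] by (metis (no_types))
    qed
  next
    assume G: "Ecl Y Z (cmp g)" and GF: "Ecl X Z (cmp (Comp LE g f))"
    show "Ecl X Y (cmp f)"
      unfolding Ecl_def
    proof (intro allI impI conjI ballI)
      show "tors X V x" if V: "sp V" and x: "x \<in> el X V" and "tors Y V (cmp f V x)" for V x
        using that EclD(1)[OF GF V x] tors_nt[OF L(2,3) ng] cc[OF V x] by simp
      show "\<exists>x\<in>el X V. tors Y V (y \<ominus>\<^bsub>FObj Y V\<^esub> cmp f V x)" if V: "sp V" and y: "y \<in> el Y V" for V y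
      proof -
        obtain x where x: "x \<in> el X V" "tors Z V (cmp g V y \<ominus>\<^bsub>FObj Z V\<^esub> cmp g V (cmp f V x))"
          using EclD(2)[OF GF V nt_closed[OF ng V y]] cc[OF V] by auto
        have "y \<ominus>\<^bsub>FObj Y V\<^esub> cmp f V x \<in> el Y V"
          using L V y nt_closed[OF nf V x(1)] by simp
        then have "tors Y V (y \<ominus>\<^bsub>FObj Y V\<^esub> cmp f V x)"
          using EclD(1)[OF G V] x(2) diff[OF V y x(1)] by simp
        then show ?thesis
          using x(1) by (rule bexI)
      qed
    qed
  qed
qed

text \<open>Three-for-two for bijections between torsion parts; \<open>tors_nt\<close> ensures that
  the arrows restrict to these parts.\<close>

lemma three_for_two_M: "three_for_two IE Mclass"
  unfolding three_for_two_def
proof (intro ballI impI)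
  fix f g
  assume f: "f \<in> Arr IE" and g: "g \<in> Arr IE" and "Cod IE f = Dom IE g"
  then have fg: "tgt f = src g"
    by simp
  define X Y Z where "X = src f" and "Y = tgt f" and "Z = tgt g"
  have L: "X \<in> Obj LE" "Y \<in> Obj LE" "Z \<in> Obj LE" and nf: "nt X Y (cmp f)" and ng: "nt Y Z (cmp g)"
    using ArrE[OF f] ArrE[OF g] fg by (auto simp: X_def Y_def Z_def)
  note c = composable[OF f g fg]
  have cc: "cmp (Comp LE g f) V x = cmp g V (cmp f V x)" if "sp V" "tors X V x" for V x
    using c(4) that tors_el[OF L(1) that(2)] by (simp add: X_def)
  have fM: "f \<in> Mclass \<longleftrightarrow> Mcl X Y (cmp f)" and gM: "g \<in> Mclass \<longleftrightarrow> Mcl Y Z (cmp g)"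
    and gfM: "Comp IE g f \<in> Mclass \<longleftrightarrow> Mcl X Z (cmp (Comp LE g f))"
    using f g c fg by (auto simp: Mclass_def X_def Y_def Z_def)
  note tf = tors_nt[OF L(1,2) nf] and tg = tors_nt[OF L(2,3) ng]
  show "(f \<in> Mclass \<and> g \<in> Mclass \<longrightarrow> Comp IE g f \<in> Mclass) \<and>
      (f \<in> Mclass \<and> Comp IE g f \<in> Mclass \<longrightarrow> g \<in> Mclass) \<and>
      (g \<in> Mclass \<and> Comp IE g f \<in> Mclass \<longrightarrow> f \<in> Mclass)"
    unfolding fM gM gfM
  proof (intro conjI impI; elim conjE)
    assume F: "Mcl X Y (cmp f)" and G: "Mcl Y Z (cmp g)"
    show "Mcl X Z (cmp (Comp LE g f))"
      unfolding Mcl_def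
    proof (intro allI impI conjI)
      show "x = \<zero>\<^bsub>FObj X V\<^esub>" if V: "sp V" and x: "tors X V x" and "cmp (Comp LE g f) V x = \<zero>\<^bsub>FObj Z V\<^esub>" for V x
        using MclD(1)[OF F V x] MclD(1)[OF G V tf[OF x]] cc[OF V x] that(3) by simp
      show "\<exists>x. tors X V x \<and> cmp (Comp LE g f) V x = z" if V: "sp V" and z: "tors Z V z" for V z
        using MclD(2)[OF G V z] MclD(2)[OF F V] cc[OF V] by metis
    qed
  next
    assume F: "Mcl X Y (cmp f)" and GF: "Mcl X Z (cmp (Comp LE g f))"
    show "Mcl Y Z (cmp g)"
      unfolding Mcl_def
    proof (intro allI impI conjI)
      show "y = \<zero>\<^bsub>FObj Y V\<^esub>" if V: "sp V" and y: "tors Y V y" and gy: "cmp g V y = \<zero>\<^bsub>FObj Z V\<^esub>" for V y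
      proof -
        obtain x where x: "tors X V x" "cmp f V x = y"
          using MclD(2)[OF F V y] by blast
        then have "x = \<zero>\<^bsub>FObj X V\<^esub>"
          using MclD(1)[OF GF V x(1)] cc[OF V x(1)] gy by simp
        then show ?thesis
          using x(2) nt_zero[OF L(1,2) nf V] by simp
      qed
      show "\<exists>y. tors Y V y \<and> cmp g V y = z" if V: "sp V" and z: "tors Z V z" for V z
        using MclD(2)[OF GF V z] cc[OF V] tf by metis
    qed
  next
    assume G: "Mcl Y Z (cmp g)" and GF: "Mcl X Z (cmp (Comp LE g f))"
    show "Mcl X Y (cmp f)"
      unfolding Mcl_def
    proof (intro allI impI conjI)
      show "x = \<zero>\<^bsub>FObj X V\<^esub>" if V: "sp V" and x: "tors X V x" and "cmp f V x = \<zero>\<^bsub>FObj Y V\<^esub>" for V x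
        using MclD(1)[OF GF V x] cc[OF V x] that(3) nt_zero[OF L(2,3) ng V] by simp
      show "\<exists>x. tors X V x \<and> cmp f V x = y" if V: "sp V" and y: "tors Y V y" for V y
      proof -
        obtain x where x: "tors X V x" "cmp g V (cmp f V x) = cmp g V y"
          using MclD(2)[OF GF V tg[OF y]] cc[OF V] by metis
        then show ?thesis
          using Mcl_inj[OF L(2,3) ng G V tf[OF x(1)] y] by blast
      qed
    qed
  qed
qed

section \<open>Zero objects and the torsion-free part\<close>

lemma zero_object_el:
  assumes z: "zero_object IE z" and V: "sp V" and x: "x \<in> el z V"
  shows "x = \<zero>\<^bsub>FObj z V\<^esub>"
proof -
  have zI: "z \<in> Obj IE" and uniq: "\<exists>!f. f \<in> Hom IE z z"
    using z by (auto simp: zero_object_def)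
  note L = IE_LE[OF zI]
  \<comment> \<open>The identity and the zero map are both endomorphisms of z, so uniqueness
    identifies them.\<close>
  have "Id LE z \<in> Hom IE z z" "mk_nat z z (\<lambda>V x. \<zero>\<^bsub>FObj z V\<^esub>) \<in> Hom IE z z"
    using Hom_IE[OF zI zI] Id_LE_Hom[OF L] mk_nat_in_Hom[OF L L nt_zero_map[OF L L]] by auto
  then have "Id LE z = mk_nat z z (\<lambda>V x. \<zero>\<^bsub>FObj z V\<^esub>)"
    using uniq by blast
  then have "cmp (Id LE z) V x = cmp (mk_nat z z (\<lambda>V x. \<zero>\<^bsub>FObj z V\<^esub>)) V x"
    by simp
  then show ?thesis
    using V x by simp
qed

text \<open>Taken as the quotient of c by all of itself, which gives the functor and its bound
  without a separate construction.\<close>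

lemma zero_object_exists:
  assumes c: "c \<in> Obj IE"
  obtains z where "zero_object IE z" "\<And>V x. sp V \<Longrightarrow> x \<in> el z V \<Longrightarrow> x = \<zero>\<^bsub>FObj z V\<^esub>"
proof -
  note L = IE_LE[OF c]
  have "subfun c (el c)"
    using L by (auto simp: subfun_def subsp_carrier)
  then obtain z q where zL: "z \<in> Obj LE" and q: "nt c z q"
    and surj: "\<And>V y. sp V \<Longrightarrow> y \<in> el z V \<Longrightarrow> \<exists>x\<in>el c V. q V x = y"
    and ker: "\<And>V x. sp V \<Longrightarrow> x \<in> el c V \<Longrightarrow> q V x = \<zero>\<^bsub>FObj z V\<^esub> \<longleftrightarrow> x \<in> el c V"
    using quotient_functor[OF L] by blast
  have triv: "x = \<zero>\<^bsub>FObj z V\<^esub>" if "sp V" "x \<in> el z V" for V x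
    using surj[OF that] ker[OF that(1)] by blast
  have zI: "z \<in> Obj IE"
    using zL bdd_quotient[OF q surj] c by (simp add: Obj_IE)
  have "zero_object IE z"
    unfolding zero_object_def
  proof (intro conjI ballI zI)
    fix a
    assume a: "a \<in> Obj IE"
    note aL = IE_LE[OF a]
    show "\<exists>!f. f \<in> Hom IE a z"
      unfolding Hom_IE[OF a zI]
    proof (rule ex1I)
      show 0: "mk_nat a z (\<lambda>V x. \<zero>\<^bsub>FObj z V\<^esub>) \<in> Hom LE a z"
        by (rule mk_nat_in_Hom[OF aL zL nt_zero_map[OF aL zL]])
      show "f = mk_nat a z (\<lambda>V x. \<zero>\<^bsub>FObj z V\<^esub>)" if f: "f \<in> Hom LE a z" for f
        by (rule Hom_LE_eqI[OF f 0]) (simp add: triv nt_closed[OF Hom_LE_cmp(1)[OF f]])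
    qed
    show "\<exists>!f. f \<in> Hom IE z a"
      unfolding Hom_IE[OF zI a]
    proof (rule ex1I)
      show 0: "mk_nat z a (\<lambda>V x. \<zero>\<^bsub>FObj a V\<^esub>) \<in> Hom LE z a"
        by (rule mk_nat_in_Hom[OF zL aL nt_zero_map[OF zL aL]])
      show "f = mk_nat z a (\<lambda>V x. \<zero>\<^bsub>FObj a V\<^esub>)" if f: "f \<in> Hom LE z a" for f
      proof (rule Hom_LE_eqI[OF f 0])
        show "cmp f V x = cmp (mk_nat z a (\<lambda>V x. \<zero>\<^bsub>FObj a V\<^esub>)) V x" if "sp V" "x \<in> el z V" for V x
          using triv[OF that] that nt_zero[OF zL aL Hom_LE_cmp(1)[OF f] that(1)] by simp
      qed
    qed
  qed
  then show ?thesis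
    using that triv by blast
qed

text \<open>A zero object has no nonzero torsion to be lifted, and every element of c goes to zero
  in it. The condition \<open>Mcl\<close> on the map to it therefore says exactly that torsion in c
  is zero.\<close>

lemma torsion_free_part_eq: "torsion_free_part IE Mclass = Obj SV"
proof (intro subset_antisym subsetI)
  fix c
  assume "c \<in> torsion_free_part IE Mclass"
  then obtain z f where c: "c \<in> Obj IE" and z: "zero_object IE z" and f: "f \<in> Hom IE c z" "f \<in> Mclass"
    by (auto simp: torsion_free_part_def)
  have zI: "z \<in> Obj IE"
    using z by (simp add: zero_object_def)
  have fH: "f \<in> Hom LE c z" and M: "Mcl c z (cmp f)"
    using f Hom_IE[OF c zI] by (auto simp: Mclass_def Hom_def)
  have "x = \<zero>\<^bsub>FObj c V\<^esub>" if x: "tors c V x" for V x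
  proof -
    have V: "sp V" "x \<in> el c V"
      using tors_el[OF IE_LE[OF c] x] by auto
    then show ?thesis
      using MclD(1)[OF M V(1) x] zero_object_el[OF z V(1) nt_closed[OF Hom_LE_cmp(1)[OF fH] V]] by simp
  qed
  then show "c \<in> Obj SV"
    using IE_LE[OF c] by (simp add: Obj_SV torsion_free_def)
next
  fix c
  assume c: "c \<in> Obj SV"
  note cI = SV_IE[OF c] and cL = SV_LE[OF c]
  obtain z where z: "zero_object IE z" and triv: "\<And>V x. sp V \<Longrightarrow> x \<in> el z V \<Longrightarrow> x = \<zero>\<^bsub>FObj z V\<^esub>"
    using zero_object_exists[OF cI] by blast
  have zI: "z \<in> Obj IE"
    using z by (simp add: zero_object_def)
  note zL = IE_LE[OF zI]
  define f where "f = mk_nat c z (\<lambda>V x. \<zero>\<^bsub>FObj z V\<^esub>)"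
  have fH: "f \<in> Hom LE c z"
    unfolding f_def by (rule mk_nat_in_Hom[OF cL zL nt_zero_map[OF cL zL]])
  have "Mcl c z (cmp f)"
    unfolding Mcl_def
  proof (intro allI impI conjI)
    show "x = \<zero>\<^bsub>FObj c V\<^esub>" if "tors c V x" for V x
      using c that by (simp add: Obj_SV torsion_free_def)
    show "\<exists>x. tors c V x \<and> cmp f V x = y" if V: "sp V" and y: "tors z V y" for V y
      using triv[OF V] tors_el[OF zL y] tors.zero[OF V, of c] cL V
      by (intro exI[of _ "\<zero>\<^bsub>FObj c V\<^esub>"]) (simp add: f_def)
  qed
  then have "f \<in> Mclass"
    using fH cI zI by (simp add: Mclass_def Arr_IE f_def)
  then show "c \<in> torsion_free_part IE Mclass"
    using cI z fH Hom_IE[OF cI zI] by (auto simp: torsion_free_part_def)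
qed

end

theorem corollary4p44:
  fixes elts :: "'u \<Rightarrow> 'u set" and K :: "'u ring"
  assumes "grothendieck_universe elts"
    and "field K"
    and "small elts (carrier K)"
  shows "is_full_subcategory (SigmaVect elts K) (IndVectOp elts K) \<and>
    reflective_subcategory (SigmaVect elts K) (IndVectOp elts K) \<and>
    (\<exists>E M. torsion_theory (IndVectOp elts K) E M \<and>
       torsion_free_part (IndVectOp elts K) M = Obj (SigmaVect elts K))"
proof -
  interpret small_field elts K
    using assms by (simp add: small_field_def small_field_axioms_def)
  have "torsion_theory IE Eclass Mclass"
    using factorization_system three_for_two_E three_for_two_M by (simp add: torsion_theory_def)
  then show ?thesis
    using SV_full SV_reflective torsion_free_part_eq by blast
qed

end
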